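(* Let $m\ge 1$ be an integer and let $b\in C^m([0,\infty))$ be real-valued with a decomposition $2b(t)=\mu(t)+\sigma(t)$, where $\mu,\sigma$ are real-valued functions on $[0,\infty)$. Assume that there are a number $\omega_\infty>0$ and positive functions $\Theta,\Xi$ on $[0,\infty)$ such that: (1) $\mu(t)>0$, $\mu'(t)<0$ and $\limsup_{t\to\infty}t\mu(t)<1$; (2) $\sup_{t}\left|\int_0^t\sigma(s)\,ds\right|<\infty$; (3) $\int_0^t\left|\exp\left(\int_0^\theta\sigma(s)\,ds\right)-\omega_\infty\right|d\theta\lesssim\Theta(t)$, with $\Theta(t)=o(t)$ as $t\to\infty$ and $\Theta$ normalised by $\Theta(0)=\mu(0)$; (4) $\left|\frac{d^k}{dt^k}b(t)\right|\le C_k\,\Xi(t)^{-k-1}$ for $k=1,2,\dots,m$, with $\Xi(t)\gtrsim\Theta(t)$; (5) $\int_t^\infty\Xi(s)^{-m-1}\,ds\lesssim\Theta(t)^{-m}$. Set $\lambda(t)=\exp\left(\frac12\int_0^t\mu(\tau)\,d\tau\right)$; then $\lambda(t)\approx\exp\left(\int_0^tb(s)\,ds\right)$. For all data $u_1\in H^1(\mathbb R^n)$ and $u_2\in L^2(\mathbb R^n)$ the solution $u$ of the Cauchy problem $$\partial_t^2u-\Delta u+2b(t)u_t=0,\qquad u(0,\cdot)=u_1,\quad u_t(0,\cdot)=u_2$$ satisfies, for all $t\ge0$, the a-priori estimate $$\|\nabla u(t,\cdot)\|_{L^2}+\|u_t(t,\cdot)\|_{L^2}\le C\,\frac1{\lambda(t)}\left(\|u_1\|_{H^1}+\|u_2\|_{L^2}\right)$$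 with a constant $C$ depending on the size of the coefficient $b(t)$ and its first $m$ derivatives (and not on $t$, $u_1$, $u_2$).
   Context: For positive functions, $f\lesssim g$ means $f\le Cg$ with a constant $C>0$ uniformly in all arguments; $f\gtrsim g$ means $g\lesssim f$; $f\approx g$ means both. The Cauchy problem is posed for $t\ge0$, $x\in\mathbb R^n$, and is solved by partial Fourier transform in $x$, i.e. $\hat u_{tt}+|\xi|^2\hat u+2b(t)\hat u_t=0$ for each frequency $\xi\in\mathbb R^n$. *)

theory Defs
  imports "HOL-Analysis.Analysis" "HOL-Library.Landau_Symbols"
begin

section \<open>Functions on the half-line\<close>

text \<open>The derivatives are one-sided at 0; only the values of the function on \<open>[0,\<infinity>)\<close> matter.\<close>

definition halfline_deriv :: "nat \<Rightarrow> (real \<Rightarrow> real) \<Rightarrow> real \<Rightarrow> real" where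
  "halfline_deriv k f = ((\<lambda>g t. vector_derivative g (at t within {0..})) ^^ k) f"

definition C_halfline :: "nat \<Rightarrow> (real \<Rightarrow> real) \<Rightarrow> bool" where
  "C_halfline m f \<longleftrightarrow>
     (\<forall>k<m. \<forall>t\<ge>0. halfline_deriv k f differentiable (at t within {0..})) \<and>
     continuous_on {0..} (halfline_deriv m f)"

definition lesssim :: "(real \<Rightarrow> real) \<Rightarrow> (real \<Rightarrow> real) \<Rightarrow> bool" where
  "lesssim f g \<longleftrightarrow> (\<exists>C>0. \<forall>t\<ge>0. f t \<le> C * g t)"

definition comparable :: "(real \<Rightarrow> real) \<Rightarrow> (real \<Rightarrow> real) \<Rightarrow> bool" where
  "comparable f g \<longleftrightarrow> lesssim f g \<and> lesssim g f"

definition lambda_of :: "(real \<Rightarrow> real) \<Rightarrow> real \<Rightarrow> real" where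
  "lambda_of \<mu> t = exp (1 / 2 * integral {0..t} \<mu>)"


section \<open>\<open>L\<^sup>2\<close>, \<open>H\<^sup>1\<close> and the Fourier transform on \<open>\<real>\<^sup>n\<close>\<close>

text \<open>Elements of \<open>L\<^sup>2\<close> are represented by functions; equality in \<open>L\<^sup>2\<close> is equality almost
  everywhere.\<close>

definition L2 :: "(real ^ 'n \<Rightarrow> 'b::euclidean_space) \<Rightarrow> bool" where
  "L2 f \<longleftrightarrow> f \<in> borel_measurable lebesgue \<and> integrable lebesgue (\<lambda>x. (norm (f x))\<^sup>2)"

definition L2_norm :: "(real ^ 'n \<Rightarrow> 'b::euclidean_space) \<Rightarrow> real" where
  "L2_norm f = sqrt (LINT x|lebesgue. (norm (f x))\<^sup>2)"

definition partial_deriv :: "'n \<Rightarrow> (real ^ 'n \<Rightarrow> real) \<Rightarrow> real ^ 'n \<Rightarrow> real" where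
  "partial_deriv i \<phi> x = frechet_derivative \<phi> (at x) (axis i 1)"

primrec C_space :: "nat \<Rightarrow> (real ^ 'n \<Rightarrow> real) \<Rightarrow> bool" where
  "C_space 0 \<phi> \<longleftrightarrow> continuous_on UNIV \<phi>"
| "C_space (Suc k) \<phi> \<longleftrightarrow>
     (\<forall>x. \<phi> differentiable (at x)) \<and> (\<forall>i. C_space k (partial_deriv i \<phi>))"

definition test_function :: "(real ^ 'n \<Rightarrow> real) \<Rightarrow> bool" where
  "test_function \<phi> \<longleftrightarrow> (\<forall>k. C_space k \<phi>) \<and> compact (closure {x. \<phi> x \<noteq> 0})"

definition weak_gradient :: "(real ^ 'n \<Rightarrow> complex) \<Rightarrow> (real ^ 'n \<Rightarrow> complex ^ 'n) \<Rightarrow> bool" where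
  "weak_gradient f g \<longleftrightarrow>
     (\<forall>\<phi> i. test_function \<phi> \<longrightarrow>
        (LINT x|lebesgue. f x * of_real (partial_deriv i \<phi> x)) =
        - (LINT x|lebesgue. g x $ i * of_real (\<phi> x)))"

definition H1 :: "(real ^ 'n \<Rightarrow> complex) \<Rightarrow> bool" where
  "H1 f \<longleftrightarrow> L2 f \<and> (\<exists>g. L2 g \<and> weak_gradient f g)"

text \<open>For \<open>f\<close> in \<open>H\<^sup>1\<close> the chosen function is unique up to a null set.\<close>

definition grad :: "(real ^ 'n \<Rightarrow> complex) \<Rightarrow> real ^ 'n \<Rightarrow> complex ^ 'n" where
  "grad f = (SOME g. L2 g \<and> weak_gradient f g)"

definition H1_norm :: "(real ^ 'n \<Rightarrow> complex) \<Rightarrow> real" where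
  "H1_norm f = sqrt ((L2_norm f)\<^sup>2 + (L2_norm (grad f))\<^sup>2)"

text \<open>A function in \<open>L\<^sup>2\<close> need not be integrable, so its Fourier transform is the limit in
  \<open>L\<^sup>2\<close>, as \<open>R \<rightarrow> \<infinity>\<close>, of the Fourier integrals over the balls of radius \<open>R\<close>. The factor
  makes it unitary.\<close>

definition fourier_ball :: "real \<Rightarrow> (real ^ 'n \<Rightarrow> complex) \<Rightarrow> real ^ 'n \<Rightarrow> complex" where
  "fourier_ball R f \<xi> =
     of_real ((2 * pi) powr (- real CARD('n) / 2)) *
     (LINT x:cball 0 R|lebesgue. exp (- \<i> * of_real (x \<bullet> \<xi>)) * f x)"

definition L2_fourier :: "(real ^ 'n \<Rightarrow> complex) \<Rightarrow> (real ^ 'n \<Rightarrow> complex) \<Rightarrow> bool" where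
  "L2_fourier f F \<longleftrightarrow> L2 f \<and> L2 F \<and>
     ((\<lambda>R. \<integral>\<^sup>+ \<xi>. ennreal ((norm (fourier_ball R f \<xi> - F \<xi>))\<^sup>2) \<partial>lebesgue) \<longlongrightarrow> 0) at_top"


section \<open>The Cauchy problem\<close>

text \<open>\<open>u t\<close> and \<open>ut t\<close> are the functions \<open>u(t,\<cdot>)\<close> and \<open>u\<^sub>t(t,\<cdot>)\<close>; the time derivative is taken
  in \<open>L\<^sup>2\<close>. The differential equation is imposed on the partial Fourier transform \<open>w t \<xi>\<close>,
  frequency by frequency: each \<open>u t\<close> determines \<open>w t\<close> up to a null set, and the representatives
  are to be chosen such that \<open>w\<close> is a classical solution in \<open>t\<close> for every \<open>\<xi>\<close>. Continuity of
  \<open>u\<close> into \<open>H\<^sup>1\<close> and of \<open>ut\<close> into \<open>L\<^sup>2\<close> is a consequence and need not be required.\<close>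

definition has_L2_time_derivative ::
    "(real \<Rightarrow> real ^ 'n \<Rightarrow> complex) \<Rightarrow> (real \<Rightarrow> real ^ 'n \<Rightarrow> complex) \<Rightarrow> bool" where
  "has_L2_time_derivative u ut \<longleftrightarrow>
     (\<forall>t\<ge>0. L2 (u t) \<and> L2 (ut t) \<and>
        ((\<lambda>s. L2_norm (\<lambda>x. (u s x - u t x) /\<^sub>R (s - t) - ut t x)) \<longlongrightarrow> 0) (at t within {0..}))"

definition frequency_solution :: "(real \<Rightarrow> real) \<Rightarrow> real ^ 'n \<Rightarrow> (real \<Rightarrow> complex) \<Rightarrow> bool" where
  "frequency_solution b \<xi> w \<longleftrightarrow>
     (\<exists>w'. \<forall>t\<ge>0. (w has_vector_derivative w' t) (at t within {0..}) \<and>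
        (w' has_vector_derivative - of_real ((norm \<xi>)\<^sup>2) * w t - 2 * of_real (b t) * w' t)
          (at t within {0..}))"

definition cauchy_solution ::
    "(real \<Rightarrow> real) \<Rightarrow> (real ^ 'n \<Rightarrow> complex) \<Rightarrow> (real ^ 'n \<Rightarrow> complex) \<Rightarrow>
     (real \<Rightarrow> real ^ 'n \<Rightarrow> complex) \<Rightarrow> (real \<Rightarrow> real ^ 'n \<Rightarrow> complex) \<Rightarrow> bool" where
  "cauchy_solution b u1 u2 u ut \<longleftrightarrow>
     (\<forall>t\<ge>0. H1 (u t)) \<and>
     has_L2_time_derivative u ut \<and>
     (\<exists>w. (\<forall>t\<ge>0. L2_fourier (u t) (w t)) \<and> (\<forall>\<xi>. frequency_solution b \<xi> (\<lambda>t. w t \<xi>))) \<and>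
     (AE x in lebesgue. u 0 x = u1 x) \<and>
     (AE x in lebesgue. ut 0 x = u2 x)"

end

theory Submission
  imports Defs "HOL-Probability.Probability" "HOL-Computational_Algebra.Polynomial"
begin

text \<open>The Fourier transform in space turns the equation into the damped oscillators
  \<open>w'' + 2 b w' + r\<^sup>2 w = 0\<close> with \<open>r = |\<xi>|\<close>. The core is \<open>oscillator_decay\<close>: the energy
  \<open>\<lambda>\<^sup>2 (r\<^sup>2 w\<^sup>2 + w'\<^sup>2)\<close> is bounded by the data at time 0, uniformly in \<open>r\<close> and \<open>t\<close>. Plancherel's
  theorem carries this over to the wave equation.

  For the oscillator the half-line is cut, depending on \<open>r\<close>, into four intervals. Let \<open>s(t)\<close> be the
  integral of \<open>\<sigma>\<close> up to \<open>t\<close>, let \<open>a = \<lambda>\<^sup>2 exp s\<close> be the integrating factor, so that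
  \<open>(a w')' = - r\<^sup>2 a w\<close>, and let \<open>\<Psi>(t)\<close> be the integral of \<open>|exp s - \<omega>|\<close>, which is at most a
  multiple of \<open>\<Theta>\<close>.

  \<^item> While \<open>r t\<close> is small (\<open>low_zone\<close>), the term with \<open>r\<^sup>2\<close> is a perturbation. Solving for \<open>w\<close>
    produces the integral of \<open>1 / \<lambda>\<^sup>2\<close>, and this is at most a multiple of \<open>t / \<lambda>\<^sup>2\<close> because
    the upper limit of \<open>t \<mu>\<close> is smaller than 1. This is where the factor \<open>1 / \<lambda>\<close> for low
    frequencies comes from.
  \<^item> While \<open>r t\<close> is between two constants (\<open>middle_zone\<close>), all coefficients are of size \<open>r\<close> on an
    interval of length a multiple of \<open>1 / r\<close>, and Gronwall's inequality suffices.
  \<^item> For larger \<open>t\<close> with \<open>r \<Psi>(t)\<close> bounded (\<open>stabilisation_zone\<close>), \<open>exp s\<close> is replaced by its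
    mean value \<open>\<omega>\<close>; the error is \<open>r |exp s - \<omega>|\<close>, with integral \<open>r \<Psi>\<close>. The damping \<open>\<mu>\<close>
    acts with opposite signs on the two halves of the energy, and a cross term with factor \<open>\<mu> / r\<close>
    cancels it. The derivative of this factor has a sign because \<open>\<mu>\<close> decreases.
  \<^item> For \<open>r \<Psi>(t)\<close> large (\<open>hyperbolic_zone\<close>) the derivatives of \<open>b\<close> enter. Starting from
    \<open>\<i> r - b\<close>, the Riccati equation \<open>P' + P\<^sup>2 + 2 b P + r\<^sup>2 = 0\<close> is solved up to a defect of
    order \<open>rate\<^sup>m\<^sup>+\<^sup>1 / r\<^sup>m\<^sup>-\<^sup>1\<close>, where \<open>rate = |b| + 1 / \<Xi>\<close>. The energy \<open>a |w' - P w|\<^sup>2 / Im P\<close>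
    then changes at a relative rate of the size of the defect divided by \<open>r\<close>, and the integral of this
    rate is at most a multiple of \<open>(r \<Psi>)\<^sup>-\<^sup>m\<close>. The symbol estimates say nothing about \<open>b\<close>
    itself; \<open>b_le\<close> and \<open>rate_power_integral\<close> extract what is needed from the bounded primitive of
    \<open>\<sigma>\<close>.

  On the side of the wave equation, Plancherel's theorem is derived from the Fourier transform of the Gaussian, and
  \<open>fourier_gradient\<close> shows that the weak gradient corresponds to multiplication by \<open>\<xi>\<close>. The time
  derivative is handled through difference quotients: those of \<open>u\<close> and of its transform \<open>w\<close> have equal
  norms. At time 0 Fatou's lemma bounds \<open>w'\<close> by \<open>u\<^sub>t\<close>; at a later time the pointwise bound of \<open>w'\<close>
  bounds the quotients and with them \<open>u\<^sub>t\<close>.\<close>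

section \<open>Differential inequalities on the half-line\<close>

text \<open>The mean value theorem applied to \<open>g - f\<close>, in place of integrating the derivatives.\<close>

lemma derivative_comparison:
  fixes f g :: "real \<Rightarrow> real"
  assumes "0 \<le> s" "s \<le> t"
    and f: "\<And>x. s \<le> x \<Longrightarrow> x \<le> t \<Longrightarrow> (f has_real_derivative f' x) (at x within {0..})"
    and g: "\<And>x. s \<le> x \<Longrightarrow> x \<le> t \<Longrightarrow> (g has_real_derivative g' x) (at x within {0..})"
    and le: "\<And>x. s < x \<Longrightarrow> x < t \<Longrightarrow> f' x \<le> g' x"
  shows "f t - f s \<le> g t - g s"
proof -
  have d: "((\<lambda>x. f x - g x) has_real_derivative f' x - g' x) (at x within {0..})"
    if "s \<le> x" "x \<le> t" for x
    using DERIV_diff[OF f g] that by blast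
  have "(\<lambda>x. f x - g x) t \<le> (\<lambda>x. f x - g x) s"
  proof (rule DERIV_nonpos_imp_decreasing_open[OF assms(2)])
    fix x assume x: "s < x" "x < t"
    then have "at x within {0..} = at x"
      using assms(1) by (intro at_within_interior) auto
    then have "((\<lambda>x. f x - g x) has_real_derivative f' x - g' x) (at x)"
      using d[of x] x by simp
    then show "\<exists>y. ((\<lambda>x. f x - g x) has_real_derivative y) (at x) \<and> y \<le> 0"
      using le[OF x] by (intro exI[of _ "f' x - g' x"]) auto
  next
    have "continuous (at x within {s..t}) (\<lambda>x. f x - g x)" if "x \<in> {s..t}" for x
      using d[of x] that assms(1)
      by (intro continuous_within_subset[OF DERIV_continuous[OF d]]) auto
    then show "continuous_on {s..t} (\<lambda>x. f x - g x)"
      by (simp add: continuous_on_eq_continuous_within)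
  qed
  then show ?thesis by simp
qed

lemma derivative_comparison_abs:
  fixes f g :: "real \<Rightarrow> real"
  assumes "0 \<le> s" "s \<le> t"
    and f: "\<And>x. s \<le> x \<Longrightarrow> x \<le> t \<Longrightarrow> (f has_real_derivative f' x) (at x within {0..})"
    and g: "\<And>x. s \<le> x \<Longrightarrow> x \<le> t \<Longrightarrow> (g has_real_derivative g' x) (at x within {0..})"
    and le: "\<And>x. s < x \<Longrightarrow> x < t \<Longrightarrow> \<bar>f' x\<bar> \<le> g' x"
  shows "\<bar>f t - f s\<bar> \<le> g t - g s"
proof -
  have "f t - f s \<le> g t - g s"
    by (rule derivative_comparison[OF assms(1,2) f g]) (use le in \<open>auto intro: order_trans[OF abs_ge_self]\<close>)
  moreover have "(\<lambda>x. - f x) t - (\<lambda>x. - f x) s \<le> g t - g s"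
    by (rule derivative_comparison[OF assms(1,2) DERIV_minus[OF f] g])
       (use le in \<open>auto intro: order_trans[OF abs_ge_minus_self]\<close>)
  ultimately show ?thesis by (auto simp: abs_le_iff)
qed

text \<open>The product of \<open>F\<close> with \<open>exp (- G)\<close> decreases. The exponent is given through its primitive \<open>G\<close>, so
  that explicit primitives such as \<open>\<mu> / r\<close> can be used.\<close>

lemma gronwall:
  fixes F G :: "real \<Rightarrow> real"
  assumes "0 \<le> s" "s \<le> t"
    and F: "\<And>x. s \<le> x \<Longrightarrow> x \<le> t \<Longrightarrow> (F has_real_derivative F' x) (at x within {0..})"
    and G: "\<And>x. s \<le> x \<Longrightarrow> x \<le> t \<Longrightarrow> (G has_real_derivative G' x) (at x within {0..})"
    and le: "\<And>x. s < x \<Longrightarrow> x < t \<Longrightarrow> F' x \<le> G' x * F x"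
  shows "F t \<le> exp (G t - G s) * F s"
proof -
  have d: "((\<lambda>x. F x * exp (- G x)) has_real_derivative (F' x - G' x * F x) * exp (- G x))
      (at x within {0..})" if "s \<le> x" "x \<le> t" for x
    by (rule derivative_eq_intros refl F G that)+ (simp add: algebra_simps)
  have "F t * exp (- G t) - F s * exp (- G s) \<le> 0 - 0"
    by (rule derivative_comparison[OF assms(1,2) d DERIV_const])
       (use le in \<open>auto simp: mult_le_0_iff\<close>)
  then have "F t * exp (- G t) * exp (G t) \<le> F s * exp (- G s) * exp (G t)"
    by (intro mult_right_mono) auto
  then show ?thesis
    by (simp add: mult.assoc exp_minus_inverse exp_add[symmetric] exp_diff exp_minus field_simps)
qed

lemma integral_has_real_derivative_halfline:
  fixes f :: "real \<Rightarrow> real"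
  assumes f: "continuous_on {0..} f" and t: "0 \<le> t"
  shows "((\<lambda>t. integral {0..t} f) has_real_derivative f t) (at t within {0..})"
proof -
  have "((\<lambda>t. integral {0..t} f) has_real_derivative f t) (at t within {0..t+1})"
    by (rule integral_has_real_derivative) (use f t in \<open>auto intro: continuous_on_subset\<close>)
  moreover have "at t within {0..t+1} = at t within {0..}"
    by (rule at_within_nhd[of _ "{..<t+1}"]) auto
  ultimately show ?thesis by simp
qed

section \<open>Damped oscillators at low frequencies\<close>

text \<open>The equation \<open>w'' + 2 b w' + r\<^sup>2 w = 0\<close> as a system; \<open>v\<close> is the derivative of \<open>w\<close>.\<close>

definition damped_oscillator :: "(real \<Rightarrow> real) \<Rightarrow> real \<Rightarrow> (real \<Rightarrow> real) \<Rightarrow> (real \<Rightarrow> real) \<Rightarrow> bool" where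
  "damped_oscillator b r w v \<longleftrightarrow> (\<forall>t\<ge>0.
     (w has_real_derivative v t) (at t within {0..}) \<and>
     (v has_real_derivative - r\<^sup>2 * w t - 2 * b t * v t) (at t within {0..}))"

text \<open>The damping \<open>m / 2\<close> enters with opposite signs, so it does not simply multiply the energy. The
  coupling by \<open>r\<close> cancels as far as \<open>e1\<close> and \<open>e2\<close> are in the ratio \<open>1 : \<omega>\<^sup>2\<close>.\<close>

lemma quadratic_energy_deriv:
  fixes p q :: "real \<Rightarrow> real"
  assumes "\<omega> > 0"
    and "(p has_real_derivative m / 2 * p t + r * e1 * q t) (at t within {0..})"
    and "(q has_real_derivative - m / 2 * q t - r * e2 * p t) (at t within {0..})"
  shows "((\<lambda>t. \<omega> * (p t)\<^sup>2 + (q t)\<^sup>2 / \<omega>) has_real_derivative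
      m * (\<omega> * (p t)\<^sup>2 - (q t)\<^sup>2 / \<omega>) + 2 * r * (p t * q t) * (\<omega> * e1 - e2 / \<omega>)) (at t within {0..})"
  by (rule DERIV_cong[OF DERIV_add[OF DERIV_cmult[OF DERIV_power[OF assms(2)]] DERIV_cdivide[OF DERIV_power[OF assms(3)]]]])
     (use assms(1) in \<open>simp add: field_simps power2_eq_square\<close>)

text \<open>Added to the preceding energy with \<open>e1\<close> close to \<open>1 / \<omega>\<close> and \<open>e2\<close> close to \<open>\<omega>\<close>, the last summand cancels
  the contribution of the damping. Only the term with \<open>m' / r\<close> remains, and the integral of \<open>m'\<close> is bounded by \<open>\<mu>\<close>.\<close>

lemma cross_term_deriv:
  fixes p q :: "real \<Rightarrow> real"
  assumes "r > 0" and "(\<mu> has_real_derivative m') (at t within {0..})"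
    and "(p has_real_derivative \<mu> t / 2 * p t + r * e1 * q t) (at t within {0..})"
    and "(q has_real_derivative - \<mu> t / 2 * q t - r * e2 * p t) (at t within {0..})"
  shows "((\<lambda>t. \<mu> t / r * (p t * q t)) has_real_derivative
      m' / r * (p t * q t) + \<mu> t * (e1 * (q t)\<^sup>2 - e2 * (p t)\<^sup>2)) (at t within {0..})"
  by (rule DERIV_cong[OF DERIV_mult[OF DERIV_cdivide[OF assms(2)] DERIV_mult[OF assms(3,4)]]])
     (use assms(1) in \<open>simp add: field_simps power2_eq_square\<close>)

locale stabilised_damping =
  fixes b \<mu> \<sigma> :: "real \<Rightarrow> real" and \<omega> :: real
  assumes b_cont: "continuous_on {0..} b"
    and b_split: "t \<ge> 0 \<Longrightarrow> 2 * b t = \<mu> t + \<sigma> t"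
    and omega_pos: "\<omega> > 0"
    and mu_pos: "t \<ge> 0 \<Longrightarrow> \<mu> t > 0"
    and mu_decreasing: "t \<ge> 0 \<Longrightarrow> \<exists>D<0. (\<mu> has_real_derivative D) (at t within {0..})"
    and mu_limsup: "Limsup at_top (\<lambda>t. ereal (t * \<mu> t)) < 1"
    and sigma_bdd: "bdd_above ((\<lambda>t. \<bar>integral {0..t} \<sigma>\<bar>) ` {0..})"
begin

definition mu' :: "real \<Rightarrow> real" where
  "mu' t = (SOME D. D < 0 \<and> (\<mu> has_real_derivative D) (at t within {0..}))"

lemma mu': "t \<ge> 0 \<Longrightarrow> mu' t < 0" "t \<ge> 0 \<Longrightarrow> (\<mu> has_real_derivative mu' t) (at t within {0..})"
proof -
  have "mu' t < 0 \<and> (\<mu> has_real_derivative mu' t) (at t within {0..})" if "t \<ge> 0" for t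
    unfolding mu'_def by (rule someI_ex) (use mu_decreasing[OF that] in auto)
  then show "t \<ge> 0 \<Longrightarrow> mu' t < 0" "t \<ge> 0 \<Longrightarrow> (\<mu> has_real_derivative mu' t) (at t within {0..})"
    by auto
qed

lemma mu_cont: "continuous_on {0..} \<mu>"
  using mu'(2) by (auto simp: continuous_on_eq_continuous_within intro: DERIV_continuous)

lemma sigma_cont: "continuous_on {0..} \<sigma>"
proof -
  have "continuous_on {0..} (\<lambda>t. 2 * b t - \<mu> t)"
    by (intro continuous_intros b_cont mu_cont)
  then show ?thesis by (rule continuous_on_eq) (use b_split in \<open>fastforce simp: algebra_simps\<close>)
qed

lemma mu_antimono: "0 \<le> s \<Longrightarrow> s \<le> t \<Longrightarrow> \<mu> t \<le> \<mu> s"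
  using derivative_comparison[of s t \<mu> mu' "\<lambda>_. 0" "\<lambda>_. 0"] mu' by (auto simp: less_imp_le)

text \<open>A number strictly between the upper limit of \<open>t \<mu>(t)\<close> and 1, made positive to avoid case
  distinctions.\<close>

definition \<kappa> :: real where "\<kappa> = (SOME k. 0 < k \<and> k < 1 \<and> (\<exists>T>0. \<forall>t\<ge>T. t * \<mu> t \<le> k))"

lemma kappa: "0 < \<kappa>" "\<kappa> < 1" "\<exists>T>0. \<forall>t\<ge>T. t * \<mu> t \<le> \<kappa>"
proof -
  obtain k0 where k0: "Limsup at_top (\<lambda>t. ereal (t * \<mu> t)) < ereal k0" "k0 < 1"
    using ereal_dense2[OF mu_limsup] by (auto simp: one_ereal_def)
  define k where "k = max k0 (1/2)"
  have "eventually (\<lambda>t. ereal (t * \<mu> t) < ereal k0) at_top"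
    using k0(1) by (rule Limsup_lessD)
  then obtain T where T: "\<And>t. t \<ge> T \<Longrightarrow> t * \<mu> t < k0"
    by (auto simp: eventually_at_top_linorder)
  have "0 < k \<and> k < 1 \<and> (\<exists>T>0. \<forall>t\<ge>T. t * \<mu> t \<le> k)"
    using k0(2) T by (auto simp: k_def intro!: exI[of _ "max T 1"]) (smt (verit, best))
  then have "0 < \<kappa> \<and> \<kappa> < 1 \<and> (\<exists>T>0. \<forall>t\<ge>T. t * \<mu> t \<le> \<kappa>)"
    unfolding \<kappa>_def by (rule someI)
  then show "0 < \<kappa>" "\<kappa> < 1" "\<exists>T>0. \<forall>t\<ge>T. t * \<mu> t \<le> \<kappa>" by auto
qed

definition "kappa_start = (SOME T. T > 0 \<and> (\<forall>t\<ge>T. t * \<mu> t \<le> \<kappa>))"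

lemma kappa_start: "kappa_start > 0" "t \<ge> kappa_start \<Longrightarrow> t * \<mu> t \<le> \<kappa>"
proof -
  have "kappa_start > 0 \<and> (\<forall>t\<ge>kappa_start. t * \<mu> t \<le> \<kappa>)"
    unfolding kappa_start_def by (rule someI_ex) (use kappa(3) in blast)
  then show "kappa_start > 0" "t \<ge> kappa_start \<Longrightarrow> t * \<mu> t \<le> \<kappa>" by auto
qed

text \<open>A bound for \<open>t \<mu>(t)\<close>. The damping is at most \<open>r\<close> as soon as \<open>r t\<close> is at least this number,
  which therefore also marks the end of the middle zone.\<close>

definition "K = 1 + kappa_start * \<mu> 0"

lemma K: "K \<ge> 1" "t \<ge> 0 \<Longrightarrow> t * \<mu> t \<le> K"
proof -
  show "K \<ge> 1" using kappa_start(1) mu_pos[of 0] by (simp add: K_def)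
  assume t: "t \<ge> 0"
  show "t * \<mu> t \<le> K"
  proof (cases "t \<ge> kappa_start")
    case True
    then have "t * \<mu> t \<le> 1" using kappa_start(2) kappa(2) by force
    then show ?thesis using \<open>K \<ge> 1\<close> by linarith
  next
    case False
    have "t * \<mu> t \<le> kappa_start * \<mu> 0"
      using False t mu_pos[of t] mu_antimono[of 0 t] kappa_start(1) by (intro mult_mono) auto
    then show ?thesis by (simp add: K_def)
  qed
qed

definition "sigma_int t = integral {0..t} \<sigma>"
definition "B = (SOME B. B \<ge> 0 \<and> (\<forall>t\<ge>0. \<bar>sigma_int t\<bar> \<le> B))"

lemma B: "B \<ge> 0" "t \<ge> 0 \<Longrightarrow> \<bar>sigma_int t\<bar> \<le> B"
proof -
  obtain B0 where B0: "\<forall>x\<in>(\<lambda>t. \<bar>sigma_int t\<bar>) ` {0..}. x \<le> B0"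
    using sigma_bdd unfolding bdd_above_def sigma_int_def by blast
  have "0 \<le> B0" using B0 abs_ge_zero[of "sigma_int 0"] by force
  then have "B0 \<ge> 0 \<and> (\<forall>t\<ge>0. \<bar>sigma_int t\<bar> \<le> B0)" using B0 by auto
  then have "B \<ge> 0 \<and> (\<forall>t\<ge>0. \<bar>sigma_int t\<bar> \<le> B)" unfolding B_def by (rule someI)
  then show "B \<ge> 0" "t \<ge> 0 \<Longrightarrow> \<bar>sigma_int t\<bar> \<le> B" by auto
qed

lemma exp_sigma_int: assumes "t \<ge> 0" shows "exp (sigma_int t) \<le> exp B" "exp (- B) \<le> exp (sigma_int t)" "exp (- sigma_int t) \<le> exp B"
  using B(2)[OF assms] by auto

lemma sigma_int_deriv: "t \<ge> 0 \<Longrightarrow> (sigma_int has_real_derivative \<sigma> t) (at t within {0..})"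
  unfolding sigma_int_def[abs_def] by (rule integral_has_real_derivative_halfline[OF sigma_cont])

abbreviation "\<Lambda> \<equiv> lambda_of \<mu>"

lemma Lam_deriv: "t \<ge> 0 \<Longrightarrow> (\<Lambda> has_real_derivative \<mu> t / 2 * \<Lambda> t) (at t within {0..})"
  unfolding lambda_of_def[abs_def]
  by (rule derivative_eq_intros refl integral_has_real_derivative_halfline[OF mu_cont] | simp)+

lemma Lam_pos [simp]: "\<Lambda> t > 0" by (simp add: lambda_of_def)
lemma Lam_abs [simp]: "\<bar>\<Lambda> t\<bar> = \<Lambda> t" using Lam_pos[of t] by linarith
lemma Lam_nonneg [simp]: "0 \<le> \<Lambda> t" using Lam_pos[of t] by linarith
lemma Lam_nz [simp]: "\<Lambda> t \<noteq> 0" using Lam_pos[of t] by linarith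
lemma Lam_0: "\<Lambda> 0 = 1" by (simp add: lambda_of_def)

lemma Lam_mono: "0 \<le> s \<Longrightarrow> s \<le> t \<Longrightarrow> \<Lambda> s \<le> \<Lambda> t"
  using derivative_comparison[of s t "\<lambda>_. 0" "\<lambda>_. 0" \<Lambda> "\<lambda>t. \<mu> t / 2 * \<Lambda> t"] Lam_deriv mu_pos
  by (auto simp: less_imp_le)

lemma Lam_ge1: "t \<ge> 0 \<Longrightarrow> \<Lambda> t \<ge> 1"
  using Lam_mono[of 0 t] Lam_0 by simp

definition "inv_sq_int t = integral {0..t} (\<lambda>s. 1 / (\<Lambda> s)\<^sup>2)"

lemma inv_sq_int_deriv: "t \<ge> 0 \<Longrightarrow> (inv_sq_int has_real_derivative 1 / (\<Lambda> t)\<^sup>2) (at t within {0..})"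
proof -
  have "continuous_on {0..} \<Lambda>"
    using Lam_deriv by (auto simp: continuous_on_eq_continuous_within intro: DERIV_continuous)
  then have "continuous_on {0..} (\<lambda>s. 1 / (\<Lambda> s)\<^sup>2)" by (intro continuous_intros) auto
  then show "t \<ge> 0 \<Longrightarrow> (inv_sq_int has_real_derivative 1 / (\<Lambda> t)\<^sup>2) (at t within {0..})"
    unfolding inv_sq_int_def[abs_def] by (rule integral_has_real_derivative_halfline)
qed

lemma inv_sq_int_0: "inv_sq_int 0 = 0" by (simp add: inv_sq_int_def)

definition "inv_sq_const = (\<Lambda> kappa_start)\<^sup>2 + 1 / (1 - \<kappa>)"

lemma inv_sq_const_pos: "inv_sq_const > 0" using kappa(2) by (auto simp: inv_sq_const_def intro!: add_pos_pos)

text \<open>The function \<open>t / \<lambda>\<^sup>2\<close> has derivative \<open>(1 - t \<mu>) / \<lambda>\<^sup>2\<close>, which is comparable to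
  \<open>1 / \<lambda>\<^sup>2\<close> because \<open>t \<mu>\<close> stays below a number smaller than 1.\<close>

lemma inv_sq_int_le: assumes t: "t \<ge> 0" shows "inv_sq_int t \<le> inv_sq_const * (t / (\<Lambda> t)\<^sup>2)"
proof -
  have dt: "((\<lambda>s. s / (\<Lambda> s)\<^sup>2) has_real_derivative (1 - s * \<mu> s) / (\<Lambda> s)\<^sup>2) (at s within {0..})"
    if "s \<ge> 0" for s
    using that by (auto intro!: derivative_eq_intros Lam_deriv simp: field_simps power2_eq_square)
  have small: "inv_sq_int s \<le> (\<Lambda> kappa_start)\<^sup>2 * (s / (\<Lambda> s)\<^sup>2)" if s: "0 \<le> s" "s \<le> kappa_start" for s
  proof -
    have "inv_sq_int s - inv_sq_int 0 \<le> s - 0"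
      by (rule derivative_comparison[OF _ _ inv_sq_int_deriv DERIV_ident]) (use s in \<open>auto simp: power2_eq_square intro!: divide_le_eq_1_pos[THEN iffD2] mult_ge1_I Lam_ge1\<close>)
    also have "s = (\<Lambda> s)\<^sup>2 * (s / (\<Lambda> s)\<^sup>2)" by simp
    also have "\<dots> \<le> (\<Lambda> kappa_start)\<^sup>2 * (s / (\<Lambda> s)\<^sup>2)"
      using s Lam_mono[of s kappa_start] by (intro mult_right_mono power_mono) (auto simp: less_imp_le)
    finally show ?thesis by (simp add: inv_sq_int_0)
  qed
  have "0 \<le> 1 / (1 - \<kappa>)" using kappa(2) by simp
  have le1: "(\<Lambda> kappa_start)\<^sup>2 * x \<le> inv_sq_const * x" if "x \<ge> 0" for x
    using that kappa(2) by (auto simp: inv_sq_const_def algebra_simps)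
  show ?thesis
  proof (cases "t \<le> kappa_start")
    case True
    then show ?thesis using small[of t] le1[of "t / (\<Lambda> t)\<^sup>2"] t by auto
  next
    case False
    have "inv_sq_int t - inv_sq_int kappa_start \<le> 1 / (1 - \<kappa>) * (t / (\<Lambda> t)\<^sup>2) - 1 / (1 - \<kappa>) * (kappa_start / (\<Lambda> kappa_start)\<^sup>2)"
    proof (rule derivative_comparison[OF _ _ inv_sq_int_deriv DERIV_cmult[OF dt]])
      fix x assume x: "kappa_start < x" "x < t"
      have "1 \<le> (1 - x * \<mu> x) / (1 - \<kappa>)"
        using kappa_start(2)[of x] x kappa(2) by (simp add: field_simps)
      then have "1 / (\<Lambda> x)\<^sup>2 \<le> (1 - x * \<mu> x) / (1 - \<kappa>) / (\<Lambda> x)\<^sup>2"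
        by (intro divide_right_mono) auto
      then show "1 / (\<Lambda> x)\<^sup>2 \<le> 1 / (1 - \<kappa>) * ((1 - x * \<mu> x) / (\<Lambda> x)\<^sup>2)" by simp
    qed (use False kappa_start(1) in auto)
    moreover have "inv_sq_int kappa_start \<le> kappa_start"
      using small[of kappa_start] kappa_start(1) by simp
    moreover have "kappa_start \<le> (\<Lambda> kappa_start)\<^sup>2 * (t / (\<Lambda> t)\<^sup>2)"
    proof -
      have "0 - 0 \<le> t / (\<Lambda> t)\<^sup>2 - kappa_start / (\<Lambda> kappa_start)\<^sup>2"
      proof (rule derivative_comparison[OF _ _ DERIV_const dt])
        fix x assume x: "kappa_start < x" "x < t"
        show "0 \<le> (1 - x * \<mu> x) / (\<Lambda> x)\<^sup>2" using kappa_start(2)[of x] x kappa(2) by simp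
      qed (use False kappa_start(1) in auto)
      then have "(\<Lambda> kappa_start)\<^sup>2 * (kappa_start / (\<Lambda> kappa_start)\<^sup>2) \<le> (\<Lambda> kappa_start)\<^sup>2 * (t / (\<Lambda> t)\<^sup>2)"
        by (intro mult_left_mono) auto
      then show ?thesis by simp
    qed
    moreover have "0 \<le> 1 / (1 - \<kappa>) * (kappa_start / (\<Lambda> kappa_start)\<^sup>2)"
      using kappa_start(1) kappa(2) by simp
    ultimately show ?thesis unfolding inv_sq_const_def distrib_right by linarith
  qed
qed

lemma Lam_growth: "\<exists>C>0. \<forall>t\<ge>0. \<Lambda> t \<le> C * (1 + t)"
proof -
  define C where "C = \<Lambda> 1 + inv_sq_const * (\<Lambda> 1)\<^sup>2"
  have Cpos: "C > 0" using inv_sq_const_pos by (auto simp: C_def intro!: add_pos_nonneg)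
  have "\<Lambda> t \<le> C * (1 + t)" if t: "t \<ge> 0" for t
  proof (cases "t \<le> 1")
    case True
    have "\<Lambda> t \<le> \<Lambda> 1" using True t by (intro Lam_mono) auto
    also have "\<dots> \<le> C * 1" using inv_sq_const_pos by (simp add: C_def)
    also have "\<dots> \<le> C * (1 + t)" using t Cpos by (intro mult_left_mono) auto
    finally show ?thesis .
  next
    case False
    have "1 / (\<Lambda> 1)\<^sup>2 - 0 \<le> inv_sq_int 1 - inv_sq_int 0"
    proof -
      have "1 * (1 / (\<Lambda> 1)\<^sup>2) - 0 * (1 / (\<Lambda> 1)\<^sup>2) \<le> inv_sq_int 1 - inv_sq_int 0"
      proof (rule derivative_comparison[OF _ _ DERIV_cmult_right[OF DERIV_ident] inv_sq_int_deriv])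
        fix x :: real assume "0 < x" "x < 1"
        then show "1 * (1 / (\<Lambda> 1)\<^sup>2) \<le> 1 / (\<Lambda> x)\<^sup>2"
          using Lam_mono[of x 1] by (auto intro!: divide_left_mono power_mono simp: less_imp_le)
      qed auto
      then show ?thesis by simp
    qed
    also have "inv_sq_int 1 - inv_sq_int 0 \<le> inv_sq_int t - inv_sq_int 0"
      using derivative_comparison[of 1 t "\<lambda>_. 0" "\<lambda>_. 0" inv_sq_int "\<lambda>t. 1 / (\<Lambda> t)\<^sup>2"] inv_sq_int_deriv False by auto
    also have "\<dots> \<le> inv_sq_const * (t / (\<Lambda> t)\<^sup>2)" using inv_sq_int_le[OF t] inv_sq_int_0 by simp
    finally have "(\<Lambda> t)\<^sup>2 \<le> inv_sq_const * (\<Lambda> 1)\<^sup>2 * t"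
      by (simp add: divide_simps split: if_splits) (simp add: mult_ac)
    moreover have "\<Lambda> t \<le> (\<Lambda> t)\<^sup>2" using Lam_ge1[OF t] by (simp add: power2_eq_square)
    moreover have "inv_sq_const * (\<Lambda> 1)\<^sup>2 * t \<le> C * t" using t by (intro mult_right_mono) (auto simp: C_def less_imp_le)
    ultimately show ?thesis using Cpos by (simp add: distrib_left)
  qed
  then show ?thesis using Cpos by blast
qed

text \<open>The integrating factor: \<open>(a w')' = - r\<^sup>2 a w\<close> for every solution \<open>w\<close>. It equals \<open>exp\<close> of the
  integral of \<open>2 b\<close> and is comparable to \<open>\<lambda>\<^sup>2\<close>.\<close>

definition "int_factor t = (\<Lambda> t)\<^sup>2 * exp (sigma_int t)"

lemma int_factor_pos [simp]: "int_factor t > 0" by (simp add: int_factor_def)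
lemma int_factor_abs [simp]: "\<bar>int_factor t\<bar> = int_factor t" using int_factor_pos[of t] by linarith
lemma int_factor_nz [simp]: "int_factor t \<noteq> 0" using int_factor_pos[of t] by linarith

lemma int_factor_deriv: "t \<ge> 0 \<Longrightarrow> (int_factor has_real_derivative 2 * b t * int_factor t) (at t within {0..})"
  unfolding int_factor_def[abs_def] b_split
  by (auto intro!: derivative_eq_intros Lam_deriv sigma_int_deriv simp: algebra_simps power2_eq_square)

lemma int_factor_bounds: assumes "t \<ge> 0"
  shows "int_factor t \<le> exp B * (\<Lambda> t)\<^sup>2" "exp (- B) * (\<Lambda> t)\<^sup>2 \<le> int_factor t" "1 / int_factor t \<le> exp B / (\<Lambda> t)\<^sup>2"
proof -
  show "int_factor t \<le> exp B * (\<Lambda> t)\<^sup>2" "exp (- B) * (\<Lambda> t)\<^sup>2 \<le> int_factor t"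
    using exp_sigma_int[OF assms] by (auto simp: int_factor_def mult_ac intro!: mult_left_mono)
  have "1 / int_factor t = exp (- sigma_int t) / (\<Lambda> t)\<^sup>2" by (simp add: int_factor_def exp_minus field_simps)
  also have "\<dots> \<le> exp B / (\<Lambda> t)\<^sup>2" using exp_sigma_int[OF assms] by (intro divide_right_mono) auto
  finally show "1 / int_factor t \<le> exp B / (\<Lambda> t)\<^sup>2" .
qed

text \<open>The energy \<open>r\<^sup>2 w\<^sup>2 + v\<^sup>2\<close> multiplied by the expected rate \<open>\<lambda>\<^sup>2\<close>.\<close>

definition "wenergy r w v t = (r * \<Lambda> t * w t)\<^sup>2 + (\<Lambda> t * v t)\<^sup>2"

text \<open>Small enough for the term with \<open>r\<^sup>2\<close> to be absorbed in the proof of the next lemma.\<close>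

definition "low_bound = exp (- B)"

text \<open>Integrating the equation twice bounds the maximum of \<open>|w|\<close> by the data and by one half of itself,
  which is absorbed. The integral of \<open>1 / \<lambda>\<^sup>2\<close> that multiplies \<open>v 0\<close> is converted into \<open>t / \<lambda>\<^sup>2\<close>, and
  \<open>r t\<close> is bounded. The factor \<open>1 + r\<close> in front of \<open>w 0\<close> is due to the growth of \<open>\<lambda>\<close>, which is at most
  linear.\<close>

lemma low_zone:
  "\<exists>C>0. \<forall>r w v t. damped_oscillator b r w v \<longrightarrow> r \<ge> 0 \<longrightarrow> t \<ge> 0 \<longrightarrow> r * t \<le> low_bound \<longrightarrow>
     wenergy r w v t \<le> C * ((1 + r) * \<bar>w 0\<bar> + \<bar>v 0\<bar>)\<^sup>2"
proof -
  obtain C1 where C1: "C1 > 0" "\<And>t. t \<ge> 0 \<Longrightarrow> \<Lambda> t \<le> C1 * (1 + t)" using Lam_growth by blast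
  define C2 where "C2 = 2 * C1 + 2 * exp B * inv_sq_const"
  define C3 where "C3 = exp B * (1 + exp B * C2)"
  have C2: "C2 > 0" using C1(1) inv_sq_const_pos by (auto simp: C2_def intro!: add_pos_pos)
  have C3: "C3 > 0" unfolding C3_def using C2 by (intro mult_pos_pos add_pos_pos) auto
  have eps1: "low_bound \<le> 1" "low_bound > 0" using B(1) by (auto simp: low_bound_def)
  have main: "wenergy r w v t \<le> (C2\<^sup>2 + C3\<^sup>2) * ((1 + r) * \<bar>w 0\<bar> + \<bar>v 0\<bar>)\<^sup>2"
    if sol: "damped_oscillator b r w v" and r: "r \<ge> 0" and t: "t \<ge> 0" and rt: "r * t \<le> low_bound" for r w v t
  proof -
    define D where "D = (1 + r) * \<bar>w 0\<bar> + \<bar>v 0\<bar>"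
    have dw: "(w has_real_derivative v x) (at x within {0..})"
      and dv: "(v has_real_derivative - r\<^sup>2 * w x - 2 * b x * v x) (at x within {0..})" if "x \<ge> 0" for x
      using sol that by (auto simp: damped_oscillator_def)
    have dp: "((\<lambda>x. int_factor x * v x) has_real_derivative - r\<^sup>2 * int_factor x * w x) (at x within {0..})" if "x \<ge> 0" for x
      using that by (auto intro!: derivative_eq_intros int_factor_deriv dv simp: algebra_simps)
    have am0: "int_factor 0 = 1" by (simp add: int_factor_def Lam_0 sigma_int_def)
    have "continuous_on {0..t} (\<lambda>x. \<bar>w x\<bar>)"
      using dw by (intro continuous_on_rabs) (auto simp: continuous_on_eq_continuous_within intro!: continuous_within_subset[OF DERIV_continuous[OF dw]])
    \<comment> \<open>the maximum of \<open>|w|\<close> on the interval, in which the unknown is absorbed\<close>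
    then obtain \<tau> where tau: "\<tau> \<in> {0..t}" and max: "\<And>x. x \<in> {0..t} \<Longrightarrow> \<bar>w x\<bar> \<le> \<bar>w \<tau>\<bar>"
      using continuous_attains_sup[of "{0..t}" "\<lambda>x. \<bar>w x\<bar>"] t by fastforce
    define M where "M = \<bar>w \<tau>\<bar>"
    have M0: "M \<ge> 0" by (simp add: M_def)
    have p: "\<bar>int_factor x * v x\<bar> \<le> \<bar>v 0\<bar> + exp B * r\<^sup>2 * M * x * (\<Lambda> x)\<^sup>2" if x: "0 \<le> x" "x \<le> t" for x
    proof -
      have "\<bar>int_factor x * v x - int_factor 0 * v 0\<bar> \<le> x * (exp B * r\<^sup>2 * M * (\<Lambda> x)\<^sup>2) - 0 * (exp B * r\<^sup>2 * M * (\<Lambda> x)\<^sup>2)"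
      proof (rule derivative_comparison_abs[OF _ _ dp DERIV_cmult_right[OF DERIV_ident]])
        fix y assume y: "0 < y" "y < x"
        have "int_factor y \<le> exp B * (\<Lambda> x)\<^sup>2"
          using int_factor_bounds(1)[of y] Lam_mono[of y x] y
          by (auto intro!: order_trans[OF int_factor_bounds(1)] mult_left_mono power_mono simp: less_imp_le)
        moreover have "\<bar>w y\<bar> \<le> M" using max[of y] y x by (simp add: M_def)
        ultimately have "r\<^sup>2 * (int_factor y * \<bar>w y\<bar>) \<le> r\<^sup>2 * ((exp B * (\<Lambda> x)\<^sup>2) * M)"
          by (intro mult_left_mono mult_mono) (auto simp: less_imp_le)
        then show "\<bar>- r\<^sup>2 * int_factor y * w y\<bar> \<le> 1 * (exp B * r\<^sup>2 * M * (\<Lambda> x)\<^sup>2)"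
          by (simp add: abs_mult mult_ac)
      qed (use x in auto)
      then show ?thesis by (simp add: am0 mult_ac abs_le_iff) linarith
    qed
    have v_le: "\<bar>v x\<bar> \<le> exp B * \<bar>v 0\<bar> * (1 / (\<Lambda> x)\<^sup>2) + (exp B)\<^sup>2 * r\<^sup>2 * M * x" if x: "0 \<le> x" "x \<le> t" for x
    proof -
      have "\<bar>v x\<bar> = 1 / int_factor x * \<bar>int_factor x * v x\<bar>" by (simp add: abs_mult)
      also have "\<dots> \<le> exp B / (\<Lambda> x)\<^sup>2 * (\<bar>v 0\<bar> + exp B * r\<^sup>2 * M * x * (\<Lambda> x)\<^sup>2)"
        using int_factor_bounds(3)[of x] p[OF x] x by (intro mult_mono) auto
      finally show ?thesis by (simp add: field_simps power2_eq_square)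
    qed
    have "\<bar>w \<tau> - w 0\<bar> \<le> (exp B * \<bar>v 0\<bar> * inv_sq_int \<tau> + (exp B)\<^sup>2 * r\<^sup>2 * M * (\<tau>\<^sup>2 / 2))
        - (exp B * \<bar>v 0\<bar> * inv_sq_int 0 + (exp B)\<^sup>2 * r\<^sup>2 * M * (0\<^sup>2 / 2))"
    proof (rule derivative_comparison_abs[OF _ _ dw])
      fix x assume "0 \<le> x" "x \<le> \<tau>"
      then show "((\<lambda>x. exp B * \<bar>v 0\<bar> * inv_sq_int x + (exp B)\<^sup>2 * r\<^sup>2 * M * (x\<^sup>2 / 2)) has_real_derivative
          exp B * \<bar>v 0\<bar> * (1 / (\<Lambda> x)\<^sup>2) + (exp B)\<^sup>2 * r\<^sup>2 * M * x) (at x within {0..})"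
        by (auto intro!: derivative_eq_intros inv_sq_int_deriv)
    qed (use tau v_le in auto)
    then have "M \<le> \<bar>w 0\<bar> + exp B * \<bar>v 0\<bar> * inv_sq_int \<tau> + (exp B)\<^sup>2 * r\<^sup>2 * M * (\<tau>\<^sup>2 / 2)"
      by (simp add: inv_sq_int_0 M_def)
    also have "inv_sq_int \<tau> \<le> inv_sq_int t"
      using derivative_comparison[of \<tau> t "\<lambda>_. 0" "\<lambda>_. 0" inv_sq_int "\<lambda>t. 1 / (\<Lambda> t)\<^sup>2"] inv_sq_int_deriv tau by auto
    \<comment> \<open>the end of the zone is chosen such that \<open>exp B * (r * t) \<le> 1\<close>\<close>
    also have "(exp B)\<^sup>2 * r\<^sup>2 * M * (\<tau>\<^sup>2 / 2) \<le> M / 2"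
    proof -
      have "r * \<tau> \<le> low_bound" using tau r rt mult_left_mono[of \<tau> t r] by auto
      then have "exp B * (r * \<tau>) \<le> exp B * low_bound" by simp
      then have "exp B * (r * \<tau>) \<le> 1" by (simp add: low_bound_def exp_minus)
      then have "(exp B * (r * \<tau>))\<^sup>2 \<le> 1" using r tau by (intro power_le_one) auto
      then have "(exp B * (r * \<tau>))\<^sup>2 * (M / 2) \<le> 1 * (M / 2)" using M0 by (intro mult_right_mono) auto
      then show ?thesis by (simp add: power_mult_distrib mult_ac)
    qed
    finally have "M \<le> \<bar>w 0\<bar> + exp B * \<bar>v 0\<bar> * inv_sq_int t + M / 2"
      by (auto simp: mult_left_mono)
    then have "M \<le> 2 * \<bar>w 0\<bar> + 2 * exp B * \<bar>v 0\<bar> * inv_sq_int t" by linarith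
    also have "\<dots> \<le> 2 * \<bar>w 0\<bar> + 2 * exp B * \<bar>v 0\<bar> * (inv_sq_const * (t / (\<Lambda> t)\<^sup>2))"
      using inv_sq_int_le[OF t] by (intro add_left_mono mult_left_mono) auto
    finally have "r * \<Lambda> t * M \<le> r * \<Lambda> t * (2 * \<bar>w 0\<bar> + 2 * exp B * \<bar>v 0\<bar> * (inv_sq_const * (t / (\<Lambda> t)\<^sup>2)))"
      using r by (intro mult_left_mono) (auto simp: less_imp_le)
    also have "\<dots> = 2 * (r * \<Lambda> t) * \<bar>w 0\<bar> + 2 * exp B * inv_sq_const * ((r * t) / \<Lambda> t) * \<bar>v 0\<bar>"
      by (simp add: field_simps power2_eq_square)
    also have "\<dots> \<le> 2 * (C1 * (1 + r)) * \<bar>w 0\<bar> + 2 * exp B * inv_sq_const * 1 * \<bar>v 0\<bar>"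
    proof -
      have "r * \<Lambda> t \<le> r * (C1 * (1 + t))" using C1(2)[OF t] r by (intro mult_left_mono)
      also have "\<dots> = C1 * (r + r * t)" by (simp add: algebra_simps)
      also have "\<dots> \<le> C1 * (1 + r)" using rt eps1 C1(1) by (intro mult_left_mono) auto
      finally have 1: "r * \<Lambda> t \<le> C1 * (1 + r)" .
      have "r * t / \<Lambda> t \<le> r * t / 1" using Lam_ge1[OF t] r t by (intro divide_left_mono) auto
      also have "\<dots> \<le> 1" using rt eps1 by simp
      finally have 2: "r * t / \<Lambda> t \<le> 1" .
      show ?thesis
        using 1 2 inv_sq_const_pos by (intro add_mono mult_right_mono mult_left_mono) (auto simp: less_imp_le)
    qed
    also have "\<dots> \<le> C2 * D"
    proof -
      have "0 \<le> 2 * C1 * \<bar>v 0\<bar> + 2 * exp B * inv_sq_const * ((1 + r) * \<bar>w 0\<bar>)"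
        using C1(1) inv_sq_const_pos r by (auto intro!: add_nonneg_nonneg)
      then show ?thesis by (simp add: C2_def D_def algebra_simps)
    qed
    finally have rM: "r * \<Lambda> t * M \<le> C2 * D" .
    have D0: "D \<ge> 0" using r by (simp add: D_def)
    have "\<bar>r * \<Lambda> t * w t\<bar> \<le> r * \<Lambda> t * M"
      using max[of t] t r by (auto simp: abs_mult M_def intro!: mult_left_mono)
    then have wt: "\<bar>r * \<Lambda> t * w t\<bar> \<le> C2 * D" using rM by simp
    have vt: "\<bar>\<Lambda> t * v t\<bar> \<le> C3 * D"
    proof -
      have "\<bar>\<Lambda> t * v t\<bar> \<le> \<Lambda> t * (exp B * \<bar>v 0\<bar> * (1 / (\<Lambda> t)\<^sup>2) + (exp B)\<^sup>2 * r\<^sup>2 * M * t)"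
        using v_le[of t] t by (auto simp: abs_mult simp del: Lam_pos intro!: mult_left_mono)
      also have "\<dots> = exp B * (\<bar>v 0\<bar> / \<Lambda> t) + (exp B)\<^sup>2 * ((r * t) * (r * \<Lambda> t * M))"
        by (simp add: field_simps power2_eq_square)
      also have "\<dots> \<le> exp B * D + (exp B)\<^sup>2 * (1 * (C2 * D))"
      proof -
        have "\<bar>v 0\<bar> / \<Lambda> t \<le> \<bar>v 0\<bar> / 1" using Lam_ge1[OF t] by (intro divide_left_mono) auto
        also have "\<dots> \<le> D" using r by (simp add: D_def)
        finally have 1: "\<bar>v 0\<bar> / \<Lambda> t \<le> D" .
        have "(r * t) * (r * \<Lambda> t * M) \<le> 1 * (C2 * D)"
          by (rule mult_mono[OF _ rM]) (use rt eps1 r t M0 in \<open>auto simp: less_imp_le\<close>)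
        then show ?thesis using 1 by (intro add_mono mult_left_mono) auto
      qed
      also have "\<dots> = C3 * D" by (simp add: C3_def algebra_simps power2_eq_square)
      finally show ?thesis .
    qed
    have "(r * \<Lambda> t * w t)\<^sup>2 \<le> (C2 * D)\<^sup>2" "(\<Lambda> t * v t)\<^sup>2 \<le> (C3 * D)\<^sup>2"
      using wt vt D0 C2 C3 by (auto simp: abs_le_square_iff[symmetric])
    then have "wenergy r w v t \<le> (C2\<^sup>2 + C3\<^sup>2) * D\<^sup>2"
      by (simp add: wenergy_def power_mult_distrib distrib_right)
    then show ?thesis by (simp add: D_def)
  qed
  have "C2\<^sup>2 + C3\<^sup>2 > 0" using C2 by (auto intro!: add_pos_nonneg)
  then show ?thesis using main by (intro exI[of _ "C2\<^sup>2 + C3\<^sup>2"]) auto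
qed

text \<open>Next to \<open>r \<lambda> w\<close> this is the second component of the system in which \<open>\<sigma>\<close> appears only through its
  bounded primitive, as a factor of \<open>r\<close>, and no longer as a damping.\<close>

definition "scaled_velocity v t = \<Lambda> t * exp (sigma_int t) * v t"
definition "mid_energy r w v t = \<omega> * (r * \<Lambda> t * w t)\<^sup>2 + (scaled_velocity v t)\<^sup>2 / \<omega>"
definition "mid_const = (\<omega> + 1 / \<omega>) * exp (2 * B)"

lemma mid_const_pos: "mid_const > 0" using omega_pos by (auto simp: mid_const_def intro!: mult_pos_pos add_pos_pos)

lemma mid_energy_nonneg: "mid_energy r w v t \<ge> 0" using omega_pos by (simp add: mid_energy_def)

lemma mid_energy_equiv: assumes t: "t \<ge> 0" shows "mid_energy r w v t \<le> mid_const * wenergy r w v t" "wenergy r w v t \<le> mid_const * mid_energy r w v t"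
proof -
  have y: "(scaled_velocity v t)\<^sup>2 = exp (2 * sigma_int t) * (\<Lambda> t * v t)\<^sup>2"
    by (simp add: scaled_velocity_def power_mult_distrib exp_double)
  have e: "exp (2 * sigma_int t) \<le> exp (2 * B)" "exp (- 2 * sigma_int t) \<le> exp (2 * B)" "1 \<le> exp (2 * B)"
    using B(2)[OF t] B(1) by auto
  have "\<omega> + 1 / \<omega> \<le> mid_const"
    using omega_pos mult_left_mono[OF e(3), of "\<omega> + 1 / \<omega>"] by (simp add: mid_const_def)
  moreover have "1 / \<omega> > 0" using omega_pos by simp
  ultimately have "\<omega> \<le> mid_const" by linarith
  have 1: "exp (2 * sigma_int t) / \<omega> \<le> mid_const"
    using omega_pos e(1) mult_mono[of "1 / \<omega>" "\<omega> + 1 / \<omega>" "exp (2 * sigma_int t)" "exp (2 * B)"] by (auto simp: mid_const_def)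
  have 2: "exp (- 2 * sigma_int t) \<le> mid_const * (1 / \<omega>)"
  proof -
    have "1 * exp (- 2 * sigma_int t) \<le> (1 + 1 / \<omega>\<^sup>2) * exp (2 * B)"
      using e by (intro mult_mono) auto
    also have "\<dots> = mid_const * (1 / \<omega>)" using omega_pos by (simp add: mid_const_def field_simps power2_eq_square)
    finally show ?thesis by simp
  qed
  have 3: "1 \<le> mid_const * \<omega>"
  proof -
    have "1 * 1 \<le> (\<omega>\<^sup>2 + 1) * exp (2 * B)" using e(3) by (intro mult_mono) auto
    also have "\<dots> = mid_const * \<omega>" using omega_pos by (simp add: mid_const_def field_simps power2_eq_square)
    finally show ?thesis by simp
  qed
  have "\<omega> * (r * \<Lambda> t * w t)\<^sup>2 \<le> mid_const * (r * \<Lambda> t * w t)\<^sup>2"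
    using \<open>\<omega> \<le> mid_const\<close> by (intro mult_right_mono) auto
  moreover have "(scaled_velocity v t)\<^sup>2 / \<omega> \<le> mid_const * (\<Lambda> t * v t)\<^sup>2"
    using mult_right_mono[OF 1, of "(\<Lambda> t * v t)\<^sup>2"] by (simp add: y)
  ultimately show "mid_energy r w v t \<le> mid_const * wenergy r w v t" by (simp add: mid_energy_def wenergy_def distrib_left)
  have "1 * (r * \<Lambda> t * w t)\<^sup>2 \<le> (mid_const * \<omega>) * (r * \<Lambda> t * w t)\<^sup>2"
    using 3 by (intro mult_right_mono) auto
  moreover have "(\<Lambda> t * v t)\<^sup>2 = exp (- 2 * sigma_int t) * (scaled_velocity v t)\<^sup>2"
    by (simp add: y mult.assoc[symmetric] exp_add[symmetric])
  moreover have "exp (- 2 * sigma_int t) * (scaled_velocity v t)\<^sup>2 \<le> mid_const * (1 / \<omega>) * (scaled_velocity v t)\<^sup>2"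
    using 2 by (intro mult_right_mono) auto
  ultimately show "wenergy r w v t \<le> mid_const * mid_energy r w v t" by (simp add: mid_energy_def wenergy_def distrib_left mult.assoc)
qed

lemma scaled_deriv:
  assumes sol: "damped_oscillator b r w v" and t: "t \<ge> 0"
  shows "((\<lambda>t. r * \<Lambda> t * w t) has_real_derivative
      \<mu> t / 2 * (r * \<Lambda> t * w t) + r * exp (- sigma_int t) * scaled_velocity v t) (at t within {0..})"
    and "(scaled_velocity v has_real_derivative
      - \<mu> t / 2 * scaled_velocity v t - r * exp (sigma_int t) * (r * \<Lambda> t * w t)) (at t within {0..})"
proof -
  have dw: "(w has_real_derivative v t) (at t within {0..})"
    and dv: "(v has_real_derivative - r\<^sup>2 * w t - 2 * b t * v t) (at t within {0..})"
    using sol t by (auto simp: damped_oscillator_def)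
  have sg: "\<sigma> t = 2 * b t - \<mu> t" using b_split[OF t] by simp
  have "exp (- sigma_int t) * exp (sigma_int t) = 1" by (simp add: exp_minus)
  then show "((\<lambda>t. r * \<Lambda> t * w t) has_real_derivative
      \<mu> t / 2 * (r * \<Lambda> t * w t) + r * exp (- sigma_int t) * scaled_velocity v t) (at t within {0..})"
    using t by (auto intro!: derivative_eq_intros Lam_deriv dw simp: scaled_velocity_def algebra_simps)
  show "(scaled_velocity v has_real_derivative
      - \<mu> t / 2 * scaled_velocity v t - r * exp (sigma_int t) * (r * \<Lambda> t * w t)) (at t within {0..})"
    unfolding scaled_velocity_def[abs_def]
    by (rule DERIV_cong[OF DERIV_mult[OF DERIV_mult[OF Lam_deriv[OF t] DERIV_chain2[OF DERIV_exp sigma_int_deriv[OF t]]] dv]])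
       (simp add: scaled_velocity_def sg algebra_simps power2_eq_square)
qed

lemma mid_energy_deriv:
  assumes sol: "damped_oscillator b r w v" and t: "t \<ge> 0"
  shows "(mid_energy r w v has_real_derivative
      \<mu> t * (\<omega> * (r * \<Lambda> t * w t)\<^sup>2 - (scaled_velocity v t)\<^sup>2 / \<omega>) +
      2 * r * ((r * \<Lambda> t * w t) * scaled_velocity v t) * (\<omega> * exp (- sigma_int t) - exp (sigma_int t) / \<omega>)) (at t within {0..})"
  unfolding mid_energy_def[abs_def] by (rule quadratic_energy_deriv[OF omega_pos scaled_deriv[OF sol t]])

lemma cross_le: "2 * \<bar>(r * \<Lambda> t * w t) * scaled_velocity v t\<bar> \<le> mid_energy r w v t"
proof -
  define x y where "x = sqrt \<omega> * (r * \<Lambda> t * w t)" and "y = scaled_velocity v t / sqrt \<omega>"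
  have "2 * \<bar>x * y\<bar> \<le> x\<^sup>2 + y\<^sup>2" using sum_squares_bound[of "\<bar>x\<bar>" "\<bar>y\<bar>"] by (simp add: abs_mult)
  moreover have "x * y = (r * \<Lambda> t * w t) * scaled_velocity v t" using omega_pos by (simp add: x_def y_def)
  moreover have "x\<^sup>2 + y\<^sup>2 = mid_energy r w v t" using omega_pos
    by (simp add: x_def y_def mid_energy_def power_mult_distrib power_divide)
  ultimately show ?thesis by simp
qed

text \<open>Here \<open>\<mu>(t)\<close> and the coupling are of size \<open>r\<close>, and the zone has length at most \<open>K / r\<close>.\<close>

lemma middle_zone:
  "\<exists>C>0. \<forall>r w v s t. damped_oscillator b r w v \<longrightarrow> r > 0 \<longrightarrow> low_bound / r \<le> s \<longrightarrow> s \<le> t \<longrightarrow> t \<le> K / r \<longrightarrow>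
     wenergy r w v t \<le> C * wenergy r w v s"
proof -
  define c where "c = K / low_bound + (\<omega> * exp B + exp B / \<omega>)"
  have low_bound: "low_bound > 0" by (simp add: low_bound_def)
  have c: "c > 0" using low_bound K(1) omega_pos by (auto simp: c_def intro!: add_pos_pos)
  have "wenergy r w v t \<le> (mid_const * mid_const * exp (c * K)) * wenergy r w v s"
    if sol: "damped_oscillator b r w v" and r: "r > 0" and st: "low_bound / r \<le> s" "s \<le> t" "t \<le> K / r"
    for r w v s t
  proof -
    have s: "s > 0" using st(1) low_bound r by (auto intro: less_le_trans[of 0 "low_bound / r"])
    have "mid_energy r w v t \<le> exp (c * r * t - c * r * s) * mid_energy r w v s"
    proof (rule gronwall[OF _ st(2) mid_energy_deriv[OF sol]])
      fix x assume x: "s < x" "x < t"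
      define p q where "p = r * \<Lambda> x * w x" and "q = scaled_velocity v x"
      have "x * \<mu> x \<le> K" using K(2) x s by auto
      then have "\<mu> x \<le> K / x" using x s by (simp add: field_simps)
      also have "\<dots> \<le> K / (low_bound / r)"
        using x st low_bound r K(1) s by (intro divide_left_mono) auto
      finally have mu: "\<mu> x \<le> r * (K / low_bound)" by (simp add: mult.commute)
      have "\<mu> x * (\<omega> * p\<^sup>2 - q\<^sup>2 / \<omega>) \<le> \<mu> x * mid_energy r w v x"
        using mu_pos[of x] x s omega_pos by (intro mult_left_mono) (auto simp: mid_energy_def p_def q_def)
      also have "\<dots> \<le> r * (K / low_bound) * mid_energy r w v x"
        using mu mid_energy_nonneg by (intro mult_right_mono) auto
      finally have 1: "\<mu> x * (\<omega> * p\<^sup>2 - q\<^sup>2 / \<omega>) \<le> r * (K / low_bound) * mid_energy r w v x" .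
      have ab: "\<bar>\<omega> * exp (- sigma_int x) - exp (sigma_int x) / \<omega>\<bar> \<le> \<omega> * exp B + exp B / \<omega>"
      proof -
        have "\<omega> * exp (- sigma_int x) \<le> \<omega> * exp B" "exp (sigma_int x) / \<omega> \<le> exp B / \<omega>"
          using exp_sigma_int[of x] x s omega_pos by (auto intro!: mult_left_mono divide_right_mono)
        moreover have "0 < \<omega> * exp (- sigma_int x)" "0 < exp (sigma_int x) / \<omega>" using omega_pos by auto
        ultimately show ?thesis by linarith
      qed
      have "(2 * r * (p * q)) * (\<omega> * exp (- sigma_int x) - exp (sigma_int x) / \<omega>) \<le>
          \<bar>2 * r * (p * q)\<bar> * \<bar>\<omega> * exp (- sigma_int x) - exp (sigma_int x) / \<omega>\<bar>"
        by (metis abs_ge_self abs_mult)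
      also have "\<dots> \<le> (r * mid_energy r w v x) * (\<omega> * exp B + exp B / \<omega>)"
        using ab cross_le[of r x w v] r mid_energy_nonneg[of r w v x]
        by (intro mult_mono) (auto simp: abs_mult p_def q_def)
      finally show "\<mu> x * (\<omega> * (r * \<Lambda> x * w x)\<^sup>2 - (scaled_velocity v x)\<^sup>2 / \<omega>) +
          2 * r * ((r * \<Lambda> x * w x) * scaled_velocity v x) * (\<omega> * exp (- sigma_int x) - exp (sigma_int x) / \<omega>) \<le> (c * r) * mid_energy r w v x"
        using 1 by (simp add: c_def p_def q_def algebra_simps)
    next
      fix x show "((\<lambda>x. c * r * x) has_real_derivative c * r) (at x within {0..})"
        by (auto intro!: derivative_eq_intros)
    qed (use s in auto)
    also have "\<dots> \<le> exp (c * K) * mid_energy r w v s"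
    proof -
      have "r * t \<le> K" using st(3) r by (simp add: field_simps)
      then have "c * (r * t) \<le> c * K" using c by (intro mult_left_mono) auto
      moreover have "0 \<le> c * r * s" using c r s by simp
      ultimately have "c * r * t - c * r * s \<le> c * K" by (simp add: mult.assoc)
      then show ?thesis using mid_energy_nonneg by (intro mult_right_mono) auto
    qed
    finally have "mid_const * mid_energy r w v t \<le> mid_const * (exp (c * K) * mid_energy r w v s)"
      using mid_const_pos by (intro mult_left_mono) auto
    also have "\<dots> \<le> mid_const * (exp (c * K) * (mid_const * wenergy r w v s))"
      using mid_const_pos mid_energy_equiv(1)[of s] s by (intro mult_left_mono) auto
    finally show ?thesis using mid_energy_equiv(2)[of t r w v] s st by (simp add: mult_ac)
  qed
  moreover have "mid_const * mid_const * exp (c * K) > 0" using mid_const_pos by simp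
  ultimately show ?thesis by blast
qed

text \<open>The deviation in the stabilisation condition. Using it in place of \<open>\<Theta>\<close> to separate the zones gives
  a function that is monotone and continuous.\<close>

definition "Psi t = integral {0..t} (\<lambda>x. \<bar>exp (sigma_int x) - \<omega>\<bar>)"

lemma Psi_deriv: "t \<ge> 0 \<Longrightarrow> (Psi has_real_derivative \<bar>exp (sigma_int t) - \<omega>\<bar>) (at t within {0..})"
proof -
  have "continuous_on {0..} sigma_int"
    using sigma_int_deriv by (auto simp: continuous_on_eq_continuous_within intro: DERIV_continuous)
  then have "continuous_on {0..} (\<lambda>x. \<bar>exp (sigma_int x) - \<omega>\<bar>)" by (intro continuous_intros)
  then show "t \<ge> 0 \<Longrightarrow> (Psi has_real_derivative \<bar>exp (sigma_int t) - \<omega>\<bar>) (at t within {0..})"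
    unfolding Psi_def[abs_def] by (rule integral_has_real_derivative_halfline)
qed

lemma Psi_0: "Psi 0 = 0" by (simp add: Psi_def)

lemma Psi_mono: "0 \<le> s \<Longrightarrow> s \<le> t \<Longrightarrow> Psi s \<le> Psi t"
  using derivative_comparison[of s t "\<lambda>_. 0" "\<lambda>_. 0" Psi "\<lambda>t. \<bar>exp (sigma_int t) - \<omega>\<bar>"] Psi_deriv by auto

lemma Psi_nonneg: "t \<ge> 0 \<Longrightarrow> Psi t \<ge> 0" using Psi_mono[of 0 t] Psi_0 by simp

text \<open>The energy with weights \<open>\<omega>\<close> and \<open>1 / \<omega>\<close> is corrected by the cross term of \<open>cross_term_deriv\<close>. What
  remains of its derivative is at most \<open>r |exp sigma_int - \<omega>| - \<mu>' / r\<close> times the energy, up to a constant. The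
  integral of the first part is \<open>r \<Psi>\<close>, and that of the second is at most \<open>\<mu> / r\<close>, which is at most 1
  beyond the middle zone.\<close>

lemma stabilisation_zone:
  "\<exists>C>0. \<forall>r w v s t. damped_oscillator b r w v \<longrightarrow> r > 0 \<longrightarrow> K / r \<le> s \<longrightarrow> s \<le> t \<longrightarrow> r * Psi t \<le> N \<longrightarrow>
     wenergy r w v t \<le> C * wenergy r w v s"
proof -
  define c where "c = exp B + 1 / \<omega>"
  have c: "c > 0" using omega_pos by (auto simp: c_def intro!: add_pos_pos)
  have "wenergy r w v t \<le> (3 * mid_const * mid_const * exp (1 + 4 * c * N)) * wenergy r w v s"
    if sol: "damped_oscillator b r w v" and r: "r > 0" and st: "K / r \<le> s" "s \<le> t" "r * Psi t \<le> N"
    for r w v s t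
  proof -
    have s: "s > 0" using st(1) K(1) r by (auto intro: less_le_trans[of 0 "K / r"])
    \<comment> \<open>the cross term is at most one half of the energy because \<open>\<mu> \<le> r\<close> in this zone\<close>
    define F where "F x = mid_energy r w v x + \<mu> x / r * ((r * \<Lambda> x * w x) * scaled_velocity v x)" for x
    have mu_r: "\<mu> x \<le> r" if x: "s \<le> x" for x
    proof -
      have "x * \<mu> x \<le> K" using K(2) x s by auto
      also have "K \<le> s * r" using st(1) r by (simp add: field_simps)
      also have "\<dots> \<le> x * r" using x r by (intro mult_right_mono) auto
      finally show ?thesis using x s by simp
    qed
    have FE: "mid_energy r w v x \<le> 2 * F x" "2 * F x \<le> 3 * mid_energy r w v x" if x: "s \<le> x" for x
    proof -
      define z where "z = \<mu> x / r * ((r * \<Lambda> x * w x) * scaled_velocity v x)"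
      have F: "F x = mid_energy r w v x + z" by (simp add: F_def z_def)
      have "\<bar>z\<bar> \<le> 1 * (mid_energy r w v x / 2)"
        unfolding z_def abs_mult[of "\<mu> x / r"]
      proof (rule mult_mono)
        show "\<bar>\<mu> x / r\<bar> \<le> 1" using mu_r[OF x] mu_pos[of x] x s r by auto
      qed (use cross_le[of r x w v] in auto)
      then have "z \<le> mid_energy r w v x / 2" "- z \<le> mid_energy r w v x / 2"
        unfolding mult_1 abs_le_iff by blast+
      then show "mid_energy r w v x \<le> 2 * F x" "2 * F x \<le> 3 * mid_energy r w v x"
        unfolding F by (simp_all add: field_simps)
    qed
    have dF: "(F has_real_derivative
        (\<mu> x * (\<omega> * (r * \<Lambda> x * w x)\<^sup>2 - (scaled_velocity v x)\<^sup>2 / \<omega>) +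
        2 * r * ((r * \<Lambda> x * w x) * scaled_velocity v x) * (\<omega> * exp (- sigma_int x) - exp (sigma_int x) / \<omega>)) +
        (mu' x / r * ((r * \<Lambda> x * w x) * scaled_velocity v x) +
         \<mu> x * (exp (- sigma_int x) * (scaled_velocity v x)\<^sup>2 - exp (sigma_int x) * (r * \<Lambda> x * w x)\<^sup>2))) (at x within {0..})"
      if x: "s \<le> x" for x
    proof -
      have x0: "x \<ge> 0" using x s by auto
      show ?thesis unfolding F_def[abs_def]
        by (intro DERIV_add mid_energy_deriv[OF sol x0] cross_term_deriv[OF r mu'(2)[OF x0] scaled_deriv[OF sol x0]])
    qed
    have "F t \<le> exp ((4 * r * c * Psi t - \<mu> t / r) - (4 * r * c * Psi s - \<mu> s / r)) * F s"
    proof (rule gronwall[OF _ st(2) dF])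
      fix x assume x: "s < x" "x < t"
      define p q where "p = r * \<Lambda> x * w x" and "q = scaled_velocity v x"
      define d where "d = \<bar>exp (sigma_int x) - \<omega>\<bar>"
      define e where "e = mid_energy r w v x"
      have x0: "x \<ge> 0" using x s by simp
      have ex: "exp (- sigma_int x) * exp (sigma_int x) = 1" by (simp add: exp_minus)
      have pq: "2 * \<bar>p * q\<bar> \<le> e" unfolding p_def q_def e_def by (rule cross_le)
      have e: "e = \<omega> * p\<^sup>2 + q\<^sup>2 / \<omega>" by (simp add: e_def mid_energy_def p_def q_def)
      have e0: "e \<ge> 0" using mid_energy_nonneg by (simp add: e_def)
      have 1: "\<bar>exp (- sigma_int x) - 1 / \<omega>\<bar> \<le> d * c / \<omega>"
      proof -
        have "exp (- sigma_int x) - 1 / \<omega> = (\<omega> - exp (sigma_int x)) * exp (- sigma_int x) / \<omega>"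
          using ex omega_pos by (simp add: field_simps)
        then have "\<bar>exp (- sigma_int x) - 1 / \<omega>\<bar> = d * exp (- sigma_int x) / \<omega>"
          using omega_pos by (simp add: d_def abs_mult abs_minus_commute)
        also have "\<dots> \<le> d * c / \<omega>"
          using exp_sigma_int(3)[OF x0] omega_pos
          by (intro divide_right_mono mult_left_mono) (auto simp: c_def d_def intro: add_increasing2)
        finally show ?thesis .
      qed
      have 2: "\<bar>\<omega> * exp (- sigma_int x) - exp (sigma_int x) / \<omega>\<bar> \<le> d * c"
      proof -
        have "\<omega> * exp (- sigma_int x) - exp (sigma_int x) / \<omega> = (\<omega> - exp (sigma_int x)) * (exp (- sigma_int x) + 1 / \<omega>)"
          using ex omega_pos by (simp add: field_simps)
        then have "\<bar>\<omega> * exp (- sigma_int x) - exp (sigma_int x) / \<omega>\<bar> = d * (exp (- sigma_int x) + 1 / \<omega>)"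
          using omega_pos by (simp add: d_def abs_mult abs_minus_commute)
        also have "\<dots> \<le> d * c" using exp_sigma_int(3)[OF x0] by (intro mult_left_mono) (auto simp: c_def d_def)
        finally show ?thesis .
      qed
      have mu0: "0 < \<mu> x" and mur: "\<mu> x \<le> r" using mu_pos[OF x0] mu_r x by auto
      have d0: "d \<ge> 0" by (simp add: d_def)
      \<comment> \<open>the damping and the main part of the derivative of the cross term cancel up to \<open>|exp sigma_int - \<omega>|\<close>\<close>
      have A: "\<mu> x * (\<omega> * p\<^sup>2 - q\<^sup>2 / \<omega>) + \<mu> x * (exp (- sigma_int x) * q\<^sup>2 - exp (sigma_int x) * p\<^sup>2) \<le> r * (d * c * e)"
      proof -
        have "(\<omega> - exp (sigma_int x)) * p\<^sup>2 \<le> d * p\<^sup>2" by (intro mult_right_mono) (auto simp: d_def)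
        also have "\<dots> \<le> (d * c * \<omega>) * p\<^sup>2"
        proof (rule mult_right_mono)
          have "1 \<le> c * \<omega>" using omega_pos by (simp add: c_def distrib_right)
          then show "d \<le> d * c * \<omega>" using d0 mult_left_mono[of 1 "c * \<omega>" d] by (simp add: mult_ac)
        qed auto
        finally have "(\<omega> - exp (sigma_int x)) * p\<^sup>2 \<le> (d * c * \<omega>) * p\<^sup>2" .
        moreover have "(exp (- sigma_int x) - 1 / \<omega>) * q\<^sup>2 \<le> (d * c / \<omega>) * q\<^sup>2"
          using 1 by (intro mult_right_mono) auto
        ultimately have "(\<omega> - exp (sigma_int x)) * p\<^sup>2 + (exp (- sigma_int x) - 1 / \<omega>) * q\<^sup>2 \<le> d * c * e"
          by (simp add: e algebra_simps)
        then have "\<mu> x * ((\<omega> - exp (sigma_int x)) * p\<^sup>2 + (exp (- sigma_int x) - 1 / \<omega>) * q\<^sup>2) \<le> \<mu> x * (d * c * e)"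
          using mu0 by (intro mult_left_mono) auto
        also have "\<dots> \<le> r * (d * c * e)"
          using mur d0 c e0 by (intro mult_right_mono) auto
        finally show ?thesis by (simp add: algebra_simps)
      qed
      have Bd: "2 * r * (p * q) * (\<omega> * exp (- sigma_int x) - exp (sigma_int x) / \<omega>) \<le> r * (d * c * e)"
      proof -
        have "2 * r * (p * q) * (\<omega> * exp (- sigma_int x) - exp (sigma_int x) / \<omega>) \<le>
            \<bar>2 * r * (p * q)\<bar> * \<bar>\<omega> * exp (- sigma_int x) - exp (sigma_int x) / \<omega>\<bar>"
          by (metis abs_ge_self abs_mult)
        also have "\<dots> \<le> (r * e) * (d * c)"
          using 2 pq r e0 by (intro mult_mono) (auto simp: abs_mult)
        finally show ?thesis by (simp add: mult_ac)
      qed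
      \<comment> \<open>\<open>- \<mu>' / r\<close> is nonnegative because \<open>\<mu>\<close> decreases\<close>
      have Cd: "mu' x / r * (p * q) \<le> - mu' x / r * (e / 2)"
      proof -
        have "mu' x / r * (p * q) = (- mu' x / r) * (- (p * q))" by simp
        also have "\<dots> \<le> (- mu' x / r) * (e / 2)"
          using mu'(1)[OF x0] r pq by (intro mult_left_mono) (auto simp: field_simps)
        finally show ?thesis .
      qed
      have "(\<mu> x * (\<omega> * p\<^sup>2 - q\<^sup>2 / \<omega>) + 2 * r * (p * q) * (\<omega> * exp (- sigma_int x) - exp (sigma_int x) / \<omega>)) +
          (mu' x / r * (p * q) + \<mu> x * (exp (- sigma_int x) * q\<^sup>2 - exp (sigma_int x) * p\<^sup>2))
          \<le> 2 * (r * (d * c * e)) + - mu' x / r * (e / 2)"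
        using A Bd Cd by linarith
      also have "\<dots> = (2 * r * c * d - mu' x / r / 2) * e" by (simp add: algebra_simps)
      also have "\<dots> \<le> (2 * r * c * d - mu' x / r / 2) * (2 * F x)"
      proof (rule mult_left_mono)
        have "mu' x / r / 2 \<le> 0" using mu'(1)[OF x0] r by (simp add: divide_le_0_iff)
        also have "0 \<le> 2 * r * c * d" using r c d0 by simp
        finally show "0 \<le> 2 * r * c * d - mu' x / r / 2" unfolding diff_ge_0_iff_ge .
      qed (use FE(1)[of x] x in \<open>auto simp: e_def\<close>)
      also have "\<dots> = (4 * r * c * d - mu' x / r) * F x" by (simp add: algebra_simps)
      finally show "(\<mu> x * (\<omega> * (r * \<Lambda> x * w x)\<^sup>2 - (scaled_velocity v x)\<^sup>2 / \<omega>) +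
        2 * r * ((r * \<Lambda> x * w x) * scaled_velocity v x) * (\<omega> * exp (- sigma_int x) - exp (sigma_int x) / \<omega>)) +
        (mu' x / r * ((r * \<Lambda> x * w x) * scaled_velocity v x) +
         \<mu> x * (exp (- sigma_int x) * (scaled_velocity v x)\<^sup>2 - exp (sigma_int x) * (r * \<Lambda> x * w x)\<^sup>2))
         \<le> (4 * r * c * \<bar>exp (sigma_int x) - \<omega>\<bar> - mu' x / r) * F x" unfolding p_def q_def d_def .
    next
      fix x assume "s \<le> x"
      then show "((\<lambda>x. 4 * r * c * Psi x - \<mu> x / r) has_real_derivative
          4 * r * c * \<bar>exp (sigma_int x) - \<omega>\<bar> - mu' x / r) (at x within {0..})"
        using s r by (auto intro!: derivative_eq_intros Psi_deriv mu'(2))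
    qed (use s in auto)
    also have "\<dots> \<le> exp (1 + 4 * c * N) * F s"
    proof -
      have "4 * c * (r * Psi t) \<le> 4 * c * N" using st(3) c by (intro mult_left_mono) auto
      moreover have "\<mu> s / r \<le> 1" using mu_r[of s] r by simp
      moreover have "\<mu> t / r \<ge> 0" using mu_pos[of t] s st r by auto
      moreover have "4 * r * c * Psi s \<ge> 0" using Psi_nonneg[of s] r c s by simp
      ultimately have "(4 * r * c * Psi t - \<mu> t / r) - (4 * r * c * Psi s - \<mu> s / r) \<le> 1 + 4 * c * N"
        by (simp add: mult_ac)
      moreover have "F s \<ge> 0" using FE(1)[of s] mid_energy_nonneg[of r w v s] by simp
      ultimately show ?thesis by (intro mult_right_mono) auto
    qed
    finally have "2 * F t \<le> exp (1 + 4 * c * N) * (2 * F s)" by simp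
    also have "\<dots> \<le> exp (1 + 4 * c * N) * (3 * mid_energy r w v s)"
      using FE(2)[of s] by (intro mult_left_mono) auto
    finally have "mid_energy r w v t \<le> exp (1 + 4 * c * N) * (3 * mid_energy r w v s)"
      using FE(1)[of t] st by linarith
    then have "mid_const * mid_energy r w v t \<le> mid_const * (exp (1 + 4 * c * N) * (3 * mid_energy r w v s))"
      using mid_const_pos by (intro mult_left_mono) auto
    also have "\<dots> \<le> mid_const * (exp (1 + 4 * c * N) * (3 * (mid_const * wenergy r w v s)))"
      using mid_const_pos mid_energy_equiv(1)[of s r w v] s by (intro mult_left_mono) auto
    finally show ?thesis using mid_energy_equiv(2)[of t r w v] s st by (simp add: mult_ac)
  qed
  moreover have "3 * mid_const * mid_const * exp (1 + 4 * c * N) > 0" using mid_const_pos by simp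
  ultimately show ?thesis by blast
qed

end

section \<open>The coefficient in the hyperbolic zone\<close>

text \<open>Young's inequality with exponents \<open>m + 1\<close>, proved by distinguishing which of \<open>x\<close> and \<open>y\<close> dominates.\<close>

lemma young_split:
  fixes c :: real assumes c: "c \<ge> 0" and m: "m \<ge> 1"
  shows "\<exists>C\<ge>0. \<forall>x y. x \<ge> 0 \<longrightarrow> y \<ge> 0 \<longrightarrow> c * x ^ (m - 1) * y\<^sup>2 \<le> x ^ (m + 1) / 2 + C * y ^ (m + 1)"
proof -
  \<comment> \<open>any \<open>d\<close> with \<open>d \<le> 1\<close> and \<open>c * d \<le> 1 / 2\<close> serves as the threshold for the quotient of \<open>y\<close> by \<open>x\<close>\<close>
  define d where "d = 1 / (1 + 2 * c)"
  have d: "0 < d" "d \<le> 1" "c * d \<le> 1 / 2" using c by (auto simp: d_def field_simps)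
  have pw: "x ^ (m + 1) = x ^ (m - 1) * x\<^sup>2" for x :: real
    using m by (simp flip: power_add)
  have "c * x ^ (m - 1) * y\<^sup>2 \<le> x ^ (m + 1) / 2 + c * (1 / d) ^ (m - 1) * y ^ (m + 1)"
    if xy: "x \<ge> 0" "y \<ge> 0" for x y
  proof (cases "y \<le> d * x")
    case True
    have "c * d\<^sup>2 \<le> 1 / 2"
    proof -
      have "c * d\<^sup>2 = (c * d) * d" by (simp add: power2_eq_square)
      also have "\<dots> \<le> (1 / 2) * 1" using d c by (intro mult_mono) auto
      finally show ?thesis by simp
    qed
    have "c * x ^ (m - 1) * y\<^sup>2 \<le> c * x ^ (m - 1) * (d * x)\<^sup>2"
      using True xy c by (intro mult_left_mono power_mono) auto
    also have "\<dots> = (c * d\<^sup>2) * x ^ (m + 1)" unfolding pw by (simp add: power_mult_distrib mult_ac)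
    also have "\<dots> \<le> 1 / 2 * x ^ (m + 1)" using \<open>c * d\<^sup>2 \<le> 1 / 2\<close> xy by (intro mult_right_mono) auto
    finally have "c * x ^ (m - 1) * y\<^sup>2 \<le> 1 / 2 * x ^ (m + 1)" .
    moreover have "0 \<le> c * (1 / d) ^ (m - 1) * y ^ (m + 1)" using c d xy by simp
    ultimately show ?thesis by linarith
  next
    case False
    then have "x \<le> 1 / d * y" using d by (simp add: field_simps)
    then have "c * x ^ (m - 1) * y\<^sup>2 \<le> c * (1 / d * y) ^ (m - 1) * y\<^sup>2"
      using xy c by (intro mult_right_mono mult_left_mono power_mono) auto
    also have "\<dots> = c * (1 / d) ^ (m - 1) * y ^ (m + 1)" unfolding pw by (simp add: power_mult_distrib mult_ac power_divide)
    finally have "c * x ^ (m - 1) * y\<^sup>2 \<le> c * (1 / d) ^ (m - 1) * y ^ (m + 1)" .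
    moreover have "0 \<le> x ^ (m + 1)" using xy by simp
    ultimately show ?thesis by linarith
  qed
  then show ?thesis using c d by (intro exI[of _ "c * (1 / d) ^ (m - 1)"]) auto
qed

text \<open>The odd version of the power \<open>m\<close> is differentiable also at 0, whatever the parity of \<open>m\<close>.\<close>

lemma signed_power_deriv:
  fixes x :: real assumes m: "m \<ge> 1"
  shows "((\<lambda>x. x * \<bar>x\<bar> ^ (m - 1)) has_real_derivative real m * \<bar>x\<bar> ^ (m - 1)) (at x)"
proof -
  obtain k where k: "m = Suc k" using m by (cases m) auto
  consider "x > 0" | "x < 0" | "x = 0" by linarith
  then show ?thesis
  proof cases
    case 1
    have "((\<lambda>x::real. x ^ m) has_real_derivative real m * x ^ (m - 1)) (at x)"
      by (auto intro!: derivative_eq_intros)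
    then have "((\<lambda>x. x * \<bar>x\<bar> ^ (m - 1)) has_real_derivative real m * x ^ (m - 1)) (at x)"
      by (rule has_field_derivative_transform_within_open[of _ _ _ "{0<..}"]) (use 1 k in auto)
    then show ?thesis using 1 by simp
  next
    case 2
    have "((\<lambda>x::real. - ((- x) ^ m)) has_real_derivative real m * (- x) ^ (m - 1)) (at x)"
      by (auto intro!: derivative_eq_intros)
    then have "((\<lambda>x. x * \<bar>x\<bar> ^ (m - 1)) has_real_derivative real m * (- x) ^ (m - 1)) (at x)"
      by (rule has_field_derivative_transform_within_open[of _ _ _ "{..<0}"]) (use 2 k in auto)
    then show ?thesis using 2 by simp
  next
    case 3
    have "((\<lambda>h. \<bar>h\<bar> ^ k) \<longlongrightarrow> \<bar>0\<bar> ^ k) (at (0::real))" by (intro tendsto_intros)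
    then have "((\<lambda>h. \<bar>h\<bar> ^ k) \<longlongrightarrow> 0 ^ k) (at (0::real))" by simp
    then have "((\<lambda>h. (h * \<bar>h\<bar> ^ k - 0 * \<bar>0\<bar> ^ k) / (h - 0)) \<longlongrightarrow> 0 ^ k) (at (0::real))"
      by (rule Lim_transform_eventually) (auto simp: eventually_at_filter)
    then have "((\<lambda>x. x * \<bar>x\<bar> ^ k) has_real_derivative 0 ^ k) (at (0::real))"
      by (simp add: has_field_derivative_iff)
    then show ?thesis using 3 k by (cases k) auto
  qed
qed

locale symbol_damping = stabilised_damping +
  fixes m :: nat and \<Theta> \<Xi> :: "real \<Rightarrow> real"
  assumes m: "m \<ge> 1"
    and smooth: "C_halfline m b"
    and Theta_pos: "t \<ge> 0 \<Longrightarrow> \<Theta> t > 0"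
    and Xi_pos: "t \<ge> 0 \<Longrightarrow> \<Xi> t > 0"
    and stabilisation: "lesssim (\<lambda>t. integral {0..t} (\<lambda>\<theta>. \<bar>exp (integral {0..\<theta>} \<sigma>) - \<omega>\<bar>)) \<Theta>"
    and symbol: "\<exists>C. \<forall>k\<in>{1..m}. \<forall>t\<ge>0. \<bar>halfline_deriv k b t\<bar> \<le> C k * (1 / \<Xi> t ^ (k + 1))"
    and Theta_Xi: "lesssim \<Theta> \<Xi>"
    and Xi_int: "t \<ge> 0 \<Longrightarrow> (\<lambda>s. 1 / \<Xi> s ^ (m + 1)) integrable_on {t..}"
    and Xi_tail: "lesssim (\<lambda>t. integral {t..} (\<lambda>s. 1 / \<Xi> s ^ (m + 1))) (\<lambda>t. 1 / \<Theta> t ^ m)"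
begin

abbreviation "bk k \<equiv> halfline_deriv k b"

lemma bk_deriv: assumes "k < m" "t \<ge> 0" shows "(bk k has_real_derivative bk (Suc k) t) (at t within {0..})"
proof -
  have "bk k differentiable (at t within {0..})" using smooth assms by (auto simp: C_halfline_def)
  then have "(bk k has_vector_derivative vector_derivative (bk k) (at t within {0..})) (at t within {0..})"
    by (simp add: vector_derivative_works)
  then show ?thesis by (simp add: halfline_deriv_def has_real_derivative_iff_has_vector_derivative)
qed

lemma bk_0: "bk 0 = b" by (simp add: halfline_deriv_def)

lemma bk_cont: "continuous_on {0..} (bk m)" using smooth by (simp add: C_halfline_def)

lemma bk_bound: "\<exists>C>0. \<forall>k\<in>{1..m}. \<forall>t\<ge>0. \<bar>bk k t\<bar> \<le> C * (1 / \<Xi> t) ^ (k + 1)"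
proof -
  obtain C where C: "\<And>k t. k \<in> {1..m} \<Longrightarrow> t \<ge> 0 \<Longrightarrow> \<bar>bk k t\<bar> \<le> C k * (1 / \<Xi> t ^ (k + 1))"
    using symbol by blast
  define D where "D = 1 + (\<Sum>k\<in>{1..m}. \<bar>C k\<bar>)"
  have D: "D > 0" by (auto simp: D_def intro!: add_pos_nonneg sum_nonneg)
  have "\<bar>bk k t\<bar> \<le> D * (1 / \<Xi> t) ^ (k + 1)" if kt: "k \<in> {1..m}" "t \<ge> 0" for k t
  proof -
    have "C k \<le> \<bar>C k\<bar>" by simp
    also have "\<dots> \<le> (\<Sum>k\<in>{1..m}. \<bar>C k\<bar>)" using kt by (intro member_le_sum) auto
    finally have "C k * (1 / \<Xi> t ^ (k + 1)) \<le> D * (1 / \<Xi> t ^ (k + 1))"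
      using Xi_pos[OF kt(2)] by (intro mult_right_mono) (auto simp: D_def)
    then show ?thesis using C[OF kt] by (simp add: power_one_over)
  qed
  then show ?thesis using D by blast
qed

lemma Psi_le_Theta: "\<exists>C>0. \<forall>t\<ge>0. Psi t \<le> C * \<Theta> t"
  using stabilisation unfolding lesssim_def Psi_def sigma_int_def .

lemma Xi_inv_le: "\<exists>C>0. \<forall>t\<ge>0. Psi t > 0 \<longrightarrow> 1 / \<Xi> t \<le> C / Psi t"
proof -
  obtain C1 where C1: "C1 > 0" "\<And>t. t \<ge> 0 \<Longrightarrow> Psi t \<le> C1 * \<Theta> t" using Psi_le_Theta by blast
  obtain C2 where C2: "C2 > 0" "\<And>t. t \<ge> 0 \<Longrightarrow> \<Theta> t \<le> C2 * \<Xi> t" using Theta_Xi by (auto simp: lesssim_def)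
  have "1 / \<Xi> t \<le> (C1 * C2) / Psi t" if t: "t \<ge> 0" "Psi t > 0" for t
  proof -
    have "Psi t \<le> C1 * \<Theta> t" using C1(2) t by auto
    also have "\<dots> \<le> C1 * (C2 * \<Xi> t)" using C1(1) C2(2)[OF t(1)] by (intro mult_left_mono) auto
    finally show ?thesis using Xi_pos[OF t(1)] t by (simp add: field_simps)
  qed
  then show ?thesis using C1(1) C2(1) by (intro exI[of _ "C1 * C2"]) auto
qed

lemma Psi_linear: "t \<ge> 0 \<Longrightarrow> Psi t \<le> (exp B + \<omega>) * t"
proof -
  assume t: "t \<ge> 0"
  have "Psi t - Psi 0 \<le> (exp B + \<omega>) * t - (exp B + \<omega>) * 0"
  proof (rule derivative_comparison[OF _ _ Psi_deriv DERIV_cmult_Id])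
    fix x assume "0 < x" "x < t"
    then show "\<bar>exp (sigma_int x) - \<omega>\<bar> \<le> exp B + \<omega>"
      using exp_sigma_int(1)[of x] omega_pos exp_gt_zero[of "sigma_int x"] exp_gt_zero[of B] by linarith
  qed (use t in auto)
  then show ?thesis by (simp add: Psi_0)
qed

lemma bk1_bound: "\<exists>C>0. \<forall>t\<ge>0. \<bar>bk 1 t\<bar> \<le> C * (1 / \<Xi> t)\<^sup>2"
proof -
  obtain C where C: "C > 0" "\<forall>k\<in>{1..m}. \<forall>t\<ge>0. \<bar>bk k t\<bar> \<le> C * (1 / \<Xi> t) ^ (k + 1)"
    using bk_bound by blast
  then have "\<forall>t\<ge>0. \<bar>bk 1 t\<bar> \<le> C * (1 / \<Xi> t) ^ (1 + 1)" using m by (metis atLeastAtMost_iff order_refl)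
  then show ?thesis using C(1) by (auto simp: numeral_2_eq_2)
qed

text \<open>The symbol estimates concern only the derivatives of \<open>b\<close>. On an interval of length
  \<open>h = \<Psi>(t)\<close> the coefficient varies by at most a multiple of \<open>1 / h\<close>, while its integral over this
  interval is bounded; hence \<open>b\<close> itself is at most a multiple of \<open>1 / h\<close>.\<close>

lemma b_le: "\<exists>C>0. \<forall>t\<ge>0. Psi t > 0 \<longrightarrow> \<bar>b t\<bar> \<le> C / Psi t"
proof -
  obtain C1 where C1: "C1 > 0" "\<And>t. t \<ge> 0 \<Longrightarrow> \<bar>bk 1 t\<bar> \<le> C1 * (1 / \<Xi> t) ^ 2"
    using bk1_bound by blast
  obtain C2 where C2: "C2 > 0" "\<And>t. t \<ge> 0 \<Longrightarrow> Psi t > 0 \<Longrightarrow> 1 / \<Xi> t \<le> C2 / Psi t" using Xi_inv_le by blast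
  define C3 where "C3 = C1 * C2\<^sup>2"
  define C where "C = C3 + B + K * (exp B + \<omega>) / 2"
  have C3: "C3 > 0" using C1 C2 by (simp add: C3_def)
  have C: "C > 0" using C3 B(1) K(1) omega_pos by (auto simp: C_def intro!: add_pos_nonneg add_nonneg_nonneg mult_nonneg_nonneg)
  have "\<bar>b t\<bar> \<le> C / Psi t" if t: "t \<ge> 0" "Psi t > 0" for t
  proof -
    define h where "h = Psi t"
    have h: "h > 0" using t by (simp add: h_def)
    have t0: "t > 0" using t Psi_0 by (cases "t = 0") auto
    have b': "\<bar>bk 1 x\<bar> \<le> C3 / h\<^sup>2" if x: "t \<le> x" for x
    proof -
      have hx: "h \<le> Psi x" using Psi_mono[of t x] x t by (simp add: h_def)
      have "\<bar>bk 1 x\<bar> \<le> C1 * (1 / \<Xi> x)\<^sup>2" using C1(2) x t by auto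
      also have "\<dots> \<le> C1 * (C2 / h)\<^sup>2"
      proof (intro mult_left_mono power_mono)
        have "1 / \<Xi> x \<le> C2 / Psi x" using C2(2)[of x] hx h x t by auto
        also have "\<dots> \<le> C2 / h" using hx h C2(1) by (intro divide_left_mono) auto
        finally show "1 / \<Xi> x \<le> C2 / h" .
      qed (use C1 Xi_pos[of x] x t in \<open>auto simp: less_imp_le\<close>)
      finally show ?thesis by (simp add: C3_def power_divide)
    qed
    have osc: "\<bar>b x - b t\<bar> \<le> C3 / h" if x: "t \<le> x" "x \<le> t + h" for x
    proof -
      have "\<bar>b x - b t\<bar> \<le> C3 / h\<^sup>2 * x - C3 / h\<^sup>2 * t"
        by (rule derivative_comparison_abs[OF _ _ bk_deriv[of 0, unfolded bk_0] DERIV_cmult_Id])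
           (use t x m b' in auto)
      also have "\<dots> = C3 / h\<^sup>2 * (x - t)" by (simp only: right_diff_distrib)
      also have "\<dots> \<le> C3 / h\<^sup>2 * h" using x C3 by (intro mult_left_mono) auto
      also have "\<dots> = C3 / h" using h by (simp add: power2_eq_square)
      finally show ?thesis .
    qed
    \<comment> \<open>a primitive of \<open>b\<close>; its increment over the interval is bounded, for \<open>\<sigma>\<close> through its bounded primitive and for \<open>\<mu>\<close>
      because \<open>h\<close> is at most a multiple of \<open>t\<close> and \<open>t \<mu>\<close> is bounded\<close>
    define J where "J x = ln (\<Lambda> x) + sigma_int x / 2" for x
    have dln: "((\<lambda>x. ln (\<Lambda> x)) has_real_derivative \<mu> x / 2) (at x within {0..})" if "x \<ge> 0" for x
      using that by (auto intro!: derivative_eq_intros Lam_deriv simp: field_simps)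
    have dJ: "(J has_real_derivative b x) (at x within {0..})" if x: "x \<ge> 0" for x
      unfolding J_def[abs_def]
      by (rule DERIV_cong[OF DERIV_add[OF dln[OF x] DERIV_cdivide[OF sigma_int_deriv[OF x]]]])
         (use b_split[OF x] in \<open>simp add: field_simps\<close>)
    have "\<bar>(J (t + h) - b t * (t + h)) - (J t - b t * t)\<bar> \<le> C3 / h * (t + h) - C3 / h * t"
      by (rule derivative_comparison_abs[OF _ _ DERIV_diff[OF dJ DERIV_cmult_Id] DERIV_cmult_Id])
         (use t h osc in auto)
    also have "\<dots> = C3" using h by (simp add: field_simps)
    finally have 1: "\<bar>(J (t + h) - J t) - b t * h\<bar> \<le> C3" by (simp add: algebra_simps)
    have 2: "\<bar>sigma_int (t + h) / 2 - sigma_int t / 2\<bar> \<le> B" using B(2)[of t] B(2)[of "t + h"] t h by linarith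
    have 3: "\<bar>ln (\<Lambda> (t + h)) - ln (\<Lambda> t)\<bar> \<le> K * (exp B + \<omega>) / 2"
    proof -
      have "\<bar>ln (\<Lambda> (t + h)) - ln (\<Lambda> t)\<bar> \<le> \<mu> t / 2 * (t + h) - \<mu> t / 2 * t"
      proof (rule derivative_comparison_abs[OF _ _ dln DERIV_cmult_Id])
        fix x assume x: "t < x" "x < t + h"
        then show "\<bar>\<mu> x / 2\<bar> \<le> \<mu> t / 2" using mu_pos[of x] mu_antimono[of t x] t by simp
      qed (use t h in auto)
      also have "\<dots> = \<mu> t * h / 2" by (simp add: algebra_simps)
      also have "\<dots> \<le> \<mu> t * ((exp B + \<omega>) * t) / 2"
        using Psi_linear[OF t(1)] mu_pos[OF t(1)] by (intro divide_right_mono mult_left_mono) (auto simp: h_def)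
      also have "\<dots> = (t * \<mu> t) * (exp B + \<omega>) / 2" by simp
      also have "\<dots> \<le> K * (exp B + \<omega>) / 2"
        using K(2)[OF t(1)] omega_pos by (intro divide_right_mono mult_right_mono) (auto intro: add_nonneg_nonneg)
      finally show ?thesis .
    qed
    have "\<bar>b t * h\<bar> \<le> C" using 1 2 3 unfolding C_def J_def by linarith
    then show ?thesis using h by (simp add: abs_mult h_def field_simps)
  qed
  then show ?thesis using C by blast
qed

text \<open>The rate of change of \<open>b\<close> in the sense that the derivative of order \<open>k\<close>, including \<open>b\<close> itself for
  \<open>k = 0\<close>, is at most a multiple of the power \<open>k + 1\<close>.\<close>

definition "rate t = \<bar>b t\<bar> + 1 / \<Xi> t"

lemma rate_pos: "t \<ge> 0 \<Longrightarrow> rate t > 0" using Xi_pos[of t] by (auto simp: rate_def intro!: add_nonneg_pos)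

lemma rate_le: "\<exists>C>0. \<forall>t\<ge>0. Psi t > 0 \<longrightarrow> rate t \<le> C / Psi t"
proof -
  obtain C1 where "C1 > 0" "\<And>t. t \<ge> 0 \<Longrightarrow> Psi t > 0 \<Longrightarrow> \<bar>b t\<bar> \<le> C1 / Psi t" using b_le by blast
  moreover obtain C2 where "C2 > 0" "\<And>t. t \<ge> 0 \<Longrightarrow> Psi t > 0 \<Longrightarrow> 1 / \<Xi> t \<le> C2 / Psi t" using Xi_inv_le by blast
  ultimately show ?thesis by (intro exI[of _ "C1 + C2"]) (auto simp: rate_def add_divide_distrib intro!: add_mono)
qed

text \<open>The power \<open>m + 1\<close> of \<open>b\<close> is integrable up to a derivative of a small function. The reason is that
  \<open>2 b = \<mu> + \<sigma>\<close>, where \<open>\<sigma>\<close> has a bounded primitive: multiplied with \<open>b\<^sup>m\<close>, one integration by parts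
  against this primitive trades two factors \<open>b\<close> for one \<open>b'\<close>, for which there is an estimate.\<close>

lemma b_power_le:
  "\<exists>C\<ge>0. \<forall>t\<ge>0. \<exists>d. ((\<lambda>t. sigma_int t * (b t * \<bar>b t\<bar> ^ (m - 1))) has_real_derivative d) (at t within {0..}) \<and>
     \<bar>b t\<bar> ^ (m + 1) \<le> d + C * (\<mu> t ^ (m + 1) + (1 / \<Xi> t) ^ (m + 1))"
proof -
  obtain C1 where C1: "C1 > 0" "\<And>t. t \<ge> 0 \<Longrightarrow> \<bar>bk 1 t\<bar> \<le> C1 * (1 / \<Xi> t) ^ 2"
    using bk1_bound by blast
  have "B * real m * C1 \<ge> 0" using B(1) C1(1) by simp
  then obtain C2 where C2: "C2 \<ge> 0" "\<And>x y. x \<ge> 0 \<Longrightarrow> y \<ge> 0 \<Longrightarrow>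
      B * real m * C1 * x ^ (m - 1) * y\<^sup>2 \<le> x ^ (m + 1) / 2 + C2 * y ^ (m + 1)"
    using young_split[OF _ m] by metis
  define C where "C = max (2 ^ m) C2"
  have "\<exists>d. ((\<lambda>t. sigma_int t * (b t * \<bar>b t\<bar> ^ (m - 1))) has_real_derivative d) (at t within {0..}) \<and>
     \<bar>b t\<bar> ^ (m + 1) \<le> d + C * (\<mu> t ^ (m + 1) + (1 / \<Xi> t) ^ (m + 1))" if t: "t \<ge> 0" for t
  proof -
    define \<phi> where "\<phi> = b t * \<bar>b t\<bar> ^ (m - 1)"
    define d where "d = sigma_int t * (real m * \<bar>b t\<bar> ^ (m - 1) * bk 1 t) + \<sigma> t * \<phi>"
    have db: "(b has_real_derivative bk 1 t) (at t within {0..})" using bk_deriv[of 0 t] bk_0 m t by simp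
    have "((\<lambda>t. sigma_int t * (b t * \<bar>b t\<bar> ^ (m - 1))) has_real_derivative d) (at t within {0..})"
      by (rule DERIV_cong[OF DERIV_mult[OF sigma_int_deriv[OF t] DERIV_chain2[OF signed_power_deriv[OF m] db]]])
         (simp add: d_def \<phi>_def mult_ac)
    moreover have "\<bar>b t\<bar> ^ (m + 1) \<le> d + C * (\<mu> t ^ (m + 1) + (1 / \<Xi> t) ^ (m + 1))"
    proof -
      define x where "x = \<bar>b t\<bar>"
      have x0: "x \<ge> 0" by (simp add: x_def)
      have ph: "\<bar>\<phi>\<bar> = x ^ m" using m by (cases m) (auto simp: \<phi>_def x_def abs_mult power_abs)
      have "b t * \<phi> = x\<^sup>2 * x ^ (m - 1)" by (simp add: \<phi>_def x_def power2_eq_square abs_mult_self_eq mult.assoc[symmetric])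
      also have "\<dots> = x ^ (m + 1)" using m by (simp flip: power_add)
      finally have bph: "b t * \<phi> = x ^ (m + 1)" .
      have "2 * x ^ (m + 1) = \<mu> t * \<phi> + \<sigma> t * \<phi>"
        using b_split[OF t] bph by (metis distrib_right mult.assoc)
      also have "\<sigma> t * \<phi> = d - sigma_int t * (real m * \<bar>b t\<bar> ^ (m - 1) * bk 1 t)" by (simp add: d_def)
      finally have "2 * x ^ (m + 1) = d + \<mu> t * \<phi> + - (sigma_int t * (real m * x ^ (m - 1) * bk 1 t))" by (simp add: x_def)
      also have "\<dots> \<le> d + \<mu> t * x ^ m + B * (real m * x ^ (m - 1) * (C1 * (1 / \<Xi> t)\<^sup>2))"
      proof (intro add_mono order_refl)
        show "\<mu> t * \<phi> \<le> \<mu> t * x ^ m"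
          using mu_pos[OF t] ph by (intro mult_left_mono) auto
        have "- (sigma_int t * (real m * x ^ (m - 1) * bk 1 t)) \<le> \<bar>sigma_int t\<bar> * \<bar>real m * x ^ (m - 1) * bk 1 t\<bar>"
          by (metis abs_ge_minus_self abs_mult)
        also have "\<bar>real m * x ^ (m - 1) * bk 1 t\<bar> = real m * x ^ (m - 1) * \<bar>bk 1 t\<bar>"
          using x0 by (simp add: abs_mult)
        also have "\<bar>sigma_int t\<bar> * (real m * x ^ (m - 1) * \<bar>bk 1 t\<bar>) \<le> B * (real m * x ^ (m - 1) * (C1 * (1 / \<Xi> t)\<^sup>2))"
          using B(2)[OF t] B(1) C1(2)[OF t] x0 by (intro mult_mono mult_left_mono) auto
        finally show "- (sigma_int t * (real m * x ^ (m - 1) * bk 1 t)) \<le> B * (real m * x ^ (m - 1) * (C1 * (1 / \<Xi> t)\<^sup>2))" .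
      qed
      also have "B * (real m * x ^ (m - 1) * (C1 * (1 / \<Xi> t)\<^sup>2)) = B * real m * C1 * x ^ (m - 1) * (1 / \<Xi> t)\<^sup>2"
        by (simp only: mult_ac)
      also have "\<dots> \<le> x ^ (m + 1) / 2 + C2 * (1 / \<Xi> t) ^ (m + 1)"
        using Xi_pos[OF t] x0 by (intro C2(2)) auto
      also have "\<mu> t * x ^ m \<le> x ^ (m + 1) / 2 + 2 ^ m * \<mu> t ^ (m + 1)"
      proof (cases "\<mu> t \<le> x / 2")
        case True
        then have "\<mu> t * x ^ m \<le> x / 2 * x ^ m" using x0 by (intro mult_right_mono) auto
        moreover have "0 \<le> 2 ^ m * \<mu> t ^ (m + 1)" using mu_pos[OF t] by simp
        ultimately show ?thesis by simp
      next
        case False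
        then have "\<mu> t * x ^ m \<le> \<mu> t * (2 * \<mu> t) ^ m"
          using mu_pos[OF t] x0 by (intro mult_left_mono power_mono) auto
        moreover have "0 \<le> x ^ (m + 1) / 2" using x0 by simp
        ultimately show ?thesis by (simp add: power_mult_distrib mult_ac)
      qed
      finally have "x ^ (m + 1) \<le> d + 2 ^ m * \<mu> t ^ (m + 1) + C2 * (1 / \<Xi> t) ^ (m + 1)" by simp
      also have "\<dots> \<le> d + C * \<mu> t ^ (m + 1) + C * (1 / \<Xi> t) ^ (m + 1)"
        using mu_pos[OF t] Xi_pos[OF t] by (intro add_mono mult_right_mono order_refl) (auto simp: C_def)
      finally show ?thesis by (simp add: x_def distrib_left)
    qed
    ultimately show ?thesis by blast
  qed
  moreover have "C \<ge> 0" by (auto simp: C_def le_max_iff_disj)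
  ultimately show ?thesis by blast
qed

text \<open>For the part \<open>1 / \<Xi>\<close> this is the tail condition, and for the part \<open>b\<close> it is the preceding lemma with
  \<open>\<mu>(t) \<le> K / t\<close>. The bound is stated for minorants \<open>g\<close> because they are what has to be integrated
  later; their integrability is easier to see than that of the power of the rate.\<close>

lemma rate_power_integral:
  "\<exists>C>0. \<forall>s t g. 0 \<le> s \<longrightarrow> s \<le> t \<longrightarrow> Psi s > 0 \<longrightarrow> g integrable_on {s..t} \<longrightarrow>
     (\<forall>x\<in>{s..t}. g x \<le> rate x ^ (m + 1)) \<longrightarrow> integral {s..t} g \<le> C / Psi s ^ m"
proof -
  obtain C1 where C1: "C1 \<ge> 0" and ex: "\<And>t. t \<ge> 0 \<Longrightarrow> \<exists>d. ((\<lambda>t. sigma_int t * (b t * \<bar>b t\<bar> ^ (m - 1))) has_real_derivative d) (at t within {0..}) \<and>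
     \<bar>b t\<bar> ^ (m + 1) \<le> d + C1 * (\<mu> t ^ (m + 1) + (1 / \<Xi> t) ^ (m + 1))" using b_power_le by blast
  have "\<forall>t\<in>{0..}. \<exists>d. ((\<lambda>t. sigma_int t * (b t * \<bar>b t\<bar> ^ (m - 1))) has_real_derivative d) (at t within {0..}) \<and>
     \<bar>b t\<bar> ^ (m + 1) \<le> d + C1 * (\<mu> t ^ (m + 1) + (1 / \<Xi> t) ^ (m + 1))"
    using ex by simp
  from bchoice[OF this] obtain d where d: "\<And>t. t \<ge> 0 \<Longrightarrow> ((\<lambda>t. sigma_int t * (b t * \<bar>b t\<bar> ^ (m - 1))) has_real_derivative d t) (at t within {0..})"
    "\<And>t. t \<ge> 0 \<Longrightarrow> \<bar>b t\<bar> ^ (m + 1) \<le> d t + C1 * (\<mu> t ^ (m + 1) + (1 / \<Xi> t) ^ (m + 1))"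
    by auto
  obtain C2 where C2: "C2 > 0" "\<And>t. t \<ge> 0 \<Longrightarrow> Psi t > 0 \<Longrightarrow> \<bar>b t\<bar> \<le> C2 / Psi t" using b_le by blast
  obtain C3 where C3: "C3 > 0" "\<And>t. t \<ge> 0 \<Longrightarrow> Psi t \<le> C3 * \<Theta> t" using Psi_le_Theta by blast
  obtain C4 where C4: "C4 > 0" "\<And>t. t \<ge> 0 \<Longrightarrow> integral {t..} (\<lambda>s. 1 / \<Xi> s ^ (m + 1)) \<le> C4 * (1 / \<Theta> t ^ m)"
    using Xi_tail by (auto simp: lesssim_def)
  define c5 where "c5 = exp B + \<omega>"
  have c5: "c5 > 0" using omega_pos by (auto simp: c5_def intro: add_pos_pos)
  define Cx where "Cx = (2 * B * C2 ^ m + C1 * (K ^ (m + 1) * c5 ^ m)) + (C1 + 1) * (C4 * C3 ^ m)"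
  define C where "C = 2 ^ (m + 1) * Cx"
  have Cpos: "C > 0"
    unfolding C_def Cx_def using C1 C2(1) C3(1) C4(1) B(1) K(1) c5
    by (intro mult_pos_pos add_nonneg_pos add_nonneg_nonneg mult_nonneg_nonneg) auto
  have "integral {s..t} g \<le> C / Psi s ^ m"
    if st: "0 \<le> s" "s \<le> t" "Psi s > 0" and gi: "g integrable_on {s..t}"
      and gX: "\<And>x. x \<in> {s..t} \<Longrightarrow> g x \<le> rate x ^ (m + 1)" for s t g
  proof -
    have s0: "s > 0" using st Psi_0 by (cases "s = 0") auto
    \<comment> \<open>the second summand has the derivative that dominates \<open>\<mu>\<^sup>m\<^sup>+\<^sup>1\<close>\<close>
    define H where "H x = sigma_int x * (b x * \<bar>b x\<bar> ^ (m - 1)) - C1 * K ^ (m + 1) * (1 / x ^ m)" for x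
    define h where "h x = d x + C1 * K ^ (m + 1) * (real m / x ^ (m + 1))" for x
    have dH: "(H has_real_derivative h x) (at x within {0..})" if x: "x \<ge> s" for x
    proof -
      have xp: "x > 0" using x s0 by simp
      have "((\<lambda>x. 1 / x ^ m) has_real_derivative - (real m / x ^ (m + 1))) (at x within {0..})"
      proof (rule DERIV_cong)
        show "((\<lambda>x. 1 / x ^ m) has_real_derivative (0 * x ^ m - 1 * (real m * (1 * x ^ (m - Suc 0)))) / (x ^ m * x ^ m)) (at x within {0..})"
          using xp by (intro DERIV_divide DERIV_const DERIV_power DERIV_ident) auto
        show "(0 * x ^ m - 1 * (real m * (1 * x ^ (m - Suc 0)))) / (x ^ m * x ^ m) = - (real m / x ^ (m + 1))"
          using xp m by (cases m) (auto simp: field_simps)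
      qed
      from DERIV_diff[OF d(1) DERIV_cmult[OF this, of "C1 * K ^ (m + 1)"]] show ?thesis
        unfolding H_def[abs_def] h_def using xp by (auto elim!: DERIV_cong)
    qed
    have hb: "\<bar>b x\<bar> ^ (m + 1) \<le> h x + C1 * (1 / \<Xi> x) ^ (m + 1)" if x: "x \<ge> s" for x
    proof -
      have xp: "x > 0" using x s0 by simp
      have "\<mu> x \<le> K / x" using K(2)[of x] xp by (simp add: field_simps)
      then have "\<mu> x ^ (m + 1) \<le> (K / x) ^ (m + 1)"
        using mu_pos[of x] xp by (intro power_mono) auto
      also have "\<dots> = K ^ (m + 1) * (1 / x ^ (m + 1))" by (simp add: power_divide)
      also have "\<dots> \<le> K ^ (m + 1) * (real m / x ^ (m + 1))"
        using m xp K(1) by (intro mult_left_mono divide_right_mono) auto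
      finally have "C1 * \<mu> x ^ (m + 1) \<le> C1 * (K ^ (m + 1) * (real m / x ^ (m + 1)))"
        using C1 by (intro mult_left_mono)
      then show ?thesis using d(2)[of x] xp unfolding h_def by (simp add: distrib_left mult.assoc)
    qed
    have hint: "(h has_integral H t - H s) {s..t}"
    proof (rule fundamental_theorem_of_calculus[OF st(2)])
      fix x assume "x \<in> {s..t}"
      then show "(H has_vector_derivative h x) (at x within {s..t})"
        using dH[of x] st unfolding has_real_derivative_iff_has_vector_derivative
        by (auto elim!: has_vector_derivative_within_subset)
    qed
    define xi where "xi x = 1 / \<Xi> x ^ (m + 1)" for x
    have xii: "xi integrable_on {s..}" using Xi_int[OF st(1)] by (simp add: xi_def[abs_def])
    then have xist: "xi integrable_on {s..t}" by (rule integrable_on_subinterval) auto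
    have xi_le: "integral {s..t} xi \<le> C4 * C3 ^ m / Psi s ^ m"
    proof -
      have "integral {s..t} xi \<le> integral {s..} xi"
        by (rule integral_subset_le[OF _ xist xii]) (use Xi_pos st in \<open>auto simp: xi_def less_imp_le\<close>)
      also have "\<dots> \<le> C4 * (1 / \<Theta> s ^ m)" using C4(2)[OF st(1)] by (simp add: xi_def[abs_def])
      also have "\<dots> \<le> C4 * (C3 / Psi s) ^ m"
      proof (rule mult_left_mono)
        have "1 / \<Theta> s \<le> C3 / Psi s" using C3(2)[OF st(1)] st(3) Theta_pos[OF st(1)] by (simp add: field_simps)
        then have "(1 / \<Theta> s) ^ m \<le> (C3 / Psi s) ^ m" using Theta_pos[OF st(1)] by (intro power_mono) auto
        then show "1 / \<Theta> s ^ m \<le> (C3 / Psi s) ^ m" by (simp add: power_one_over)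
      qed (use C4 in auto)
      finally show ?thesis by (simp add: power_divide)
    qed
    have "integral {s..t} g \<le> 2 ^ (m + 1) * ((H t - H s) + (C1 + 1) * integral {s..t} xi)"
    proof (rule has_integral_le[OF integrable_integral[OF gi]])
      show "((\<lambda>x. 2 ^ (m + 1) * (h x + (C1 + 1) * xi x)) has_integral
          2 ^ (m + 1) * ((H t - H s) + (C1 + 1) * integral {s..t} xi)) {s..t}"
        by (intro has_integral_mult_right has_integral_add hint integrable_integral xist)
      fix x assume x: "x \<in> {s..t}"
      have xx: "0 < 1 / \<Xi> x" using Xi_pos[of x] x st by auto
      have "rate x ^ (m + 1) \<le> (2 * max \<bar>b x\<bar> (1 / \<Xi> x)) ^ (m + 1)"
        using xx by (intro power_mono) (auto simp: rate_def)
      also have "\<dots> = 2 ^ (m + 1) * max \<bar>b x\<bar> (1 / \<Xi> x) ^ (m + 1)" by (simp add: power_mult_distrib)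
      also have "\<dots> \<le> 2 ^ (m + 1) * (\<bar>b x\<bar> ^ (m + 1) + (1 / \<Xi> x) ^ (m + 1))"
        using xx by (intro mult_left_mono) (auto simp: max_def)
      also have "\<dots> \<le> 2 ^ (m + 1) * (h x + (C1 + 1) * xi x)"
      proof (rule mult_left_mono)
        have "(1 / \<Xi> x) ^ (m + 1) = xi x" by (simp add: xi_def power_one_over)
        moreover have "(C1 + 1) * xi x = C1 * xi x + xi x" by (simp add: distrib_right)
        ultimately show "\<bar>b x\<bar> ^ (m + 1) + (1 / \<Xi> x) ^ (m + 1) \<le> h x + (C1 + 1) * xi x"
          using hb[of x] x by simp
      qed simp
      finally show "g x \<le> 2 ^ (m + 1) * (h x + (C1 + 1) * xi x)" using gX[OF x] by linarith
    qed
    also have "\<dots> \<le> 2 ^ (m + 1) * ((2 * B * C2 ^ m + C1 * (K ^ (m + 1) * c5 ^ m)) / Psi s ^ m + (C1 + 1) * (C4 * C3 ^ m / Psi s ^ m))"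
    proof (intro mult_left_mono add_mono xi_le)
      have bb: "\<bar>sigma_int x * (b x * \<bar>b x\<bar> ^ (m - 1))\<bar> \<le> B * (C2 / Psi s) ^ m" if x: "x \<ge> s" for x
      proof -
        have "b x * \<bar>b x\<bar> ^ (m - 1) = sgn (b x) * \<bar>b x\<bar> ^ m" using m
          by (cases m) (auto simp: sgn_mult_abs[symmetric] mult.assoc[symmetric] simp del: sgn_mult_abs)
        then have "\<bar>sigma_int x * (b x * \<bar>b x\<bar> ^ (m - 1))\<bar> \<le> \<bar>sigma_int x\<bar> * \<bar>b x\<bar> ^ m"
          by (auto simp: abs_mult sgn_if)
        also have "\<bar>b x\<bar> \<le> C2 / Psi s"
        proof -
          have ps: "Psi s \<le> Psi x" using Psi_mono st x by auto
          then have "\<bar>b x\<bar> \<le> C2 / Psi x" using C2(2)[of x] st x by auto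
          also have "\<dots> \<le> C2 / Psi s" using ps st C2(1) by (intro divide_left_mono) auto
          finally show ?thesis .
        qed
        then have "\<bar>sigma_int x\<bar> * \<bar>b x\<bar> ^ m \<le> B * (C2 / Psi s) ^ m"
          using B x st by (intro mult_mono power_mono) auto
        finally show ?thesis .
      qed
      have sm: "1 / s ^ m \<le> c5 ^ m / Psi s ^ m"
      proof -
        have "1 / s \<le> c5 / Psi s" using Psi_linear[OF st(1)] st(3) s0 by (simp add: field_simps c5_def)
        then have "(1 / s) ^ m \<le> (c5 / Psi s) ^ m" using s0 by (intro power_mono) auto
        then show ?thesis by (simp add: power_divide)
      qed
      have "C1 * K ^ (m + 1) * (1 / s ^ m) \<le> C1 * K ^ (m + 1) * (c5 ^ m / Psi s ^ m)"
        using sm C1 K(1) by (intro mult_left_mono) auto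
      moreover have "0 \<le> C1 * K ^ (m + 1) * (1 / t ^ m)" using C1 K(1) st by simp
      moreover have "B * (C2 / Psi s) ^ m = B * C2 ^ m / Psi s ^ m" by (simp add: power_divide)
      ultimately have "H t - H s \<le> 2 * (B * C2 ^ m / Psi s ^ m) + C1 * K ^ (m + 1) * (c5 ^ m / Psi s ^ m)"
        using bb[of s] bb[of t] st unfolding H_def abs_le_iff by linarith
      then show "H t - H s \<le> (2 * B * C2 ^ m + C1 * (K ^ (m + 1) * c5 ^ m)) / Psi s ^ m"
        by (simp add: add_divide_distrib mult.assoc)
    qed (use C1 in auto)
    also have "\<dots> = C / Psi s ^ m" by (simp add: C_def Cx_def add_divide_distrib algebra_simps)
    finally show ?thesis .
  qed
  then show ?thesis using Cpos by blast
qed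

end

section \<open>Approximate solutions of the Riccati equation and high frequencies\<close>

context symbol_damping
begin

text \<open>The region where \<open>b\<close> behaves like a symbol: there the rate is at most a multiple of \<open>r\<close>.\<close>

definition hyp_region :: "(real \<times> real) set" where "hyp_region = {(r, t). r > 0 \<and> t \<ge> 0 \<and> r * Psi t \<ge> 1}"

lemma hyp_region_D: "(r, t) \<in> hyp_region \<Longrightarrow> r > 0" "(r, t) \<in> hyp_region \<Longrightarrow> t \<ge> 0" "(r, t) \<in> hyp_region \<Longrightarrow> Psi t > 0" "(r, t) \<in> hyp_region \<Longrightarrow> rate t > 0"
  using rate_pos by (auto simp: hyp_region_def) (metis less_le_trans zero_less_mult_pos zero_less_one)

lemma rate_le_r: "\<exists>c>0. \<forall>r t. (r, t) \<in> hyp_region \<longrightarrow> rate t \<le> c * r"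
proof -
  obtain c where c: "c > 0" "\<And>t. t \<ge> 0 \<Longrightarrow> Psi t > 0 \<Longrightarrow> rate t \<le> c / Psi t" using rate_le by blast
  have "rate t \<le> c * r" if "(r, t) \<in> hyp_region" for r t
  proof -
    have "rate t \<le> c / Psi t" using c(2) hyp_region_D that by blast
    also have "1 / Psi t \<le> r" using that hyp_region_D(3)[OF that] by (simp add: hyp_region_def field_simps)
    then have "c / Psi t \<le> c * r" using c(1) mult_left_mono[of "1 / Psi t" r c] by simp
    finally show ?thesis .
  qed
  then show ?thesis using c(1) by blast
qed

text \<open>Families of functions over the frequency that behave like symbols on the hyperbolic region: each of \<open>j\<close>
  derivatives costs one more factor \<open>rate\<close>, starting from the size \<open>rate\<^sup>p / r\<^sup>q\<close>. The constants
  do not depend on the frequency.\<close>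

primrec symb :: "nat \<Rightarrow> nat \<Rightarrow> nat \<Rightarrow> (real \<Rightarrow> real \<Rightarrow> complex) \<Rightarrow> bool" where
  "symb 0 p q f \<longleftrightarrow> (\<exists>C\<ge>0. \<forall>r t. (r, t) \<in> hyp_region \<longrightarrow> norm (f r t) \<le> C * (rate t ^ p / r ^ q)) \<and>
     (\<forall>r. continuous_on {t. (r, t) \<in> hyp_region} (f r))"
| "symb (Suc j) p q f \<longleftrightarrow> (\<exists>C\<ge>0. \<forall>r t. (r, t) \<in> hyp_region \<longrightarrow> norm (f r t) \<le> C * (rate t ^ p / r ^ q)) \<and>
     (\<exists>f'. (\<forall>r t. (r, t) \<in> hyp_region \<longrightarrow> (f r has_vector_derivative f' r t) (at t within {0..})) \<and> symb j (Suc p) q f')"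

lemma symb_bound: "symb j p q f \<Longrightarrow> \<exists>C\<ge>0. \<forall>r t. (r, t) \<in> hyp_region \<longrightarrow> norm (f r t) \<le> C * (rate t ^ p / r ^ q)"
  by (cases j) auto

lemma symb_SucI:
  assumes "\<exists>C\<ge>0. \<forall>r t. (r, t) \<in> hyp_region \<longrightarrow> norm (f r t) \<le> C * (rate t ^ p / r ^ q)"
    and "\<forall>r t. (r, t) \<in> hyp_region \<longrightarrow> (f r has_vector_derivative f' r t) (at t within {0..})"
    and "symb j (Suc p) q f'"
  shows "symb (Suc j) p q f"
  unfolding symb.simps using assms by (intro conjI exI[of _ f'])

lemma symb_SucD: "symb (Suc j) p q f \<Longrightarrow> symb j p q f"
proof (induction j arbitrary: p q f)
  case 0
  then obtain f' where f': "\<forall>r t. (r, t) \<in> hyp_region \<longrightarrow> (f r has_vector_derivative f' r t) (at t within {0..})" by auto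
  have "continuous_on {t. (r, t) \<in> hyp_region} (f r)" for r
    unfolding continuous_on_eq_continuous_within
  proof
    fix t assume t: "t \<in> {t. (r, t) \<in> hyp_region}"
    then have "continuous (at t within {0..}) (f r)"
      using f' has_vector_derivative_continuous by fastforce
    then show "continuous (at t within {t. (r, t) \<in> hyp_region}) (f r)"
      by (rule continuous_within_subset) (auto simp: hyp_region_def)
  qed
  then show ?case using 0 by auto
next
  case (Suc j)
  then obtain f' where f': "\<forall>r t. (r, t) \<in> hyp_region \<longrightarrow> (f r has_vector_derivative f' r t) (at t within {0..})" "symb (Suc j) (Suc p) q f'"
    by auto
  then have "symb j (Suc p) q f'" using Suc.IH by blast
  then show ?case using f'(1) symb_bound[OF Suc.prems] by auto
qed

text \<open>On the hyperbolic region the quotient of the rate by \<open>r\<close> is bounded.\<close>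

lemma symb_weaken: "symb j (p + n) (q + n) f \<Longrightarrow> symb j p q f"
proof -
  obtain c where c: "c > 0" "\<forall>r t. (r, t) \<in> hyp_region \<longrightarrow> rate t \<le> c * r" using rate_le_r by blast
  have *: "\<exists>C\<ge>0. \<forall>r t. (r, t) \<in> hyp_region \<longrightarrow> norm (f r t) \<le> C * (rate t ^ p / r ^ q)"
    if "\<exists>C\<ge>0. \<forall>r t. (r, t) \<in> hyp_region \<longrightarrow> norm (f r t) \<le> C * (rate t ^ (p + n) / r ^ (q + n))" for f :: "real \<Rightarrow> real \<Rightarrow> complex" and p q
  proof -
    from that obtain C where C: "C \<ge> 0" "\<forall>r t. (r, t) \<in> hyp_region \<longrightarrow> norm (f r t) \<le> C * (rate t ^ (p + n) / r ^ (q + n))"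
      by (elim exE conjE)
    have "norm (f r t) \<le> (C * c ^ n) * (rate t ^ p / r ^ q)" if rt: "(r, t) \<in> hyp_region" for r t
    proof -
      have r: "r > 0" and x: "rate t > 0" using hyp_region_D rt by auto
      have "norm (f r t) \<le> C * (rate t ^ (p + n) / r ^ (q + n))" using C rt by auto
      also have "\<dots> = C * (rate t ^ p / r ^ q) * (rate t / r) ^ n" by (simp add: power_add power_divide)
      also have "\<dots> \<le> C * (rate t ^ p / r ^ q) * c ^ n"
      proof (intro mult_left_mono power_mono)
        show "rate t / r \<le> c" using c(2) rt r by (auto simp: pos_divide_le_eq)
      qed (use C(1) r x in auto)
      finally show ?thesis by (simp add: mult_ac)
    qed
    then show ?thesis using C(1) c(1) by (intro exI[of _ "C * c ^ n"]) auto
  qed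
  show "symb j (p + n) (q + n) f \<Longrightarrow> symb j p q f"
  proof (induction j arbitrary: p q f)
    case 0 then show ?case using * by auto
  next
    case (Suc j)
    then obtain f' where f': "\<forall>r t. (r, t) \<in> hyp_region \<longrightarrow> (f r has_vector_derivative f' r t) (at t within {0..})" "symb j (Suc p + n) (q + n) f'"
      by auto
    then have "symb j (Suc p) q f'" using Suc.IH by blast
    then show ?case using f'(1) *[OF symb_bound[OF Suc.prems]] by auto
  qed
qed

lemma symb_add: "symb j p q f \<Longrightarrow> symb j p q g \<Longrightarrow> symb j p q (\<lambda>r t. f r t + g r t)"
proof (induction j arbitrary: p q f g)
  have *: "\<exists>C\<ge>0. \<forall>r t. (r, t) \<in> hyp_region \<longrightarrow> norm (f r t + g r t) \<le> C * (rate t ^ p / r ^ q)"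
    if fg: "symb j p q f" "symb j p q g" for f g p q j
  proof -
    obtain C1 where C1: "C1 \<ge> 0" "\<forall>r t. (r, t) \<in> hyp_region \<longrightarrow> norm (f r t) \<le> C1 * (rate t ^ p / r ^ q)" using symb_bound[OF fg(1)] by blast
    obtain C2 where C2: "C2 \<ge> 0" "\<forall>r t. (r, t) \<in> hyp_region \<longrightarrow> norm (g r t) \<le> C2 * (rate t ^ p / r ^ q)" using symb_bound[OF fg(2)] by blast
    have "norm (f r t + g r t) \<le> (C1 + C2) * (rate t ^ p / r ^ q)" if "(r, t) \<in> hyp_region" for r t
      using C1(2) C2(2) that norm_triangle_ineq[of "f r t" "g r t"] unfolding distrib_right by fastforce
    then show ?thesis using C1(1) C2(1) by (intro exI[of _ "C1 + C2"]) auto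
  qed
  {
    case 0 then show ?case using *[OF 0] by (auto intro: continuous_on_add)
  next
    case (Suc j)
    from Suc.prems obtain f' g' where
      f': "\<forall>r t. (r, t) \<in> hyp_region \<longrightarrow> (f r has_vector_derivative f' r t) (at t within {0..})" "symb j (Suc p) q f'" and
      g': "\<forall>r t. (r, t) \<in> hyp_region \<longrightarrow> (g r has_vector_derivative g' r t) (at t within {0..})" "symb j (Suc p) q g'"
      by auto
    have "\<forall>r t. (r, t) \<in> hyp_region \<longrightarrow> ((\<lambda>t. f r t + g r t) has_vector_derivative f' r t + g' r t) (at t within {0..})"
      using f'(1) g'(1) by (auto intro!: has_vector_derivative_add)
    moreover have "symb j (Suc p) q (\<lambda>r t. f' r t + g' r t)" using Suc.IH f'(2) g'(2) by blast
    ultimately show ?case using *[OF Suc.prems] by (intro symb_SucI) auto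
  }
qed

lemma symb_mult: "symb j p q f \<Longrightarrow> symb j p' q' g \<Longrightarrow> symb j (p + p') (q + q') (\<lambda>r t. f r t * g r t)"
proof (induction j arbitrary: p q f p' q' g)
  have *: "\<exists>C\<ge>0. \<forall>r t. (r, t) \<in> hyp_region \<longrightarrow> norm (f r t * g r t) \<le> C * (rate t ^ (p + p') / r ^ (q + q'))"
    if fg: "symb j p q f" "symb j p' q' g" for f g p q p' q' j
  proof -
    obtain C1 where C1: "C1 \<ge> 0" "\<forall>r t. (r, t) \<in> hyp_region \<longrightarrow> norm (f r t) \<le> C1 * (rate t ^ p / r ^ q)" using symb_bound[OF fg(1)] by blast
    obtain C2 where C2: "C2 \<ge> 0" "\<forall>r t. (r, t) \<in> hyp_region \<longrightarrow> norm (g r t) \<le> C2 * (rate t ^ p' / r ^ q')" using symb_bound[OF fg(2)] by blast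
    have "norm (f r t * g r t) \<le> (C1 * C2) * (rate t ^ (p + p') / r ^ (q + q'))" if rt: "(r, t) \<in> hyp_region" for r t
    proof -
      have r: "r > 0" and x: "rate t > 0" using hyp_region_D rt by auto
      have "norm (f r t) * norm (g r t) \<le> (C1 * (rate t ^ p / r ^ q)) * (C2 * (rate t ^ p' / r ^ q'))"
        using C1 C2 rt r x by (intro mult_mono) auto
      then show ?thesis by (simp add: norm_mult power_add mult_ac)
    qed
    then show ?thesis using C1(1) C2(1) by (intro exI[of _ "C1 * C2"]) auto
  qed
  {
    case 0 then show ?case using *[OF 0] by (auto intro: continuous_on_mult)
  next
    case (Suc j)
    from Suc.prems obtain f' g' where
      f': "\<forall>r t. (r, t) \<in> hyp_region \<longrightarrow> (f r has_vector_derivative f' r t) (at t within {0..})" "symb j (Suc p) q f'" and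
      g': "\<forall>r t. (r, t) \<in> hyp_region \<longrightarrow> (g r has_vector_derivative g' r t) (at t within {0..})" "symb j (Suc p') q' g'"
      by auto
    have "\<forall>r t. (r, t) \<in> hyp_region \<longrightarrow> ((\<lambda>t. f r t * g r t) has_vector_derivative f r t * g' r t + f' r t * g r t) (at t within {0..})"
      using f'(1) g'(1) by (auto intro!: has_vector_derivative_mult)
    moreover have "symb j (Suc (p + p')) (q + q') (\<lambda>r t. f r t * g' r t + f' r t * g r t)"
      using Suc.IH[OF symb_SucD[OF Suc.prems(1)] g'(2)] Suc.IH[OF f'(2) symb_SucD[OF Suc.prems(2)]]
      by (intro symb_add) auto
    ultimately show ?case using *[OF Suc.prems] by (intro symb_SucI) auto
  }
qed

lemma symb_const_power: "symb j 0 q (\<lambda>r t. c / of_real r ^ q)"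
proof -
  have zero: "symb j p q (\<lambda>r t. 0)" for j p q
  proof (induction j arbitrary: p)
    case (Suc j)
    have "\<forall>r t. (r, t) \<in> hyp_region \<longrightarrow> ((\<lambda>t. 0) has_vector_derivative (\<lambda>r t. 0::complex) r t) (at t within {0..})" by auto
    then show ?case using Suc hyp_region_D by (auto intro!: exI[of _ 0] exI[of _ "\<lambda>r t. 0"])
  qed (auto intro!: exI[of _ 0])
  have bd: "\<exists>C\<ge>0. \<forall>r t. (r, t) \<in> hyp_region \<longrightarrow> norm (c / of_real r ^ q) \<le> C * (rate t ^ 0 / r ^ q)"
    using hyp_region_D(1) by (intro exI[of _ "norm c"]) (fastforce simp: norm_divide norm_power)
  show ?thesis
  proof (cases j)
    case (Suc i)
    have "\<forall>r t. (r, t) \<in> hyp_region \<longrightarrow> ((\<lambda>t. c / of_real r ^ q) has_vector_derivative (\<lambda>r t. 0::complex) r t) (at t within {0..})" by auto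
    then show ?thesis using Suc zero bd by (auto simp del: of_real_power intro!: exI[of _ "\<lambda>r t. 0"])
  qed (use bd in auto)
qed

lemma symb_scale: "symb j p q f \<Longrightarrow> symb j p (q + n) (\<lambda>r t. (c / of_real r ^ n) * f r t)"
  using symb_mult[OF symb_const_power[of j n c], of p q f] by (simp only: add_0 add.commute[of q n])

lemma symb_minus: "symb j p q f \<Longrightarrow> symb j p q (\<lambda>r t. - f r t)"
  using symb_scale[of j p q f 0 "-1"] by simp

lemma symb_bk: "k \<le> m \<Longrightarrow> symb (m - k) (Suc k) 0 (\<lambda>r t. of_real (bk k t))"
proof (induction "m - k" arbitrary: k)
  have bd: "\<exists>C\<ge>0. \<forall>r t. (r, t) \<in> hyp_region \<longrightarrow> norm (complex_of_real (bk k t)) \<le> C * (rate t ^ Suc k / r ^ 0)" if k: "k \<le> m" for k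
  proof (cases "k = 0")
    case True
    have "\<bar>b t\<bar> \<le> rate t" if "t \<ge> 0" for t using Xi_pos[OF that] by (simp add: rate_def)
    then show ?thesis using True hyp_region_D(2) by (intro exI[of _ 1]) (auto simp: bk_0)
  next
    case False
    obtain C where C: "C > 0" "\<forall>k\<in>{1..m}. \<forall>t\<ge>0. \<bar>bk k t\<bar> \<le> C * (1 / \<Xi> t) ^ (k + 1)" using bk_bound by blast
    have "\<bar>bk k t\<bar> \<le> C * rate t ^ Suc k" if t: "t \<ge> 0" for t
    proof -
      have "\<bar>bk k t\<bar> \<le> C * (1 / \<Xi> t) ^ (k + 1)" using C(2) False k t by auto
      also have "\<dots> \<le> C * rate t ^ (k + 1)"
        using C(1) Xi_pos[OF t] by (intro mult_left_mono power_mono) (auto simp: rate_def)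
      finally show ?thesis by simp
    qed
    then show ?thesis using C(1) hyp_region_D(2) by (intro exI[of _ C]) auto
  qed
  {
    case 0
    then have k: "k = m" by simp
    have "continuous_on {t. (r, t) \<in> hyp_region} (\<lambda>t. complex_of_real (bk m t))" for r
      by (intro continuous_on_of_real continuous_on_subset[OF bk_cont]) (auto simp: hyp_region_def)
    then show ?case using bd[of m] k by auto
  next
    case (Suc i)
    have "symb (m - Suc k) (Suc (Suc k)) 0 (\<lambda>r t. of_real (bk (Suc k) t))"
      using Suc.hyps(1)[of "Suc k"] Suc.hyps(2) by simp
    moreover have "\<forall>r t. (r, t) \<in> hyp_region \<longrightarrow> ((\<lambda>t. complex_of_real (bk k t)) has_vector_derivative of_real (bk (Suc k) t)) (at t within {0..})"
      using Suc.hyps(2) hyp_region_D(2) bk_deriv[of k]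
      by (auto simp: has_real_derivative_iff_has_vector_derivative intro!: has_vector_derivative_of_real)
    moreover have mk: "m - k = Suc (m - Suc k)" using Suc.hyps(2) by simp
    ultimately show ?case unfolding mk using bd[OF Suc.prems] by (intro symb_SucI)
  }
qed

text \<open>The Riccati equation \<open>P' + P\<^sup>2 + 2 b P + r\<^sup>2 = 0\<close> with \<open>P = \<i> r + G\<close> is solved with defect \<open>e\<close>.
  Subtracting \<open>e / (2 \<i> r)\<close> from \<open>P\<close> removes \<open>e\<close>, because \<open>2 \<i> r\<close> is the main part of the linearisation
  at \<open>P\<close>. The new defect is smaller by the quotient of the rate by \<open>r\<close> and has one derivative less, so
  \<open>m\<close> derivatives of \<open>b\<close> allow for \<open>m\<close> approximations, the first of which is \<open>\<i> r - b\<close>.\<close>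

lemma riccati_approx:
  assumes "1 \<le> n" "n \<le> m"
  shows "\<exists>G e. symb (Suc (m - n)) 1 0 G \<and> symb (m - n) (n + 1) (n - 1) e \<and>
    (\<forall>r t. (r, t) \<in> hyp_region \<longrightarrow> (G r has_vector_derivative
       e r t - (\<i> * of_real r + G r t)\<^sup>2 - 2 * of_real (b t) * (\<i> * of_real r + G r t) - (of_real r)\<^sup>2) (at t within {0..}))"
  using assms
proof (induction n rule: dec_induct)
  case base
  define G :: "real \<Rightarrow> real \<Rightarrow> complex" where "G r t = - of_real (b t)" for r t
  define e :: "real \<Rightarrow> real \<Rightarrow> complex" where "e r t = - of_real (bk 1 t) + - (of_real (b t) * of_real (b t))" for r t
  have b: "symb m 1 0 (\<lambda>r t. of_real (b t))" using symb_bk[of 0] by (simp add: bk_0)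
  have mm: "m = Suc (m - 1)" using m by simp
  then have b': "symb (m - 1) 1 0 (\<lambda>r t. of_real (b t))" using b symb_SucD by metis
  have "symb (Suc (m - 1)) 1 0 G" unfolding G_def[abs_def] using symb_minus[OF b] mm by simp
  moreover have "symb (m - 1) (1 + 1) (1 - 1) e" unfolding e_def[abs_def]
    using symb_bk[OF m] symb_mult[OF b' b'] by (intro symb_add symb_minus) (auto simp: numeral_2_eq_2)
  moreover have "\<forall>r t. (r, t) \<in> hyp_region \<longrightarrow> (G r has_vector_derivative
       e r t - (\<i> * of_real r + G r t)\<^sup>2 - 2 * of_real (b t) * (\<i> * of_real r + G r t) - (of_real r)\<^sup>2) (at t within {0..})"
  proof clarify
    fix r t assume rt: "(r, t) \<in> hyp_region"
    have "(bk 0 has_real_derivative bk (Suc 0) t) (at t within {0..})"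
      using m hyp_region_D(2)[OF rt] by (intro bk_deriv) auto
    then have "(b has_real_derivative bk 1 t) (at t within {0..})"
      unfolding bk_0 One_nat_def .
    then have "(G r has_vector_derivative - of_real (bk 1 t)) (at t within {0..})"
      unfolding G_def[abs_def] by (intro has_vector_derivative_minus has_vector_derivative_of_real)
    moreover have "e r t - (\<i> * of_real r + G r t)\<^sup>2 - 2 * of_real (b t) * (\<i> * of_real r + G r t) - (of_real r)\<^sup>2 = - of_real (bk 1 t)"
      by (simp add: e_def G_def power2_eq_square algebra_simps)
    ultimately show "(G r has_vector_derivative
       e r t - (\<i> * of_real r + G r t)\<^sup>2 - 2 * of_real (b t) * (\<i> * of_real r + G r t) - (of_real r)\<^sup>2) (at t within {0..})" by simp
  qed
  ultimately show ?case by blast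
next
  case (step n)
  then obtain G e where G: "symb (Suc (m - n)) 1 0 G" and e: "symb (m - n) (n + 1) (n - 1) e" and
    dQ: "\<forall>r t. (r, t) \<in> hyp_region \<longrightarrow> (G r has_vector_derivative
       e r t - (\<i> * of_real r + G r t)\<^sup>2 - 2 * of_real (b t) * (\<i> * of_real r + G r t) - (of_real r)\<^sup>2) (at t within {0..})"
    by auto
  define j where "j = m - Suc n"
  have j: "m - n = Suc j" using step.prems by (simp only: j_def Suc_diff_Suc Suc_le_eq)
  from e obtain e' where e': "\<forall>r t. (r, t) \<in> hyp_region \<longrightarrow> (e r has_vector_derivative e' r t) (at t within {0..})"
    "symb j (Suc (n + 1)) (n - 1) e'" unfolding j symb.simps by metis
  define k where "k r = \<i> * complex_of_real r" for r :: real
  define G1 where "G1 r t = G r t + - ((- \<i> / 2 / of_real r ^ 1) * e r t)" for r t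
  define e1 where "e1 r t = (\<i> / of_real r ^ 1) * ((G r t + of_real (b t)) * e r t)
     + (\<i> / 2 / of_real r ^ 1) * e' r t + (- 1 / 4 / of_real r ^ 2) * (e r t * e r t)" for r t
  have Qj: "symb (Suc j) 1 0 G" using G symb_SucD j by metis
  have Qj0: "symb j 1 0 G" using Qj symb_SucD by blast
  have ej: "symb (Suc j) (n + 1) (n - 1) e" using e j by simp
  have ej0: "symb j (n + 1) (n - 1) e" using ej symb_SucD by blast
  have n1: "n - 1 + 1 = n" using step(1) by simp
  have bj: "symb j 1 0 (\<lambda>r t. of_real (b t))"
  proof -
    have *: "symb (i + l) p q f \<Longrightarrow> symb i p q f" for i l p q f
      by (induction l) (simp_all only: add_0_right add_Suc_right symb_SucD)
    have "symb (j + (m - j)) 1 0 (\<lambda>r t. of_real (b t))" using symb_bk[of 0] by (simp add: bk_0 j_def)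
    then show ?thesis by (rule *)
  qed
  have "symb (Suc (m - Suc n)) 1 0 G1"
  proof -
    have "symb (Suc j) (1 + n) (0 + n) (\<lambda>r t. (- \<i> / 2 / of_real r ^ 1) * e r t)"
      using symb_scale[OF ej, of 1 "- \<i> / 2"] n1 by simp
    then have "symb (Suc j) 1 0 (\<lambda>r t. (- \<i> / 2 / of_real r ^ 1) * e r t)" by (rule symb_weaken)
    then show ?thesis unfolding G1_def[abs_def] j_def[symmetric] by (intro symb_add symb_minus Qj)
  qed
  moreover have "symb (m - Suc n) (Suc n + 1) (Suc n - 1) e1"
  proof -
    have 1: "symb j (Suc n + 1) n (\<lambda>r t. (\<i> / of_real r ^ 1) * ((G r t + of_real (b t)) * e r t))"
      using symb_scale[OF symb_mult[OF symb_add[OF Qj0 bj] ej0], of 1 \<i>] n1 by simp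
    have 2: "symb j (Suc n + 1) n (\<lambda>r t. (\<i> / 2 / of_real r ^ 1) * e' r t)"
      using symb_scale[OF e'(2), of 1 "\<i> / 2"] n1 by simp
    have idx: "n + 1 + (n + 1) = Suc n + 1 + n" "n - 1 + (n - 1) + 2 = n + n" using step(1) by auto
    have "symb j (Suc n + 1 + n) (n + n) (\<lambda>r t. (- 1 / 4 / of_real r ^ 2) * (e r t * e r t))"
      using symb_scale[OF symb_mult[OF ej0 ej0], of 2 "- 1 / 4"] unfolding idx .
    then have 3: "symb j (Suc n + 1) n (\<lambda>r t. (- 1 / 4 / of_real r ^ 2) * (e r t * e r t))" by (rule symb_weaken)
    show ?thesis unfolding e1_def[abs_def] j_def[symmetric] diff_Suc_1 by (intro symb_add 1 2 3)
  qed
  moreover have "\<forall>r t. (r, t) \<in> hyp_region \<longrightarrow> (G1 r has_vector_derivative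
       e1 r t - (\<i> * of_real r + G1 r t)\<^sup>2 - 2 * of_real (b t) * (\<i> * of_real r + G1 r t) - (of_real r)\<^sup>2) (at t within {0..})"
  proof clarify
    fix r t assume rt: "(r, t) \<in> hyp_region"
    define R where "R = complex_of_real r"
    have R: "R \<noteq> 0" using hyp_region_D(1)[OF rt] by (simp add: R_def)
    define q where "q = G r t"
    define f where "f = e r t"
    define \<beta> where "\<beta> = complex_of_real (b t)"
    have "(G1 r has_vector_derivative
        (e r t - (\<i> * of_real r + G r t)\<^sup>2 - 2 * of_real (b t) * (\<i> * of_real r + G r t) - (of_real r)\<^sup>2)
        + - ((- \<i> / 2 / of_real r ^ 1) * e' r t)) (at t within {0..})"
      unfolding G1_def[abs_def] using dQ e'(1) rt
      by (intro has_vector_derivative_add has_vector_derivative_minus has_vector_derivative_mult_right) auto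
    moreover have "(f - (\<i> * R + q)\<^sup>2 - 2 * \<beta> * (\<i> * R + q) - R\<^sup>2) + - ((- \<i> / 2 / R) * e' r t) =
       ((\<i> / R) * ((q + \<beta>) * f) + (\<i> / 2 / R) * e' r t + (- 1 / 4 / R ^ 2) * (f * f))
        - (\<i> * R + (q + - ((- \<i> / 2 / R) * f)))\<^sup>2 - 2 * \<beta> * (\<i> * R + (q + - ((- \<i> / 2 / R) * f))) - R\<^sup>2"
    proof -
      define g where "g = f / R"
      have f: "f = g * R" using R by (simp add: g_def)
      have i: "\<i> * \<i> = -1" by simp
      have "(- \<i> / 2 / R) * f = - \<i> / 2 * g" "(\<i> / R) * ((q + \<beta>) * f) = \<i> * (q + \<beta>) * g"
        "(- 1 / 4 / R ^ 2) * (f * f) = - 1 / 4 * g\<^sup>2"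
        using R by (auto simp: f power2_eq_square)
      then show ?thesis unfolding f by (simp add: power2_eq_square algebra_simps)
    qed
    ultimately show "(G1 r has_vector_derivative
       e1 r t - (\<i> * of_real r + G1 r t)\<^sup>2 - 2 * of_real (b t) * (\<i> * of_real r + G1 r t) - (of_real r)\<^sup>2) (at t within {0..})"
      by (simp only: G1_def e1_def R_def q_def f_def \<beta>_def power_one_right)
  qed
  ultimately show ?case by blast
qed

text \<open>The energy belonging to an approximate solution \<open>R + \<i> S\<close> of the Riccati equation with
  defect \<open>e + \<i> f\<close>. For a vanishing defect it is conserved, because then
  \<open>w' - (R + \<i> S) w\<close> solves an equation of first order.\<close>

lemma riccati_energy_deriv:
  fixes R S w v :: "real \<Rightarrow> real"
  assumes t: "t \<ge> 0" and S: "S t > 0"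
    and dR: "(R has_real_derivative e - ((R t)\<^sup>2 - (S t)\<^sup>2) - 2 * b t * R t - r\<^sup>2) (at t within {0..})"
    and dS: "(S has_real_derivative f - 2 * R t * S t - 2 * b t * S t) (at t within {0..})"
    and sol: "damped_oscillator b r w v"
  shows "((\<lambda>t. int_factor t * ((v t - R t * w t)\<^sup>2 + (S t * w t)\<^sup>2) / S t) has_real_derivative
     int_factor t / S t * ((- f / S t) * ((v t - R t * w t)\<^sup>2 + (S t * w t)\<^sup>2)
       + 2 * (- e / S t) * ((v t - R t * w t) * (S t * w t)) + 2 * (f / S t) * (S t * w t)\<^sup>2)) (at t within {0..})"
proof -
  have dw: "(w has_real_derivative v t) (at t within {0..})"
    and dv: "(v has_real_derivative - r\<^sup>2 * w t - 2 * b t * v t) (at t within {0..})"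
    using sol t by (auto simp: damped_oscillator_def)
  have St: "S t \<noteq> 0" using S by simp
  define x where "x = v t - R t * w t"
  define y where "y = S t * w t"
  define x' where "x' = - (2 * b t + R t) * x - S t * y - (e / S t) * y"
  define y' where "y' = S t * x + (f / S t) * y - (R t + 2 * b t) * y"
  have dx: "((\<lambda>t. v t - R t * w t) has_real_derivative x') (at t within {0..})"
    by (rule DERIV_cong[OF DERIV_diff[OF dv DERIV_mult[OF dR dw]]])
       (use St in \<open>simp add: x'_def x_def y_def field_simps power2_eq_square\<close>)
  have dy: "((\<lambda>t. S t * w t) has_real_derivative y') (at t within {0..})"
    by (rule DERIV_cong[OF DERIV_mult[OF dS dw]])
       (use St in \<open>simp add: y'_def x_def y_def field_simps\<close>)
  show ?thesis
  proof (rule DERIV_cong[OF DERIV_divide[OF DERIV_mult[OF int_factor_deriv[OF t] DERIV_add[OF DERIV_power[OF dx] DERIV_power[OF dy]]] dS St]],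
      unfold x_def[symmetric] y_def[symmetric])
    define s g h where "s = S t" and "g = f / s" and "h = e / s"
    have fS: "f = g * s" and eS: "e = h * s" and s: "s \<noteq> 0" using St by (auto simp: g_def h_def s_def)
    show "((2 * b t * int_factor t * (x\<^sup>2 + y\<^sup>2) + (real 2 * (x' * x ^ (2 - Suc 0)) + real 2 * (y' * y ^ (2 - Suc 0))) * int_factor t) * S t -
        int_factor t * (x\<^sup>2 + y\<^sup>2) * (f - 2 * R t * S t - 2 * b t * S t)) / (S t * S t) =
        int_factor t / S t * (- f / S t * (x\<^sup>2 + y\<^sup>2) + 2 * (- e / S t) * (x * y) + 2 * (f / S t) * y\<^sup>2)"
      unfolding x'_def y'_def s_def[symmetric] fS eS
      using s by (simp add: divide_simps) (simp add: power2_eq_square algebra_simps)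
  qed
qed

text \<open>The energy of \<open>riccati_energy_deriv\<close> for the best approximation is comparable to the
  energy of the oscillator. Its relative change is the integral of the defect divided by \<open>r\<close>, hence at most a
  multiple of \<open>1 / (r \<Psi>(s))\<^sup>m\<close>.\<close>

lemma hyperbolic_zone:
  "\<exists>N>0. \<exists>C>0. \<forall>r w v s t. damped_oscillator b r w v \<longrightarrow> r > 0 \<longrightarrow> 0 \<le> s \<longrightarrow> s \<le> t \<longrightarrow> N \<le> r * Psi s \<longrightarrow>
     wenergy r w v t \<le> C * wenergy r w v s"
proof -
  obtain q e where q: "symb (Suc (m - m)) 1 0 q" and e: "symb (m - m) (m + 1) (m - 1) e" and
    dq: "\<forall>r t. (r, t) \<in> hyp_region \<longrightarrow> (q r has_vector_derivative
       e r t - (\<i> * of_real r + q r t)\<^sup>2 - 2 * of_real (b t) * (\<i> * of_real r + q r t) - (of_real r)\<^sup>2) (at t within {0..})"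
    using riccati_approx[OF m order_refl] by (elim exE conjE)
  obtain Cq where Cq: "Cq \<ge> 0" "\<forall>r t. (r, t) \<in> hyp_region \<longrightarrow> norm (q r t) \<le> Cq * (rate t ^ 1 / r ^ 0)"
    using symb_bound[OF q] by (elim exE conjE)
  obtain Ce where Ce: "Ce \<ge> 0" "\<forall>r t. (r, t) \<in> hyp_region \<longrightarrow> norm (e r t) \<le> Ce * (rate t ^ (m + 1) / r ^ (m - 1))"
    using symb_bound[OF e] by (elim exE conjE)
  have econt: "continuous_on {t. (r, t) \<in> hyp_region} (e r)" for r using e by simp
  obtain Cx where Cx: "Cx > 0" "\<And>t. t \<ge> 0 \<Longrightarrow> Psi t > 0 \<Longrightarrow> rate t \<le> Cx / Psi t" using rate_le by blast
  obtain Ci where Ci: "Ci > 0" "\<And>s t g. 0 \<le> s \<Longrightarrow> s \<le> t \<Longrightarrow> Psi s > 0 \<Longrightarrow> g integrable_on {s..t} \<Longrightarrow>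
     (\<forall>x\<in>{s..t}. g x \<le> rate x ^ (m + 1)) \<Longrightarrow> integral {s..t} g \<le> Ci / Psi s ^ m"
    using rate_power_integral by blast
  \<comment> \<open>large enough for the correction of \<open>\<i> r\<close> to stay below \<open>r / 2\<close>\<close>
  define N where "N = 1 + 2 * Cq * Cx"
  have N: "N \<ge> 1" using Cq(1) Cx(1) by (simp add: N_def)
  define C where "C = 54 * (exp B)\<^sup>2 * exp (8 * (Ce + 1) * Ci)"
  have main: "wenergy r w v t \<le> C * wenergy r w v s"
    if sol: "damped_oscillator b r w v" and r: "r > 0" and st: "0 \<le> s" "s \<le> t" "N \<le> r * Psi s" for r w v s t
  proof -
    have ND: "N \<le> r * Psi x" if x: "s \<le> x" for x
    proof -
      have "r * Psi s \<le> r * Psi x" using Psi_mono[of s x] x st r by (intro mult_left_mono) auto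
      then show ?thesis using st by simp
    qed
    have inD: "(r, x) \<in> hyp_region" if x: "s \<le> x" for x using ND[OF x] N r x st by (simp add: hyp_region_def)
    define R where "R x = Re (q r x)" for x
    define S where "S x = r + Im (q r x)" for x
    have qs: "norm (q r x) \<le> r / 2" if x: "s \<le> x" for x
    proof -
      have P: "Psi x > 0" using hyp_region_D(3)[OF inD[OF x]] .
      have "norm (q r x) \<le> Cq * rate x" using Cq(2) inD[OF x] by auto
      also have "\<dots> \<le> Cq * (Cx / Psi x)" using Cx(2)[of x] P x st Cq(1) by (intro mult_left_mono) auto
      also have "\<dots> = Cq * Cx / Psi x" by simp
      also have "\<dots> \<le> (r * Psi x / 2) / Psi x"
        using ND[OF x] P by (intro divide_right_mono) (auto simp: N_def)
      finally show ?thesis using P by simp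
    qed
    have Rb: "\<bar>R x\<bar> \<le> r / 2" and Sb: "r / 2 \<le> S x" "S x \<le> 3 / 2 * r" if x: "s \<le> x" for x
      using qs[OF x] abs_Re_le_cmod[of "q r x"] abs_Im_le_cmod[of "q r x"] unfolding R_def S_def abs_le_iff by linarith+
    have Sp: "S x > 0" if x: "s \<le> x" for x using Sb(1)[OF x] r by linarith
    have dR: "(R has_real_derivative Re (e r x) - ((R x)\<^sup>2 - (S x)\<^sup>2) - 2 * b x * R x - r\<^sup>2) (at x within {0..})"
      and dS: "(S has_real_derivative Im (e r x) - 2 * R x * S x - 2 * b x * S x) (at x within {0..})" if x: "s \<le> x" for x
    proof -
      have d: "(q r has_vector_derivative
       e r x - (\<i> * of_real r + q r x)\<^sup>2 - 2 * of_real (b x) * (\<i> * of_real r + q r x) - (of_real r)\<^sup>2) (at x within {0..})"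
        using dq inD[OF x] by blast
      have sq: "Re ((\<i> * of_real r + q r x)\<^sup>2) = (R x)\<^sup>2 - (S x)\<^sup>2" "Im ((\<i> * of_real r + q r x)\<^sup>2) = 2 * R x * S x"
        by (simp_all add: R_def S_def Re_power2 Im_power2)
      have r2: "(complex_of_real r)\<^sup>2 = of_real (r\<^sup>2)" by simp
      from bounded_linear.has_vector_derivative[OF bounded_linear_Re d]
      show "(R has_real_derivative Re (e r x) - ((R x)\<^sup>2 - (S x)\<^sup>2) - 2 * b x * R x - r\<^sup>2) (at x within {0..})"
        unfolding has_real_derivative_iff_has_vector_derivative R_def[abs_def, symmetric] minus_complex.sel sq r2
        by (simp add: R_def[symmetric])
      from has_vector_derivative_add[OF has_vector_derivative_const[of r] bounded_linear.has_vector_derivative[OF bounded_linear_Im d]]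
      show "(S has_real_derivative Im (e r x) - 2 * R x * S x - 2 * b x * S x) (at x within {0..})"
        unfolding has_real_derivative_iff_has_vector_derivative S_def[abs_def, symmetric] minus_complex.sel sq r2
        by (simp add: S_def[symmetric])
    qed
    define U where "U x = int_factor x * ((v x - R x * w x)\<^sup>2 + (S x * w x)\<^sup>2) / S x" for x
    have U0: "U x \<ge> 0" if x: "s \<le> x" for x using Sp[OF x] int_factor_pos[of x] by (auto simp: U_def less_imp_le)
    \<comment> \<open>continued constantly to the left of \<open>s\<close>, to have a continuous function on the half-line\<close>
    define ee where "ee x = norm (e r (max s x))" for x
    have "continuous_on {0..} ee"
      unfolding ee_def
      by (intro continuous_on_norm continuous_on_compose2[OF econt[of r], of _ "\<lambda>x. max s x"] continuous_intros)
         (auto intro: inD)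
    then have dG: "((\<lambda>t. integral {0..t} ee) has_real_derivative ee x) (at x within {0..})" and eei: "ee integrable_on {0..x}" if "x \<ge> 0" for x
      using integral_has_real_derivative_halfline that
      by (auto intro!: integrable_continuous_real continuous_on_subset[of "{0..}" ee])
    have "U t \<le> exp (8 / r * integral {0..t} ee - 8 / r * integral {0..s} ee) * U s"
    proof (rule gronwall[OF st(1,2)])
      fix x assume x: "s \<le> x" "x \<le> t"
      show "(U has_real_derivative int_factor x / S x * ((- Im (e r x) / S x) * ((v x - R x * w x)\<^sup>2 + (S x * w x)\<^sup>2)
       + 2 * (- Re (e r x) / S x) * ((v x - R x * w x) * (S x * w x)) + 2 * (Im (e r x) / S x) * (S x * w x)\<^sup>2)) (at x within {0..})"
        unfolding U_def[abs_def] using x st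
        by (intro riccati_energy_deriv[OF _ Sp dR dS sol]) auto
      show "((\<lambda>t. 8 / r * integral {0..t} ee) has_real_derivative 8 / r * ee x) (at x within {0..})"
        using dG x st by (intro DERIV_cmult) auto
    next
      fix x assume x: "s < x" "x < t"
      then have xs: "s \<le> x" by simp
      define y z where "y = v x - R x * w x" and "z = S x * w x"
      define n where "n = norm (e r x) / S x"
      have S: "S x > 0" using Sp[OF xs] .
      have n0: "n \<ge> 0" using S by (simp add: n_def)
      have i: "\<bar>Im (e r x) / S x\<bar> \<le> n" and rr: "\<bar>- Re (e r x) / S x\<bar> \<le> n"
        using abs_Im_le_cmod[of "e r x"] abs_Re_le_cmod[of "e r x"] S
        by (auto simp: n_def abs_div intro!: divide_right_mono)
      have t1: "(- Im (e r x) / S x) * (y\<^sup>2 + z\<^sup>2) \<le> n * (y\<^sup>2 + z\<^sup>2)"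
        using i unfolding abs_le_iff by (intro mult_right_mono) auto
      have t2: "2 * (- Re (e r x) / S x) * (y * z) \<le> n * (y\<^sup>2 + z\<^sup>2)"
      proof -
        have "(- Re (e r x) / S x) * (2 * (y * z)) \<le> \<bar>- Re (e r x) / S x\<bar> * \<bar>2 * (y * z)\<bar>"
          by (metis abs_ge_self abs_mult)
        also have "\<bar>2 * (y * z)\<bar> \<le> y\<^sup>2 + z\<^sup>2"
          using sum_squares_bound[of "\<bar>y\<bar>" "\<bar>z\<bar>"] by (simp add: abs_mult)
        then have "\<bar>- Re (e r x) / S x\<bar> * \<bar>2 * (y * z)\<bar> \<le> n * (y\<^sup>2 + z\<^sup>2)"
          using rr n0 by (intro mult_mono) auto
        finally show ?thesis by (simp add: mult_ac)
      qed
      have t3: "2 * (Im (e r x) / S x) * z\<^sup>2 \<le> 2 * (n * (y\<^sup>2 + z\<^sup>2))"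
      proof -
        have "(Im (e r x) / S x) * z\<^sup>2 \<le> n * z\<^sup>2" using i unfolding abs_le_iff by (intro mult_right_mono) auto
        also have "\<dots> \<le> n * (y\<^sup>2 + z\<^sup>2)" using n0 by (intro mult_left_mono) auto
        finally show ?thesis by simp
      qed
      have "int_factor x / S x * ((- Im (e r x) / S x) * (y\<^sup>2 + z\<^sup>2) + 2 * (- Re (e r x) / S x) * (y * z) + 2 * (Im (e r x) / S x) * z\<^sup>2)
          \<le> int_factor x / S x * (4 * (n * (y\<^sup>2 + z\<^sup>2)))"
        using t1 t2 t3 S int_factor_pos[of x] by (intro mult_left_mono) (auto simp: less_imp_le)
      also have "\<dots> = 4 * n * U x" by (simp add: U_def y_def z_def)
      also have "\<dots> \<le> 4 * (norm (e r x) / (r / 2)) * U x"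
        using Sb(1)[OF xs] r U0[OF xs] S unfolding n_def
        by (intro mult_right_mono mult_left_mono divide_left_mono) auto
      also have "\<dots> = 8 / r * ee x * U x" using xs by (simp add: ee_def max_def)
      finally show "int_factor x / S x * ((- Im (e r x) / S x) * ((v x - R x * w x)\<^sup>2 + (S x * w x)\<^sup>2)
       + 2 * (- Re (e r x) / S x) * ((v x - R x * w x) * (S x * w x)) + 2 * (Im (e r x) / S x) * (S x * w x)\<^sup>2)
         \<le> 8 / r * ee x * U x"
        unfolding y_def z_def .
    qed
    also have "\<dots> \<le> exp (8 * (Ce + 1) * Ci) * U s"
    proof (rule mult_right_mono[OF _ U0])
      have P: "Psi s > 0" using hyp_region_D(3)[OF inD] by simp
      have "integral {0..s} ee + integral {s..t} ee = integral {0..t} ee"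
        using st eei[of t] by (intro Henstock_Kurzweil_Integration.integral_combine) auto
      moreover have "integral {s..t} ee \<le> (Ce + 1) * Ci * r"
      proof -
        have ei: "ee integrable_on {s..t}" using eei[of t] st by (auto intro: integrable_subinterval_real)
        have r0: "r ^ (m - 1) > 0" using r by simp
        define g where "g x = ee x * (r ^ (m - 1) / (Ce + 1))" for x
        have "integral {s..t} g \<le> Ci / Psi s ^ m"
        proof (rule Ci(2)[OF st(1,2) P])
          show "g integrable_on {s..t}" unfolding g_def by (rule integrable_on_mult_left[OF ei])
          show "\<forall>x\<in>{s..t}. g x \<le> rate x ^ (m + 1)"
          proof
            fix x assume x: "x \<in> {s..t}"
            have Xx: "rate x ^ (m + 1) / r ^ (m - 1) \<ge> 0" using hyp_region_D(4)[OF inD[of x]] x r by simp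
            have "ee x \<le> Ce * (rate x ^ (m + 1) / r ^ (m - 1))" using Ce(2) inD[of x] x by (auto simp: ee_def max_def)
            also have "\<dots> \<le> (Ce + 1) * (rate x ^ (m + 1) / r ^ (m - 1))" using Xx by (intro mult_right_mono) auto
            finally have "g x \<le> (Ce + 1) * (rate x ^ (m + 1) / r ^ (m - 1)) * (r ^ (m - 1) / (Ce + 1))"
              unfolding g_def using Ce(1) r by (intro mult_right_mono) auto
            then show "g x \<le> rate x ^ (m + 1)" using Ce(1) r by simp
          qed
        qed
        moreover have "integral {s..t} g = integral {s..t} ee * (r ^ (m - 1) / (Ce + 1))"
          unfolding g_def by (rule integral_mult_left)
        ultimately have "integral {s..t} ee * (r ^ (m - 1) / (Ce + 1)) \<le> Ci / Psi s ^ m" by simp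
        also have "\<dots> \<le> Ci * r ^ m"
        proof -
          have "1 \<le> r * Psi s" using ND[of s] N by simp
          then have "1 \<le> (r * Psi s) ^ m" by (rule one_le_power)
          then have "Ci * 1 \<le> Ci * (r ^ m * Psi s ^ m)" using Ci(1) by (simp add: power_mult_distrib)
          then show ?thesis using P by (simp add: field_simps)
        qed
        finally have "integral {s..t} ee \<le> Ci * r ^ m * ((Ce + 1) / r ^ (m - 1))"
          using Ce(1) r0 by (simp add: field_simps)
        also have "\<dots> = (Ce + 1) * Ci * r" using r m by (cases m) auto
        finally show ?thesis .
      qed
      ultimately have "8 / r * integral {0..t} ee - 8 / r * integral {0..s} ee \<le> 8 / r * ((Ce + 1) * Ci * r)"
        using r unfolding right_diff_distrib[symmetric] by (intro mult_left_mono) auto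
      then show "exp (8 / r * integral {0..t} ee - 8 / r * integral {0..s} ee) \<le> exp (8 * (Ce + 1) * Ci)" using r by (simp add: algebra_simps)
    qed simp
    finally have UU: "U t \<le> exp (8 * (Ce + 1) * Ci) * U s" .
    have QU: "wenergy r w v x \<le> 9 * exp B * r * U x" and UQ: "U x \<le> 6 * exp B / r * wenergy r w v x" if x: "s \<le> x" for x
    proof -
      define y z where "y = v x - R x * w x" and "z = S x * w x"
      have x0: "x \<ge> 0" using x st by simp
      note S = Sp[OF x] Sb[OF x] Rb[OF x]
      have "r * \<bar>w x\<bar> \<le> (2 * S x) * \<bar>w x\<bar>" using S by (intro mult_right_mono) auto
      then have "\<bar>r * w x\<bar> \<le> \<bar>2 * z\<bar>" using S(1) r by (simp add: z_def abs_mult)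
      then have "(r * w x)\<^sup>2 \<le> (2 * z)\<^sup>2" by (rule abs_le_square_iff[THEN iffD1])
      then have 1: "(r * w x)\<^sup>2 \<le> 4 * z\<^sup>2" by (simp add: power_mult_distrib)
      have Rw: "(R x * w x)\<^sup>2 \<le> (r * w x)\<^sup>2 / 4"
      proof -
        have "\<bar>R x\<bar> * \<bar>w x\<bar> \<le> (r / 2) * \<bar>w x\<bar>" using S by (intro mult_right_mono) auto
        then have "\<bar>R x * w x\<bar> \<le> \<bar>r / 2 * w x\<bar>" using r by (simp add: abs_mult)
        then have "(R x * w x)\<^sup>2 \<le> (r / 2 * w x)\<^sup>2" by (rule abs_le_square_iff[THEN iffD1])
        then show ?thesis by (simp add: power_mult_distrib power_divide)
      qed
      have two: "(\<alpha> + \<beta>)\<^sup>2 \<le> 2 * \<alpha>\<^sup>2 + 2 * \<beta>\<^sup>2" "(\<alpha> - \<beta>)\<^sup>2 \<le> 2 * \<alpha>\<^sup>2 + 2 * \<beta>\<^sup>2" for \<alpha> \<beta> :: real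
        using zero_le_power2[of "\<alpha> - \<beta>"] zero_le_power2[of "\<alpha> + \<beta>"] unfolding power2_sum power2_diff by linarith+
      have "v x = y + R x * w x" by (simp add: y_def)
      then have "(v x)\<^sup>2 \<le> 2 * y\<^sup>2 + 2 * (R x * w x)\<^sup>2" using two(1) by simp
      then have 2: "(r * w x)\<^sup>2 + (v x)\<^sup>2 \<le> 6 * (y\<^sup>2 + z\<^sup>2)" using 1 Rw zero_le_power2[of y] zero_le_power2[of z] unfolding distrib_left by linarith
      have z2: "z\<^sup>2 \<le> 9 / 4 * (r * w x)\<^sup>2"
      proof -
        have "S x * \<bar>w x\<bar> \<le> (3 / 2 * r) * \<bar>w x\<bar>" using S by (intro mult_right_mono) auto
        then have "\<bar>z\<bar> \<le> \<bar>3 / 2 * r * w x\<bar>" using S(1) r by (simp add: z_def abs_mult)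
        then have "z\<^sup>2 \<le> (3 / 2 * r * w x)\<^sup>2" by (rule abs_le_square_iff[THEN iffD1])
        then show ?thesis by (simp add: power_mult_distrib power_divide)
      qed
      have "y\<^sup>2 \<le> 2 * (v x)\<^sup>2 + 2 * (R x * w x)\<^sup>2" unfolding y_def by (rule two(2))
      then have 3: "y\<^sup>2 + z\<^sup>2 \<le> 3 * ((r * w x)\<^sup>2 + (v x)\<^sup>2)" using z2 Rw zero_le_power2[of "v x"] zero_le_power2[of "r * w x"] unfolding distrib_left by linarith
      have Qx: "wenergy r w v x = (\<Lambda> x)\<^sup>2 * ((r * w x)\<^sup>2 + (v x)\<^sup>2)" by (simp add: wenergy_def power_mult_distrib algebra_simps)
      have Ux: "U x = int_factor x * (y\<^sup>2 + z\<^sup>2) / S x" by (simp add: U_def y_def z_def)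
      have "(\<Lambda> x)\<^sup>2 \<le> exp B * int_factor x"
      proof -
        have "exp B * (exp (- B) * (\<Lambda> x)\<^sup>2) \<le> exp B * int_factor x" using int_factor_bounds(2)[OF x0] by (intro mult_left_mono) auto
        then show ?thesis by (simp add: exp_minus field_simps)
      qed
      then have "wenergy r w v x \<le> (exp B * int_factor x) * (6 * (y\<^sup>2 + z\<^sup>2))"
        unfolding Qx using 2 int_factor_pos[of x, THEN less_imp_le] by (intro mult_mono) auto
      also have "\<dots> = 6 * exp B * S x * U x" using S(1) by (simp add: Ux)
      also have "\<dots> \<le> 6 * exp B * (3 / 2 * r) * U x"
        using S U0[OF x] by (intro mult_right_mono mult_left_mono) auto
      finally show "wenergy r w v x \<le> 9 * exp B * r * U x" by (simp add: mult_ac)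
      have "U x \<le> (exp B * (\<Lambda> x)\<^sup>2) * (3 * ((r * w x)\<^sup>2 + (v x)\<^sup>2)) / (r / 2)"
        unfolding Ux using 3 int_factor_bounds(1)[OF x0] S r
        by (intro frac_le mult_mono) (auto simp: less_imp_le)
      also have "\<dots> = 6 * exp B / r * wenergy r w v x" by (simp add: Qx field_simps)
      finally show "U x \<le> 6 * exp B / r * wenergy r w v x" .
    qed
    have "wenergy r w v t \<le> 9 * exp B * r * U t" using QU st by simp
    also have "\<dots> \<le> 9 * exp B * r * (exp (8 * (Ce + 1) * Ci) * (6 * exp B / r * wenergy r w v s))"
      using UU UQ[of s] r by (intro mult_left_mono order_trans[OF UU]) auto
    also have "\<dots> = C * wenergy r w v s" using r by (simp add: C_def power2_eq_square)
    finally show ?thesis .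
  qed
  moreover have "C > 0" by (simp add: C_def)
  moreover have "N > 0" using N by simp
  ultimately show ?thesis by blast
qed

text \<open>The zones are traversed one after the other, each with its own constant factor; for small \<open>r\<close> or bounded
  \<open>\<Psi>\<close> the later ones are never reached.\<close>

theorem oscillator_decay:
  "\<exists>C>0. \<forall>r w v t. damped_oscillator b r w v \<longrightarrow> r \<ge> 0 \<longrightarrow> t \<ge> 0 \<longrightarrow>
     wenergy r w v t \<le> C * ((1 + r) * \<bar>w 0\<bar> + \<bar>v 0\<bar>)\<^sup>2"
proof -
  obtain C1 where C1: "C1 > 0" "\<And>r w v t. damped_oscillator b r w v \<Longrightarrow> r \<ge> 0 \<Longrightarrow> t \<ge> 0 \<Longrightarrow> r * t \<le> low_bound \<Longrightarrow>
     wenergy r w v t \<le> C1 * ((1 + r) * \<bar>w 0\<bar> + \<bar>v 0\<bar>)\<^sup>2" using low_zone by metis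
  obtain C2 where C2: "C2 > 0" "\<And>r w v s t. damped_oscillator b r w v \<Longrightarrow> r > 0 \<Longrightarrow> low_bound / r \<le> s \<Longrightarrow> s \<le> t \<Longrightarrow> t \<le> K / r \<Longrightarrow>
     wenergy r w v t \<le> C2 * wenergy r w v s" using middle_zone by metis
  obtain N C4 where C4: "N > 0" "C4 > 0" "\<And>r w v s t. damped_oscillator b r w v \<Longrightarrow> r > 0 \<Longrightarrow> 0 \<le> s \<Longrightarrow> s \<le> t \<Longrightarrow> N \<le> r * Psi s \<Longrightarrow>
     wenergy r w v t \<le> C4 * wenergy r w v s" using hyperbolic_zone by metis
  obtain C3 where C3: "C3 > 0" "\<And>r w v s t. damped_oscillator b r w v \<Longrightarrow> r > 0 \<Longrightarrow> K / r \<le> s \<Longrightarrow> s \<le> t \<Longrightarrow> r * Psi t \<le> N \<Longrightarrow>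
     wenergy r w v t \<le> C3 * wenergy r w v s" using stabilisation_zone[of N] by metis
  define c where "c = max 1 C4 * max 1 C3 * max 1 C2 * C1"
  have low_bound: "0 < low_bound" "low_bound \<le> 1" using B(1) by (auto simp: low_bound_def)
  have Q0: "wenergy r w v t \<ge> 0" for r w v t by (simp add: wenergy_def)
  have main: "wenergy r w v t \<le> c * ((1 + r) * \<bar>w 0\<bar> + \<bar>v 0\<bar>)\<^sup>2"
    if sol: "damped_oscillator b r w v" and r: "r \<ge> 0" and t: "t \<ge> 0" for r w v t
  proof -
    define D where "D = ((1 + r) * \<bar>w 0\<bar> + \<bar>v 0\<bar>)\<^sup>2"
    have D0: "D \<ge> 0" by (simp add: D_def)
    \<comment> \<open>the factor of a zone is irrelevant as long as the zone has not been reached\<close>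
    have up: "x \<le> max 1 a * y" if "x \<le> a * y \<or> x \<le> y" "y \<ge> 0" for a x y :: real
      using that mult_right_mono[of a "max 1 a" y] mult_right_mono[of 1 "max 1 a" y] by auto
    have A: "wenergy r w v s \<le> C1 * D" if "s \<ge> 0" "r * s \<le> low_bound" for s
      using C1(2)[OF sol r that] by (simp add: D_def)
    have Bz: "wenergy r w v s \<le> max 1 C2 * (C1 * D)" if s: "s \<ge> 0" "r * s \<le> K" for s
    proof (cases "r * s \<le> low_bound")
      case True then show ?thesis using A s D0 C1(1) by (intro up) auto
    next
      case False
      then have rp: "r > 0" using r low_bound by (cases "r = 0") auto
      have "wenergy r w v s \<le> C2 * wenergy r w v (low_bound / r)"
        using False s rp by (intro C2(2)[OF sol rp]) (auto simp: field_simps)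
      also have "\<dots> \<le> C2 * (C1 * D)"
        using A[of "low_bound / r"] rp low_bound C2(1) by (intro mult_left_mono) auto
      finally show ?thesis using D0 C1(1) by (intro up) auto
    qed
    have Cz: "wenergy r w v s \<le> max 1 C3 * (max 1 C2 * (C1 * D))" if s: "s \<ge> 0" "r * Psi s \<le> N" for s
    proof (cases "r * s \<le> K")
      case True then show ?thesis using Bz s D0 C1(1) by (intro up) auto
    next
      case False
      then have rp: "r > 0" using r K(1) by (cases "r = 0") auto
      have "wenergy r w v s \<le> C3 * wenergy r w v (K / r)"
        using False s rp by (intro C3(2)[OF sol rp]) (auto simp: field_simps)
      also have "\<dots> \<le> C3 * (max 1 C2 * (C1 * D))"
        using Bz[of "K / r"] rp K(1) C3(1) by (intro mult_left_mono) auto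
      finally show ?thesis using D0 C1(1) by (intro up) auto
    qed
    have "wenergy r w v t \<le> max 1 C4 * (max 1 C3 * (max 1 C2 * (C1 * D)))"
    proof (cases "r * Psi t \<le> N")
      case True then show ?thesis using Cz t D0 C1(1) by (intro up) auto
    next
      case False
      then have rp: "r > 0" using r C4(1) by (cases "r = 0") auto
      have "continuous_on {0..} Psi"
        using Psi_deriv by (auto simp: continuous_on_eq_continuous_within intro: DERIV_continuous)
      then have "continuous_on {0..t} (\<lambda>s. r * Psi s)"
        by (intro continuous_intros) (auto intro: continuous_on_subset)
      \<comment> \<open>the time at which the hyperbolic zone begins\<close>
      then obtain s where s: "0 \<le> s" "s \<le> t" "r * Psi s = N"
        using IVT'[of "\<lambda>s. r * Psi s" 0 N t] False C4(1) t Psi_0 by auto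
      have "wenergy r w v t \<le> C4 * wenergy r w v s" using s by (intro C4(3)[OF sol rp]) auto
      also have "\<dots> \<le> C4 * (max 1 C3 * (max 1 C2 * (C1 * D)))"
        using Cz[of s] s C4(2) by (intro mult_left_mono) auto
      finally show ?thesis using D0 C1(1) by (intro up) auto
    qed
    then show ?thesis by (simp add: c_def D_def mult_ac)
  qed
  have "c > 0" using C1(1) by (auto simp: c_def intro!: mult_pos_pos)
  then show ?thesis using main by (intro exI[of _ c]) blast
qed

end

text \<open>The quotient is \<open>exp (s / 2)\<close> with the bounded integral \<open>s\<close> of \<open>\<sigma>\<close>.\<close>

theorem (in stabilised_damping) lambda_comparable: "comparable (lambda_of \<mu>) (\<lambda>t. exp (integral {0..t} b))"
proof -
  have eq: "exp (integral {0..t} b) = \<Lambda> t * exp (sigma_int t / 2)" if t: "t \<ge> 0" for t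
  proof -
    have i: "\<mu> integrable_on {0..t}" "\<sigma> integrable_on {0..t}"
      by (auto intro!: integrable_continuous_real continuous_on_subset[OF mu_cont] continuous_on_subset[OF sigma_cont])
    have "integral {0..t} b = integral {0..t} (\<lambda>x. (1 / 2) * \<mu> x + (1 / 2) * \<sigma> x)"
      by (rule integral_cong) (use b_split in \<open>auto simp: field_simps\<close>)
    also have "\<dots> = integral {0..t} (\<lambda>x. (1 / 2) * \<mu> x) + integral {0..t} (\<lambda>x. (1 / 2) * \<sigma> x)"
      by (rule integral_add) (use i in \<open>auto intro!: integrable_on_mult_right\<close>)
    also have "\<dots> = 1 / 2 * integral {0..t} \<mu> + 1 / 2 * integral {0..t} \<sigma>"
      by (simp only: integral_mult_right)
    finally show ?thesis by (simp add: lambda_of_def sigma_int_def exp_add)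
  qed
  have e: "exp (- B / 2) \<le> exp (sigma_int t / 2)" "exp (sigma_int t / 2) \<le> exp (B / 2)" if "t \<ge> 0" for t
    using B(2)[OF that] by auto
  have "lesssim \<Lambda> (\<lambda>t. exp (integral {0..t} b))" unfolding lesssim_def
  proof (intro exI[of _ "exp (B / 2)"] conjI allI impI)
    fix t :: real assume t: "0 \<le> t"
    have "\<Lambda> t = exp (B / 2) * (\<Lambda> t * exp (- B / 2))" by (simp add: exp_minus)
    also have "\<dots> \<le> exp (B / 2) * (\<Lambda> t * exp (sigma_int t / 2))" using e(1)[OF t] by (intro mult_left_mono) auto
    finally show "\<Lambda> t \<le> exp (B / 2) * exp (integral {0..t} b)" using eq[OF t] by simp
  qed simp
  moreover have "lesssim (\<lambda>t. exp (integral {0..t} b)) \<Lambda>" unfolding lesssim_def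
  proof (intro exI[of _ "exp (B / 2)"] conjI allI impI)
    fix t :: real assume t: "0 \<le> t"
    show "exp (integral {0..t} b) \<le> exp (B / 2) * \<Lambda> t"
      unfolding eq[OF t] using e(2)[OF t] by (simp add: mult.commute mult_right_mono)
  qed simp
  ultimately show ?thesis by (simp add: comparable_def)
qed

section \<open>The space \<open>L\<^sup>2\<close>\<close>

text \<open>The square of the norm as a nonnegative integral, which has a value also for functions that are not
  square integrable. Limit theorems apply to it without preparation.\<close>

definition sq_integral :: "(real ^ 'n \<Rightarrow> 'b::euclidean_space) \<Rightarrow> ennreal" where
  "sq_integral f = (\<integral>\<^sup>+ x. ennreal ((norm (f x))\<^sup>2) \<partial>lebesgue)"

lemma L2_D: "L2 f \<Longrightarrow> f \<in> borel_measurable lebesgue" "L2 f \<Longrightarrow> integrable lebesgue (\<lambda>x. (norm (f x))\<^sup>2)"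
  by (auto simp: L2_def)

lemma L2_iff_sq_integral: "L2 f \<longleftrightarrow> f \<in> borel_measurable lebesgue \<and> sq_integral f < \<infinity>"
proof (cases "f \<in> borel_measurable lebesgue")
  case True
  then have "integrable lebesgue (\<lambda>x. (norm (f x))\<^sup>2) \<longleftrightarrow> sq_integral f < \<infinity>"
    unfolding sq_integral_def by (subst integrable_iff_bounded) (auto simp: borel_measurable_norm)
  then show ?thesis using True by (simp add: L2_def)
qed (simp add: L2_def)

lemma L2_norm_nonneg: "L2_norm f \<ge> 0"
  by (simp add: L2_norm_def)

lemma sq_integral_eq_L2_norm: "L2 f \<Longrightarrow> sq_integral f = ennreal ((L2_norm f)\<^sup>2)"
  unfolding sq_integral_def L2_norm_def by (subst nn_integral_eq_integral) (auto simp: L2_def)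

lemma L2_norm_power2: "(L2_norm f)\<^sup>2 = (LINT x|lebesgue. (norm (f x))\<^sup>2)"
  by (simp add: L2_norm_def)

lemma L2_bound:
  assumes "L2 g" "f \<in> borel_measurable lebesgue" "AE x in lebesgue. norm (f x) \<le> c * norm (g x)"
  shows "L2 f" "c \<ge> 0 \<Longrightarrow> L2_norm f \<le> c * L2_norm g"
proof -
  have le: "AE x in lebesgue. (norm (f x))\<^sup>2 \<le> c\<^sup>2 * (norm (g x))\<^sup>2"
    using assms(3) by eventually_elim (metis norm_ge_zero power_mono power_mult_distrib)
  have i: "integrable lebesgue (\<lambda>x. c\<^sup>2 * (norm (g x))\<^sup>2)" using L2_D(2)[OF assms(1)] by simp
  have fi: "integrable lebesgue (\<lambda>x. (norm (f x))\<^sup>2)"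
  proof (rule Bochner_Integration.integrable_bound[OF i])
    show "(\<lambda>x. (norm (f x))\<^sup>2) \<in> borel_measurable lebesgue" using assms(2) by measurable
  qed (use le in eventually_elim, auto)
  then show "L2 f" using assms(2) by (simp add: L2_def)
  assume c: "c \<ge> 0"
  have "(LINT x|lebesgue. (norm (f x))\<^sup>2) \<le> (LINT x|lebesgue. c\<^sup>2 * (norm (g x))\<^sup>2)"
    by (rule integral_mono_AE[OF fi i le])
  then have "(L2_norm f)\<^sup>2 \<le> (c * L2_norm g)\<^sup>2" by (simp add: L2_norm_power2 power_mult_distrib)
  then show "L2_norm f \<le> c * L2_norm g"
    by (rule power2_le_imp_le) (use c L2_norm_nonneg[of g] in auto)
qed

lemma L2_cong_AE:
  assumes "AE x in lebesgue. f x = g x" "L2 f" "g \<in> borel_measurable lebesgue"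
  shows "L2 g" "L2_norm g = L2_norm f"
proof -
  have 1: "AE x in lebesgue. norm (g x) \<le> 1 * norm (f x)" using assms(1) by eventually_elim simp
  show g: "L2 g" using L2_bound(1)[OF assms(2,3) 1] .
  have 2: "AE x in lebesgue. norm (f x) \<le> 1 * norm (g x)" using assms(1) by eventually_elim simp
  show "L2_norm g = L2_norm f"
    using L2_bound(2)[OF assms(2,3) 1] L2_bound(2)[OF g L2_D(1)[OF assms(2)] 2] by simp
qed

lemma L2_scaleR: "L2 f \<Longrightarrow> L2 (\<lambda>x. c *\<^sub>R f x)"
  by (rule L2_bound(1)[of f _ "\<bar>c\<bar>"]) (auto dest: L2_D)

lemma L2_cmult: "L2 (f :: real^'n \<Rightarrow> complex) \<Longrightarrow> L2 (\<lambda>x. c * f x)"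
  by (rule L2_bound(1)[of f _ "norm c"]) (auto simp: norm_mult dest: L2_D)

lemma L2_norm_scaleR: "L2_norm (\<lambda>x. c *\<^sub>R f x) = \<bar>c\<bar> * L2_norm f"
  by (simp add: L2_norm_def power_mult_distrib real_sqrt_mult)

lemma L2_norm_cmult: "L2_norm (\<lambda>x. c * f x) = norm c * L2_norm (f :: real^'n \<Rightarrow> complex)"
  by (simp add: L2_norm_def norm_mult power_mult_distrib real_sqrt_mult)

lemma L2_norm_minus: "L2_norm (\<lambda>x. - f x) = L2_norm f"
  by (simp add: L2_norm_def)

lemma L2_norm_minus_commute: "L2_norm (\<lambda>x. f x - g x) = L2_norm (\<lambda>x. g x - f x)"
  by (simp add: L2_norm_def norm_minus_commute)

text \<open>The optimal \<open>s\<close> is \<open>b / a\<close>; approaching \<open>a\<close> and \<open>b\<close> from above avoids the case \<open>a = 0\<close>.\<close>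

lemma product_le_of_young:
  fixes x a b :: real
  assumes "a \<ge> 0" "b \<ge> 0" "\<And>s. s > 0 \<Longrightarrow> 2 * x \<le> s * a\<^sup>2 + b\<^sup>2 / s"
  shows "x \<le> a * b"
proof -
  have e: "x \<le> (a + e) * (b + e)" if e: "e > 0" for e
  proof -
    define s where "s = (b + e) / (a + e)"
    have s: "s > 0" using assms e by (simp add: s_def)
    have "s * a\<^sup>2 \<le> s * (a + e)\<^sup>2" using assms e s by (intro mult_left_mono power_mono) auto
    also have "\<dots> = (a + e) * (b + e)" using assms(1) e by (simp add: s_def power2_eq_square)
    finally have 1: "s * a\<^sup>2 \<le> (a + e) * (b + e)" .
    have "b\<^sup>2 / s \<le> (b + e)\<^sup>2 / s" using assms e s by (intro divide_right_mono power_mono) auto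
    also have "\<dots> = (a + e) * (b + e)" using assms(1,2) e by (simp add: s_def power2_eq_square)
    finally show ?thesis using 1 assms(3)[OF s] by linarith
  qed
  have "((\<lambda>e. (a + e) * (b + e)) \<longlongrightarrow> (a + 0) * (b + 0)) (at_right 0)"
    by (intro tendsto_intros)
  then have "x \<le> (a + 0) * (b + 0)"
    by (rule tendsto_lowerbound) (auto simp: eventually_at_filter e)
  then show ?thesis by simp
qed

text \<open>Integrating \<open>2 x y \<le> s x\<^sup>2 + y\<^sup>2 / s\<close> and optimising over \<open>s\<close> gives the Cauchy--Schwarz inequality for
  the norms, also when \<open>f\<close> and \<open>g\<close> take values in different spaces.\<close>

lemma L2_mult_integrable:
  assumes "L2 f" "L2 g"
  shows "integrable lebesgue (\<lambda>x. norm (f x) * norm (g x))"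
    and "(LINT x|lebesgue. norm (f x) * norm (g x)) \<le> L2_norm f * L2_norm g"
proof -
  have [measurable]: "f \<in> borel_measurable lebesgue" "g \<in> borel_measurable lebesgue" using assms by (auto dest: L2_D)
  have y: "2 * (norm (f x) * norm (g x)) \<le> s * (norm (f x))\<^sup>2 + (norm (g x))\<^sup>2 / s" if "s > 0" for s x
  proof -
    have "2 * (sqrt s * norm (f x)) * (norm (g x) / sqrt s) \<le> (sqrt s * norm (f x))\<^sup>2 + (norm (g x) / sqrt s)\<^sup>2"
      by (rule sum_squares_bound)
    then show ?thesis using that by (simp add: power_mult_distrib power_divide)
  qed
  have i: "integrable lebesgue (\<lambda>x. s * (norm (f x))\<^sup>2 + (norm (g x))\<^sup>2 / s)" for s
    using L2_D(2)[OF assms(1)] L2_D(2)[OF assms(2)] by auto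
  show fg: "integrable lebesgue (\<lambda>x. norm (f x) * norm (g x))"
  proof (rule Bochner_Integration.integrable_bound[OF i[of 1]])
    show "AE x in lebesgue. norm (norm (f x) * norm (g x)) \<le> norm (1 * (norm (f x))\<^sup>2 + (norm (g x))\<^sup>2 / 1)"
    proof (rule AE_I2)
      fix x show "norm (norm (f x) * norm (g x)) \<le> norm (1 * (norm (f x))\<^sup>2 + (norm (g x))\<^sup>2 / 1)"
      proof -
        have "norm (f x) * norm (g x) \<le> (norm (f x))\<^sup>2 + (norm (g x))\<^sup>2"
          using y[of 1 x] mult_nonneg_nonneg[OF norm_ge_zero[of "f x"] norm_ge_zero[of "g x"]] by linarith
        then show ?thesis by simp
      qed
    qed
  qed measurable
  show "(LINT x|lebesgue. norm (f x) * norm (g x)) \<le> L2_norm f * L2_norm g"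
  proof (rule product_le_of_young[OF L2_norm_nonneg L2_norm_nonneg])
    fix s :: real assume s: "s > 0"
    have "2 * (LINT x|lebesgue. norm (f x) * norm (g x)) = (LINT x|lebesgue. 2 * (norm (f x) * norm (g x)))" by simp
    also have "\<dots> \<le> (LINT x|lebesgue. s * (norm (f x))\<^sup>2 + (norm (g x))\<^sup>2 / s)"
      using fg i[of s] y[OF s] by (intro integral_mono) auto
    also have "\<dots> = s * (L2_norm f)\<^sup>2 + (L2_norm g)\<^sup>2 / s"
      using L2_D(2)[OF assms(1)] L2_D(2)[OF assms(2)] by (simp add: L2_norm_power2)
    finally show "2 * (LINT x|lebesgue. norm (f x) * norm (g x)) \<le> s * (L2_norm f)\<^sup>2 + (L2_norm g)\<^sup>2 / s" .
  qed
qed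

lemma cauchy_schwarz_L2:
  fixes f g :: "real^'n \<Rightarrow> complex"
  assumes "L2 f" "L2 g"
  shows "integrable lebesgue (\<lambda>x. f x * g x)"
    and "norm (LINT x|lebesgue. f x * g x) \<le> L2_norm f * L2_norm g"
proof -
  have [measurable]: "f \<in> borel_measurable lebesgue" "g \<in> borel_measurable lebesgue" using assms by (auto dest: L2_D)
  show "integrable lebesgue (\<lambda>x. f x * g x)"
    by (rule Bochner_Integration.integrable_bound[OF L2_mult_integrable(1)[OF assms]]) (auto simp: norm_mult)
  have "norm (LINT x|lebesgue. f x * g x) \<le> (LINT x|lebesgue. norm (f x * g x))" by (rule integral_norm_bound)
  also have "\<dots> \<le> L2_norm f * L2_norm g" using L2_mult_integrable(2)[OF assms] by (simp add: norm_mult)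
  finally show "norm (LINT x|lebesgue. f x * g x) \<le> L2_norm f * L2_norm g" .
qed

lemma L2_add:
  assumes "L2 f" "L2 g"
  shows "L2 (\<lambda>x. f x + g x)" and "L2_norm (\<lambda>x. f x + g x) \<le> L2_norm f + L2_norm g"
proof -
  have [measurable]: "f \<in> borel_measurable lebesgue" "g \<in> borel_measurable lebesgue" using assms by (auto dest: L2_D)
  note fg = L2_mult_integrable[OF assms]
  have i: "integrable lebesgue (\<lambda>x. (norm (f x))\<^sup>2 + 2 * (norm (f x) * norm (g x)) + (norm (g x))\<^sup>2)"
    using fg(1) L2_D(2)[OF assms(1)] L2_D(2)[OF assms(2)] by auto
  have le: "(norm (f x + g x))\<^sup>2 \<le> (norm (f x))\<^sup>2 + 2 * (norm (f x) * norm (g x)) + (norm (g x))\<^sup>2" for x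
  proof -
    have "(norm (f x + g x))\<^sup>2 \<le> (norm (f x) + norm (g x))\<^sup>2"
      by (intro power_mono norm_triangle_ineq) auto
    then show ?thesis by (simp add: power2_sum)
  qed
  have "integrable lebesgue (\<lambda>x. (norm (f x + g x))\<^sup>2)"
    by (rule Bochner_Integration.integrable_bound[OF i]) (use le in \<open>auto intro!: AE_I2 order_trans[OF le]\<close>)
  then show s: "L2 (\<lambda>x. f x + g x)" by (simp add: L2_def)
  have "(L2_norm (\<lambda>x. f x + g x))\<^sup>2 \<le> (LINT x|lebesgue. (norm (f x))\<^sup>2 + 2 * (norm (f x) * norm (g x)) + (norm (g x))\<^sup>2)"
    unfolding L2_norm_power2 using L2_D(2)[OF s] i le by (intro integral_mono) auto
  also have "\<dots> = (L2_norm f)\<^sup>2 + 2 * (LINT x|lebesgue. norm (f x) * norm (g x)) + (L2_norm g)\<^sup>2"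
    using fg(1) L2_D(2)[OF assms(1)] L2_D(2)[OF assms(2)] by (simp add: L2_norm_power2)
  also have "\<dots> \<le> (L2_norm f + L2_norm g)\<^sup>2" using fg(2) by (simp add: power2_sum)
  finally show "L2_norm (\<lambda>x. f x + g x) \<le> L2_norm f + L2_norm g"
    by (rule power2_le_imp_le) (simp add: L2_norm_nonneg)
qed

lemma L2_diff:
  assumes "L2 f" "L2 g"
  shows "L2 (\<lambda>x. f x - g x)" and "L2_norm (\<lambda>x. f x - g x) \<le> L2_norm f + L2_norm g"
  using L2_add[OF assms(1) L2_scaleR[OF assms(2), of "-1"]] L2_norm_minus[of g] by auto

lemma L2_norm_triangle:
  assumes "L2 f" "L2 g" "L2 h"
  shows "L2_norm (\<lambda>x. f x - h x) \<le> L2_norm (\<lambda>x. f x - g x) + L2_norm (\<lambda>x. g x - h x)"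
  using L2_add(2)[OF L2_diff(1)[OF assms(1,2)] L2_diff(1)[OF assms(2,3)]] by simp

lemma L2_norm_le_add_diff:
  assumes "L2 f" "L2 g"
  shows "L2_norm f \<le> L2_norm g + L2_norm (\<lambda>x. f x - g x)"
  using L2_add(2)[OF assms(2) L2_diff(1)[OF assms]] by simp

lemma L2_norm_reverse_triangle:
  assumes "L2 f" "L2 g"
  shows "\<bar>L2_norm f - L2_norm g\<bar> \<le> L2_norm (\<lambda>x. f x - g x)"
  using L2_norm_le_add_diff[OF assms] L2_norm_le_add_diff[OF assms(2,1)] L2_norm_minus_commute[of f g] by auto

lemma tendsto_L2_norm:
  assumes "\<forall>\<^sub>F i in F. L2 (f i)" "L2 g" "((\<lambda>i. L2_norm (\<lambda>x. f i x - g x)) \<longlongrightarrow> 0) F"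
  shows "((\<lambda>i. L2_norm (f i)) \<longlongrightarrow> L2_norm g) F"
proof -
  have "((\<lambda>i. L2_norm (f i) - L2_norm g) \<longlongrightarrow> 0) F"
    by (rule Lim_null_comparison[OF _ assms(3)])
       (use assms(1) in eventually_elim, use assms(2) in \<open>auto intro: L2_norm_reverse_triangle\<close>)
  then show ?thesis by (simp add: LIM_zero_iff)
qed

lemma L2_dominated_convergence:
  fixes f :: "real^'n \<Rightarrow> 'b::euclidean_space" and h :: "real^'n \<Rightarrow> 'c::euclidean_space"
  assumes "\<And>i. s i \<in> borel_measurable lebesgue" "L2 h"
    and le: "\<And>i x. norm (s i x) \<le> norm (h x)" and lim: "\<And>x. (\<lambda>i. s i x) \<longlonglongrightarrow> f x"
  shows "L2 f" "(\<lambda>i. L2_norm (\<lambda>x. s i x - f x)) \<longlonglongrightarrow> 0"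
proof -
  have [measurable]: "s i \<in> borel_measurable lebesgue" for i by (rule assms(1))
  have f[measurable]: "f \<in> borel_measurable lebesgue"
    by (rule borel_measurable_LIMSEQ_metric[OF assms(1) lim])
  have fh: "norm (f x) \<le> norm (h x)" for x
    by (rule tendsto_upperbound[OF tendsto_norm[OF lim]]) (auto simp: le)
  show "L2 f" by (rule L2_bound(1)[OF assms(2) f, of 1]) (auto simp: fh)
  have "(\<lambda>i. LINT x|lebesgue. (norm (s i x - f x))\<^sup>2) \<longlonglongrightarrow> (LINT x|(lebesgue :: (real^'n) measure). (0::real))"
  proof (rule integral_dominated_convergence[where w="\<lambda>x. 4 * (norm (h x))\<^sup>2" and
        s="\<lambda>i x. (norm (s i x - f x))\<^sup>2" and f="\<lambda>x. 0::real"])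
    show "integrable lebesgue (\<lambda>x. 4 * (norm (h x))\<^sup>2)" using L2_D(2)[OF assms(2)] by simp
    show "(\<lambda>x. (norm (s i x - f x))\<^sup>2) \<in> borel_measurable lebesgue" for i
      by measurable
    show "AE x in lebesgue. (\<lambda>i. (norm (s i x - f x))\<^sup>2) \<longlonglongrightarrow> 0"
    proof (rule AE_I2)
      fix x
      have "(\<lambda>i. (norm (s i x - f x))\<^sup>2) \<longlonglongrightarrow> (norm (f x - f x))\<^sup>2" by (intro tendsto_intros lim)
      then show "(\<lambda>i. (norm (s i x - f x))\<^sup>2) \<longlonglongrightarrow> 0" by simp
    qed
    show "AE x in lebesgue. norm ((norm (s i x - f x))\<^sup>2) \<le> 4 * (norm (h x))\<^sup>2" for i
    proof (rule AE_I2)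
      fix x
      have "norm (s i x - f x) \<le> 2 * norm (h x)"
        using norm_triangle_ineq4[of "s i x" "f x"] le[of i x] fh[of x] by linarith
      then have "(norm (s i x - f x))\<^sup>2 \<le> (2 * norm (h x))\<^sup>2" by (intro power_mono) auto
      then show "norm ((norm (s i x - f x))\<^sup>2) \<le> 4 * (norm (h x))\<^sup>2" by (simp add: power_mult_distrib)
    qed
  qed auto
  then have "(\<lambda>i. sqrt (LINT x|lebesgue. (norm (s i x - f x))\<^sup>2)) \<longlonglongrightarrow> sqrt 0"
    by (intro tendsto_real_sqrt) simp
  then show "(\<lambda>i. L2_norm (\<lambda>x. s i x - f x)) \<longlonglongrightarrow> 0" by (simp add: L2_norm_def)
qed

lemma L2_indicator:
  assumes "A \<in> sets lebesgue" "emeasure lebesgue A < \<infinity>"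
  shows "L2 (\<lambda>x. indicator A x *\<^sub>R (c::'b::euclidean_space))"
proof -
  have "(norm (indicator A x *\<^sub>R c))\<^sup>2 = indicator A x * (norm c)\<^sup>2" for x by (auto simp: indicator_def)
  moreover have "integrable lebesgue (\<lambda>x. indicator A x * (norm c)\<^sup>2)"
    using assms by (intro integrable_mult_left integrable_real_indicator)
  ultimately show ?thesis using assms unfolding L2_def by (auto intro!: borel_measurable_scaleR)
qed

lemma L2_bounded_support:
  fixes f :: "real^'n \<Rightarrow> 'b::euclidean_space"
  assumes "f \<in> borel_measurable lebesgue" "bounded S" "\<And>x. norm (f x) \<le> M" "\<And>x. x \<notin> S \<Longrightarrow> f x = 0"
  shows "L2 f"
proof -
  from assms(2) obtain R where "\<forall>x\<in>S. norm x \<le> R" unfolding bounded_iff ..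
  then have R: "S \<subseteq> cball 0 R" by auto
  have "L2 (\<lambda>x::real^'n. indicator (cball 0 R) x *\<^sub>R (1::real))"
    by (rule L2_indicator) (use emeasure_bounded_finite[OF bounded_cball, of "0::real^'n" R] in auto)
  then show ?thesis
  proof (rule L2_bound(1)[of _ _ M])
    show "AE x in lebesgue. norm (f x) \<le> M * norm (indicator (cball 0 R) x *\<^sub>R (1::real))"
    proof (rule AE_I2)
      fix x show "norm (f x) \<le> M * norm (indicator (cball 0 R) x *\<^sub>R (1::real))"
        using assms(3)[of x] assms(4)[of x] R by (cases "x \<in> S") (auto simp: indicator_def)
    qed
  qed (fact assms(1))
qed

lemma translation_lebesgue:
  shows "(\<lambda>x. x + h) \<in> lebesgue \<rightarrow>\<^sub>M (lebesgue :: (real^'n) measure)"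
    and "distr lebesgue lebesgue (\<lambda>x. x + h) = (lebesgue :: (real^'n) measure)"
proof -
  have T: "(\<lambda>x. h + (\<Sum>j\<in>Basis. (1 * (x \<bullet> j)) *\<^sub>R j)) = (\<lambda>x::real^'n. x + h)"
    by (simp add: euclidean_representation add.commute)
  show "(\<lambda>x. x + h) \<in> lebesgue \<rightarrow>\<^sub>M (lebesgue :: (real^'n) measure)"
    using lebesgue_affine_measurable[of "\<lambda>_. 1" h] unfolding T by simp
  show "distr lebesgue lebesgue (\<lambda>x. x + h) = (lebesgue :: (real^'n) measure)"
    using lebesgue_affine_euclidean[of "\<lambda>_. 1" h] unfolding T by (simp add: density_1)
qed

lemma integral_translation:
  fixes f :: "real^'n \<Rightarrow> 'b::{banach, second_countable_topology}"
  assumes "f \<in> borel_measurable lebesgue"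
  shows "(LINT x|lebesgue. f (x + h)) = (LINT x|lebesgue. f x)"
  using integral_distr[OF translation_lebesgue(1) assms, of h] unfolding translation_lebesgue(2) by simp

lemma L2_translation:
  assumes "L2 (f :: real^'n \<Rightarrow> 'b::euclidean_space)"
  shows "L2 (\<lambda>x. f (x + h))" "L2_norm (\<lambda>x. f (x + h)) = L2_norm f"
proof -
  have m: "(\<lambda>x. (norm (f x))\<^sup>2) \<in> borel_measurable lebesgue" using L2_D(1)[OF assms] by measurable
  have "integrable lebesgue (\<lambda>x. (norm (f (x + h)))\<^sup>2)"
    using integrable_distr[OF translation_lebesgue(1)[of h], of "\<lambda>x. (norm (f x))\<^sup>2"] L2_D(2)[OF assms]
    unfolding translation_lebesgue(2) .
  moreover have "(\<lambda>x. f (x + h)) \<in> borel_measurable lebesgue"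
    by (rule measurable_compose[OF translation_lebesgue(1) L2_D(1)[OF assms]])
  ultimately show "L2 (\<lambda>x. f (x + h))" by (simp add: L2_def)
  show "L2_norm (\<lambda>x. f (x + h)) = L2_norm f"
    using integral_translation[OF m, of h] by (simp add: L2_norm_def)
qed

text \<open>Needed because Fubini's theorem is applied to products of Borel functions.\<close>

lemma borel_representative:
  fixes f :: "real^'n \<Rightarrow> complex"
  assumes "f \<in> borel_measurable lebesgue"
  obtains g where "g \<in> borel_measurable borel" "AE x in lebesgue. f x = g x"
proof -
  have "(\<lambda>x. Re (f x)) \<in> borel_measurable lebesgue" "(\<lambda>x. Im (f x)) \<in> borel_measurable lebesgue"
    using assms by measurable
  from this[THEN completion_ex_borel_measurable_real] obtain g1 g2 where
    g: "g1 \<in> borel_measurable lborel" "AE x in lborel. Re (f x) = g1 x"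
       "g2 \<in> borel_measurable lborel" "AE x in lborel. Im (f x) = g2 x" by blast
  have "(\<lambda>x. Complex (g1 x) (g2 x)) = (\<lambda>x. of_real (g1 x) + \<i> * of_real (g2 x))"
    by (auto simp: complex_eq_iff)
  moreover have "(\<lambda>x. of_real (g1 x) + \<i> * of_real (g2 x)) \<in> borel_measurable borel"
    using g(1,3) by auto
  ultimately have "(\<lambda>x. Complex (g1 x) (g2 x)) \<in> borel_measurable borel" by simp
  moreover have "AE x in lborel. f x = Complex (g1 x) (g2 x)"
    using g(2,4) by eventually_elim (simp add: complex_eq_iff)
  ultimately show ?thesis using that AE_completion by blast
qed

section \<open>Test functions and their density\<close>

lemma has_derivative_partial:
  assumes "(f has_derivative f') (at x)"
  shows "partial_deriv i f x = f' (axis i 1)"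
  using frechet_derivative_at[OF assms] by (simp add: partial_deriv_def)

lemma C_space_Suc_D: "C_space (Suc k) f \<Longrightarrow> C_space k f"
proof (induction k arbitrary: f)
  case 0
  then show ?case by (auto simp: continuous_on_eq_continuous_at dest: differentiable_imp_continuous_within)
qed auto

lemma C_space_const: "C_space k (\<lambda>x. c)"
proof (induction k arbitrary: c)
  case (Suc k)
  have "partial_deriv i (\<lambda>x. c) = (\<lambda>x::real^'a. 0)" for i
    by (rule ext) (simp add: has_derivative_partial[OF has_derivative_const])
  then show ?case using Suc by simp
qed simp

lemma C_space_add: "C_space k f \<Longrightarrow> C_space k g \<Longrightarrow> C_space k (\<lambda>x. f x + g x)"
proof (induction k arbitrary: f g)
  case (Suc k)
  have "partial_deriv i (\<lambda>x. f x + g x) = (\<lambda>x. partial_deriv i f x + partial_deriv i g x)" for i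
  proof (rule ext)
    fix x
    have "(f has_derivative frechet_derivative f (at x)) (at x)" "(g has_derivative frechet_derivative g (at x)) (at x)"
      using Suc.prems by (auto simp: frechet_derivative_works)
    from has_derivative_partial[OF has_derivative_add[OF this]]
    show "partial_deriv i (\<lambda>x. f x + g x) x = partial_deriv i f x + partial_deriv i g x"
      by (simp add: partial_deriv_def)
  qed
  then show ?case using Suc by simp
qed (auto intro: continuous_on_add)

lemma C_space_mult: "C_space k f \<Longrightarrow> C_space k g \<Longrightarrow> C_space k (\<lambda>x. f x * g x)"
proof (induction k arbitrary: f g)
  case (Suc k)
  have "partial_deriv i (\<lambda>x. f x * g x) = (\<lambda>x. f x * partial_deriv i g x + partial_deriv i f x * g x)" for i
  proof (rule ext)
    fix x
    have "(f has_derivative frechet_derivative f (at x)) (at x)" "(g has_derivative frechet_derivative g (at x)) (at x)"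
      using Suc.prems by (auto simp: frechet_derivative_works)
    from has_derivative_partial[OF has_derivative_mult[OF this]]
    show "partial_deriv i (\<lambda>x. f x * g x) x = f x * partial_deriv i g x + partial_deriv i f x * g x"
      by (simp add: partial_deriv_def)
  qed
  moreover have "C_space k (\<lambda>x. f x * partial_deriv i g x + partial_deriv i f x * g x)" for i
    using Suc.prems C_space_Suc_D[OF Suc.prems(1)] C_space_Suc_D[OF Suc.prems(2)]
    by (intro C_space_add Suc.IH) auto
  ultimately show ?case using Suc.prems by auto
qed (auto intro: continuous_on_mult)

lemma C_space_prod: "finite A \<Longrightarrow> (\<And>i. i \<in> A \<Longrightarrow> C_space k (f i)) \<Longrightarrow> C_space k (\<lambda>x. \<Prod>i\<in>A. f i x)"
  by (induction A rule: finite_induct) (auto intro: C_space_const C_space_mult)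

lemma partial_deriv_translation:
  assumes "\<And>x. f differentiable (at x)"
  shows "partial_deriv i (\<lambda>x. f (x + h)) = (\<lambda>x. partial_deriv i f (x + h))"
proof (rule ext)
  fix x
  have "(f has_derivative frechet_derivative f (at (x + h))) (at (x + h))"
    using assms by (simp add: frechet_derivative_works)
  then have "((\<lambda>x. f (x + h)) has_derivative (\<lambda>y. frechet_derivative f (at (x + h)) y)) (at x)"
    by (intro has_derivative_compose[of "\<lambda>x. x + h" "\<lambda>y. y" x UNIV f]) (auto intro!: derivative_eq_intros)
  from has_derivative_partial[OF this] show "partial_deriv i (\<lambda>x. f (x + h)) x = partial_deriv i f (x + h)"
    by (simp add: partial_deriv_def)
qed

lemma C_space_translation: "C_space k f \<Longrightarrow> C_space k (\<lambda>x. f (x + h))"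
proof (induction k arbitrary: f)
  case 0
  then show ?case by (auto intro!: continuous_on_compose2[of UNIV f] continuous_intros)
next
  case (Suc k)
  have "(\<lambda>x. f (x + h)) differentiable (at x)" for x
    using Suc.prems by (intro differentiable_compose[of f "\<lambda>x. x + h"]) auto
  then show ?case using Suc partial_deriv_translation[of f _ h] by simp
qed

primrec smooth1 :: "nat \<Rightarrow> (real \<Rightarrow> real) \<Rightarrow> bool" where
  "smooth1 0 f \<longleftrightarrow> continuous_on UNIV f"
| "smooth1 (Suc k) f \<longleftrightarrow> (\<exists>f'. (\<forall>x. (f has_real_derivative f' x) (at x)) \<and> smooth1 k f')"

text \<open>Composition with an affine function of one coordinate is all that the construction of test functions by
  products needs.\<close>

lemma C_space_coordinate:
  assumes "smooth1 k f"
  shows "C_space k (\<lambda>x::real^'n. f (a * x $ i + c))"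
  using assms
proof (induction k arbitrary: f)
  case 0
  then show ?case by (auto intro!: continuous_on_compose2[of UNIV f] continuous_intros)
next
  case (Suc k)
  then obtain f' where f': "\<And>x. (f has_real_derivative f' x) (at x)" "smooth1 k f'" by auto
  have d: "((\<lambda>x::real^'n. f (a * x $ i + c)) has_derivative (\<lambda>y. f' (a * x $ i + c) * (a * y $ i))) (at x)" for x
  proof -
    have "((\<lambda>x::real^'n. a * x $ i + c) has_derivative (\<lambda>y. a * y $ i)) (at x)"
      by (auto intro!: derivative_eq_intros bounded_linear_imp_has_derivative[OF bounded_linear_vec_nth])
    moreover have "(f has_derivative (\<lambda>y. f' (a * x $ i + c) * y)) (at (a * x $ i + c))"
      using f'(1)[of "a * x $ i + c"] by (simp add: has_field_derivative_def)
    ultimately show ?thesis by (rule has_derivative_compose)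
  qed
  have "partial_deriv j (\<lambda>x::real^'n. f (a * x $ i + c)) = (\<lambda>x. f' (a * x $ i + c) * (a * axis j 1 $ i))" for j
    by (rule ext) (rule has_derivative_partial[OF d])
  moreover have "C_space k (\<lambda>x::real^'n. f' (a * x $ i + c) * (a * axis j 1 $ i))" for j
    by (intro C_space_mult C_space_const Suc.IH f')
  ultimately show ?case using d by (auto simp: differentiable_def)
qed

text \<open>The functions \<open>p (1 / y) exp (- 1 / y)\<close>, extended by 0 to the left of 0. This family is closed under
  differentiation, which makes its members smooth by a plain induction.\<close>

definition flat :: "real poly \<Rightarrow> real \<Rightarrow> real" where
  "flat p y = (if y > 0 then poly p (1 / y) * exp (- (1 / y)) else 0)"

lemma flat_tendsto_0: "(flat p \<longlongrightarrow> 0) (at_right 0)"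
proof -
  have "((\<lambda>x. poly p x * exp (- x)) \<longlongrightarrow> (\<Sum>i\<le>degree p. coeff p i * 0)) at_top"
  proof -
    have "(\<lambda>x. poly p x * exp (- x)) = (\<lambda>x. \<Sum>i\<le>degree p. coeff p i * (x ^ i / exp x))"
      by (auto simp: poly_altdef sum_distrib_right exp_minus divide_inverse mult.assoc)
    then show ?thesis by (simp only:) (intro tendsto_intros tendsto_power_div_exp_0)
  qed
  then have "((\<lambda>x. poly p x * exp (- x)) \<longlongrightarrow> 0) at_top" by simp
  from filterlim_compose[OF this filterlim_inverse_at_top_right]
  have "((\<lambda>y. poly p (inverse y) * exp (- inverse y)) \<longlongrightarrow> 0) (at_right 0)" .
  then show ?thesis
    by (rule Lim_transform_eventually) (auto simp: flat_def eventually_at_filter inverse_eq_divide)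
qed

lemma flat_deriv: "(flat p has_real_derivative flat ((p - pderiv p) * [:0, 0, 1:]) y) (at y)"
proof -
  consider "y > 0" | "y < 0" | "y = 0" by linarith
  then show ?thesis
  proof cases
    case 1
    have "((\<lambda>y. poly p (1 / y) * exp (- (1 / y))) has_real_derivative
        (poly (pderiv p) (1 / y) * (- 1 / y\<^sup>2)) * exp (- (1 / y)) + (exp (- (1 / y)) * (1 / y\<^sup>2)) * poly p (1 / y)) (at y)"
      using 1 by (auto intro!: derivative_eq_intros DERIV_chain2[OF poly_DERIV] simp: power2_eq_square)
    moreover have "(poly (pderiv p) (1 / y) * (- 1 / y\<^sup>2)) * exp (- (1 / y)) + (exp (- (1 / y)) * (1 / y\<^sup>2)) * poly p (1 / y)
       = flat ((p - pderiv p) * [:0, 0, 1:]) y"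
      using 1 by (simp add: flat_def field_simps power2_eq_square)
    ultimately have "((\<lambda>y. poly p (1 / y) * exp (- (1 / y))) has_real_derivative flat ((p - pderiv p) * [:0, 0, 1:]) y) (at y)" by simp
    then show ?thesis
      by (rule has_field_derivative_transform_within_open[of _ _ _ "{0<..}"]) (use 1 in \<open>auto simp: flat_def\<close>)
  next
    case 2
    have "((\<lambda>y. 0) has_real_derivative 0) (at y)" by simp
    then have "(flat p has_real_derivative 0) (at y)"
      by (rule has_field_derivative_transform_within_open[of _ _ _ "{..<0}"]) (use 2 in \<open>auto simp: flat_def\<close>)
    then show ?thesis using 2 by (simp add: flat_def)
  next
    case 3
    have "((\<lambda>h. (flat p h - flat p 0) / (h - 0)) \<longlongrightarrow> 0) (at_right 0)"
      by (rule Lim_transform_eventually[OF flat_tendsto_0[of "p * [:0, 1:]"]])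
         (auto simp: flat_def eventually_at_filter field_simps)
    moreover have "((\<lambda>h. (flat p h - flat p 0) / (h - 0)) \<longlongrightarrow> 0) (at_left 0)"
      by (rule Lim_transform_eventually[OF tendsto_const]) (auto simp: flat_def eventually_at_filter)
    ultimately have "((\<lambda>h. (flat p h - flat p 0) / (h - 0)) \<longlongrightarrow> 0) (at 0)"
      by (simp add: filterlim_split_at_real)
    then show ?thesis using 3 by (simp add: has_field_derivative_iff flat_def)
  qed
qed

lemma smooth1_flat: "smooth1 k (flat p)"
proof (induction k arbitrary: p)
  case 0
  then show ?case using flat_deriv[of p] by (auto simp: continuous_on_eq_continuous_at intro!: DERIV_isCont)
next
  case (Suc k)
  then show ?case using flat_deriv[of p] by auto
qed

text \<open>A smooth function that is positive exactly on the box. For \<open>n \<rightarrow> \<infinity>\<close> the values inside increase to 1,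
  since \<open>exp (- 1 / y)\<close> tends to 1.\<close>

definition box_bump :: "real \<Rightarrow> real^'n \<Rightarrow> real^'n \<Rightarrow> real^'n \<Rightarrow> real" where
  "box_bump n a b x = (\<Prod>i\<in>UNIV. flat 1 (n * x $ i + - n * a $ i) * flat 1 (- n * x $ i + n * b $ i))"

lemma flat1_bounds: "0 \<le> flat 1 y" "flat 1 y \<le> 1" by (auto simp: flat_def)

lemma box_bump_bounds: "0 \<le> box_bump n a b x" "box_bump n a b x \<le> 1"
  using flat1_bounds by (auto simp: box_bump_def intro!: prod_nonneg prod_le_1 mult_le_one)

lemma box_bump_0: assumes "n \<ge> 0" "x \<notin> box a b" shows "box_bump n a b x = 0"
proof -
  obtain i where "\<not> (a $ i < x $ i \<and> x $ i < b $ i)" using assms(2) by (auto simp: mem_box_cart)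
  then have "n * x $ i + - n * a $ i \<le> 0 \<or> - n * x $ i + n * b $ i \<le> 0"
    using assms(1) mult_left_mono[of "x $ i" "a $ i" n] mult_left_mono[of "b $ i" "x $ i" n] by auto
  then have "flat 1 (n * x $ i + - n * a $ i) * flat 1 (- n * x $ i + n * b $ i) = 0"
    by (auto simp: flat_def)
  then show ?thesis unfolding box_bump_def by (intro prod_zero) auto
qed

lemma box_bump_tendsto: "(\<lambda>n. box_bump (real n) a b x) \<longlonglongrightarrow> indicator (box a b) x"
proof (cases "x \<in> box a b")
  case True
  have fl: "(flat 1 \<longlongrightarrow> 1) at_top"
  proof -
    have "((\<lambda>y::real. exp (- (1 / y))) \<longlongrightarrow> exp (- 0)) at_top"
      by (intro tendsto_intros tendsto_divide_0[OF tendsto_const] filterlim_at_top_imp_at_infinity filterlim_ident)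
    then have l: "((\<lambda>y::real. exp (- (1 / y))) \<longlongrightarrow> 1) at_top" by simp
    have "\<forall>\<^sub>F y::real in at_top. exp (- (1 / y)) = flat 1 y"
      using eventually_gt_at_top[of "0::real"] by eventually_elim (simp add: flat_def)
    with l show ?thesis by (rule Lim_transform_eventually)
  qed
  have lin: "filterlim (\<lambda>n. real n * d) at_top sequentially" if "d > 0" for d
    unfolding mult.commute[of _ d]
    by (rule filterlim_tendsto_pos_mult_at_top[OF tendsto_const that filterlim_real_sequentially])
  have "(\<lambda>n. flat 1 (real n * x $ i + - real n * a $ i) * flat 1 (- real n * x $ i + real n * b $ i)) \<longlonglongrightarrow> 1 * 1" for i
  proof (intro tendsto_mult filterlim_compose[OF fl])
    have "filterlim (\<lambda>n. real n * (x $ i - a $ i)) at_top sequentially" using True by (intro lin) (auto simp: mem_box_cart)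
    then show "filterlim (\<lambda>n. real n * x $ i + - real n * a $ i) at_top sequentially" by (simp add: algebra_simps)
    have "filterlim (\<lambda>n. real n * (b $ i - x $ i)) at_top sequentially" using True by (intro lin) (auto simp: mem_box_cart)
    then show "filterlim (\<lambda>n. - real n * x $ i + real n * b $ i) at_top sequentially" by (simp add: algebra_simps)
  qed
  then have "(\<lambda>n. box_bump (real n) a b x) \<longlonglongrightarrow> (\<Prod>i\<in>(UNIV::'a set). 1 * 1)"
    unfolding box_bump_def by (intro tendsto_prod)
  then show ?thesis using True by simp
next
  case False
  then show ?thesis by (simp add: box_bump_0)
qed

lemma test_function_box_bump: "n \<ge> 0 \<Longrightarrow> test_function (box_bump n a b)"
proof -
  assume n: "n \<ge> 0"
  have "C_space k (box_bump n a b)" for k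
  proof -
    have "C_space k (\<lambda>x. \<Prod>i\<in>UNIV. flat 1 (n * x $ i + - n * a $ i) * flat 1 (- n * x $ i + n * b $ i))"
      by (intro C_space_prod C_space_mult C_space_coordinate smooth1_flat) auto
    then show ?thesis by (simp add: box_bump_def[abs_def])
  qed
  moreover have "bounded {x. box_bump n a b x \<noteq> 0}"
    by (rule bounded_subset[OF bounded_box[of a b]]) (use box_bump_0[OF n] in blast)
  ultimately show ?thesis by (simp add: test_function_def compact_closure)
qed

lemma test_function_add:
  assumes "test_function f" "test_function g" shows "test_function (\<lambda>x. f x + g x)"
proof -
  have "bounded ({x. f x \<noteq> 0} \<union> {x. g x \<noteq> 0})" using assms by (simp add: test_function_def compact_closure)
  then have "bounded {x. f x + g x \<noteq> 0}" by (rule bounded_subset) auto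
  then show ?thesis using assms by (auto simp: test_function_def compact_closure intro: C_space_add)
qed

lemma test_function_cmult:
  assumes "test_function f" shows "test_function (\<lambda>x. c * f x)"
proof -
  have "bounded {x. f x \<noteq> 0}" using assms by (simp add: test_function_def compact_closure)
  then have "bounded {x. c * f x \<noteq> 0}" by (rule bounded_subset) auto
  then show ?thesis using assms by (auto simp: test_function_def compact_closure intro: C_space_mult C_space_const)
qed

lemma test_function_translation:
  assumes "test_function f" shows "test_function (\<lambda>x. f (x + h))"
proof -
  have "bounded {x. f x \<noteq> 0}" using assms by (simp add: test_function_def compact_closure)
  then have "bounded ((\<lambda>x. x - h) ` {x. f x \<noteq> 0})" by (rule bounded_translation_minus)
  moreover have "{x. f (x + h) \<noteq> 0} \<subseteq> (\<lambda>x. x - h) ` {x. f x \<noteq> 0}"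
  proof
    fix x assume "x \<in> {x. f (x + h) \<noteq> 0}"
    then show "x \<in> (\<lambda>x. x - h) ` {x. f x \<noteq> 0}" by (intro image_eqI[of _ _ "x + h"]) auto
  qed
  ultimately have "bounded {x. f (x + h) \<noteq> 0}" by (rule bounded_subset)
  then show ?thesis using assms by (auto simp: test_function_def compact_closure intro: C_space_translation)
qed

lemma test_function_D:
  assumes "test_function f"
  shows "continuous_on UNIV f" "f differentiable (at x)" "bounded {x. f x \<noteq> 0}" "test_function (partial_deriv i f)"
proof -
  have C: "C_space k f" for k using assms by (simp add: test_function_def)
  show "continuous_on UNIV f" using C[of 0] by simp
  show "f differentiable (at x)" using C[of 1] by simp
  show b: "bounded {x. f x \<noteq> 0}" using assms by (simp add: test_function_def compact_closure)
  have "C_space k (partial_deriv i f)" for k using C[of "Suc k"] by simp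
  moreover have "bounded {x. partial_deriv i f x \<noteq> 0}"
  proof (rule bounded_subset[OF bounded_closure[OF b]])
    show "{x. partial_deriv i f x \<noteq> 0} \<subseteq> closure {x. f x \<noteq> 0}"
    proof
      fix x assume x: "x \<in> {x. partial_deriv i f x \<noteq> 0}"
      show "x \<in> closure {x. f x \<noteq> 0}"
      proof (rule ccontr)
        assume nx: "x \<notin> closure {x. f x \<noteq> 0}"
        have "((\<lambda>x. 0) has_derivative (\<lambda>x. 0)) (at x)" by simp
        then have "(f has_derivative (\<lambda>x. 0)) (at x)"
          by (rule has_derivative_transform_within_open[of _ _ _ _ "- closure {x. f x \<noteq> 0}"])
             (use nx closure_subset[of "{x. f x \<noteq> 0}"] in auto)
        from has_derivative_partial[OF this] show False using x by simp
      qed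
    qed
  qed
  ultimately show "test_function (partial_deriv i f)" by (simp add: test_function_def compact_closure)
qed

lemma test_function_bounded:
  assumes "test_function (f :: real^'n \<Rightarrow> real)"
  obtains M where "M \<ge> 0" "\<And>x. \<bar>f x\<bar> \<le> M"
proof -
  have "compact (f ` closure {x. f x \<noteq> 0})"
    using assms by (intro compact_continuous_image continuous_on_subset[OF test_function_D(1)]) (auto simp: test_function_def)
  then have "bounded (f ` closure {x. f x \<noteq> 0})" by (rule compact_imp_bounded)
  then obtain M where M: "\<forall>y\<in>f ` closure {x. f x \<noteq> 0}. norm y \<le> M" unfolding bounded_iff ..
  have "\<bar>f x\<bar> \<le> max M 0" for x
  proof (cases "f x = 0")
    case False
    then have "x \<in> closure {x. f x \<noteq> 0}" using closure_subset[of "{x. f x \<noteq> 0}"] by auto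
    then show ?thesis using M by force
  qed auto
  then show ?thesis using that[of "max M 0"] by auto
qed

lemma L2_test_function:
  assumes "test_function (f :: real^'n \<Rightarrow> real)" shows "L2 f"
proof -
  obtain M where M: "\<And>x. \<bar>f x\<bar> \<le> M" using test_function_bounded[OF assms] by metis
  have "f \<in> borel_measurable lebesgue"
    using borel_measurable_continuous_onI[OF test_function_D(1)[OF assms]] by (simp add: measurable_completion)
  then show ?thesis
    by (rule L2_bounded_support[OF _ test_function_D(3)[OF assms], where M = M]) (use M in auto)
qed

definition ctest :: "(real^'n \<Rightarrow> complex) \<Rightarrow> bool" where
  "ctest \<phi> \<longleftrightarrow> test_function (\<lambda>x. Re (\<phi> x)) \<and> test_function (\<lambda>x. Im (\<phi> x))"

lemma ctest_of_real: "test_function f \<Longrightarrow> ctest (\<lambda>x. of_real (f x))"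
  using test_function_cmult[of f 0] by (simp add: ctest_def)

lemma ctest_add: "ctest f \<Longrightarrow> ctest g \<Longrightarrow> ctest (\<lambda>x. f x + g x)"
  by (auto simp: ctest_def intro: test_function_add)

lemma ctest_cmult: "ctest f \<Longrightarrow> ctest (\<lambda>x. c * f x)"
  using test_function_add[OF test_function_cmult[of "\<lambda>x. Re (f x)" "Re c"] test_function_cmult[of "\<lambda>x. Im (f x)" "- Im c"]]
    test_function_add[OF test_function_cmult[of "\<lambda>x. Im (f x)" "Re c"] test_function_cmult[of "\<lambda>x. Re (f x)" "Im c"]]
  by (simp add: ctest_def)

lemma ctest_translation: "ctest f \<Longrightarrow> ctest (\<lambda>x. f (x + h))"
  by (auto simp: ctest_def dest: test_function_translation)

lemma L2_ctest: assumes "ctest f" shows "L2 f"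
proof -
  have 1: "L2 (\<lambda>x. Re (f x))" "L2 (\<lambda>x. Im (f x))" using assms by (auto simp: ctest_def intro: L2_test_function)
  have m: "(\<lambda>x. complex_of_real (Re (f x))) \<in> borel_measurable lebesgue" "(\<lambda>x. complex_of_real (Im (f x))) \<in> borel_measurable lebesgue"
    using L2_D(1)[OF 1(1)] L2_D(1)[OF 1(2)] by measurable
  have "L2 (\<lambda>x. complex_of_real (Re (f x)))" by (rule L2_bound(1)[OF 1(1) m(1), of 1]) simp
  moreover have "L2 (\<lambda>x. complex_of_real (Im (f x)))" by (rule L2_bound(1)[OF 1(2) m(2), of 1]) simp
  ultimately have "L2 (\<lambda>x. complex_of_real (Re (f x)) + \<i> * complex_of_real (Im (f x)))"
    by (intro L2_add(1) L2_cmult)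
  then show ?thesis by (simp add: complex_eq[symmetric])
qed

text \<open>The closure of the test functions in \<open>L\<^sup>2\<close>.\<close>

definition test_closure :: "(real^'n \<Rightarrow> complex) \<Rightarrow> bool" where
  "test_closure f \<longleftrightarrow> L2 f \<and> (\<forall>e>0. \<exists>\<phi>. ctest \<phi> \<and> L2_norm (\<lambda>x. f x - \<phi> x) < e)"

lemma test_closure_add:
  assumes "test_closure f" "test_closure g" shows "test_closure (\<lambda>x. f x + g x)"
  unfolding test_closure_def
proof (intro conjI allI impI)
  have fg: "L2 f" "L2 g" using assms by (auto simp: test_closure_def)
  show "L2 (\<lambda>x. f x + g x)" using L2_add(1)[OF fg] .
  fix e :: real assume e: "e > 0"
  obtain \<phi> where p: "ctest \<phi>" "L2_norm (\<lambda>x. f x - \<phi> x) < e / 2" using assms(1) e unfolding test_closure_def by (meson half_gt_zero)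
  obtain \<psi> where q: "ctest \<psi>" "L2_norm (\<lambda>x. g x - \<psi> x) < e / 2" using assms(2) e unfolding test_closure_def by (meson half_gt_zero)
  have "L2_norm (\<lambda>x. (f x - \<phi> x) + (g x - \<psi> x)) \<le> L2_norm (\<lambda>x. f x - \<phi> x) + L2_norm (\<lambda>x. g x - \<psi> x)"
    by (intro L2_add(2) L2_diff(1) fg L2_ctest[OF p(1)] L2_ctest[OF q(1)])
  then have "L2_norm (\<lambda>x. (f x + g x) - (\<phi> x + \<psi> x)) < e" using p(2) q(2) by (simp add: algebra_simps)
  then show "\<exists>\<phi>. ctest \<phi> \<and> L2_norm (\<lambda>x. (f x + g x) - \<phi> x) < e" using ctest_add[OF p(1) q(1)] by blast
qed

lemma test_closure_cmult:
  assumes "test_closure f" shows "test_closure (\<lambda>x. c * f x)"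
  unfolding test_closure_def
proof (intro conjI allI impI)
  have f: "L2 f" using assms by (auto simp: test_closure_def)
  show "L2 (\<lambda>x. c * f x)" using L2_cmult[OF f] .
  fix e :: real assume e: "e > 0"
  then have "e / (norm c + 1) > 0" by (simp add: add_nonneg_pos)
  then obtain \<phi> where p: "ctest \<phi>" "L2_norm (\<lambda>x. f x - \<phi> x) < e / (norm c + 1)" using assms unfolding test_closure_def by blast
  have "L2_norm (\<lambda>x. c * f x - c * \<phi> x) = norm c * L2_norm (\<lambda>x. f x - \<phi> x)"
    using L2_norm_cmult[of c "\<lambda>x. f x - \<phi> x"] by (simp add: algebra_simps)
  also have "\<dots> \<le> (norm c + 1) * L2_norm (\<lambda>x. f x - \<phi> x)" by (intro mult_right_mono) (auto simp: L2_norm_nonneg)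
  also have "\<dots> < e" using p(2) by (simp add: pos_less_divide_eq add_nonneg_pos mult.commute)
  finally show "\<exists>\<phi>. ctest \<phi> \<and> L2_norm (\<lambda>x. c * f x - \<phi> x) < e" using ctest_cmult[OF p(1)] by blast
qed

lemma test_closure_limit:
  assumes "\<And>i::nat. test_closure (s i)" "L2 f" "(\<lambda>i. L2_norm (\<lambda>x. s i x - f x)) \<longlonglongrightarrow> 0"
  shows "test_closure f"
  unfolding test_closure_def
proof (intro conjI allI impI assms(2))
  fix e :: real assume e: "e > 0"
  then have "\<forall>\<^sub>F i in sequentially. L2_norm (\<lambda>x. s i x - f x) < e / 2"
    using assms(3) by (intro order_tendstoD) auto
  then obtain i where i: "L2_norm (\<lambda>x. s i x - f x) < e / 2" by (auto simp: eventually_sequentially)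
  obtain \<phi> where p: "ctest \<phi>" "L2_norm (\<lambda>x. s i x - \<phi> x) < e / 2" using assms(1)[of i] e unfolding test_closure_def by (meson half_gt_zero)
  have "L2_norm (\<lambda>x. f x - \<phi> x) \<le> L2_norm (\<lambda>x. f x - s i x) + L2_norm (\<lambda>x. s i x - \<phi> x)"
    using assms(1,2) by (intro L2_norm_triangle L2_ctest[OF p(1)]) (auto simp: test_closure_def)
  then show "\<exists>\<phi>. ctest \<phi> \<and> L2_norm (\<lambda>x. f x - \<phi> x) < e"
    using i p L2_norm_minus_commute[of f "s i"] by (intro exI[of _ \<phi>]) auto
qed

lemma test_closure_ctest: "ctest \<phi> \<Longrightarrow> test_closure \<phi>"
  using L2_ctest by (auto simp: test_closure_def L2_norm_def intro!: exI[of _ \<phi>])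

lemma test_closure_box: "test_closure (\<lambda>x::real^'n. indicator (box a b) x)"
proof (rule test_closure_limit[of "\<lambda>n x. of_real (box_bump (real n) a b x)"])
  show *: "test_closure (\<lambda>x. of_real (box_bump (real i) a b x))" for i
    by (intro test_closure_ctest ctest_of_real test_function_box_bump) simp
  have ind: "L2 (\<lambda>x. indicator (box a b) x *\<^sub>R (1::real))"
    using emeasure_lborel_box_finite[of a b] by (intro L2_indicator) auto
  have m: "(\<lambda>x. complex_of_real (box_bump (real i) a b x)) \<in> borel_measurable lebesgue" for i
    using *[of i] L2_D(1) by (auto simp: test_closure_def)
  have le: "norm (complex_of_real (box_bump (real i) a b x)) \<le> norm (indicator (box a b) x *\<^sub>R (1::real))" for i x
    using box_bump_bounds[of "real i" a b x] box_bump_0[of "real i" x a b] by (cases "x \<in> box a b") auto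
  have lim: "(\<lambda>i. complex_of_real (box_bump (real i) a b x)) \<longlonglongrightarrow> indicator (box a b) x" for x
    using tendsto_of_real[OF box_bump_tendsto[of a b x], where 'a=complex] by (cases "x \<in> box a b") auto
  show "L2 (\<lambda>x. indicator (box a b) x :: complex)" "(\<lambda>i. L2_norm (\<lambda>x. of_real (box_bump (real i) a b x) - (indicator (box a b) x :: complex))) \<longlonglongrightarrow> 0"
    using L2_dominated_convergence[OF m ind le lim] by auto
qed

lemma test_closure_cong_AE:
  assumes "test_closure f" "g \<in> borel_measurable lebesgue" "AE x in lebesgue. f x = g x"
  shows "test_closure g"
proof (rule test_closure_limit[of "\<lambda>_. f"])
  have f: "L2 f" using assms(1) by (simp add: test_closure_def)
  show g: "L2 g" by (rule L2_cong_AE(1)[OF assms(3) f assms(2)])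
  have z: "(\<lambda>x. 0::complex) \<in> borel_measurable lebesgue" by simp
  have "AE x in lebesgue. f x - g x = 0" using assms(3) by eventually_elim simp
  from L2_cong_AE(2)[OF this L2_diff(1)[OF f g] z]
  have "L2_norm (\<lambda>x. f x - g x) = 0" by (simp add: L2_norm_def)
  then show "(\<lambda>i. L2_norm (\<lambda>x. f x - g x)) \<longlonglongrightarrow> 0" by simp
qed (fact assms(1))

text \<open>The boxes generate the Borel sets and are stable under intersection. The sets whose part in a fixed
  box is approximated are closed under complements and disjoint unions; the fixed box keeps all measures finite.\<close>

lemma test_closure_borel_Int_box:
  assumes "A \<in> sets (borel :: (real^'n) measure)"
  shows "test_closure (\<lambda>x::real^'n. indicator (A \<inter> box a b) x)"
proof -
  define G where "G = range (\<lambda>(a, b). box a b :: (real^'n) set)"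
  have borel: "sets (borel :: (real^'n) measure) = sigma_sets UNIV G"
    unfolding G_def by (subst borel_eq_box) simp
  have L2i: "L2 (\<lambda>x::real^'n. indicator (C \<inter> box a b) x *\<^sub>R (1::real))" if C: "C \<in> sets borel" for C
  proof (rule L2_indicator)
    have "emeasure lebesgue (C \<inter> box a b) \<le> emeasure lebesgue (box a b)" using C by (intro emeasure_mono) auto
    also have "\<dots> < \<infinity>" using emeasure_lborel_box_finite[of a b] by auto
    finally show "emeasure lebesgue (C \<inter> box a b) < \<infinity>" .
  qed (use C in auto)
  have "Int_stable G" unfolding G_def Int_stable_def by (auto simp: box_Int_box)
  moreover have "G \<subseteq> Pow UNIV" by simp
  moreover have "A \<in> sigma_sets UNIV G" using assms borel by simp
  ultimately show ?thesis
  proof (induction rule: sigma_sets_induct_disjoint)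
    case (basic A)
    then obtain c d where "A = box c d" by (auto simp: G_def)
    then obtain e f where "A \<inter> box a b = box e f" by (auto simp: box_Int_box)
    then show ?case using test_closure_box by simp
  next
    case empty
    have "test_closure (\<lambda>x. 0 * indicator (box a b) x :: complex)" by (intro test_closure_cmult test_closure_box)
    then show ?case by simp
  next
    case (compl A)
    have "test_closure (\<lambda>x. indicator (box a b) x + (-1) * indicator (A \<inter> box a b) x :: complex)"
      by (intro test_closure_add test_closure_cmult test_closure_box compl)
    moreover have "indicator (box a b) x + (-1) * indicator (A \<inter> box a b) x = (indicator ((UNIV - A) \<inter> box a b) x :: complex)" for x
      by (auto simp: indicator_def)
    ultimately show ?case by simp
  next
    case (union A)
    have fin: "test_closure (\<lambda>x. \<Sum>i<n. indicator (A i \<inter> box a b) x :: complex)" for n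
    proof (induction n)
      case 0
      have "test_closure (\<lambda>x. 0 * indicator (box a b) x :: complex)" by (intro test_closure_cmult test_closure_box)
      then show ?case by simp
    next
      case (Suc n)
      then show ?case using union.IH by (auto intro: test_closure_add)
    qed
    have sum: "(\<Sum>i<n. indicator (A i \<inter> box a b) x :: complex) = indicator ((\<Union>i<n. A i) \<inter> box a b) x" for n x
    proof -
      have "disjoint_family_on (\<lambda>i. A i \<inter> box a b) {..<n}"
        using union.hyps(1) by (auto simp: disjoint_family_on_def)
      then have "(\<Sum>i<n. indicator (A i \<inter> box a b) x :: complex) = indicator (\<Union>i<n. A i \<inter> box a b) x"
        by (intro indicator_UN_disjoint[symmetric]) auto
      then show ?thesis by simp
    qed
    have un: "(\<Union>i. A i) \<in> sets borel" using union.hyps(2) unfolding borel by (intro sigma_sets.Union) auto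
    show ?case
    proof (rule test_closure_limit[OF fin])
      have lim: "(\<lambda>n. \<Sum>i<n. indicator (A i \<inter> box a b) x :: complex) \<longlonglongrightarrow> indicator ((\<Union>i. A i) \<inter> box a b) x" for x
      proof (cases "x \<in> (\<Union>i. A i) \<inter> box a b")
        case True
        then obtain k where k: "x \<in> A k" by auto
        have "\<forall>\<^sub>F n in sequentially. (\<Sum>i<n. indicator (A i \<inter> box a b) x :: complex) = 1"
          unfolding sum using eventually_gt_at_top[of k] by eventually_elim (use k True in \<open>auto simp: indicator_def\<close>)
        then show ?thesis using True by (auto intro: tendsto_eventually)
      qed (auto simp: sum)
      have le: "norm (\<Sum>i<n. indicator (A i \<inter> box a b) x :: complex) \<le> norm (indicator ((\<Union>i. A i) \<inter> box a b) x *\<^sub>R (1::real))" for n x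
        unfolding sum by (auto simp: indicator_def)
      have m: "(\<lambda>x. \<Sum>i<n. indicator (A i \<inter> box a b) x :: complex) \<in> borel_measurable lebesgue" for n
        using fin[of n] by (auto simp: test_closure_def dest: L2_D)
      show "L2 (\<lambda>x. indicator ((\<Union>i. A i) \<inter> box a b) x :: complex)"
        "(\<lambda>n. L2_norm (\<lambda>x. (\<Sum>i<n. indicator (A i \<inter> box a b) x) - (indicator ((\<Union>i. A i) \<inter> box a b) x :: complex))) \<longlonglongrightarrow> 0"
        using L2_dominated_convergence[OF m L2i[OF un] le lim] by auto
    qed
  qed
qed

lemma test_closure_indicator:
  assumes "A \<in> sets (borel :: (real^'n) measure)" "emeasure lborel A < \<infinity>"
  shows "test_closure (\<lambda>x::real^'n. indicator A x)"
proof (rule test_closure_limit[of "\<lambda>n x. indicator (A \<inter> box (- real n *\<^sub>R One) (real n *\<^sub>R One)) x"])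
  let ?W = "\<lambda>n. box (- real n *\<^sub>R One) (real n *\<^sub>R One) :: (real^'n) set"
  show *: "test_closure (\<lambda>x. indicator (A \<inter> ?W n) x)" for n
    by (rule test_closure_borel_Int_box[OF assms(1)])
  have m: "(\<lambda>x. indicator (A \<inter> ?W n) x :: complex) \<in> borel_measurable lebesgue" for n
    using *[of n] by (auto simp: test_closure_def dest: L2_D)
  have i: "L2 (\<lambda>x. indicator A x *\<^sub>R (1::real))" using assms by (intro L2_indicator) auto
  have le: "norm (indicator (A \<inter> ?W n) x :: complex) \<le> norm (indicator A x *\<^sub>R (1::real))" for n x
    by (auto simp: indicator_def)
  have lim: "(\<lambda>n. indicator (A \<inter> ?W n) x :: complex) \<longlonglongrightarrow> indicator A x" for x
  proof -
    obtain N where N: "norm x < real N" using reals_Archimedean2 by blast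
    have "x \<in> ?W n" if "n \<ge> N" for n
    proof -
      have "\<bar>x \<bullet> j\<bar> < real n" if "j \<in> Basis" for j
        using Basis_le_norm[OF that, of x] N \<open>n \<ge> N\<close> by linarith
      then show ?thesis by (auto simp: mem_box abs_less_iff) force+
    qed
    then have "\<forall>\<^sub>F n in sequentially. (indicator (A \<inter> ?W n) x :: complex) = indicator A x"
      by (intro eventually_sequentiallyI[of N]) (auto simp: indicator_def)
    then show ?thesis by (rule tendsto_eventually)
  qed
  show "L2 (\<lambda>x. indicator A x :: complex)" "(\<lambda>n. L2_norm (\<lambda>x. indicator (A \<inter> ?W n) x - (indicator A x :: complex))) \<longlonglongrightarrow> 0"
    using L2_dominated_convergence[OF m i le lim] by auto
qed

text \<open>From indicator functions to simple functions, and then by dominated convergence to arbitrary ones.\<close>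

theorem test_functions_dense:
  fixes f :: "real^'n \<Rightarrow> complex"
  assumes "L2 f" shows "test_closure f"
proof -
  obtain g where g: "g \<in> borel_measurable borel" "AE x in lebesgue. f x = g x"
    using borel_representative[OF L2_D(1)[OF assms]] .
  have gm: "g \<in> borel_measurable lebesgue" using g(1) by (simp add: measurable_completion)
  have g2: "L2 g" by (rule L2_cong_AE(1)[OF g(2) assms gm])
  have "g \<in> borel_measurable lborel" using g(1) by simp
  from borel_measurable_implies_sequence_metric[OF this, of 0] obtain s where
    s: "\<And>i. simple_function lborel (s i)" "\<And>x. (\<lambda>i. s i x) \<longlonglongrightarrow> g x" "\<And>i x. norm (s i x) \<le> 2 * norm (g x)"
    by (auto simp: dist_norm)
  have sm: "s i \<in> borel_measurable lebesgue" for i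
    using borel_measurable_simple_function[OF s(1)[of i]] by (simp add: measurable_completion)
  have le: "norm (s i x) \<le> norm (2 *\<^sub>R g x)" for i x using s(3)[of i x] by simp
  note conv = L2_dominated_convergence[OF sm L2_scaleR[OF g2] le s(2)]
  have "test_closure (s i)" for i
  proof -
    have s2: "L2 (s i)" by (rule L2_bound(1)[OF g2 sm, of _ 2]) (use s(3) in auto)
    have fin: "finite (range (s i))" using s(1)[of i] by (auto simp: simple_function_def)
    have each: "test_closure (\<lambda>x. y * indicator (s i -` {y}) x)" for y
    proof (cases "y = 0")
      case True
      have "test_closure (\<lambda>x. 0 * indicator (box 0 0) x :: complex)" by (intro test_closure_cmult test_closure_box)
      then show ?thesis using True by simp
    next
      case False
      have "s i -` {y} \<inter> space lborel \<in> sets lborel"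
        by (rule simple_functionD(2)[OF s(1)])
      then have A: "s i -` {y} \<in> sets borel" by simp
      have "ennreal ((norm y)\<^sup>2) * emeasure lborel (s i -` {y}) = (\<integral>\<^sup>+x. ennreal ((norm y)\<^sup>2) * indicator (s i -` {y}) x \<partial>lebesgue)"
        using A by (subst nn_integral_cmult_indicator) auto
      also have "\<dots> \<le> sq_integral (s i)"
        unfolding sq_integral_def by (intro nn_integral_mono) (auto simp: indicator_def)
      also have "\<dots> < \<infinity>" using s2 by (simp add: L2_iff_sq_integral)
      finally have "emeasure lborel (s i -` {y}) < \<infinity>"
        using False by (auto simp: ennreal_mult_less_top ennreal_mult_eq_top_iff top.not_eq_extremum[symmetric])
      then show ?thesis by (intro test_closure_cmult test_closure_indicator A)
    qed
    have sumc: "test_closure (\<lambda>x. \<Sum>y\<in>Y. y * indicator (s i -` {y}) x)" if "finite Y" for Y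
      using that
    proof (induction Y rule: finite_induct)
      case empty
      have "test_closure (\<lambda>x. 0 * indicator (box 0 0) x :: complex)" by (intro test_closure_cmult test_closure_box)
      then show ?case by simp
    next
      case (insert y Y)
      show ?case unfolding sum.insert[OF insert.hyps] by (rule test_closure_add[OF each insert.IH])
    qed
    have "(\<Sum>y\<in>range (s i). y * indicator (s i -` {y}) x) = s i x" for x
    proof -
      have "(\<Sum>y\<in>range (s i). y * indicator (s i -` {y}) x) = (\<Sum>y\<in>range (s i). if y = s i x then y else 0)"
        by (intro sum.cong) (auto simp: indicator_def)
      also have "\<dots> = s i x" using fin by simp
      finally show ?thesis .
    qed
    then show ?thesis using sumc[OF fin] by simp
  qed
  then have "test_closure g" using conv g2 by (intro test_closure_limit[of s g]) auto
  moreover have "AE x in lebesgue. g x = f x" using g(2) by eventually_elim simp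
  ultimately show ?thesis by (intro test_closure_cong_AE[of g f] L2_D(1)[OF assms])
qed

text \<open>The pairing of \<open>g\<close> with its complex conjugate is the square of the norm, and the conjugate is
  approximated by test functions.\<close>

lemma L2_norm_le_by_duality:
  fixes g :: "real^'n \<Rightarrow> complex"
  assumes g: "L2 g" and M: "M \<ge> 0"
    and le: "\<And>\<phi>. ctest \<phi> \<Longrightarrow> norm (LINT x|lebesgue. g x * \<phi> x) \<le> M * L2_norm \<phi>"
  shows "L2_norm g \<le> M"
proof -
  have gm[measurable]: "g \<in> borel_measurable lebesgue" using g by (rule L2_D)
  have cm: "(\<lambda>x. cnj (g x)) \<in> borel_measurable lebesgue"
    by (rule measurable_compose[OF gm borel_measurable_continuous_onI]) (intro continuous_intros)
  have c: "L2 (\<lambda>x. cnj (g x))" by (rule L2_bound(1)[OF g cm, of 1]) simp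
  have nc: "L2_norm (\<lambda>x. cnj (g x)) = L2_norm g" by (simp add: L2_norm_def)
  define a where "a = L2_norm g"
  have a: "a \<ge> 0" by (simp add: a_def L2_norm_nonneg)
  have "a * a \<le> M * a + e * (a + M)" if e: "e > 0" for e
  proof -
    obtain \<phi> where p: "ctest \<phi>" "L2_norm (\<lambda>x. cnj (g x) - \<phi> x) < e"
      using test_functions_dense[OF c] e by (auto simp: test_closure_def)
    note p2 = L2_ctest[OF p(1)]
    have "of_real (a * a) = (LINT x|lebesgue. g x * cnj (g x))"
    proof -
      have "of_real (a * a) = complex_of_real (LINT x|lebesgue. (norm (g x))\<^sup>2)"
        unfolding a_def using L2_norm_power2[of g] by (simp only: power2_eq_square[of "L2_norm g"])
      also have "\<dots> = (LINT x|lebesgue. complex_of_real ((norm (g x))\<^sup>2))" by (rule integral_complex_of_real[symmetric])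
      also have "(\<lambda>x. complex_of_real ((norm (g x))\<^sup>2)) = (\<lambda>x. g x * cnj (g x))"
        by (rule ext) (rule complex_norm_square)
      finally show ?thesis .
    qed
    also have "\<dots> = (LINT x|lebesgue. g x * \<phi> x) + (LINT x|lebesgue. g x * (cnj (g x) - \<phi> x))"
      using cauchy_schwarz_L2(1)[OF g p2] cauchy_schwarz_L2(1)[OF g L2_diff(1)[OF c p2]]
      by (subst Bochner_Integration.integral_add[symmetric]) (auto simp: algebra_simps)
    finally have "norm (complex_of_real (a * a)) \<le> norm (LINT x|lebesgue. g x * \<phi> x) + norm (LINT x|lebesgue. g x * (cnj (g x) - \<phi> x))"
      using norm_triangle_ineq by metis
    moreover have "norm (complex_of_real (a * a)) = a * a" using a by (simp only: norm_of_real) simp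
    moreover have "norm (LINT x|lebesgue. g x * \<phi> x) \<le> M * L2_norm \<phi>" by (rule le[OF p(1)])
    moreover have "L2_norm \<phi> \<le> a + e"
      using L2_norm_le_add_diff[OF p2 c] p(2) L2_norm_minus_commute[of \<phi> "\<lambda>x. cnj (g x)"] nc by (simp add: a_def)
    then have "M * L2_norm \<phi> \<le> M * (a + e)" using M by (rule mult_left_mono)
    moreover have "norm (LINT x|lebesgue. g x * (cnj (g x) - \<phi> x)) \<le> a * e"
      using cauchy_schwarz_L2(2)[OF g L2_diff(1)[OF c p2]] mult_left_mono[OF less_imp_le[OF p(2)] a] by (simp add: a_def)
    ultimately show ?thesis unfolding distrib_left by (simp add: mult.commute)
  qed
  note e = this
  have "((\<lambda>e. M * a + e * (a + M)) \<longlongrightarrow> M * a + 0 * (a + M)) (at_right 0)" by (intro tendsto_intros)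
  then have "a * a \<le> M * a + 0 * (a + M)"
    by (rule tendsto_lowerbound) (auto simp: eventually_at_filter e)
  then have "a * a \<le> M * a" by simp
  then show ?thesis using a M by (cases "a = 0") (auto simp: a_def[symmetric])
qed

section \<open>Plancherel's theorem for integrable functions\<close>

lemma integral_lborel_prod:
  fixes f :: "'a::euclidean_space \<Rightarrow> real \<Rightarrow> 'b::{real_normed_field, banach, second_countable_topology}"
  assumes f: "\<And>b. b \<in> Basis \<Longrightarrow> integrable lborel (f b)"
  shows "(LINT x|lborel. (\<Prod>b\<in>Basis. f b (x \<bullet> b))) = (\<Prod>b\<in>Basis. LINT t|lborel. f b t)"
    and "integrable lborel (\<lambda>x::'a. \<Prod>b\<in>Basis. f b (x \<bullet> b))"
proof -
  interpret P: product_sigma_finite "\<lambda>b::'a. lborel :: real measure" by standard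
  have [measurable]: "f b \<in> borel_measurable borel" if "b \<in> Basis" for b
    using borel_measurable_integrable[OF f[OF that]] by simp
  have m: "(\<lambda>x::'a. \<Prod>b\<in>Basis. f b (x \<bullet> b)) \<in> borel_measurable borel"
    by (intro borel_measurable_prod) measurable
  have g: "(\<lambda>x. \<Sum>b\<in>Basis. x b *\<^sub>R b) \<in> (\<Pi>\<^sub>M b\<in>(Basis :: 'a set). lborel) \<rightarrow>\<^sub>M borel" by measurable
  have eq: "(\<Prod>b\<in>Basis. f b ((\<Sum>c\<in>Basis. x c *\<^sub>R c) \<bullet> b)) = (\<Prod>b\<in>(Basis::'a set). f b (x b))" for x
    by (intro prod.cong) (auto simp: inner_sum_left inner_Basis if_distrib cong: if_cong)
  have "(LINT x|lborel. (\<Prod>b\<in>Basis. f b ((x::'a) \<bullet> b))) = (LINT x|(\<Pi>\<^sub>M b\<in>Basis. lborel). (\<Prod>b\<in>(Basis::'a set). f b (x b)))"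
    unfolding lborel_eq[where 'a='a] by (subst integral_distr[OF g m]) (simp only: eq)
  also have "\<dots> = (\<Prod>b\<in>Basis. LINT t|lborel. f b t)"
    by (rule P.product_integral_prod) (use f in auto)
  finally show "(LINT x|lborel. (\<Prod>b\<in>Basis. f b ((x::'a) \<bullet> b))) = (\<Prod>b\<in>Basis. LINT t|lborel. f b t)" .
  have "integrable (\<Pi>\<^sub>M b\<in>(Basis::'a set). lborel) (\<lambda>x. \<Prod>b\<in>Basis. f b (x b))"
    by (rule P.product_integrable_prod) (use f in auto)
  then show "integrable lborel (\<lambda>x::'a. \<Prod>b\<in>Basis. f b (x \<bullet> b))"
    unfolding lborel_eq[where 'a='a] by (subst integrable_distr_eq[OF g m]) (simp only: eq)
qed

text \<open>The density of the standard normal distribution. As a product it reduces integrals to one dimension,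
  where its characteristic function is known.\<close>

definition gauss :: "'a::euclidean_space \<Rightarrow> real" where
  "gauss x = (\<Prod>b\<in>Basis. std_normal_density (x \<bullet> b))"

lemma gauss_eq: "gauss (x::'a::euclidean_space) = (1 / sqrt (2 * pi)) ^ DIM('a) * exp (- (norm x)\<^sup>2 / 2)"
proof -
  have "(norm x)\<^sup>2 = (\<Sum>b\<in>Basis. (x \<bullet> b)\<^sup>2)"
    unfolding power2_norm_eq_inner by (subst euclidean_inner) (simp add: power2_eq_square)
  then show ?thesis
    by (simp add: gauss_def std_normal_density_def prod.distrib prod_dividef exp_sum[symmetric] sum_negf sum_divide_distrib power_one_over)
qed

lemma gauss_nonneg: "gauss x \<ge> 0" by (auto simp: gauss_def intro!: prod_nonneg)

lemma integrable_gauss: "integrable lborel (gauss :: 'a::euclidean_space \<Rightarrow> real)"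
  and integral_gauss: "(LINT x|lborel. gauss (x::'a)) = 1"
proof -
  have i: "integrable lborel std_normal_density" by (rule integrable_normal_density) simp
  have 1: "(LINT t|lborel. std_normal_density t) = 1" by (rule integral_normal_density) simp
  show "integrable lborel (gauss :: 'a \<Rightarrow> real)"
    using integral_lborel_prod(2)[of "\<lambda>_::'a. std_normal_density"] i by (simp add: gauss_def[abs_def])
  show "(LINT x|lborel. gauss (x::'a)) = 1"
    using integral_lborel_prod(1)[of "\<lambda>_::'a. std_normal_density"] i 1 by (simp add: gauss_def[abs_def])
qed

lemma fourier_gauss:
  "(LINT x|lborel. cis (z \<bullet> x) * of_real (gauss (x::'a::euclidean_space))) = of_real (exp (- (norm z)\<^sup>2 / 2))"
proof -
  have i: "integrable lborel (\<lambda>t. cis (s * t) * complex_of_real (std_normal_density t))" for s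
  proof (rule Bochner_Integration.integrable_bound[of _ std_normal_density])
    show "integrable lborel std_normal_density" by (rule integrable_normal_density) simp
    have "(\<lambda>t. cis (s * t)) \<in> borel_measurable borel"
      by (intro borel_measurable_continuous_onI continuous_intros)
    then show "(\<lambda>t. cis (s * t) * complex_of_real (std_normal_density t)) \<in> borel_measurable lborel" by simp
  qed (simp add: norm_mult)
  have 1: "(LINT t|lborel. cis (s * t) * complex_of_real (std_normal_density t)) = of_real (exp (- s\<^sup>2 / 2))" for s
  proof -
    have "char std_normal_distribution s = (LINT t|lborel. std_normal_density t *\<^sub>R iexp (s * t))"
      unfolding char_def by (subst integral_density) auto
    then have "(LINT t|lborel. std_normal_density t *\<^sub>R iexp (s * t)) = of_real (exp (- s\<^sup>2 / 2))"
      by (simp add: char_std_normal_distribution)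
    moreover have "std_normal_density t *\<^sub>R iexp (s * t) = cis (s * t) * complex_of_real (std_normal_density t)" for t
      by (simp add: scaleR_conv_of_real cis_conv_exp mult.commute)
    ultimately show ?thesis by simp
  qed
  have "cis (z \<bullet> x) * of_real (gauss x) = (\<Prod>b\<in>Basis. cis ((z \<bullet> b) * (x \<bullet> b)) * of_real (std_normal_density (x \<bullet> b)))" for x :: 'a
  proof -
    have "cis (z \<bullet> x) = (\<Prod>b\<in>Basis. cis ((z \<bullet> b) * (x \<bullet> b)))"
      by (subst euclidean_inner) (simp add: cis_conv_exp exp_sum[symmetric] sum_distrib_left)
    then show ?thesis by (simp add: gauss_def prod.distrib)
  qed
  then have "(LINT x|lborel. cis (z \<bullet> x) * of_real (gauss x)) = (\<Prod>b\<in>Basis. of_real (exp (- (z \<bullet> b)\<^sup>2 / 2)))"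
    using integral_lborel_prod(1)[of "\<lambda>b t. cis ((z \<bullet> b) * t) * complex_of_real (std_normal_density t)"] i 1 by simp
  also have "\<dots> = of_real (exp (\<Sum>b\<in>Basis. - (z \<bullet> b)\<^sup>2 / 2))" by (simp add: exp_sum)
  also have "(\<Sum>b\<in>Basis. - (z \<bullet> b)\<^sup>2 / 2) = - (norm z)\<^sup>2 / 2"
    unfolding power2_norm_eq_inner by (subst euclidean_inner) (simp add: power2_eq_square sum_negf sum_divide_distrib)
  finally show ?thesis .
qed

lemma lborel_integral_affine:
  fixes f :: "'a::euclidean_space \<Rightarrow> 'b::{banach, second_countable_topology}"
  assumes c: "c \<noteq> 0" and f[measurable]: "f \<in> borel_measurable borel"
  shows "(LINT x|lborel. f x) = \<bar>c\<bar> ^ DIM('a) *\<^sub>R (LINT x|lborel. f (t + c *\<^sub>R x))"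
  by (subst lborel_affine[OF c, of t]) (simp add: integral_density integral_distr)

lemma cis_measurable:
  "(\<lambda>(x, \<xi>). cis (s * (x \<bullet> \<xi>))) \<in> borel_measurable (borel \<Otimes>\<^sub>M (borel :: 'a::euclidean_space measure))"
  unfolding borel_prod case_prod_beta
  by (intro borel_measurable_continuous_onI continuous_intros)

lemma integrable_product_kernel:
  fixes u :: "'a::euclidean_space \<Rightarrow> complex" and G :: "'b::euclidean_space \<Rightarrow> complex"
  assumes u: "integrable lborel u" and G: "integrable lborel G"
    and k: "(\<lambda>(x, \<xi>). k x \<xi>) \<in> borel_measurable (borel \<Otimes>\<^sub>M borel)" "\<And>x \<xi>. norm (k x \<xi>) \<le> (1::real)"
  shows "integrable (lborel \<Otimes>\<^sub>M lborel) (\<lambda>(x, \<xi>). k x \<xi> * (u x * G \<xi>) :: complex)"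
proof (rule lborel_pair.Fubini_integrable)
  have [measurable]: "u \<in> borel_measurable borel" "G \<in> borel_measurable borel"
    using borel_measurable_integrable[OF u] borel_measurable_integrable[OF G] by auto
  have [measurable]: "(\<lambda>p. k (fst p) (snd p)) \<in> borel_measurable (borel \<Otimes>\<^sub>M borel)"
    using k(1) by (simp add: case_prod_beta')
  show m: "(\<lambda>(x, \<xi>). k x \<xi> * (u x * G \<xi>)) \<in> borel_measurable (lborel \<Otimes>\<^sub>M lborel)"
    unfolding case_prod_beta' by measurable
  have mx: "(\<lambda>\<xi>. k x \<xi> * (u x * G \<xi>)) \<in> borel_measurable lborel" for x
    using measurable_Pair2[OF m, of x] by simp
  have le: "norm (k x \<xi> * (u x * G \<xi>)) \<le> norm (u x) * norm (G \<xi>)" for x \<xi>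
    using mult_right_mono[OF k(2)[of x \<xi>], of "norm (u x) * norm (G \<xi>)"] by (simp add: norm_mult)
  have iG: "integrable lborel (\<lambda>\<xi>. norm (u x) * norm (G \<xi>))" for x
    using G by (intro integrable_mult_right integrable_norm)
  have i: "integrable lborel (\<lambda>\<xi>. k x \<xi> * (u x * G \<xi>))" for x
    by (rule Bochner_Integration.integrable_bound[OF iG mx]) (use le in auto)
  then show "AE x in lborel. integrable lborel (\<lambda>y. case (x, y) of (x, \<xi>) \<Rightarrow> k x \<xi> * (u x * G \<xi>))" by simp
  have "integrable lborel (\<lambda>x. LINT \<xi>|lborel. norm (k x \<xi> * (u x * G \<xi>)))"
  proof (rule Bochner_Integration.integrable_bound)
    show "integrable lborel (\<lambda>x. norm (u x) * (LINT \<xi>|lborel. norm (G \<xi>)))"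
      using u by (intro integrable_mult_left integrable_norm)
    have "(\<lambda>(x, \<xi>). norm (k x \<xi> * (u x * G \<xi>))) \<in> borel_measurable (lborel \<Otimes>\<^sub>M lborel)"
      using measurable_compose[OF m borel_measurable_norm] by (simp add: case_prod_beta')
    then show "(\<lambda>x. LINT \<xi>|lborel. norm (k x \<xi> * (u x * G \<xi>))) \<in> borel_measurable lborel"
      by (rule lborel.borel_measurable_lebesgue_integral)
    show "AE x in lborel. norm (LINT \<xi>|lborel. norm (k x \<xi> * (u x * G \<xi>))) \<le> norm (norm (u x) * (LINT \<xi>|lborel. norm (G \<xi>)))"
    proof (rule AE_I2)
      fix x
      have "(LINT \<xi>|lborel. norm (k x \<xi> * (u x * G \<xi>))) \<le> (LINT \<xi>|lborel. norm (u x) * norm (G \<xi>))"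
        using i iG le by (intro integral_mono integrable_norm) auto
      then show "norm (LINT \<xi>|lborel. norm (k x \<xi> * (u x * G \<xi>))) \<le> norm (norm (u x) * (LINT \<xi>|lborel. norm (G \<xi>)))"
        by simp
    qed
  qed
  then show "integrable lborel (\<lambda>x. LINT y|lborel. norm (case (x, y) of (x, \<xi>) \<Rightarrow> k x \<xi> * (u x * G \<xi>)))" by simp
qed

text \<open>Fubini's theorem; the exponential is the symmetric kernel of the transform.\<close>

lemma fourier_multiplication:
  fixes u G :: "'a::euclidean_space \<Rightarrow> complex"
  assumes u: "integrable lborel u" and G: "integrable lborel G"
  shows "(LINT \<xi>|lborel. (LINT x|lborel. cis (s * (x \<bullet> \<xi>)) * u x) * G \<xi>) =
    (LINT x|lborel. u x * (LINT \<xi>|lborel. cis (s * (x \<bullet> \<xi>)) * G \<xi>))"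
proof -
  have "integrable (lborel \<Otimes>\<^sub>M lborel) (\<lambda>(x, \<xi>). cis (s * (x \<bullet> \<xi>)) * (u x * G \<xi>))"
    by (rule integrable_product_kernel[OF u G cis_measurable]) simp
  from lborel_pair.Fubini_integral[OF this]
  have "(LINT \<xi>|lborel. LINT x|lborel. cis (s * (x \<bullet> \<xi>)) * (u x * G \<xi>)) =
    (LINT x|lborel. LINT \<xi>|lborel. cis (s * (x \<bullet> \<xi>)) * (u x * G \<xi>))" .
  moreover have "(LINT x|lborel. cis (s * (x \<bullet> \<xi>)) * (u x * G \<xi>)) = (LINT x|lborel. cis (s * (x \<bullet> \<xi>)) * u x) * G \<xi>" for \<xi>
    unfolding integral_mult_left_zero[symmetric] by (simp add: mult.assoc)
  moreover have "(LINT \<xi>|lborel. cis (s * (x \<bullet> \<xi>)) * (u x * G \<xi>)) = u x * (LINT \<xi>|lborel. cis (s * (x \<bullet> \<xi>)) * G \<xi>)" for x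
    unfolding integral_mult_right_zero[symmetric] by (simp add: mult_ac)
  ultimately show ?thesis by simp
qed

text \<open>For test functions this is dominated convergence, and translations preserve the norm, so density carries
  it over.\<close>

lemma L2_translation_continuous:
  fixes f :: "real^'n \<Rightarrow> complex" and h :: "nat \<Rightarrow> real^'n"
  assumes f: "L2 f" and h: "h \<longlonglongrightarrow> 0"
  shows "(\<lambda>k. L2_norm (\<lambda>x. f (x + h k) - f x)) \<longlonglongrightarrow> 0"
proof -
  have test: "(\<lambda>k. L2_norm (\<lambda>x. \<phi> (x + h k) - \<phi> x)) \<longlonglongrightarrow> 0" if p: "ctest \<phi>" for \<phi> :: "real^'n \<Rightarrow> complex"
  proof -
    have t: "test_function (\<lambda>x. Re (\<phi> x))" "test_function (\<lambda>x. Im (\<phi> x))" using p by (auto simp: ctest_def)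
    obtain M1 where M1: "\<And>x. \<bar>Re (\<phi> x)\<bar> \<le> M1" using test_function_bounded[OF t(1)] by metis
    obtain M2 where M2: "\<And>x. \<bar>Im (\<phi> x)\<bar> \<le> M2" using test_function_bounded[OF t(2)] by metis
    define M where "M = M1 + M2"
    have M: "norm (\<phi> x) \<le> M" for x using cmod_le[of "\<phi> x"] M1[of x] M2[of x] by (simp add: M_def)
    from test_function_D(3)[OF t(1)] obtain R1 where R1: "\<forall>x\<in>{x. Re (\<phi> x) \<noteq> 0}. norm x \<le> R1" unfolding bounded_iff ..
    from test_function_D(3)[OF t(2)] obtain R2 where R2: "\<forall>x\<in>{x. Im (\<phi> x) \<noteq> 0}. norm x \<le> R2" unfolding bounded_iff ..
    define R where "R = max R1 R2"
    have R: "\<phi> x = 0" if "norm x > R" for x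
      using R1 R2 that by (auto simp: R_def complex_eq_iff)
    from convergent_imp_bounded[OF h] obtain H where H: "\<And>k. norm (h k) \<le> H" unfolding bounded_iff by auto
    have m: "(\<lambda>x. \<phi> (x + h k)) \<in> borel_measurable lebesgue" for k
      using L2_translation(1)[OF L2_ctest[OF p]] by (rule L2_D(1))
    have ind: "L2 (\<lambda>x::real^'n. indicator (cball 0 (R + H)) x *\<^sub>R M)"
      by (rule L2_indicator) (use emeasure_bounded_finite[OF bounded_cball, of "0::real^'n" "R + H"] in auto)
    have le: "norm (\<phi> (x + h k)) \<le> norm (indicator (cball 0 (R + H)) x *\<^sub>R M)" for k x
    proof (cases "norm x \<le> R + H")
      case True then show ?thesis using M[of "x + h k"] by simp
    next
      case False
      have "norm x \<le> norm (x + h k) + norm (h k)" using norm_triangle_ineq4[of "x + h k" "h k"] by simp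
      then have "norm (x + h k) > R" using False H[of k] by linarith
      then show ?thesis using R by simp
    qed
    have cont: "continuous_on UNIV \<phi>"
    proof -
      have "continuous_on UNIV (\<lambda>x. Complex (Re (\<phi> x)) (Im (\<phi> x)))"
        using test_function_D(1)[OF t(1)] test_function_D(1)[OF t(2)] by (intro continuous_on_Complex)
      then show ?thesis by simp
    qed
    have lim: "(\<lambda>k. \<phi> (x + h k)) \<longlonglongrightarrow> \<phi> x" for x
    proof -
      have "(\<lambda>k. x + h k) \<longlonglongrightarrow> x + 0" by (intro tendsto_intros h)
      then have "(\<lambda>k. x + h k) \<longlonglongrightarrow> x" by simp
      moreover have "isCont \<phi> x" using cont by (simp add: continuous_on_eq_continuous_at)
      ultimately show ?thesis by (rule isCont_tendsto_compose[rotated])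
    qed
    show ?thesis by (rule L2_dominated_convergence(2)[OF m ind le lim])
  qed
  show ?thesis
  proof (rule LIMSEQ_I)
    fix e :: real assume e: "e > 0"
    obtain \<phi> where p: "ctest \<phi>" "L2_norm (\<lambda>x. f x - \<phi> x) < e / 3"
      using test_functions_dense[OF f] e unfolding test_closure_def by (meson divide_pos_pos zero_less_numeral)
    have "\<forall>\<^sub>F k in sequentially. L2_norm (\<lambda>x. \<phi> (x + h k) - \<phi> x) < e / 3"
      using test[OF p(1)] e by (intro order_tendstoD) auto
    then obtain N where N: "\<And>k. k \<ge> N \<Longrightarrow> L2_norm (\<lambda>x. \<phi> (x + h k) - \<phi> x) < e / 3"
      by (auto simp: eventually_sequentially)
    have "norm (L2_norm (\<lambda>x. f (x + h k) - f x) - 0) < e" if "k \<ge> N" for k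
    proof -
      note P = L2_ctest[OF p(1)]
      have "L2_norm (\<lambda>x. f (x + h k) - f x) \<le> L2_norm (\<lambda>x. f (x + h k) - \<phi> (x + h k)) + L2_norm (\<lambda>x. \<phi> (x + h k) - f x)"
        by (intro L2_norm_triangle L2_translation(1) f P)
      also have "L2_norm (\<lambda>x. f (x + h k) - \<phi> (x + h k)) = L2_norm (\<lambda>x. f x - \<phi> x)"
        using L2_translation(2)[OF L2_diff(1)[OF f P], of "h k"] .
      also have "L2_norm (\<lambda>x. \<phi> (x + h k) - f x) \<le> L2_norm (\<lambda>x. \<phi> (x + h k) - \<phi> x) + L2_norm (\<lambda>x. \<phi> x - f x)"
        by (intro L2_norm_triangle L2_translation(1) f P)
      finally have "L2_norm (\<lambda>x. f (x + h k) - f x) < e"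
        using p(2) N[OF that] L2_norm_minus_commute[of \<phi> f] by linarith
      then show ?thesis using L2_norm_nonneg[of "\<lambda>x. f (x + h k) - f x"] by simp
    qed
    then show "\<exists>N. \<forall>k\<ge>N. norm (L2_norm (\<lambda>x. f (x + h k) - f x) - 0) < e" by blast
  qed
qed

text \<open>Without the normalising factor, and for the Borel measure.\<close>

definition raw_fourier :: "(real^'n \<Rightarrow> complex) \<Rightarrow> real^'n \<Rightarrow> complex" where
  "raw_fourier f \<xi> = (LINT x|lborel. cis (- 1 * (x \<bullet> \<xi>)) * f x)"

lemma raw_fourier_measurable:
  assumes [measurable]: "f \<in> borel_measurable borel"
  shows "raw_fourier f \<in> borel_measurable borel"
proof -
  have [measurable]: "(\<lambda>p :: (real^'n) \<times> (real^'n). cis (- 1 * (snd p \<bullet> fst p))) \<in> borel_measurable (borel \<Otimes>\<^sub>M borel)"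
    unfolding borel_prod by (intro borel_measurable_continuous_onI continuous_intros)
  have "(\<lambda>(\<xi>, x). cis (- 1 * (x \<bullet> \<xi>)) * f x) \<in> borel_measurable (borel \<Otimes>\<^sub>M lborel)"
    unfolding case_prod_beta' by measurable
  from lborel.borel_measurable_lebesgue_integral[OF this] show ?thesis
    by (simp add: raw_fourier_def[abs_def])
qed

lemma raw_fourier_bound: "norm (raw_fourier f \<xi>) \<le> (LINT x|lborel. norm (f x))"
  unfolding raw_fourier_def using integral_norm_bound[of lborel "\<lambda>x. cis (- 1 * (x \<bullet> \<xi>)) * f x"]
  by (simp add: norm_mult)

lemma fourier_gauss_scaled:
  fixes z :: "'a::euclidean_space"
  assumes e: "e > 0"
  shows "(LINT \<xi>|lborel. cis (z \<bullet> \<xi>) * of_real (gauss (e *\<^sub>R \<xi>))) =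
    of_real ((1 / e) ^ DIM('a) * (sqrt (2 * pi) ^ DIM('a) * gauss ((1 / e) *\<^sub>R z)))"
proof -
  have m: "(\<lambda>\<xi>::'a. cis (z \<bullet> \<xi>) * complex_of_real (gauss (e *\<^sub>R \<xi>))) \<in> borel_measurable borel"
    unfolding gauss_eq by (intro borel_measurable_continuous_onI continuous_intros) auto
  have "(LINT \<xi>|lborel. cis (z \<bullet> \<xi>) * complex_of_real (gauss (e *\<^sub>R \<xi>))) =
     \<bar>1 / e\<bar> ^ DIM('a) *\<^sub>R (LINT x|lborel. cis (z \<bullet> (0 + (1 / e) *\<^sub>R x)) * of_real (gauss (e *\<^sub>R (0 + (1 / e) *\<^sub>R x))))"
    using e by (intro lborel_integral_affine m) auto
  also have "(LINT x|lborel. cis (z \<bullet> (0 + (1 / e) *\<^sub>R x)) * of_real (gauss (e *\<^sub>R (0 + (1 / e) *\<^sub>R x))))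
      = (LINT x|lborel. cis (((1 / e) *\<^sub>R z) \<bullet> x) * of_real (gauss (x::'a)))" using e by simp
  also have "\<dots> = of_real (exp (- (norm ((1 / e) *\<^sub>R z))\<^sup>2 / 2))" by (rule fourier_gauss)
  also have "exp (- (norm ((1 / e) *\<^sub>R z))\<^sup>2 / 2) = sqrt (2 * pi) ^ DIM('a) * gauss ((1 / e) *\<^sub>R z)"
    by (simp add: gauss_eq power_one_over)
  finally show ?thesis using e by (simp add: scaleR_conv_of_real)
qed

text \<open>Plancherel's identity with a Gaussian weight, which makes all integrals absolutely convergent. The
  weight becomes, on the other side, an average of the autocorrelation of \<open>f\<close> over shifts of
  size \<open>e\<close>.\<close>

lemma plancherel_weighted:
  fixes f :: "real^'n \<Rightarrow> complex"
  assumes f[measurable]: "f \<in> borel_measurable borel" and fi: "integrable lborel f" and f2: "L2 f" and e: "e > 0"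
  shows "integrable lborel (\<lambda>\<xi>. (norm (raw_fourier f \<xi>))\<^sup>2 * gauss (e *\<^sub>R \<xi>))"
    and "of_real (LINT \<xi>|lborel. (norm (raw_fourier f \<xi>))\<^sup>2 * gauss (e *\<^sub>R \<xi>)) =
      of_real (sqrt (2 * pi) ^ CARD('n)) * (LINT v|lborel. of_real (gauss v) * (LINT x|lborel. f x * cnj (f (x + e *\<^sub>R v))))"
proof -
  define d where "d = sqrt (2 * pi) ^ CARD('n)"
  define g where "g \<xi> = complex_of_real (gauss (e *\<^sub>R \<xi>))" for \<xi> :: "real^'n"
  have gm[measurable]: "g \<in> borel_measurable borel"
    unfolding g_def gauss_eq by (intro borel_measurable_continuous_onI continuous_intros) auto
  have gi: "integrable lborel g"
  proof -
    have gm2: "(gauss :: real^'n \<Rightarrow> real) \<in> borel_measurable borel"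
      using borel_measurable_integrable[OF integrable_gauss] by simp
    have "integrable (distr lborel borel (\<lambda>x. 0 + e *\<^sub>R x)) (gauss :: real^'n \<Rightarrow> real)"
    proof -
      have "integrable (density (distr lborel borel (\<lambda>x. 0 + e *\<^sub>R x)) (\<lambda>_. ennreal (\<bar>e\<bar> ^ DIM(real^'n)))) (gauss :: real^'n \<Rightarrow> real)"
        using integrable_gauss[where 'a="real^'n"] lborel_affine[of e "0::real^'n"] e by (simp add: ennreal_power)
      then have "integrable (distr lborel borel (\<lambda>x. 0 + e *\<^sub>R x)) (\<lambda>x::real^'n. (\<bar>e\<bar> ^ DIM(real^'n)) *\<^sub>R gauss x)"
        using gm2 by (subst (asm) integrable_density) auto
      then show ?thesis using e by (simp add: integrable_mult_right_iff)
    qed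
    then have "integrable lborel (\<lambda>x::real^'n. gauss (0 + e *\<^sub>R x))"
      using gm2 by (subst (asm) integrable_distr_eq) auto
    then show ?thesis by (simp add: g_def[abs_def])
  qed
  note Fm[measurable] = raw_fourier_measurable[OF f]
  define M where "M = (LINT x|lborel. norm (f x))"
  have FM: "norm (raw_fourier f \<xi>) \<le> M" for \<xi> unfolding M_def by (rule raw_fourier_bound)
  have M0: "M \<ge> 0" by (simp add: M_def)
  have cnjm: "(\<lambda>\<xi>. cnj (raw_fourier f \<xi>)) \<in> borel_measurable borel"
    by (rule measurable_compose[OF Fm borel_measurable_continuous_onI]) (intro continuous_intros)
  have cnjf: "(\<lambda>x. cnj (f x)) \<in> borel_measurable borel"
    by (rule measurable_compose[OF f borel_measurable_continuous_onI]) (intro continuous_intros)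
  \<comment> \<open>the multiplication formula is applied twice, first to \<open>f\<close> and \<open>G1\<close>, then to the conjugate of \<open>f\<close> and
    the Gaussian\<close>
  define G1 where "G1 \<xi> = g \<xi> * cnj (raw_fourier f \<xi>)" for \<xi>
  have G1i: "integrable lborel G1"
  proof (rule Bochner_Integration.integrable_bound)
    show "integrable lborel (\<lambda>\<xi>. g \<xi> * of_real M)" using gi by (rule integrable_mult_left)
    show "G1 \<in> borel_measurable lborel" unfolding G1_def using cnjm by measurable
    show "AE \<xi> in lborel. norm (G1 \<xi>) \<le> norm (g \<xi> * of_real M)"
      using FM M0 by (intro AE_I2) (auto simp: G1_def norm_mult intro!: mult_left_mono)
  qed
  have eqn: "complex_of_real ((norm (raw_fourier f \<xi>))\<^sup>2 * gauss (e *\<^sub>R \<xi>)) = raw_fourier f \<xi> * G1 \<xi>" for \<xi>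
    unfolding of_real_mult complex_norm_square G1_def g_def by (simp only: mult_ac)
  show "integrable lborel (\<lambda>\<xi>. (norm (raw_fourier f \<xi>))\<^sup>2 * gauss (e *\<^sub>R \<xi>))"
  proof (rule Bochner_Integration.integrable_bound)
    show "integrable lborel (\<lambda>\<xi>. M * norm (G1 \<xi>))" using G1i by (intro integrable_mult_right integrable_norm)
    have "(\<lambda>\<xi>. (norm (raw_fourier f \<xi>))\<^sup>2) \<in> borel_measurable lborel" by measurable
    moreover have "(\<lambda>\<xi>::real^'n. gauss (e *\<^sub>R \<xi>)) \<in> borel_measurable borel"
      unfolding gauss_eq by (intro borel_measurable_continuous_onI continuous_intros) auto
    ultimately show "(\<lambda>\<xi>. (norm (raw_fourier f \<xi>))\<^sup>2 * gauss (e *\<^sub>R \<xi>)) \<in> borel_measurable lborel" by measurable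
    show "AE \<xi> in lborel. norm ((norm (raw_fourier f \<xi>))\<^sup>2 * gauss (e *\<^sub>R \<xi>)) \<le> norm (M * norm (G1 \<xi>))"
    proof (rule AE_I2)
      fix \<xi>
      have "norm ((norm (raw_fourier f \<xi>))\<^sup>2 * gauss (e *\<^sub>R \<xi>)) = norm (complex_of_real ((norm (raw_fourier f \<xi>))\<^sup>2 * gauss (e *\<^sub>R \<xi>)))"
        by (simp only: norm_of_real real_norm_def)
      also have "\<dots> = norm (raw_fourier f \<xi>) * norm (G1 \<xi>)" unfolding eqn norm_mult ..
      also have "\<dots> \<le> M * norm (G1 \<xi>)" using FM by (intro mult_right_mono) auto
      finally show "norm ((norm (raw_fourier f \<xi>))\<^sup>2 * gauss (e *\<^sub>R \<xi>)) \<le> norm (M * norm (G1 \<xi>))" using M0 by (simp add: abs_mult)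
    qed
  qed
  have cf: "integrable lborel (\<lambda>y. cnj (f y))" using fi by simp
  have inner: "(LINT \<xi>|lborel. cis (- 1 * (x \<bullet> \<xi>)) * G1 \<xi>) = of_real d * (LINT v|lborel. cnj (f (x + e *\<^sub>R v)) * of_real (gauss v))" for x
  proof -
    have Gx: "integrable lborel (\<lambda>\<xi>. cis (- 1 * (x \<bullet> \<xi>)) * g \<xi>)"
    proof (rule Bochner_Integration.integrable_bound[OF gi])
      have "(\<lambda>\<xi>. cis (- 1 * (x \<bullet> \<xi>))) \<in> borel_measurable borel"
        by (intro borel_measurable_continuous_onI continuous_intros)
      then show "(\<lambda>\<xi>. cis (- 1 * (x \<bullet> \<xi>)) * g \<xi>) \<in> borel_measurable lborel" by measurable
    qed (simp add: norm_mult)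
    have "cnj (raw_fourier f \<xi>) = (LINT y|lborel. cis (1 * (y \<bullet> \<xi>)) * cnj (f y))" for \<xi>
    proof -
      have "(LINT y|lborel. cis (1 * (y \<bullet> \<xi>)) * cnj (f y)) = (LINT y|lborel. cnj (cis (- 1 * (y \<bullet> \<xi>)) * f y))"
        by (simp add: cis_cnj del: integral_cnj)
      also have "\<dots> = cnj (raw_fourier f \<xi>)" unfolding raw_fourier_def by (rule Bochner_Integration.integral_cnj)
      finally show ?thesis ..
    qed
    then have "(LINT \<xi>|lborel. cis (- 1 * (x \<bullet> \<xi>)) * G1 \<xi>) =
        (LINT \<xi>|lborel. (LINT y|lborel. cis (1 * (y \<bullet> \<xi>)) * cnj (f y)) * (cis (- 1 * (x \<bullet> \<xi>)) * g \<xi>))"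
      by (simp add: G1_def mult_ac)
    also have "\<dots> = (LINT y|lborel. cnj (f y) * (LINT \<xi>|lborel. cis (1 * (y \<bullet> \<xi>)) * (cis (- 1 * (x \<bullet> \<xi>)) * g \<xi>)))"
      by (rule fourier_multiplication[OF cf Gx])
    also have "(\<lambda>y. LINT \<xi>|lborel. cis (1 * (y \<bullet> \<xi>)) * (cis (- 1 * (x \<bullet> \<xi>)) * g \<xi>)) =
       (\<lambda>y. of_real ((1 / e) ^ CARD('n) * (d * gauss ((1 / e) *\<^sub>R (y - x)))))"
    proof (rule ext)
      fix y
      have "cis (1 * (y \<bullet> \<xi>)) * (cis (- 1 * (x \<bullet> \<xi>)) * g \<xi>) = cis ((y - x) \<bullet> \<xi>) * g \<xi>" for \<xi>
        by (simp add: cis_mult inner_diff_left flip: mult.assoc)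
      then show "(LINT \<xi>|lborel. cis (1 * (y \<bullet> \<xi>)) * (cis (- 1 * (x \<bullet> \<xi>)) * g \<xi>)) =
        of_real ((1 / e) ^ CARD('n) * (d * gauss ((1 / e) *\<^sub>R (y - x))))"
        using fourier_gauss_scaled[OF e, of "y - x"] by (simp only: g_def d_def) simp
    qed
    also have "(LINT y|lborel. cnj (f y) * of_real ((1 / e) ^ CARD('n) * (d * gauss ((1 / e) *\<^sub>R (y - x))))) =
       \<bar>e\<bar> ^ DIM(real^'n) *\<^sub>R (LINT v|lborel. cnj (f (x + e *\<^sub>R v)) * of_real ((1 / e) ^ CARD('n) * (d * gauss ((1 / e) *\<^sub>R ((x + e *\<^sub>R v) - x)))))"
    proof (rule lborel_integral_affine)
      have "(\<lambda>y. complex_of_real ((1 / e) ^ CARD('n) * (d * gauss ((1 / e) *\<^sub>R (y - x))))) \<in> borel_measurable borel"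
        unfolding gauss_eq by (intro borel_measurable_continuous_onI continuous_intros) auto
      then show "(\<lambda>y. cnj (f y) * complex_of_real ((1 / e) ^ CARD('n) * (d * gauss ((1 / e) *\<^sub>R (y - x))))) \<in> borel_measurable borel"
        using cnjf by measurable
    qed (use e in auto)
    also have "\<dots> = \<bar>e\<bar> ^ CARD('n) *\<^sub>R (LINT v|lborel. of_real ((1 / e) ^ CARD('n) * d) * (cnj (f (x + e *\<^sub>R v)) * of_real (gauss v)))"
      using e by (simp add: mult_ac)
    also have "\<dots> = of_real d * (LINT v|lborel. cnj (f (x + e *\<^sub>R v)) * of_real (gauss v))"
      unfolding integral_mult_right_zero using e by (simp add: scaleR_conv_of_real power_one_over)
    finally show ?thesis .
  qed
  have "complex_of_real (LINT \<xi>|lborel. (norm (raw_fourier f \<xi>))\<^sup>2 * gauss (e *\<^sub>R \<xi>)) =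
      (LINT \<xi>|lborel. raw_fourier f \<xi> * G1 \<xi>)"
    unfolding integral_complex_of_real[symmetric] eqn ..
  also have "\<dots> = (LINT x|lborel. f x * (LINT \<xi>|lborel. cis (- 1 * (x \<bullet> \<xi>)) * G1 \<xi>))"
    unfolding raw_fourier_def[of f] by (rule fourier_multiplication[OF fi G1i])
  also have "\<dots> = (LINT x|lborel. of_real d * (LINT v|lborel. of_real (gauss v) * (f x * cnj (f (x + e *\<^sub>R v)))))"
    unfolding inner by (intro Bochner_Integration.integral_cong refl) (simp add: mult_ac flip: integral_mult_right_zero)
  also have "\<dots> = of_real d * (LINT x|lborel. LINT v|lborel. of_real (gauss v) * (f x * cnj (f (x + e *\<^sub>R v))))"
    by (rule integral_mult_right_zero)
  also have "(LINT x|lborel. LINT v|lborel. of_real (gauss v) * (f x * cnj (f (x + e *\<^sub>R v)))) =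
     (LINT v|lborel. LINT x|lborel. of_real (gauss v) * (f x * cnj (f (x + e *\<^sub>R v))))"
  proof (rule lborel_pair.Fubini_integral)
    have gg[measurable]: "(gauss :: real^'n \<Rightarrow> real) \<in> borel_measurable borel"
      using borel_measurable_integrable[OF integrable_gauss] by simp
    have sh: "(\<lambda>p :: (real^'n) \<times> (real^'n). cnj (f (snd p + e *\<^sub>R fst p))) \<in> borel_measurable (borel \<Otimes>\<^sub>M borel)"
      by (rule measurable_compose[OF _ cnjf]) measurable
    have m: "(\<lambda>(v, x). complex_of_real (gauss v) * (f x * cnj (f (x + e *\<^sub>R v)))) \<in> borel_measurable (lborel \<Otimes>\<^sub>M lborel)"
      unfolding case_prod_beta' using sh by measurable
    have fm: "(\<lambda>x. cnj (f (x + h))) \<in> borel_measurable borel" for h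
      by (rule measurable_compose[OF _ cnjf]) measurable
    have ff: "integrable lborel (\<lambda>x. norm (f x) * norm (f (x + h)))"
      and fl: "(LINT x|lborel. norm (f x) * norm (f (x + h))) \<le> (L2_norm f)\<^sup>2" for h
    proof -
      have [measurable]: "(\<lambda>x. f (x + h)) \<in> borel_measurable borel" by (rule measurable_compose[OF _ f]) measurable
      have mm: "(\<lambda>x. norm (f x) * norm (f (x + h))) \<in> borel_measurable lborel" by measurable
      show "integrable lborel (\<lambda>x. norm (f x) * norm (f (x + h)))"
        using L2_mult_integrable(1)[OF f2 L2_translation(1)[OF f2, of h]] integrable_completion[OF mm] by simp
      show "(LINT x|lborel. norm (f x) * norm (f (x + h))) \<le> (L2_norm f)\<^sup>2"
        using L2_mult_integrable(2)[OF f2 L2_translation(1)[OF f2, of h]] integral_completion[OF mm]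
          L2_translation(2)[OF f2, of h] by (simp add: power2_eq_square)
    qed
    have ix: "integrable lborel (\<lambda>x. complex_of_real (gauss v) * (f x * cnj (f (x + e *\<^sub>R v))))" for v
    proof (rule Bochner_Integration.integrable_bound)
      show "integrable lborel (\<lambda>x. gauss v * (norm (f x) * norm (f (x + e *\<^sub>R v))))" using ff by (rule integrable_mult_right)
      show "(\<lambda>x. complex_of_real (gauss v) * (f x * cnj (f (x + e *\<^sub>R v)))) \<in> borel_measurable lborel" using fm by measurable
    qed (simp add: norm_mult gauss_nonneg)
    show "integrable (lborel \<Otimes>\<^sub>M lborel) (\<lambda>(v, x). complex_of_real (gauss v) * (f x * cnj (f (x + e *\<^sub>R v))))"
    proof (rule lborel_pair.Fubini_integrable[OF m])
      show "AE v in lborel. integrable lborel (\<lambda>x. case (v, x) of (v, x) \<Rightarrow> complex_of_real (gauss v) * (f x * cnj (f (x + e *\<^sub>R v))))"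
        using ix by simp
      have "integrable lborel (\<lambda>v. LINT x|lborel. norm (complex_of_real (gauss v) * (f x * cnj (f (x + e *\<^sub>R v)))))"
      proof (rule Bochner_Integration.integrable_bound)
        show "integrable lborel (\<lambda>v::real^'n. gauss v * (L2_norm f)\<^sup>2)" using integrable_gauss by (rule integrable_mult_left)
        have "(\<lambda>(v, x). norm (complex_of_real (gauss v) * (f x * cnj (f (x + e *\<^sub>R v))))) \<in> borel_measurable (lborel \<Otimes>\<^sub>M lborel)"
          using measurable_compose[OF m borel_measurable_norm] by (simp add: case_prod_beta')
        then show "(\<lambda>v. LINT x|lborel. norm (complex_of_real (gauss v) * (f x * cnj (f (x + e *\<^sub>R v))))) \<in> borel_measurable lborel"
          by (rule lborel.borel_measurable_lebesgue_integral)
        show "AE v in lborel. norm (LINT x|lborel. norm (complex_of_real (gauss v) * (f x * cnj (f (x + e *\<^sub>R v))))) \<le> norm (gauss v * (L2_norm f)\<^sup>2)"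
        proof (rule AE_I2)
          fix v :: "real^'n"
          have "(LINT x|lborel. norm (complex_of_real (gauss v) * (f x * cnj (f (x + e *\<^sub>R v))))) = gauss v * (LINT x|lborel. norm (f x) * norm (f (x + e *\<^sub>R v)))"
            by (simp add: norm_mult gauss_nonneg)
          also have "\<dots> \<le> gauss v * (L2_norm f)\<^sup>2" using fl gauss_nonneg by (intro mult_left_mono) auto
          finally show "norm (LINT x|lborel. norm (complex_of_real (gauss v) * (f x * cnj (f (x + e *\<^sub>R v))))) \<le> norm (gauss v * (L2_norm f)\<^sup>2)"
            by (simp add: gauss_nonneg)
        qed
      qed
      then show "integrable lborel (\<lambda>v. LINT x|lborel. norm (case (v, x) of (v, x) \<Rightarrow> complex_of_real (gauss v) * (f x * cnj (f (x + e *\<^sub>R v)))))" by simp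
    qed
  qed
  finally show "of_real (LINT \<xi>|lborel. (norm (raw_fourier f \<xi>))\<^sup>2 * gauss (e *\<^sub>R \<xi>)) =
      of_real (sqrt (2 * pi) ^ CARD('n)) * (LINT v|lborel. of_real (gauss v) * (LINT x|lborel. f x * cnj (f (x + e *\<^sub>R v))))"
    by (simp add: d_def)
qed

text \<open>In the limit \<open>e \<rightarrow> 0\<close> the weight increases to a constant, so monotone convergence applies on the side
  of the transform. On the other side the autocorrelation at small shifts tends to the square of the norm by
  continuity of translations.\<close>

lemma plancherel_borel:
  fixes f :: "real^'n \<Rightarrow> complex"
  assumes f[measurable]: "f \<in> borel_measurable borel" and fi: "integrable lborel f" and f2: "L2 f"
  shows "(\<integral>\<^sup>+\<xi>. ennreal ((norm (raw_fourier f \<xi>))\<^sup>2) \<partial>lborel) = ennreal ((2 * pi) ^ CARD('n) * (L2_norm f)\<^sup>2)"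
proof -
  define d where "d = sqrt (2 * pi) ^ CARD('n)"
  have d: "d > 0" by (simp add: d_def)
  have dd: "d * d = (2 * pi) ^ CARD('n)"
  proof -
    have "d * d = (sqrt (2 * pi) * sqrt (2 * pi)) ^ CARD('n)" unfolding d_def by (rule power_mult_distrib[symmetric])
    also have "sqrt (2 * pi) * sqrt (2 * pi) = 2 * pi" by (rule real_sqrt_mult_self[THEN trans]) simp
    finally show ?thesis .
  qed
  define ek where "ek k = 1 / real (Suc k)" for k
  have ek: "ek k > 0" for k by (simp add: ek_def)
  have ek0: "ek \<longlonglongrightarrow> 0" unfolding ek_def by (rule LIMSEQ_Suc[OF lim_1_over_n])
  note Fm[measurable] = raw_fourier_measurable[OF f]
  define A where "A h = (LINT x|lborel. f x * cnj (f (x + h)))" for h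
  have cnjf: "(\<lambda>x. cnj (f x)) \<in> borel_measurable borel"
    by (rule measurable_compose[OF f borel_measurable_continuous_onI]) (intro continuous_intros)
  have cnjf2: "L2 (\<lambda>x. cnj (f (x + h)))" for h
  proof (rule L2_bound(1)[OF L2_translation(1)[OF f2, of h], of _ 1])
    have "(\<lambda>x. cnj (f (x + h))) \<in> borel_measurable borel" by (rule measurable_compose[OF _ cnjf]) measurable
    then show "(\<lambda>x. cnj (f (x + h))) \<in> borel_measurable lebesgue" by (simp add: measurable_completion)
  qed simp
  have Al: "A h = (LINT x|lebesgue. f x * cnj (f (x + h)))" for h
  proof -
    have "(\<lambda>x. cnj (f (x + h))) \<in> borel_measurable borel" by (rule measurable_compose[OF _ cnjf]) measurable
    then have "(\<lambda>x. f x * cnj (f (x + h))) \<in> borel_measurable lborel" by measurable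
    then show ?thesis unfolding A_def by (simp add: integral_completion)
  qed
  have nt: "L2_norm (\<lambda>x. cnj (f (x + h))) = L2_norm f" for h
    using L2_translation(2)[OF f2, of h] by (simp add: L2_norm_def)
  have Ab: "norm (A h) \<le> (L2_norm f)\<^sup>2" for h
    using cauchy_schwarz_L2(2)[OF f2 cnjf2[of h]] nt[of h] by (simp add: Al power2_eq_square)
  have A0: "A 0 = of_real ((L2_norm f)\<^sup>2)"
  proof -
    have "A 0 = (LINT x|lebesgue. complex_of_real ((norm (f x))\<^sup>2))" unfolding Al complex_norm_square by simp
    then show ?thesis by (simp only: integral_complex_of_real L2_norm_power2)
  qed
  have Alim: "(\<lambda>k. A (ek k *\<^sub>R v)) \<longlonglongrightarrow> A 0" for v
  proof -
    have h: "(\<lambda>k. ek k *\<^sub>R v) \<longlonglongrightarrow> 0" using tendsto_scaleR[OF ek0 tendsto_const[of v]] by simp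
    have "norm (A (ek k *\<^sub>R v) - A 0) \<le> L2_norm f * L2_norm (\<lambda>x. f (x + ek k *\<^sub>R v) - f x)" for k
    proof -
      have "A (ek k *\<^sub>R v) - A 0 = (LINT x|lebesgue. f x * (cnj (f (x + ek k *\<^sub>R v)) - cnj (f (x + 0))))"
        unfolding Al right_diff_distrib
        by (rule Bochner_Integration.integral_diff[symmetric]) (rule cauchy_schwarz_L2(1)[OF f2 cnjf2])+
      also have "norm \<dots> \<le> L2_norm f * L2_norm (\<lambda>x. cnj (f (x + ek k *\<^sub>R v)) - cnj (f (x + 0)))"
        by (rule cauchy_schwarz_L2(2)[OF f2 L2_diff(1)[OF cnjf2 cnjf2]])
      also have "L2_norm (\<lambda>x. cnj (f (x + ek k *\<^sub>R v)) - cnj (f (x + 0))) = L2_norm (\<lambda>x. f (x + ek k *\<^sub>R v) - f x)"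
        unfolding L2_norm_def complex_cnj_diff[symmetric] complex_mod_cnj by simp
      finally show ?thesis .
    qed
    then have ev: "\<forall>\<^sub>F k in sequentially. norm (A (ek k *\<^sub>R v) - A 0) \<le> L2_norm f * L2_norm (\<lambda>x. f (x + ek k *\<^sub>R v) - f x)"
      by (rule always_eventually[rule_format])
    have "(\<lambda>k. L2_norm f * L2_norm (\<lambda>x. f (x + ek k *\<^sub>R v) - f x)) \<longlonglongrightarrow> L2_norm f * 0"
      by (intro tendsto_mult tendsto_const L2_translation_continuous[OF f2 h])
    then have "(\<lambda>k. L2_norm f * L2_norm (\<lambda>x. f (x + ek k *\<^sub>R v) - f x)) \<longlonglongrightarrow> 0" by simp
    with ev have "(\<lambda>k. A (ek k *\<^sub>R v) - A 0) \<longlonglongrightarrow> 0" by (rule Lim_null_comparison)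
    then show ?thesis by (simp add: LIM_zero_iff)
  qed
  have gg[measurable]: "(gauss :: real^'n \<Rightarrow> real) \<in> borel_measurable borel"
    using borel_measurable_integrable[OF integrable_gauss] by simp
  have Am: "A \<in> borel_measurable borel"
  proof -
    have sh: "(\<lambda>p :: (real^'n) \<times> (real^'n). cnj (f (snd p + fst p))) \<in> borel_measurable (borel \<Otimes>\<^sub>M borel)"
      by (rule measurable_compose[OF _ cnjf]) measurable
    have "(\<lambda>(h, x). f x * cnj (f (x + h))) \<in> borel_measurable (borel \<Otimes>\<^sub>M lborel)"
      unfolding case_prod_beta' using sh by measurable
    from lborel.borel_measurable_lebesgue_integral[OF this] show ?thesis by (simp add: A_def[abs_def])
  qed
  have lim1: "(\<lambda>k. LINT v|lborel. complex_of_real (gauss v) * A (ek k *\<^sub>R v)) \<longlonglongrightarrow> (LINT v|lborel. complex_of_real (gauss (v::real^'n)) * A 0)"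
  proof (rule integral_dominated_convergence[where w="\<lambda>v. gauss v * (L2_norm f)\<^sup>2"])
    show "(\<lambda>v::real^'n. complex_of_real (gauss v) * A 0) \<in> borel_measurable lborel" by measurable
    show "(\<lambda>v. complex_of_real (gauss v) * A (ek k *\<^sub>R v)) \<in> borel_measurable lborel" for k
    proof -
      have "(\<lambda>v. A (ek k *\<^sub>R v)) \<in> borel_measurable borel" by (rule measurable_compose[OF _ Am]) measurable
      then show ?thesis by measurable
    qed
    show "integrable lborel (\<lambda>v::real^'n. gauss v * (L2_norm f)\<^sup>2)" using integrable_gauss by (rule integrable_mult_left)
    show "AE v in lborel. (\<lambda>k. complex_of_real (gauss v) * A (ek k *\<^sub>R v)) \<longlonglongrightarrow> complex_of_real (gauss v) * A 0"
      by (intro AE_I2 tendsto_mult tendsto_const Alim)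
    show "AE v in lborel. norm (complex_of_real (gauss v) * A (ek k *\<^sub>R v)) \<le> gauss v * (L2_norm f)\<^sup>2" for k
      by (intro AE_I2) (auto simp: norm_mult gauss_nonneg intro!: mult_left_mono Ab)
  qed
  have c0: "(LINT v|lborel. complex_of_real (gauss (v::real^'n)) * A 0) = A 0"
    unfolding integral_mult_left_zero integral_complex_of_real integral_gauss by simp
  have lim2: "(\<lambda>k. LINT v|lborel. complex_of_real (gauss v) * A (ek k *\<^sub>R v)) \<longlonglongrightarrow> of_real ((L2_norm f)\<^sup>2)"
    using lim1 unfolding c0 unfolding A0 .
  define I where "I k = (LINT \<xi>|lborel. (norm (raw_fourier f \<xi>))\<^sup>2 * gauss (ek k *\<^sub>R \<xi>))" for k
  have "(\<lambda>k. complex_of_real (I k)) \<longlonglongrightarrow> complex_of_real d * of_real ((L2_norm f)\<^sup>2)"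
    unfolding I_def plancherel_weighted(2)[OF f fi f2 ek] d_def[symmetric] A_def[symmetric]
    by (intro tendsto_mult tendsto_const lim2)
  then have "(\<lambda>k. complex_of_real (I k)) \<longlonglongrightarrow> complex_of_real (d * (L2_norm f)\<^sup>2)" by simp
  then have "I \<longlonglongrightarrow> d * (L2_norm f)\<^sup>2" by (simp only: tendsto_of_real_iff)
  then have l1: "(\<lambda>k. ennreal (d * I k)) \<longlonglongrightarrow> ennreal (d * (d * (L2_norm f)\<^sup>2))"
    by (intro tendsto_ennrealI tendsto_mult tendsto_const)
  have eq: "ennreal (d * I k) = (\<integral>\<^sup>+\<xi>. ennreal ((norm (raw_fourier f \<xi>))\<^sup>2 * (d * gauss (ek k *\<^sub>R \<xi>))) \<partial>lborel)" for k
  proof -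
    have "d * I k = (LINT \<xi>|lborel. (norm (raw_fourier f \<xi>))\<^sup>2 * (d * gauss (ek k *\<^sub>R \<xi>)))"
      unfolding I_def integral_mult_right_zero[symmetric] by (simp only: mult.left_commute)
    moreover have "integrable lborel (\<lambda>\<xi>. (norm (raw_fourier f \<xi>))\<^sup>2 * (d * gauss (ek k *\<^sub>R \<xi>)))"
      using integrable_mult_right[OF plancherel_weighted(1)[OF f fi f2 ek[of k]], of d] by (simp only: mult.left_commute)
    ultimately show ?thesis
      using d by (subst nn_integral_eq_integral) (auto simp: gauss_nonneg)
  qed
  have l2: "(\<lambda>k. \<integral>\<^sup>+\<xi>. ennreal ((norm (raw_fourier f \<xi>))\<^sup>2 * (d * gauss (ek k *\<^sub>R \<xi>))) \<partial>lborel)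
     \<longlonglongrightarrow> (\<integral>\<^sup>+\<xi>. ennreal ((norm (raw_fourier f \<xi>))\<^sup>2) \<partial>lborel)"
  proof (rule nn_integral_LIMSEQ)
    have dg: "d * gauss (ek k *\<^sub>R \<xi>) = exp (- (ek k * norm \<xi>)\<^sup>2 / 2)" for k and \<xi> :: "real^'n"
      using ek[of k] by (simp add: d_def gauss_eq power_one_over)
    show "incseq (\<lambda>k \<xi>. ennreal ((norm (raw_fourier f \<xi>))\<^sup>2 * (d * gauss (ek k *\<^sub>R \<xi>))))"
    proof (rule incseq_SucI, rule le_funI)
      fix k and \<xi> :: "real^'n"
      have "ek (Suc k) \<le> ek k" by (simp add: ek_def frac_le)
      then have "(ek (Suc k) * norm \<xi>)\<^sup>2 \<le> (ek k * norm \<xi>)\<^sup>2"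
        using ek[of "Suc k"] by (intro power_mono mult_right_mono) auto
      then show "ennreal ((norm (raw_fourier f \<xi>))\<^sup>2 * (d * gauss (ek k *\<^sub>R \<xi>))) \<le> ennreal ((norm (raw_fourier f \<xi>))\<^sup>2 * (d * gauss (ek (Suc k) *\<^sub>R \<xi>)))"
        unfolding dg by (intro ennreal_leI mult_left_mono) auto
    qed
    show "(\<lambda>\<xi>. ennreal ((norm (raw_fourier f \<xi>))\<^sup>2 * (d * gauss (ek k *\<^sub>R \<xi>)))) \<in> borel_measurable lborel" for k
    proof -
      have "(\<lambda>\<xi>::real^'n. gauss (ek k *\<^sub>R \<xi>)) \<in> borel_measurable borel" by (rule measurable_compose[OF _ gg]) measurable
      then show ?thesis by measurable
    qed
    show "(\<lambda>k. ennreal ((norm (raw_fourier f \<xi>))\<^sup>2 * (d * gauss (ek k *\<^sub>R \<xi>)))) \<longlonglongrightarrow> ennreal ((norm (raw_fourier f \<xi>))\<^sup>2)" for \<xi>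
    proof -
      have "(\<lambda>k. exp (- (ek k * norm \<xi>)\<^sup>2 / 2)) \<longlonglongrightarrow> exp (- (0 * norm \<xi>)\<^sup>2 / 2)" by (intro tendsto_intros ek0) auto
      then have "(\<lambda>k. (norm (raw_fourier f \<xi>))\<^sup>2 * (d * gauss (ek k *\<^sub>R \<xi>))) \<longlonglongrightarrow> (norm (raw_fourier f \<xi>))\<^sup>2 * exp (- (0 * norm \<xi>)\<^sup>2 / 2)"
        unfolding dg by (intro tendsto_mult tendsto_const)
      then show ?thesis by (intro tendsto_ennrealI) simp
    qed
  qed
  have "(\<integral>\<^sup>+\<xi>. ennreal ((norm (raw_fourier f \<xi>))\<^sup>2) \<partial>lborel) = ennreal (d * (d * (L2_norm f)\<^sup>2))"
    using LIMSEQ_unique[OF l2 l1[unfolded eq]] .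
  then show ?thesis by (simp add: dd flip: mult.assoc)
qed

section \<open>The Fourier transform on \<open>L\<^sup>2\<close>\<close>

lemma squeeze_LIMSEQ_0:
  fixes f g :: "nat \<Rightarrow> real"
  assumes "\<And>k. 0 \<le> f k" "\<And>k. f k \<le> g k" "g \<longlonglongrightarrow> l" "l = 0"
  shows "f \<longlonglongrightarrow> 0"
  by (rule tendsto_sandwich[of "\<lambda>_. 0" f sequentially g]) (use assms in auto)

text \<open>The unitary normalisation, for functions that are integrable with respect to Lebesgue measure.\<close>

definition fhat :: "(real^'n \<Rightarrow> complex) \<Rightarrow> real^'n \<Rightarrow> complex" where
  "fhat u \<xi> = of_real ((2 * pi) powr (- real CARD('n) / 2)) * (LINT x|lebesgue. cis (- 1 * (x \<bullet> \<xi>)) * u x)"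

definition cutoff :: "real \<Rightarrow> (real^'n \<Rightarrow> complex) \<Rightarrow> real^'n \<Rightarrow> complex" where
  "cutoff R f x = indicator (cball 0 R) x *\<^sub>R f x"

lemma fourier_ball_eq: "fourier_ball R f \<xi> = fhat (cutoff R f) \<xi>"
  unfolding fourier_ball_def fhat_def cutoff_def set_lebesgue_integral_def
  by (simp add: cis_conv_exp mult.commute)

text \<open>A square integrable function on a bounded set is integrable, so its transform is an honest integral.\<close>

lemma plancherel_bounded_support:
  fixes u :: "real^'n \<Rightarrow> complex"
  assumes u: "L2 u" and S: "bounded S" "\<And>x. x \<notin> S \<Longrightarrow> u x = 0"
  shows "integrable lebesgue u" "L2 (fhat u)" "L2_norm (fhat u) = L2_norm u"
proof -
  from S(1) obtain R where "\<forall>x\<in>S. norm x \<le> R" unfolding bounded_iff ..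
  then have R: "u x = 0" if "x \<notin> cball 0 R" for x using S(2)[of x] that by auto
  have i: "L2 (\<lambda>x::real^'n. indicator (cball 0 R) x *\<^sub>R (1::complex))"
    by (rule L2_indicator) (use emeasure_bounded_finite[OF bounded_cball, of "0::real^'n" R] in auto)
  have "(\<lambda>x. u x * (indicator (cball 0 R) x *\<^sub>R (1::complex))) = u"
    by (rule ext) (use R in \<open>auto simp: indicator_def\<close>)
  then show ui: "integrable lebesgue u" using cauchy_schwarz_L2(1)[OF u i] by simp
  obtain g where g: "g \<in> borel_measurable borel" "AE x in lebesgue. u x = g x"
    using borel_representative[OF L2_D(1)[OF u]] .
  have gm: "g \<in> borel_measurable lebesgue" using g(1) by (simp add: measurable_completion)
  have gL: "g \<in> borel_measurable lborel" using g(1) by simp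
  have "integrable lebesgue g" using integrable_cong_AE[OF L2_D(1)[OF u] gm g(2)] ui by simp
  then have gi: "integrable lborel g" using integrable_completion[OF gL] by simp
  have g2: "L2 g" "L2_norm g = L2_norm u" using L2_cong_AE[OF g(2) u gm] by auto
  define c where "c = (2 * pi) powr (- real CARD('n) / 2)"
  have c2: "c\<^sup>2 * (2 * pi) ^ CARD('n) = 1"
  proof -
    have "c\<^sup>2 = (2 * pi) powr (- real CARD('n))" by (simp add: c_def power2_eq_square flip: powr_add)
    also have "\<dots> = inverse ((2 * pi) ^ CARD('n))" by (simp only: powr_minus powr_realpow[of "2 * pi"] pi_gt_zero mult_pos_pos zero_less_numeral)
    finally show ?thesis by (simp only:) (rule left_inverse, simp)
  qed
  have F: "fhat u = (\<lambda>\<xi>. of_real c * raw_fourier g \<xi>)"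
  proof (rule ext)
    fix \<xi> :: "real^'n"
    have k: "(\<lambda>x. cis (- 1 * (x \<bullet> \<xi>))) \<in> borel_measurable borel"
      by (intro borel_measurable_continuous_onI continuous_intros)
    have k2: "(\<lambda>x. cis (- 1 * (x \<bullet> \<xi>))) \<in> borel_measurable lebesgue" using k by (simp add: measurable_completion)
    have "(LINT x|lebesgue. cis (- 1 * (x \<bullet> \<xi>)) * u x) = (LINT x|lebesgue. cis (- 1 * (x \<bullet> \<xi>)) * g x)"
    proof (rule integral_cong_AE)
      show "(\<lambda>x. cis (- 1 * (x \<bullet> \<xi>)) * u x) \<in> borel_measurable lebesgue" using k2 L2_D(1)[OF u] by measurable
      show "(\<lambda>x. cis (- 1 * (x \<bullet> \<xi>)) * g x) \<in> borel_measurable lebesgue" using k2 gm by measurable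
      show "AE x in lebesgue. cis (- 1 * (x \<bullet> \<xi>)) * u x = cis (- 1 * (x \<bullet> \<xi>)) * g x"
        using g(2) by eventually_elim simp
    qed
    also have "\<dots> = raw_fourier g \<xi>"
    proof -
      have "(\<lambda>x. cis (- 1 * (x \<bullet> \<xi>)) * g x) \<in> borel_measurable borel" using k g(1) by measurable
      then show ?thesis unfolding raw_fourier_def by (intro integral_completion) simp
    qed
    finally show "fhat u \<xi> = of_real c * raw_fourier g \<xi>" by (simp add: fhat_def c_def)
  qed
  have Fb: "fhat u \<in> borel_measurable borel" unfolding F using raw_fourier_measurable[OF g(1)] by measurable
  then have Fm: "fhat u \<in> borel_measurable lebesgue" by (simp add: measurable_completion)
  have rm: "(\<lambda>\<xi>. ennreal ((norm (raw_fourier g \<xi>))\<^sup>2)) \<in> borel_measurable lborel"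
  proof -
    have "(\<lambda>\<xi>. ennreal ((norm (raw_fourier g \<xi>))\<^sup>2)) \<in> borel_measurable borel"
      using raw_fourier_measurable[OF g(1)] by measurable
    then show ?thesis by simp
  qed
  have "sq_integral (fhat u) = (\<integral>\<^sup>+\<xi>. ennreal (c\<^sup>2) * ennreal ((norm (raw_fourier g \<xi>))\<^sup>2) \<partial>lborel)"
    unfolding sq_integral_def nn_integral_completion F
    by (simp add: norm_mult power_mult_distrib ennreal_mult)
  also have "\<dots> = ennreal (c\<^sup>2) * (\<integral>\<^sup>+\<xi>. ennreal ((norm (raw_fourier g \<xi>))\<^sup>2) \<partial>lborel)"
    by (rule nn_integral_cmult[OF rm])
  also have "\<dots> = ennreal (c\<^sup>2 * ((2 * pi) ^ CARD('n) * (L2_norm g)\<^sup>2))"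
    unfolding plancherel_borel[OF g(1) gi g2(1)] by (rule ennreal_mult[symmetric]) auto
  also have "c\<^sup>2 * ((2 * pi) ^ CARD('n) * (L2_norm g)\<^sup>2) = (L2_norm u)\<^sup>2"
    using c2 g2(2) by (simp flip: mult.assoc)
  finally have s: "sq_integral (fhat u) = ennreal ((L2_norm u)\<^sup>2)" .
  then show L: "L2 (fhat u)" using Fm by (simp add: L2_iff_sq_integral)
  have "ennreal ((L2_norm (fhat u))\<^sup>2) = ennreal ((L2_norm u)\<^sup>2)" using sq_integral_eq_L2_norm[OF L] s by simp
  then have "(L2_norm (fhat u))\<^sup>2 = (L2_norm u)\<^sup>2" by (simp add: ennreal_inj)
  then show "L2_norm (fhat u) = L2_norm u" by (rule power2_eq_imp_eq) (auto simp: L2_norm_nonneg)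
qed

lemma cis_mult_integrable:
  assumes "integrable lebesgue (u :: real^'n \<Rightarrow> complex)"
  shows "integrable lebesgue (\<lambda>x. cis (- 1 * (x \<bullet> \<xi>)) * u x)"
proof (rule Bochner_Integration.integrable_bound[OF assms])
  have "(\<lambda>x. cis (- 1 * (x \<bullet> \<xi>))) \<in> borel_measurable borel"
    by (intro borel_measurable_continuous_onI continuous_intros)
  then have k2: "(\<lambda>x. cis (- 1 * (x \<bullet> \<xi>))) \<in> borel_measurable lebesgue" by (simp add: measurable_completion)
  show "(\<lambda>x. cis (- 1 * (x \<bullet> \<xi>)) * u x) \<in> borel_measurable lebesgue"
    using k2 borel_measurable_integrable[OF assms] by measurable
qed (simp add: norm_mult)

lemma fhat_diff:
  assumes "integrable lebesgue u" "integrable lebesgue v"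
  shows "fhat (\<lambda>x. u x - v x) \<xi> = fhat u \<xi> - fhat v \<xi>"
  unfolding fhat_def right_diff_distrib
    Bochner_Integration.integral_diff[OF cis_mult_integrable[OF assms(1)] cis_mult_integrable[OF assms(2)]] ..

lemma fhat_translation:
  assumes "u \<in> borel_measurable lebesgue"
  shows "fhat (\<lambda>x. u (x + h)) \<xi> = cis (h \<bullet> \<xi>) * fhat u \<xi>"
proof -
  have "(\<lambda>x. cis (- 1 * ((x - h) \<bullet> \<xi>))) \<in> borel_measurable borel"
    by (intro borel_measurable_continuous_onI continuous_intros)
  then have "(\<lambda>x. cis (- 1 * ((x - h) \<bullet> \<xi>))) \<in> borel_measurable lebesgue" by (simp add: measurable_completion)
  then have "(\<lambda>x. cis (- 1 * ((x - h) \<bullet> \<xi>)) * u x) \<in> borel_measurable lebesgue" using assms by measurable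
  from integral_translation[OF this, of h]
  have "(LINT x|lebesgue. cis (- 1 * (x \<bullet> \<xi>)) * u (x + h)) = (LINT x|lebesgue. cis (- 1 * ((x - h) \<bullet> \<xi>)) * u x)" by simp
  also have "\<dots> = (LINT x|lebesgue. cis (h \<bullet> \<xi>) * (cis (- 1 * (x \<bullet> \<xi>)) * u x))"
    by (intro Bochner_Integration.integral_cong refl) (simp add: cis_mult inner_diff_left flip: mult.assoc)
  finally show ?thesis by (simp add: fhat_def mult.left_commute)
qed

lemma L2_cutoff: "L2 f \<Longrightarrow> L2 (cutoff R f)"
proof -
  assume f: "L2 f"
  have "(\<lambda>x. indicator (cball 0 R) x *\<^sub>R f x) \<in> borel_measurable lebesgue"
    by (intro borel_measurable_scaleR borel_measurable_indicator L2_D(1)[OF f]) simp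
  then have "cutoff R f \<in> borel_measurable lebesgue" by (simp only: cutoff_def[abs_def])
  then show ?thesis by (rule L2_bound(1)[OF f, of _ 1]) (simp add: cutoff_def indicator_def)
qed

lemma cutoff_outside: "x \<notin> cball 0 R \<Longrightarrow> cutoff R f x = 0"
  by (simp add: cutoff_def)

lemma cutoff_eventually: "\<forall>\<^sub>F k in sequentially. cutoff (real k) f x = f x"
proof -
  obtain N where N: "norm x < real N" using reals_Archimedean2 by blast
  show ?thesis
    by (rule eventually_sequentiallyI[of N]) (use N in \<open>auto simp: cutoff_def\<close>)
qed

lemma cutoff_tendsto: assumes "L2 f" shows "(\<lambda>k. L2_norm (\<lambda>x. cutoff (real k) f x - f x)) \<longlonglongrightarrow> 0"
proof (rule L2_dominated_convergence(2)[OF _ assms])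
  show "cutoff (real k) f \<in> borel_measurable lebesgue" for k using L2_cutoff[OF assms] by (rule L2_D)
  show "norm (cutoff (real k) f x) \<le> norm (f x)" for k x by (simp add: cutoff_def indicator_def)
  show "(\<lambda>k. cutoff (real k) f x) \<longlonglongrightarrow> f x" for x by (rule tendsto_eventually[OF cutoff_eventually])
qed

lemma fhat_cutoff:
  assumes "L2 f"
  shows "integrable lebesgue (cutoff R f)" "L2 (fhat (cutoff R f))" "L2_norm (fhat (cutoff R f)) = L2_norm (cutoff R f)"
  using plancherel_bounded_support[OF L2_cutoff[OF assms, of R] bounded_cball[of 0 R] cutoff_outside] by auto

text \<open>The Fourier transform of a square integrable function as a limit along the balls with integer radius,
  with the norm in place of the nonnegative integral.\<close>

definition fourier_pair :: "(real^'n \<Rightarrow> complex) \<Rightarrow> (real^'n \<Rightarrow> complex) \<Rightarrow> bool" where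
  "fourier_pair f F \<longleftrightarrow> L2 f \<and> L2 F \<and> (\<lambda>k. L2_norm (\<lambda>\<xi>. fhat (cutoff (real k) f) \<xi> - F \<xi>)) \<longlonglongrightarrow> 0"

lemma L2_fourier_imp_pair:
  assumes "L2_fourier f F" shows "fourier_pair f F"
proof -
  have f: "L2 f" and F: "L2 F" using assms by (auto simp: L2_fourier_def)
  have "((\<lambda>R. sq_integral (\<lambda>\<xi>. fhat (cutoff R f) \<xi> - F \<xi>)) \<longlongrightarrow> 0) at_top"
    using assms unfolding L2_fourier_def sq_integral_def fourier_ball_eq by blast
  then have "(\<lambda>k. sq_integral (\<lambda>\<xi>. fhat (cutoff (real k) f) \<xi> - F \<xi>)) \<longlonglongrightarrow> 0"
    by (rule filterlim_compose) (rule filterlim_real_sequentially)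
  moreover have "sq_integral (\<lambda>\<xi>. fhat (cutoff (real k) f) \<xi> - F \<xi>) = ennreal ((L2_norm (\<lambda>\<xi>. fhat (cutoff (real k) f) \<xi> - F \<xi>))\<^sup>2)" for k
    by (rule sq_integral_eq_L2_norm[OF L2_diff(1)[OF fhat_cutoff(2)[OF f] F]])
  ultimately have "(\<lambda>k. ennreal ((L2_norm (\<lambda>\<xi>. fhat (cutoff (real k) f) \<xi> - F \<xi>))\<^sup>2)) \<longlonglongrightarrow> ennreal 0" by simp
  then have "(\<lambda>k. (L2_norm (\<lambda>\<xi>. fhat (cutoff (real k) f) \<xi> - F \<xi>))\<^sup>2) \<longlonglongrightarrow> 0"
    by (subst (asm) tendsto_ennreal_iff) auto
  then have "(\<lambda>k. sqrt ((L2_norm (\<lambda>\<xi>. fhat (cutoff (real k) f) \<xi> - F \<xi>))\<^sup>2)) \<longlonglongrightarrow> sqrt 0" by (rule tendsto_real_sqrt)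
  then have "(\<lambda>k. L2_norm (\<lambda>\<xi>. fhat (cutoff (real k) f) \<xi> - F \<xi>)) \<longlonglongrightarrow> 0" by (simp add: L2_norm_nonneg)
  then show ?thesis using f F by (simp add: fourier_pair_def)
qed

theorem plancherel: assumes "fourier_pair f F" shows "L2_norm F = L2_norm f"
proof -
  have f: "L2 f" and F: "L2 F" and lim: "(\<lambda>k. L2_norm (\<lambda>\<xi>. fhat (cutoff (real k) f) \<xi> - F \<xi>)) \<longlonglongrightarrow> 0"
    using assms by (auto simp: fourier_pair_def)
  have 1: "(\<lambda>k. L2_norm (fhat (cutoff (real k) f))) \<longlonglongrightarrow> L2_norm F"
    by (rule tendsto_L2_norm[OF always_eventually F lim]) (use fhat_cutoff(2)[OF f] in auto)
  have 2: "(\<lambda>k. L2_norm (cutoff (real k) f)) \<longlonglongrightarrow> L2_norm f"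
    by (rule tendsto_L2_norm[OF always_eventually f cutoff_tendsto[OF f]]) (use L2_cutoff[OF f] in auto)
  show ?thesis using LIMSEQ_unique[OF 1 2[folded fhat_cutoff(3)[OF f]]] .
qed

lemma fourier_pair_diff:
  assumes "fourier_pair f F" "fourier_pair g G" shows "fourier_pair (\<lambda>x. f x - g x) (\<lambda>\<xi>. F \<xi> - G \<xi>)"
proof -
  have f: "L2 f" "L2 F" "L2 g" "L2 G"
    and lim: "(\<lambda>k. L2_norm (\<lambda>\<xi>. fhat (cutoff (real k) f) \<xi> - F \<xi>)) \<longlonglongrightarrow> 0"
      "(\<lambda>k. L2_norm (\<lambda>\<xi>. fhat (cutoff (real k) g) \<xi> - G \<xi>)) \<longlonglongrightarrow> 0"
    using assms by (auto simp: fourier_pair_def)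
  have eq: "fhat (cutoff R (\<lambda>x. f x - g x)) \<xi> = fhat (cutoff R f) \<xi> - fhat (cutoff R g) \<xi>" for R \<xi>
  proof -
    have "cutoff R (\<lambda>x. f x - g x) = (\<lambda>x. cutoff R f x - cutoff R g x)"
      by (rule ext) (simp add: cutoff_def scaleR_diff_right)
    then show ?thesis
      using fhat_diff[OF fhat_cutoff(1)[OF f(1), of R] fhat_cutoff(1)[OF f(3), of R], of \<xi>] by simp
  qed
  have le: "L2_norm (\<lambda>\<xi>. fhat (cutoff (real k) (\<lambda>x. f x - g x)) \<xi> - (F \<xi> - G \<xi>)) \<le>
      L2_norm (\<lambda>\<xi>. fhat (cutoff (real k) f) \<xi> - F \<xi>) + L2_norm (\<lambda>\<xi>. fhat (cutoff (real k) g) \<xi> - G \<xi>)" for k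
    using L2_diff(2)[OF L2_diff(1)[OF fhat_cutoff(2)[OF f(1), of "real k"] f(2)] L2_diff(1)[OF fhat_cutoff(2)[OF f(3), of "real k"] f(4)]]
    unfolding eq by (simp add: algebra_simps)
  have "(\<lambda>k. L2_norm (\<lambda>\<xi>. fhat (cutoff (real k) f) \<xi> - F \<xi>) + L2_norm (\<lambda>\<xi>. fhat (cutoff (real k) g) \<xi> - G \<xi>)) \<longlonglongrightarrow> 0 + 0"
    by (intro tendsto_add lim)
  from squeeze_LIMSEQ_0[OF L2_norm_nonneg le this] have "(\<lambda>k. L2_norm (\<lambda>\<xi>. fhat (cutoff (real k) (\<lambda>x. f x - g x)) \<xi> - (F \<xi> - G \<xi>))) \<longlonglongrightarrow> 0"
    by simp
  then show ?thesis using L2_diff(1)[OF f(1,3)] L2_diff(1)[OF f(2,4)] by (simp add: fourier_pair_def)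
qed

text \<open>Translation moves the balls of the truncation. The difference between the truncations to the balls around 0
  and around \<open>h\<close> tends to 0 in norm, and so does its transform.\<close>

lemma fourier_pair_translation:
  assumes "fourier_pair f F" shows "fourier_pair (\<lambda>x. f (x + h)) (\<lambda>\<xi>. cis (h \<bullet> \<xi>) * F \<xi>)"
proof -
  have f: "L2 f" and F: "L2 F" and lim: "(\<lambda>k. L2_norm (\<lambda>\<xi>. fhat (cutoff (real k) f) \<xi> - F \<xi>)) \<longlonglongrightarrow> 0"
    using assms by (auto simp: fourier_pair_def)
  have fh: "L2 (\<lambda>x. f (x + h))" using L2_translation(1)[OF f] .
  have cm: "(\<lambda>\<xi>. cis (h \<bullet> \<xi>)) \<in> borel_measurable lebesgue"
    using borel_measurable_continuous_onI[of "\<lambda>\<xi>. cis (h \<bullet> \<xi>)"] by (simp add: measurable_completion continuous_intros)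
  have cF: "L2 (\<lambda>\<xi>. cis (h \<bullet> \<xi>) * F \<xi>)"
  proof (rule L2_bound(1)[OF F, of _ 1])
    show "(\<lambda>\<xi>. cis (h \<bullet> \<xi>) * F \<xi>) \<in> borel_measurable lebesgue" using cm L2_D(1)[OF F] by measurable
  qed (simp add: norm_mult)
  \<comment> \<open>the truncation to the ball around \<open>h\<close>\<close>
  define u where "u k x = cutoff (real k) (\<lambda>x. f (x + h)) (x + - h)" for k x
  have u2: "L2 (u k)" for k unfolding u_def by (rule L2_translation(1)[OF L2_cutoff[OF fh]])
  have u_eq: "u k x = indicator (cball 0 (real k)) (x - h) *\<^sub>R f x" for k x by (simp add: u_def cutoff_def)
  have ub: "u k x = 0" if "x \<notin> cball h (real k)" for k x using that by (auto simp: u_eq dist_norm norm_minus_commute)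
  note U = plancherel_bounded_support[OF u2 bounded_cball ub]
  have eq: "fhat (cutoff (real k) (\<lambda>x. f (x + h))) \<xi> = cis (h \<bullet> \<xi>) * fhat (u k) \<xi>" for k \<xi>
    using fhat_translation[OF L2_D(1)[OF u2[of k]], of h \<xi>] by (simp add: u_def)
  define v where "v k x = u k x - cutoff (real k) f x" for k x
  have v2: "L2 (v k)" for k unfolding v_def by (rule L2_diff(1)[OF u2 L2_cutoff[OF f]])
  have vb: "v k x = 0" if "x \<notin> cball h (real k) \<union> cball 0 (real k)" for k x
    using that ub[of x k] cutoff_outside[of x "real k" f] by (simp add: v_def)
  have nv: "L2_norm (\<lambda>\<xi>. fhat (u k) \<xi> - fhat (cutoff (real k) f) \<xi>) = L2_norm (v k)" for k
  proof -
    have "(\<lambda>\<xi>. fhat (u k) \<xi> - fhat (cutoff (real k) f) \<xi>) = fhat (v k)"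
      unfolding v_def by (rule ext) (rule fhat_diff[OF U(1) fhat_cutoff(1)[OF f], symmetric])
    then show ?thesis using plancherel_bounded_support(3)[OF v2, of "cball h (real k) \<union> cball 0 (real k)" k] vb by simp
  qed
  have "(\<lambda>k. L2_norm (\<lambda>x. v k x - 0)) \<longlonglongrightarrow> 0"
  proof (rule L2_dominated_convergence(2)[OF _ f])
    show "v k \<in> borel_measurable lebesgue" for k using v2 by (rule L2_D)
    show "norm (v k x) \<le> norm (f x)" for k x by (simp add: v_def u_eq cutoff_def indicator_def)
    show "(\<lambda>k. v k x) \<longlonglongrightarrow> 0" for x
    proof (rule tendsto_eventually)
      show "\<forall>\<^sub>F k in sequentially. v k x = 0"
        using cutoff_eventually[of "\<lambda>x. f (x + h)" "x + - h"] cutoff_eventually[of f x]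
        by eventually_elim (simp add: v_def u_def)
    qed
  qed
  then have vl: "(\<lambda>k. L2_norm (v k)) \<longlonglongrightarrow> 0" by simp
  have le: "L2_norm (\<lambda>\<xi>. fhat (cutoff (real k) (\<lambda>x. f (x + h))) \<xi> - cis (h \<bullet> \<xi>) * F \<xi>) \<le>
      L2_norm (v k) + L2_norm (\<lambda>\<xi>. fhat (cutoff (real k) f) \<xi> - F \<xi>)" for k
  proof -
    have "L2_norm (\<lambda>\<xi>. fhat (cutoff (real k) (\<lambda>x. f (x + h))) \<xi> - cis (h \<bullet> \<xi>) * F \<xi>) = L2_norm (\<lambda>\<xi>. fhat (u k) \<xi> - F \<xi>)"
      unfolding eq right_diff_distrib[symmetric] L2_norm_def norm_mult by simp
    also have "\<dots> \<le> L2_norm (\<lambda>\<xi>. fhat (u k) \<xi> - fhat (cutoff (real k) f) \<xi>) + L2_norm (\<lambda>\<xi>. fhat (cutoff (real k) f) \<xi> - F \<xi>)"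
      by (rule L2_norm_triangle[OF U(2) fhat_cutoff(2)[OF f] F])
    finally show ?thesis unfolding nv .
  qed
  have "(\<lambda>k. L2_norm (v k) + L2_norm (\<lambda>\<xi>. fhat (cutoff (real k) f) \<xi> - F \<xi>)) \<longlonglongrightarrow> 0 + 0"
    by (intro tendsto_add lim vl)
  from squeeze_LIMSEQ_0[OF L2_norm_nonneg le this] have "(\<lambda>k. L2_norm (\<lambda>\<xi>. fhat (cutoff (real k) (\<lambda>x. f (x + h))) \<xi> - cis (h \<bullet> \<xi>) * F \<xi>)) \<longlonglongrightarrow> 0"
    by simp
  then show ?thesis using fh cF by (simp add: fourier_pair_def)
qed

text \<open>The weak gradient is tested with real functions; complex ones are split into real and imaginary part.\<close>

definition cpartial :: "'n \<Rightarrow> (real^'n \<Rightarrow> complex) \<Rightarrow> real^'n \<Rightarrow> complex" where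
  "cpartial i \<phi> x = Complex (partial_deriv i (\<lambda>x. Re (\<phi> x)) x) (partial_deriv i (\<lambda>x. Im (\<phi> x)) x)"

lemma ctest_cpartial: "ctest \<phi> \<Longrightarrow> ctest (cpartial i \<phi>)"
  by (auto simp: ctest_def cpartial_def dest: test_function_D(4))

lemma line_derivative:
  assumes "test_function f"
  shows "((\<lambda>s. f (x + s *\<^sub>R axis i 1)) has_real_derivative partial_deriv i f (x + s *\<^sub>R axis i 1)) (at s)"
proof -
  let ?y = "x + s *\<^sub>R axis i 1"
  have "f differentiable (at ?y)" by (rule test_function_D(2)[OF assms])
  then have d: "(f has_derivative frechet_derivative f (at ?y)) (at ?y)" by (simp add: frechet_derivative_works)
  have "((\<lambda>s. x + s *\<^sub>R axis i 1) has_derivative (\<lambda>h. h *\<^sub>R axis i 1)) (at s)"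
    by (auto intro!: derivative_eq_intros)
  from has_derivative_compose[OF this d]
  have "((\<lambda>s. f (x + s *\<^sub>R axis i 1)) has_derivative (\<lambda>h. frechet_derivative f (at ?y) (h *\<^sub>R axis i 1))) (at s)" .
  moreover have "frechet_derivative f (at ?y) (h *\<^sub>R axis i 1) = partial_deriv i f ?y * h" for h
    using linear_scale[OF has_derivative_linear[OF d], of h "axis i 1"] by (simp add: partial_deriv_def)
  ultimately show ?thesis by (simp add: has_field_derivative_def)
qed

text \<open>The quotients are bounded by the maximum of the derivative and vanish outside a fixed ball.\<close>

lemma difference_quotient_real:
  assumes t: "test_function (f :: real^'n \<Rightarrow> real)" and h: "h \<longlonglongrightarrow> 0" "\<And>k. h k \<noteq> (0::real)"
  shows "(\<lambda>k. L2_norm (\<lambda>x. (f (x + h k *\<^sub>R axis i 1) - f x) / h k - partial_deriv i f x)) \<longlonglongrightarrow> 0"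
proof -
  obtain M where M: "M \<ge> 0" "\<And>x. \<bar>partial_deriv i f x\<bar> \<le> M"
    using test_function_bounded[OF test_function_D(4)[OF t]] by metis
  from test_function_D(3)[OF t] obtain R where "\<forall>x\<in>{x. f x \<noteq> 0}. norm x \<le> R" unfolding bounded_iff ..
  then have R: "f x = 0" if "norm x > R" for x using that by force
  from convergent_imp_bounded[OF h(1)] obtain H where H: "\<And>k. \<bar>h k\<bar> \<le> H" unfolding bounded_iff by auto
  have ind: "L2 (\<lambda>x::real^'n. indicator (cball 0 (R + H)) x *\<^sub>R M)"
    by (rule L2_indicator) (use emeasure_bounded_finite[OF bounded_cball, of "0::real^'n" "R + H"] in auto)
  have le: "norm ((f (x + h k *\<^sub>R axis i 1) - f x) / h k) \<le> norm (indicator (cball 0 (R + H)) x *\<^sub>R M)" for k x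
  proof (cases "norm x \<le> R + H")
    case True
    have "norm (f (x + h k *\<^sub>R axis i 1) - f (x + 0 *\<^sub>R axis i 1)) \<le> M * norm (h k - 0)"
      by (rule field_differentiable_bound[of UNIV "\<lambda>s. f (x + s *\<^sub>R axis i 1)" "\<lambda>s. partial_deriv i f (x + s *\<^sub>R axis i 1)"])
         (use line_derivative[OF t] M in auto)
    then show ?thesis using True h(2)[of k] M(1) by (simp add: divide_le_eq)
  next
    case False
    have "norm x \<le> norm (x + h k *\<^sub>R axis i 1) + norm (h k *\<^sub>R (axis i 1 :: real^'n))"
      using norm_triangle_ineq4[of "x + h k *\<^sub>R axis i 1" "h k *\<^sub>R (axis i 1 :: real^'n)"] by simp
    then have "norm (x + h k *\<^sub>R axis i 1) > R" using False H[of k] by simp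
    moreover have "norm x > R" using False H[of k] by (smt (verit) abs_ge_zero)
    ultimately show ?thesis using R by simp
  qed
  have m: "(\<lambda>x. (f (x + h k *\<^sub>R axis i 1) - f x) / h k) \<in> borel_measurable lebesgue" for k
    using L2_D(1)[OF L2_test_function[OF test_function_translation[OF t]]] L2_D(1)[OF L2_test_function[OF t]] by measurable
  have lim: "(\<lambda>k. (f (x + h k *\<^sub>R axis i 1) - f x) / h k) \<longlonglongrightarrow> partial_deriv i f x" for x
  proof -
    have "((\<lambda>s. (f (x + s *\<^sub>R axis i 1) - f x) / s) \<longlongrightarrow> partial_deriv i f x) (at 0)"
      using line_derivative[OF t, of x i 0] by (simp add: has_field_derivative_iff)
    moreover have "filterlim h (at 0) sequentially" using h by (auto simp: filterlim_at)
    ultimately show ?thesis by (rule filterlim_compose)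
  qed
  show ?thesis by (rule L2_dominated_convergence(2)[OF m ind le lim])
qed

lemma difference_quotient_test:
  assumes p: "ctest \<phi>" and h: "h \<longlonglongrightarrow> 0" "\<And>k. h k \<noteq> (0::real)"
  shows "(\<lambda>k. L2_norm (\<lambda>x. (\<phi> (x + h k *\<^sub>R axis i 1) - \<phi> x) / of_real (h k) - cpartial i \<phi> x)) \<longlonglongrightarrow> 0"
proof -
  have t: "test_function (\<lambda>x. Re (\<phi> x))" "test_function (\<lambda>x. Im (\<phi> x))" using p by (auto simp: ctest_def)
  define d1 where "d1 k x = (Re (\<phi> (x + h k *\<^sub>R axis i 1)) - Re (\<phi> x)) / h k - partial_deriv i (\<lambda>x. Re (\<phi> x)) x" for k x
  define d2 where "d2 k x = (Im (\<phi> (x + h k *\<^sub>R axis i 1)) - Im (\<phi> x)) / h k - partial_deriv i (\<lambda>x. Im (\<phi> x)) x" for k x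
  have quot: "L2 (\<lambda>x. (f (x + a *\<^sub>R axis i 1) - f x) / b - partial_deriv i f x)"
    if f: "test_function f" for f :: "real^'a \<Rightarrow> real" and a b
  proof -
    have "L2 (\<lambda>x. (1 / b) *\<^sub>R (f (x + a *\<^sub>R axis i 1) - f x) - partial_deriv i f x)"
      by (intro L2_diff(1) L2_scaleR L2_test_function f test_function_translation[OF f] test_function_D(4)[OF f])
    then show ?thesis by simp
  qed
  have L: "L2 (d1 k)" "L2 (d2 k)" for k unfolding d1_def d2_def using quot[OF t(1)] quot[OF t(2)] by auto
  have m: "(\<lambda>x. complex_of_real (d1 k x)) \<in> borel_measurable lebesgue" "(\<lambda>x. \<i> * complex_of_real (d2 k x)) \<in> borel_measurable lebesgue" for k
    using L2_D(1)[OF L(1)[of k]] L2_D(1)[OF L(2)[of k]] by measurable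
  have b1: "L2 (\<lambda>x. complex_of_real (d1 k x))" "L2_norm (\<lambda>x. complex_of_real (d1 k x)) \<le> 1 * L2_norm (d1 k)" for k
    using L2_bound[OF L(1) m(1), of k 1] by auto
  have b2: "L2 (\<lambda>x. \<i> * complex_of_real (d2 k x))" "L2_norm (\<lambda>x. \<i> * complex_of_real (d2 k x)) \<le> 1 * L2_norm (d2 k)" for k
    using L2_bound[OF L(2) m(2), of k 1] by (auto simp: norm_mult)
  have eq: "(\<phi> (x + h k *\<^sub>R axis i 1) - \<phi> x) / of_real (h k) - cpartial i \<phi> x = complex_of_real (d1 k x) + \<i> * complex_of_real (d2 k x)" for k x
    by (simp add: complex_eq_iff d1_def d2_def cpartial_def)
  have le: "L2_norm (\<lambda>x. (\<phi> (x + h k *\<^sub>R axis i 1) - \<phi> x) / of_real (h k) - cpartial i \<phi> x) \<le> L2_norm (d1 k) + L2_norm (d2 k)" for k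
    unfolding eq using L2_add(2)[OF b1(1) b2(1), of k k] b1(2)[of k] b2(2)[of k] by simp
  have "(\<lambda>k. L2_norm (d1 k) + L2_norm (d2 k)) \<longlonglongrightarrow> 0 + 0"
    unfolding d1_def d2_def by (intro tendsto_add difference_quotient_real t h)
  from squeeze_LIMSEQ_0[OF L2_norm_nonneg le this] show ?thesis by simp
qed

section \<open>Weak derivatives and the Fourier transform\<close>

lemma L2_vec_nth:
  assumes "L2 (g :: real^'n \<Rightarrow> complex^'n)" shows "L2 (\<lambda>x. g x $ i)"
proof (rule L2_bound(1)[OF assms, of _ 1])
  have "(\<lambda>v::complex^'n. v $ i) \<in> borel_measurable borel"
    by (intro borel_measurable_continuous_onI linear_continuous_on bounded_linear_vec_nth)
  then show "(\<lambda>x. g x $ i) \<in> borel_measurable lebesgue" by (rule measurable_compose[OF L2_D(1)[OF assms]])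
qed (use Finite_Cartesian_Product.norm_nth_le in auto)

lemma norm_vec_power2: "(norm (v :: 'a::real_normed_vector ^'n))\<^sup>2 = (\<Sum>i\<in>UNIV. (norm (v $ i))\<^sup>2)"
  by (simp add: norm_vec_def L2_set_def sum_nonneg)

lemma weak_gradient_ctest:
  assumes f: "L2 f" and g: "L2 g" and w: "weak_gradient f g" and p: "ctest \<phi>"
  shows "(LINT x|lebesgue. f x * cpartial i \<phi> x) = - (LINT x|lebesgue. g x $ i * \<phi> x)"
proof -
  have t: "test_function (\<lambda>x. Re (\<phi> x))" "test_function (\<lambda>x. Im (\<phi> x))" using p by (auto simp: ctest_def)
  have c: "L2 (\<lambda>x. complex_of_real (q x))" if "test_function q" for q :: "real^'n \<Rightarrow> real"
    by (rule L2_ctest[OF ctest_of_real[OF that]])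
  have split: "(LINT x|lebesgue. u x * Complex (p x) (q x)) =
      (LINT x|lebesgue. u x * of_real (p x)) + \<i> * (LINT x|lebesgue. u x * of_real (q x))"
    if "L2 u" "test_function p" "test_function q" for u :: "real^'n \<Rightarrow> complex" and p q :: "real^'n \<Rightarrow> real"
  proof -
    have 1: "integrable lebesgue (\<lambda>x. u x * of_real (p x))" "integrable lebesgue (\<lambda>x. u x * of_real (q x))"
      using that by (auto intro: cauchy_schwarz_L2(1) c)
    have "(LINT x|lebesgue. u x * Complex (p x) (q x)) = (LINT x|lebesgue. u x * of_real (p x) + \<i> * (u x * of_real (q x)))"
      by (intro Bochner_Integration.integral_cong refl) (simp add: Complex_eq algebra_simps)
    also have "\<dots> = (LINT x|lebesgue. u x * of_real (p x)) + (LINT x|lebesgue. \<i> * (u x * of_real (q x)))"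
      using 1 by (intro Bochner_Integration.integral_add integrable_mult_right)
    finally show ?thesis unfolding integral_mult_right_zero .
  qed
  have "(LINT x|lebesgue. f x * cpartial i \<phi> x) =
      (LINT x|lebesgue. f x * of_real (partial_deriv i (\<lambda>x. Re (\<phi> x)) x)) + \<i> * (LINT x|lebesgue. f x * of_real (partial_deriv i (\<lambda>x. Im (\<phi> x)) x))"
    unfolding cpartial_def by (intro split f test_function_D(4) t)
  also have "\<dots> = - ((LINT x|lebesgue. g x $ i * of_real (Re (\<phi> x))) + \<i> * (LINT x|lebesgue. g x $ i * of_real (Im (\<phi> x))))"
    using w t unfolding weak_gradient_def by simp
  also have "(LINT x|lebesgue. g x $ i * of_real (Re (\<phi> x))) + \<i> * (LINT x|lebesgue. g x $ i * of_real (Im (\<phi> x))) =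
      (LINT x|lebesgue. g x $ i * Complex (Re (\<phi> x)) (Im (\<phi> x)))"
    by (intro split[symmetric] L2_vec_nth g t)
  finally show ?thesis by simp
qed

lemma pairing_difference_quotient:
  fixes f :: "real^'n \<Rightarrow> complex"
  assumes f: "L2 f" and p: "ctest \<phi>" and h: "h \<longlonglongrightarrow> 0" "\<And>k. h k \<noteq> (0::real)"
  shows "(\<lambda>k. LINT x|lebesgue. f x * ((\<phi> (x + h k *\<^sub>R axis i 1) - \<phi> x) / of_real (h k) - cpartial i \<phi> x)) \<longlonglongrightarrow> 0"
    and "integrable lebesgue (\<lambda>x. f x * ((\<phi> (x + s *\<^sub>R axis i 1) - \<phi> x) / of_real s))"
proof -
  have q: "L2 (\<lambda>x. (\<phi> (x + s *\<^sub>R axis i 1) - \<phi> x) / of_real s)" for s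
  proof -
    have "L2 (\<lambda>x. (1 / of_real s) * (\<phi> (x + s *\<^sub>R axis i 1) - \<phi> x))"
      by (intro L2_cmult L2_diff(1) L2_ctest p ctest_translation)
    then show ?thesis by simp
  qed
  show "integrable lebesgue (\<lambda>x. f x * ((\<phi> (x + s *\<^sub>R axis i 1) - \<phi> x) / of_real s))"
    by (rule cauchy_schwarz_L2(1)[OF f q])
  have le: "norm (LINT x|lebesgue. f x * ((\<phi> (x + h k *\<^sub>R axis i 1) - \<phi> x) / of_real (h k) - cpartial i \<phi> x)) \<le>
    L2_norm f * L2_norm (\<lambda>x. (\<phi> (x + h k *\<^sub>R axis i 1) - \<phi> x) / of_real (h k) - cpartial i \<phi> x)" for k
    by (rule cauchy_schwarz_L2(2)[OF f L2_diff(1)[OF q L2_ctest[OF ctest_cpartial[OF p]]]])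
  have "(\<lambda>k. L2_norm f * L2_norm (\<lambda>x. (\<phi> (x + h k *\<^sub>R axis i 1) - \<phi> x) / of_real (h k) - cpartial i \<phi> x)) \<longlonglongrightarrow> L2_norm f * 0"
    by (intro tendsto_mult tendsto_const difference_quotient_test p h)
  from squeeze_LIMSEQ_0[OF norm_ge_zero le this]
  show "(\<lambda>k. LINT x|lebesgue. f x * ((\<phi> (x + h k *\<^sub>R axis i 1) - \<phi> x) / of_real (h k) - cpartial i \<phi> x)) \<longlonglongrightarrow> 0"
    by (simp add: tendsto_norm_zero_iff)
qed

text \<open>Moving the test function along an axis differentiates the pairing, and the weak derivative
  appears.\<close>

lemma pairing_has_derivative:
  fixes f :: "real^'n \<Rightarrow> complex"
  assumes f: "L2 f" and g: "L2 g" and w: "weak_gradient f g" and p: "ctest \<phi>"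
  shows "((\<lambda>s. LINT x|lebesgue. f x * \<phi> (x + (- s) *\<^sub>R axis i 1)) has_derivative
    (\<lambda>y. y *\<^sub>R (LINT x|lebesgue. g x $ i * \<phi> (x + (- s) *\<^sub>R axis i 1)))) (at s)"
  unfolding has_derivative_iff_norm
proof (intro conjI bounded_linear_scaleR_left)
  define \<psi> where "\<psi> x = \<phi> (x + (- s) *\<^sub>R axis i 1)" for x
  have q: "ctest \<psi>" unfolding \<psi>_def by (rule ctest_translation[OF p])
  define D where "D = (LINT x|lebesgue. g x $ i * \<psi> x)"
  have D: "D = - (LINT x|lebesgue. f x * cpartial i \<psi> x)" using weak_gradient_ctest[OF f g w q] by (simp add: D_def)
  have ic: "integrable lebesgue (\<lambda>x. f x * cpartial i \<psi> x)" by (rule cauchy_schwarz_L2(1)[OF f L2_ctest[OF ctest_cpartial[OF q]]])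
  have ip: "integrable lebesgue (\<lambda>x. f x * \<phi> (x + h))" for h by (rule cauchy_schwarz_L2(1)[OF f L2_ctest[OF ctest_translation[OF p]]])
  show "((\<lambda>y. norm (((LINT x|lebesgue. f x * \<phi> (x + (- y) *\<^sub>R axis i 1)) - (LINT x|lebesgue. f x * \<phi> (x + (- s) *\<^sub>R axis i 1)))
      - (y - s) *\<^sub>R (LINT x|lebesgue. g x $ i * \<phi> (x + (- s) *\<^sub>R axis i 1))) / norm (y - s)) \<longlongrightarrow> 0) (at s)"
    unfolding tendsto_at_iff_sequentially comp_def
  proof (intro allI impI)
    fix X :: "nat \<Rightarrow> real" assume X: "\<forall>k. X k \<in> UNIV - {s}" "X \<longlonglongrightarrow> s"
    define h where "h k = s - X k" for k
    have h0: "h k \<noteq> 0" for k using X(1)[rule_format, of k] by (simp add: h_def)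
    have "(\<lambda>k. s - X k) \<longlonglongrightarrow> s - s" by (intro tendsto_intros X(2))
    then have hl: "h \<longlonglongrightarrow> 0" by (simp add: h_def[abs_def])
    have eq: "((LINT x|lebesgue. f x * \<phi> (x + (- X k) *\<^sub>R axis i 1)) - (LINT x|lebesgue. f x * \<phi> (x + (- s) *\<^sub>R axis i 1)))
      - (X k - s) *\<^sub>R (LINT x|lebesgue. g x $ i * \<phi> (x + (- s) *\<^sub>R axis i 1))
      = of_real (h k) * (LINT x|lebesgue. f x * ((\<psi> (x + h k *\<^sub>R axis i 1) - \<psi> x) / of_real (h k) - cpartial i \<psi> x))" for k
    proof -
      have sh: "\<psi> (x + h k *\<^sub>R axis i 1) = \<phi> (x + (- X k) *\<^sub>R axis i 1)" for x
        by (simp add: \<psi>_def h_def algebra_simps)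
      have "(LINT x|lebesgue. f x * \<phi> (x + (- X k) *\<^sub>R axis i 1)) - (LINT x|lebesgue. f x * \<phi> (x + (- s) *\<^sub>R axis i 1))
         = (LINT x|lebesgue. f x * \<psi> (x + h k *\<^sub>R axis i 1) - f x * \<psi> x)"
        unfolding sh unfolding \<psi>_def by (rule Bochner_Integration.integral_diff[symmetric]) (rule ip)+
      also have "\<dots> = (LINT x|lebesgue. of_real (h k) * (f x * ((\<psi> (x + h k *\<^sub>R axis i 1) - \<psi> x) / of_real (h k))))"
      proof (intro Bochner_Integration.integral_cong refl)
        fix x
        have "of_real (h k) * (z * (y / of_real (h k))) = z * y" for y z :: complex using h0[of k] by simp
        then show "f x * \<psi> (x + h k *\<^sub>R axis i 1) - f x * \<psi> x = of_real (h k) * (f x * ((\<psi> (x + h k *\<^sub>R axis i 1) - \<psi> x) / of_real (h k)))"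
          by (simp only: right_diff_distrib[symmetric])
      qed
      also have "\<dots> = of_real (h k) * (LINT x|lebesgue. f x * ((\<psi> (x + h k *\<^sub>R axis i 1) - \<psi> x) / of_real (h k)))"
        by (rule integral_mult_right_zero)
      finally have 1: "(LINT x|lebesgue. f x * \<phi> (x + (- X k) *\<^sub>R axis i 1)) - (LINT x|lebesgue. f x * \<phi> (x + (- s) *\<^sub>R axis i 1))
        = of_real (h k) * (LINT x|lebesgue. f x * ((\<psi> (x + h k *\<^sub>R axis i 1) - \<psi> x) / of_real (h k)))" .
      have 2: "(X k - s) *\<^sub>R (LINT x|lebesgue. g x $ i * \<phi> (x + (- s) *\<^sub>R axis i 1)) = of_real (h k) * (LINT x|lebesgue. f x * cpartial i \<psi> x)"
        using D unfolding D_def \<psi>_def[symmetric] by (simp add: h_def scaleR_conv_of_real algebra_simps)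
      show ?thesis unfolding 1 2 right_diff_distrib
        Bochner_Integration.integral_diff[OF pairing_difference_quotient(2)[OF f q hl h0] ic] ..
    qed
    have "(\<lambda>k. norm (LINT x|lebesgue. f x * ((\<psi> (x + h k *\<^sub>R axis i 1) - \<psi> x) / of_real (h k) - cpartial i \<psi> x))) \<longlonglongrightarrow> 0"
      using tendsto_norm[OF pairing_difference_quotient(1)[OF f q hl h0]] by simp
    moreover have "norm (of_real (h k) * z) / norm (X k - s) = norm z" for k and z :: complex
    proof -
      have "norm (X k - s) = norm (complex_of_real (h k))" by (simp only: norm_of_real h_def real_norm_def abs_minus_commute)
      then show ?thesis using h0[of k] by (simp only: norm_mult) simp
    qed
    ultimately show "(\<lambda>k. norm (((LINT x|lebesgue. f x * \<phi> (x + (- X k) *\<^sub>R axis i 1)) - (LINT x|lebesgue. f x * \<phi> (x + (- s) *\<^sub>R axis i 1)))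
      - (X k - s) *\<^sub>R (LINT x|lebesgue. g x $ i * \<phi> (x + (- s) *\<^sub>R axis i 1))) / norm (X k - s)) \<longlonglongrightarrow> 0"
      unfolding eq by simp
  qed
qed

text \<open>By duality this is the mean value theorem for the pairing of \<open>f\<close> with a moving test function.\<close>

lemma translation_difference_le:
  fixes f :: "real^'n \<Rightarrow> complex"
  assumes f: "L2 f" and g: "L2 g" and w: "weak_gradient f g" and h: "h > 0"
  shows "L2_norm (\<lambda>x. f (x + h *\<^sub>R axis i 1) - f x) \<le> h * L2_norm (\<lambda>x. g x $ i)"
proof (rule L2_norm_le_by_duality)
  note gi = L2_vec_nth[OF g, of i]
  show "L2 (\<lambda>x. f (x + h *\<^sub>R axis i 1) - f x)" by (intro L2_diff(1) L2_translation(1) f)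
  show "0 \<le> h * L2_norm (\<lambda>x. g x $ i)" using h by (intro mult_nonneg_nonneg L2_norm_nonneg) auto
  fix \<phi> :: "real^'n \<Rightarrow> complex" assume p: "ctest \<phi>"
  define a where "a s = (LINT x|lebesgue. f x * \<phi> (x + (- s) *\<^sub>R axis i 1))" for s
  define a' where "a' s = (LINT x|lebesgue. g x $ i * \<phi> (x + (- s) *\<^sub>R axis i 1))" for s
  have d: "(a has_derivative (\<lambda>y. y *\<^sub>R a' s)) (at s)" for s
    unfolding a_def a'_def by (rule pairing_has_derivative[OF f g w p])
  have "continuous_on {0..h} a" using has_derivative_continuous[OF d] by (simp add: continuous_at_imp_continuous_on)
  then obtain s where s: "norm (a h - a 0) \<le> norm ((h - 0) *\<^sub>R a' s)"
    using mvt_general[OF h _ d] by blast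
  have "norm (a' s) \<le> L2_norm (\<lambda>x. g x $ i) * L2_norm (\<lambda>x. \<phi> (x + (- s) *\<^sub>R axis i 1))"
    unfolding a'_def by (rule cauchy_schwarz_L2(2)[OF gi L2_translation(1)[OF L2_ctest[OF p]]])
  also have "L2_norm (\<lambda>x. \<phi> (x + (- s) *\<^sub>R axis i 1)) = L2_norm \<phi>" by (rule L2_translation(2)[OF L2_ctest[OF p]])
  finally have "norm (a h - a 0) \<le> h * L2_norm (\<lambda>x. g x $ i) * L2_norm \<phi>"
    using s h by (simp add: mult.assoc order_trans[OF _ mult_left_mono[of _ _ h]])
  moreover have "(LINT x|lebesgue. (f (x + h *\<^sub>R axis i 1) - f x) * \<phi> x) = a h - a 0"
  proof -
    have i1: "integrable lebesgue (\<lambda>x. f (x + h *\<^sub>R axis i 1) * \<phi> x)" "integrable lebesgue (\<lambda>x. f x * \<phi> x)"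
      by (rule cauchy_schwarz_L2(1)[OF L2_translation(1)[OF f] L2_ctest[OF p]], rule cauchy_schwarz_L2(1)[OF f L2_ctest[OF p]])
    have m: "(\<lambda>x. f x * \<phi> (x + (- h) *\<^sub>R axis i 1)) \<in> borel_measurable lebesgue"
      using cauchy_schwarz_L2(1)[OF f L2_translation(1)[OF L2_ctest[OF p]]] by (rule borel_measurable_integrable)
    have "(LINT x|lebesgue. f (x + h *\<^sub>R axis i 1) * \<phi> x) = a h"
      using integral_translation[OF m, of "h *\<^sub>R axis i 1"] by (simp add: a_def add.assoc)
    then show ?thesis unfolding left_diff_distrib Bochner_Integration.integral_diff[OF i1] by (simp add: a_def)
  qed
  ultimately show "norm (LINT x|lebesgue. (f (x + h *\<^sub>R axis i 1) - f x) * \<phi> x) \<le> h * L2_norm (\<lambda>x. g x $ i) * L2_norm \<phi>" by simp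
qed

lemma axis_inner: "(s *\<^sub>R axis i 1) \<bullet> \<xi> = s * (\<xi> $ i)" for \<xi> :: "real^'n"
  by (simp add: inner_axis' )

lemma fourier_translation_difference:
  assumes "fourier_pair f F"
  shows "L2_norm (\<lambda>\<xi>. (cis (s * \<xi> $ i) - 1) * F \<xi>) = L2_norm (\<lambda>x. f (x + s *\<^sub>R axis i 1) - f x)"
    and "L2 (\<lambda>\<xi>. (cis (s * \<xi> $ i) - 1) * F \<xi>)"
proof -
  have "fourier_pair (\<lambda>x. f (x + s *\<^sub>R axis i 1) - f x) (\<lambda>\<xi>. cis ((s *\<^sub>R axis i 1) \<bullet> \<xi>) * F \<xi> - F \<xi>)"
    by (intro fourier_pair_diff fourier_pair_translation assms)
  then have P: "fourier_pair (\<lambda>x. f (x + s *\<^sub>R axis i 1) - f x) (\<lambda>\<xi>. (cis (s * \<xi> $ i) - 1) * F \<xi>)"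
    unfolding axis_inner left_diff_distrib mult_1 .
  show "L2_norm (\<lambda>\<xi>. (cis (s * \<xi> $ i) - 1) * F \<xi>) = L2_norm (\<lambda>x. f (x + s *\<^sub>R axis i 1) - f x)"
    by (rule plancherel[OF P])
  show "L2 (\<lambda>\<xi>. (cis (s * \<xi> $ i) - 1) * F \<xi>)" using P by (simp add: fourier_pair_def)
qed

lemma norm_cis_minus_1_le: "norm (cis x - 1) \<le> \<bar>x\<bar>"
  using iexp_approx1[of x 0] by (simp add: cis_conv_exp)

text \<open>Fatou's lemma for the norm; the majorants \<open>M\<close> allow for norms that converge as well as for
  bounded ones.\<close>

lemma L2_fatou:
  fixes q :: "nat \<Rightarrow> real^'n \<Rightarrow> complex"
  assumes q: "\<And>k. L2 (q k)" and Q: "Q \<in> borel_measurable lebesgue"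
    and lim: "\<And>x. (\<lambda>k. norm (q k x)) \<longlonglongrightarrow> norm (Q x)"
    and M: "\<And>k. L2_norm (q k) \<le> M k" "M \<longlonglongrightarrow> m"
  shows "L2 Q" "L2_norm Q \<le> m"
proof -
  have "M k \<ge> 0" for k using M(1)[of k] L2_norm_nonneg[of "q k"] by linarith
  then have m0: "m \<ge> 0" by (intro tendsto_lowerbound[OF M(2)]) auto
  have "sq_integral Q = (\<integral>\<^sup>+x. liminf (\<lambda>k. ennreal ((norm (q k x))\<^sup>2)) \<partial>lebesgue)"
    unfolding sq_integral_def
  proof (rule nn_integral_cong)
    fix x
    have "(\<lambda>k. ennreal ((norm (q k x))\<^sup>2)) \<longlonglongrightarrow> ennreal ((norm (Q x))\<^sup>2)"
      by (intro tendsto_ennrealI tendsto_power lim)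
    then show "ennreal ((norm (Q x))\<^sup>2) = liminf (\<lambda>k. ennreal ((norm (q k x))\<^sup>2))"
      by (intro lim_imp_Liminf[symmetric]) auto
  qed
  also have "\<dots> \<le> liminf (\<lambda>k. sq_integral (q k))"
    unfolding sq_integral_def
  proof (rule nn_integral_liminf)
    show "(\<lambda>x. ennreal ((norm (q k x))\<^sup>2)) \<in> borel_measurable lebesgue" for k
      using L2_D(1)[OF q[of k]] by measurable
  qed
  also have "\<dots> \<le> liminf (\<lambda>k. ennreal ((M k)\<^sup>2))"
  proof (rule Liminf_mono, rule always_eventually, rule allI)
    fix k
    show "sq_integral (q k) \<le> ennreal ((M k)\<^sup>2)"
      unfolding sq_integral_eq_L2_norm[OF q] by (intro ennreal_leI power_mono M(1) L2_norm_nonneg)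
  qed
  also have "\<dots> = ennreal (m\<^sup>2)"
    by (intro lim_imp_Liminf tendsto_ennrealI tendsto_power M(2)) auto
  finally have s: "sq_integral Q \<le> ennreal (m\<^sup>2)" .
  then have "sq_integral Q < \<infinity>" by (rule le_less_trans) simp
  then show L: "L2 Q" using Q by (simp add: L2_iff_sq_integral)
  have "(L2_norm Q)\<^sup>2 \<le> m\<^sup>2" using s unfolding sq_integral_eq_L2_norm[OF L] by simp
  then show "L2_norm Q \<le> m" by (rule power2_le_imp_le) (rule m0)
qed

text \<open>Both inequalities come from difference quotients, whose transforms are \<open>F\<close> times
  \<open>(exp (\<i> h \<xi>\<^sub>i) - 1) / h\<close>. As \<open>h \<rightarrow> 0\<close> these tend pointwise to the multiplication by \<open>\<i> \<xi>\<^sub>i\<close>, and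
  Fatou's lemma gives square integrability and one inequality. Conversely \<open>|exp (\<i> h \<xi>\<^sub>i) - 1| \<le> h |\<xi>\<^sub>i|\<close> bounds
  the quotients of \<open>f\<close>, hence the pairings with derivatives of test functions, and duality gives the other
  inequality.\<close>

lemma fourier_weak_derivative:
  fixes f :: "real^'n \<Rightarrow> complex"
  assumes fF: "fourier_pair f F" and g: "L2 g" and w: "weak_gradient f g"
  shows "L2 (\<lambda>\<xi>. of_real (\<xi> $ i) * F \<xi>)" "L2_norm (\<lambda>\<xi>. of_real (\<xi> $ i) * F \<xi>) = L2_norm (\<lambda>x. g x $ i)"
proof -
  have f: "L2 f" and F: "L2 F" using fF by (auto simp: fourier_pair_def)
  define h where "h k = 1 / real (Suc k)" for k
  have hp: "h k > 0" for k by (simp add: h_def)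
  have hl: "h \<longlonglongrightarrow> 0" unfolding h_def by (rule LIMSEQ_Suc[OF lim_1_over_n])
  define q where "q k \<xi> = of_real (1 / h k) * ((cis (h k * \<xi> $ i) - 1) * F \<xi>)" for k \<xi>
  have q2: "L2 (q k)" for k unfolding q_def by (intro L2_cmult fourier_translation_difference(2)[OF fF])
  have qn: "L2_norm (q k) \<le> L2_norm (\<lambda>x. g x $ i)" for k
  proof -
    have "L2_norm (q k) = norm (complex_of_real (1 / h k)) * L2_norm (\<lambda>\<xi>. (cis (h k * \<xi> $ i) - 1) * F \<xi>)"
      unfolding q_def by (rule L2_norm_cmult)
    also have "\<dots> = 1 / h k * L2_norm (\<lambda>x. f (x + h k *\<^sub>R axis i 1) - f x)"
      unfolding fourier_translation_difference(1)[OF fF] norm_of_real using hp[of k] by simp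
    also have "\<dots> \<le> 1 / h k * (h k * L2_norm (\<lambda>x. g x $ i))"
      using hp[of k] translation_difference_le[OF f g w hp[of k], of i] by (intro mult_left_mono) auto
    finally show ?thesis using hp[of k] by simp
  qed
  have vm: "(\<lambda>\<xi>::real^'n. complex_of_real (\<xi> $ i)) \<in> borel_measurable lebesgue"
  proof -
    have "(\<lambda>\<xi>::real^'n. \<xi> $ i) \<in> borel_measurable borel"
      by (intro borel_measurable_continuous_onI linear_continuous_on bounded_linear_vec_nth)
    then have "(\<lambda>\<xi>::real^'n. complex_of_real (\<xi> $ i)) \<in> borel_measurable borel" by measurable
    then show ?thesis by (simp add: measurable_completion)
  qed
  have Qm: "(\<lambda>\<xi>. of_real (\<xi> $ i) * F \<xi>) \<in> borel_measurable lebesgue" using vm L2_D(1)[OF F] by measurable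
  have lim: "(\<lambda>k. norm (q k \<xi>)) \<longlonglongrightarrow> norm (of_real (\<xi> $ i) * F \<xi>)" for \<xi>
  proof -
    have "((\<lambda>s. cis (s * \<xi> $ i)) has_vector_derivative (\<xi> $ i) *\<^sub>R (\<i> * cis (0 * \<xi> $ i))) (at 0)"
    proof -
      have "((\<lambda>z. exp (\<i> * of_real (\<xi> $ i) * z)) has_field_derivative \<i> * of_real (\<xi> $ i)) (at (of_real 0))"
        by (auto intro!: derivative_eq_intros)
      from has_vector_derivative_real_field[OF this] show ?thesis
        by (simp add: cis_conv_exp mult_ac scaleR_conv_of_real)
    qed
    then have "((\<lambda>y. norm ((cis (y * \<xi> $ i) - cis (0 * \<xi> $ i)) - (y - 0) *\<^sub>R ((\<xi> $ i) *\<^sub>R (\<i> * cis (0 * \<xi> $ i)))) / norm (y - 0)) \<longlongrightarrow> 0) (at 0)"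
      unfolding has_vector_derivative_def has_derivative_iff_norm by blast
    moreover have "filterlim h (at 0) sequentially" using hl hp by (auto simp: filterlim_at intro!: always_eventually) (metis less_irrefl)
    ultimately have "(\<lambda>k. norm ((cis (h k * \<xi> $ i) - cis (0 * \<xi> $ i)) - (h k - 0) *\<^sub>R ((\<xi> $ i) *\<^sub>R (\<i> * cis (0 * \<xi> $ i)))) / norm (h k - 0)) \<longlonglongrightarrow> 0"
      by (rule filterlim_compose)
    moreover have "norm ((cis (h k * \<xi> $ i) - cis (0 * \<xi> $ i)) - (h k - 0) *\<^sub>R ((\<xi> $ i) *\<^sub>R (\<i> * cis (0 * \<xi> $ i)))) / norm (h k - 0)
       = norm (of_real (1 / h k) * (cis (h k * \<xi> $ i) - 1) - \<i> * of_real (\<xi> $ i))" for k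
    proof -
      have "of_real (1 / h k) * (cis (h k * \<xi> $ i) - 1) - \<i> * of_real (\<xi> $ i) =
        ((cis (h k * \<xi> $ i) - cis (0 * \<xi> $ i)) - (h k - 0) *\<^sub>R ((\<xi> $ i) *\<^sub>R (\<i> * cis (0 * \<xi> $ i)))) / of_real (h k)"
        using hp[of k] by (simp add: scaleR_conv_of_real field_simps)
      then show ?thesis by (simp only: norm_divide norm_of_real) simp
    qed
    ultimately have "(\<lambda>k. of_real (1 / h k) * (cis (h k * \<xi> $ i) - 1) - \<i> * of_real (\<xi> $ i)) \<longlonglongrightarrow> 0"
      by (simp only: tendsto_norm_zero_iff)
    then have "(\<lambda>k. of_real (1 / h k) * (cis (h k * \<xi> $ i) - 1)) \<longlonglongrightarrow> \<i> * of_real (\<xi> $ i)" by (simp only: LIM_zero_iff)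
    then have "(\<lambda>k. norm (of_real (1 / h k) * (cis (h k * \<xi> $ i) - 1) * F \<xi>)) \<longlonglongrightarrow> norm (\<i> * of_real (\<xi> $ i) * F \<xi>)"
      by (rule tendsto_norm[OF tendsto_mult[OF _ tendsto_const]])
    moreover have "norm (\<i> * of_real (\<xi> $ i) * F \<xi>) = norm (of_real (\<xi> $ i) * F \<xi>)" by (simp add: norm_mult)
    ultimately show ?thesis unfolding q_def by (simp only: mult.assoc)
  qed
  show L: "L2 (\<lambda>\<xi>. of_real (\<xi> $ i) * F \<xi>)" by (rule L2_fatou(1)[OF q2 Qm lim qn tendsto_const])
  have le: "L2_norm (\<lambda>\<xi>. of_real (\<xi> $ i) * F \<xi>) \<le> L2_norm (\<lambda>x. g x $ i)"
    by (rule L2_fatou(2)[OF q2 Qm lim qn tendsto_const])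
  \<comment> \<open>the derivative of a test function is replaced by a difference quotient, which is then moved to \<open>f\<close>\<close>
  have "L2_norm (\<lambda>x. g x $ i) \<le> L2_norm (\<lambda>\<xi>. of_real (\<xi> $ i) * F \<xi>)"
  proof (rule L2_norm_le_by_duality[OF L2_vec_nth[OF g] L2_norm_nonneg])
    fix \<phi> :: "real^'n \<Rightarrow> complex" assume p: "ctest \<phi>"
    define b where "b = L2_norm (\<lambda>\<xi>. of_real (\<xi> $ i) * F \<xi>) * L2_norm \<phi>"
    have h': "(\<lambda>k. - h k) \<longlonglongrightarrow> 0" "- h k \<noteq> 0" for k using tendsto_minus[OF hl] hp[of k] by auto
    define z where "z k = (LINT x|lebesgue. f x * ((\<phi> (x + (- h k) *\<^sub>R axis i 1) - \<phi> x) / of_real (- h k)))" for k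
    have ic: "integrable lebesgue (\<lambda>x. f x * cpartial i \<phi> x)" by (rule cauchy_schwarz_L2(1)[OF f L2_ctest[OF ctest_cpartial[OF p]]])
    have "(\<lambda>k. z k - (LINT x|lebesgue. f x * cpartial i \<phi> x)) \<longlonglongrightarrow> 0"
      using pairing_difference_quotient(1)[OF f p h', of i]
      unfolding z_def right_diff_distrib[of "f _"] Bochner_Integration.integral_diff[OF pairing_difference_quotient(2)[OF f p h'] ic] .
    then have zl: "(\<lambda>k. norm (z k)) \<longlonglongrightarrow> norm (LINT x|lebesgue. f x * cpartial i \<phi> x)"
      by (intro tendsto_norm) (simp only: LIM_zero_iff)
    have zb: "norm (z k) \<le> b" for k
    proof -
      have i1: "integrable lebesgue (\<lambda>x. f (x + h k *\<^sub>R axis i 1) * \<phi> x)" "integrable lebesgue (\<lambda>x. f x * \<phi> x)"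
        by (rule cauchy_schwarz_L2(1)[OF L2_translation(1)[OF f] L2_ctest[OF p]], rule cauchy_schwarz_L2(1)[OF f L2_ctest[OF p]])
      have i2: "integrable lebesgue (\<lambda>x. f x * \<phi> (x + (- h k) *\<^sub>R axis i 1))"
        by (rule cauchy_schwarz_L2(1)[OF f L2_translation(1)[OF L2_ctest[OF p]]])
      have "(LINT x|lebesgue. f (x + h k *\<^sub>R axis i 1) * \<phi> x) = (LINT x|lebesgue. f x * \<phi> (x + (- h k) *\<^sub>R axis i 1))"
        using integral_translation[OF borel_measurable_integrable[OF i2], of "h k *\<^sub>R axis i 1"] by (simp add: add.assoc)
      then have "(LINT x|lebesgue. (f (x + h k *\<^sub>R axis i 1) - f x) * \<phi> x) = (LINT x|lebesgue. f x * \<phi> (x + (- h k) *\<^sub>R axis i 1) - f x * \<phi> x)"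
        unfolding left_diff_distrib Bochner_Integration.integral_diff[OF i1] Bochner_Integration.integral_diff[OF i2 i1(2)] by simp
      moreover have "z k = (LINT x|lebesgue. of_real (- 1 / h k) * (f x * \<phi> (x + (- h k) *\<^sub>R axis i 1) - f x * \<phi> x))"
        unfolding z_def by (intro Bochner_Integration.integral_cong refl) (simp add: field_simps)
      ultimately have "z k = of_real (- 1 / h k) * (LINT x|lebesgue. (f (x + h k *\<^sub>R axis i 1) - f x) * \<phi> x)"
        unfolding integral_mult_right_zero by simp
      then have "norm (z k) = 1 / h k * norm (LINT x|lebesgue. (f (x + h k *\<^sub>R axis i 1) - f x) * \<phi> x)"
        using hp[of k] by (simp only: norm_mult norm_of_real) simp
      also have "\<dots> \<le> 1 / h k * (L2_norm (\<lambda>x. f (x + h k *\<^sub>R axis i 1) - f x) * L2_norm \<phi>)"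
        using hp[of k] by (intro mult_left_mono cauchy_schwarz_L2(2) L2_diff(1) L2_translation(1) f L2_ctest p) auto
      also have "L2_norm (\<lambda>x. f (x + h k *\<^sub>R axis i 1) - f x) \<le> h k * L2_norm (\<lambda>\<xi>. of_real (\<xi> $ i) * F \<xi>)"
      proof -
        have "norm ((cis (h k * \<xi> $ i) - 1) * F \<xi>) \<le> h k * norm (of_real (\<xi> $ i) * F \<xi>)" for \<xi>
          using mult_right_mono[OF norm_cis_minus_1_le[of "h k * \<xi> $ i"], of "norm (F \<xi>)"] hp[of k] by (simp add: norm_mult abs_mult)
        then show ?thesis
          unfolding fourier_translation_difference(1)[OF fF, symmetric]
          using L2_bound(2)[OF L L2_D(1)[OF fourier_translation_difference(2)[OF fF]] AE_I2] hp[of k] by (simp add: less_imp_le)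
      qed
      then have "1 / h k * (L2_norm (\<lambda>x. f (x + h k *\<^sub>R axis i 1) - f x) * L2_norm \<phi>) \<le> 1 / h k * (h k * L2_norm (\<lambda>\<xi>. of_real (\<xi> $ i) * F \<xi>) * L2_norm \<phi>)"
        using hp[of k] by (intro mult_left_mono mult_right_mono L2_norm_nonneg) auto
      finally show ?thesis using hp[of k] by (simp add: b_def)
    qed
    have "norm (LINT x|lebesgue. f x * cpartial i \<phi> x) \<le> b"
      by (rule tendsto_upperbound[OF zl]) (auto simp: zb)
    then show "norm (LINT x|lebesgue. g x $ i * \<phi> x) \<le> L2_norm (\<lambda>\<xi>. of_real (\<xi> $ i) * F \<xi>) * L2_norm \<phi>"
      unfolding weak_gradient_ctest[OF f g w p] b_def by simp
  qed
  with le show "L2_norm (\<lambda>\<xi>. of_real (\<xi> $ i) * F \<xi>) = L2_norm (\<lambda>x. g x $ i)" by simp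
qed

theorem fourier_gradient:
  fixes f :: "real^'n \<Rightarrow> complex"
  assumes fF: "fourier_pair f F" and g: "L2 g" and w: "weak_gradient f g"
  shows "L2 (\<lambda>\<xi>. of_real (norm \<xi>) * F \<xi>)" "L2_norm (\<lambda>\<xi>. of_real (norm \<xi>) * F \<xi>) = L2_norm g"
proof -
  have F: "L2 F" using fF by (simp add: fourier_pair_def)
  note c = fourier_weak_derivative[OF fF g w]
  have sq: "(norm (of_real (norm \<xi>) * F \<xi>))\<^sup>2 = (\<Sum>i\<in>UNIV. (norm (of_real (\<xi> $ i) * F \<xi>))\<^sup>2)" for \<xi>
    unfolding norm_mult norm_of_real power_mult_distrib abs_norm_cancel norm_vec_power2[of \<xi>] sum_distrib_right by simp
  have nm: "(\<lambda>\<xi>::real^'n. complex_of_real (norm \<xi>)) \<in> borel_measurable lebesgue"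
  proof -
    have "(\<lambda>\<xi>::real^'n. complex_of_real (norm \<xi>)) \<in> borel_measurable borel" by measurable
    then show ?thesis by (simp add: measurable_completion)
  qed
  have m: "(\<lambda>\<xi>. of_real (norm \<xi>) * F \<xi>) \<in> borel_measurable lebesgue" using nm L2_D(1)[OF F] by measurable
  have "integrable lebesgue (\<lambda>\<xi>. (norm (of_real (norm \<xi>) * F \<xi>))\<^sup>2)"
    unfolding sq by (intro Bochner_Integration.integrable_sum L2_D(2) c(1))
  then show "L2 (\<lambda>\<xi>. of_real (norm \<xi>) * F \<xi>)" using m by (simp add: L2_def)
  have "(L2_norm (\<lambda>\<xi>. of_real (norm \<xi>) * F \<xi>))\<^sup>2 = (\<Sum>i\<in>UNIV. (L2_norm (\<lambda>\<xi>. of_real (\<xi> $ i) * F \<xi>))\<^sup>2)"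
    unfolding L2_norm_power2 sq by (intro Bochner_Integration.integral_sum L2_D(2) c(1))
  also have "\<dots> = (\<Sum>i\<in>UNIV. (L2_norm (\<lambda>x. g x $ i))\<^sup>2)" unfolding c(2) ..
  also have "\<dots> = (L2_norm g)\<^sup>2"
    unfolding L2_norm_power2 norm_vec_power2 by (intro Bochner_Integration.integral_sum[symmetric] L2_D(2) L2_vec_nth g)
  finally show "L2_norm (\<lambda>\<xi>. of_real (norm \<xi>) * F \<xi>) = L2_norm g"
    by (rule power2_eq_imp_eq) (auto simp: L2_norm_nonneg)
qed

section \<open>Energy decay for the wave equation\<close>

lemma grad_H1: assumes "H1 f" shows "L2 (grad f)" "weak_gradient f (grad f)"
proof -
  have "\<exists>g. L2 g \<and> weak_gradient f g" using assms by (simp add: H1_def)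
  then have "L2 (grad f) \<and> weak_gradient f (grad f)" unfolding grad_def by (rule someI_ex)
  then show "L2 (grad f)" "weak_gradient f (grad f)" by auto
qed

lemma weak_gradient_cong_AE:
  fixes f f' :: "real^'n \<Rightarrow> complex"
  assumes f: "L2 f" "L2 f'" and eq: "AE x in lebesgue. f x = f' x" and w: "weak_gradient f g"
  shows "weak_gradient f' g"
  unfolding weak_gradient_def
proof (intro allI impI)
  fix \<phi> :: "real^'n \<Rightarrow> real" and i assume p: "test_function \<phi>"
  have P: "L2 (\<lambda>x. complex_of_real (partial_deriv i \<phi> x))"
    by (rule L2_ctest[OF ctest_of_real[OF test_function_D(4)[OF p]]])
  have "(LINT x|lebesgue. f' x * of_real (partial_deriv i \<phi> x)) = (LINT x|lebesgue. f x * of_real (partial_deriv i \<phi> x))"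
  proof (rule integral_cong_AE)
    show "(\<lambda>x. f' x * of_real (partial_deriv i \<phi> x)) \<in> borel_measurable lebesgue"
      by (rule borel_measurable_integrable[OF cauchy_schwarz_L2(1)[OF f(2) P]])
    show "(\<lambda>x. f x * of_real (partial_deriv i \<phi> x)) \<in> borel_measurable lebesgue"
      by (rule borel_measurable_integrable[OF cauchy_schwarz_L2(1)[OF f(1) P]])
    show "AE x in lebesgue. f' x * of_real (partial_deriv i \<phi> x) = f x * of_real (partial_deriv i \<phi> x)"
      using eq by eventually_elim simp
  qed
  then show "(LINT x|lebesgue. f' x * of_real (partial_deriv i \<phi> x)) = - (LINT x|lebesgue. g x $ i * of_real (\<phi> x))"
    using w p by (simp add: weak_gradient_def)
qed

lemma damped_oscillator_Re_Im:
  assumes "\<And>t. t \<ge> 0 \<Longrightarrow> (w has_vector_derivative w' t) (at t within {0..})"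
    "\<And>t. t \<ge> 0 \<Longrightarrow> (w' has_vector_derivative - of_real (r\<^sup>2) * w t - 2 * of_real (b t) * w' t) (at t within {0..})"
  shows "damped_oscillator b r (\<lambda>t. Re (w t)) (\<lambda>t. Re (w' t))" "damped_oscillator b r (\<lambda>t. Im (w t)) (\<lambda>t. Im (w' t))"
  using bounded_linear.has_vector_derivative[OF bounded_linear_Re assms(1)] bounded_linear.has_vector_derivative[OF bounded_linear_Re assms(2)]
    bounded_linear.has_vector_derivative[OF bounded_linear_Im assms(1)] bounded_linear.has_vector_derivative[OF bounded_linear_Im assms(2)]
  by (simp_all add: damped_oscillator_def has_real_derivative_iff_has_vector_derivative)

lemma square_sum3_le: "(x + y + z)\<^sup>2 \<le> 3 * (x\<^sup>2 + y\<^sup>2 + z\<^sup>2)" for x y z :: real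
  using zero_le_power2[of "x - y"] zero_le_power2[of "x - z"] zero_le_power2[of "y - z"]
  by (simp add: power2_eq_square algebra_simps)

lemma le_sqrt_quotient:
  fixes a L S C x :: real
  assumes "a > 0" "C \<ge> 0" "a\<^sup>2 * x\<^sup>2 \<le> C * S" "x \<ge> 0"
  shows "x \<le> sqrt C / a * sqrt S"
proof -
  have "a * x \<le> sqrt (C * S)" by (rule real_le_rsqrt) (simp add: power_mult_distrib assms(3))
  then show ?thesis using assms by (simp add: real_sqrt_mult field_simps)
qed

text \<open>The real and the imaginary part are real oscillators. Dividing by \<open>\<Lambda> t\<close> turns the bound of the energy
  into the shape in which it is integrated over the frequencies.\<close>

lemma frequency_decay:
  fixes w w' :: "real \<Rightarrow> complex"
  assumes C: "C > 0" and L: "\<And>t. t \<ge> 0 \<Longrightarrow> \<Lambda> t > 0"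
    and decay: "\<And>w v t. damped_oscillator b r w v \<Longrightarrow> t \<ge> 0 \<Longrightarrow>
      (\<Lambda> t)\<^sup>2 * ((r * w t)\<^sup>2 + (v t)\<^sup>2) \<le> C * ((1 + r) * \<bar>w 0\<bar> + \<bar>v 0\<bar>)\<^sup>2"
    and w: "\<And>t. t \<ge> 0 \<Longrightarrow> (w has_vector_derivative w' t) (at t within {0..})"
    and w': "\<And>t. t \<ge> 0 \<Longrightarrow> (w' has_vector_derivative - of_real (r\<^sup>2) * w t - 2 * of_real (b t) * w' t) (at t within {0..})"
    and t: "t \<ge> 0" and r: "r \<ge> 0"
  defines "S \<equiv> (norm (w 0))\<^sup>2 + (r * norm (w 0))\<^sup>2 + (norm (w' 0))\<^sup>2"
  shows "r * norm (w t) \<le> sqrt (3 * C) / \<Lambda> t * sqrt S" "norm (w' t) \<le> sqrt (3 * C) / \<Lambda> t * sqrt S"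
proof -
  note d = damped_oscillator_Re_Im[OF w w']
  have part: "(\<Lambda> t)\<^sup>2 * ((r * x t)\<^sup>2 + (v t)\<^sup>2) \<le> 3 * C * ((x 0)\<^sup>2 + (r * x 0)\<^sup>2 + (v 0)\<^sup>2)" if "damped_oscillator b r x v" for x v
  proof -
    have "((1 + r) * \<bar>x 0\<bar> + \<bar>v 0\<bar>)\<^sup>2 \<le> 3 * ((x 0)\<^sup>2 + (r * x 0)\<^sup>2 + (v 0)\<^sup>2)"
      using square_sum3_le[of "\<bar>x 0\<bar>" "r * \<bar>x 0\<bar>" "\<bar>v 0\<bar>"] by (simp add: power_mult_distrib distrib_right)
    then have "C * ((1 + r) * \<bar>x 0\<bar> + \<bar>v 0\<bar>)\<^sup>2 \<le> C * (3 * ((x 0)\<^sup>2 + (r * x 0)\<^sup>2 + (v 0)\<^sup>2))"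
      by (rule mult_left_mono) (use C in simp)
    then show ?thesis by (intro order_trans[OF decay[OF that t]]) (simp only: mult_ac)
  qed
  have "(\<Lambda> t)\<^sup>2 * ((r * norm (w t))\<^sup>2 + (norm (w' t))\<^sup>2) \<le> 3 * C * S"
    using add_mono[OF part[OF d(1)] part[OF d(2)]] unfolding S_def power_mult_distrib cmod_power2 by (simp add: algebra_simps)
  then have s: "(\<Lambda> t)\<^sup>2 * (r * norm (w t))\<^sup>2 + (\<Lambda> t)\<^sup>2 * (norm (w' t))\<^sup>2 \<le> 3 * C * S" by (simp only: distrib_left)
  have n: "(\<Lambda> t)\<^sup>2 * (r * norm (w t))\<^sup>2 \<le> 3 * C * S" "(\<Lambda> t)\<^sup>2 * (norm (w' t))\<^sup>2 \<le> 3 * C * S"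
    by (rule order_trans[OF _ s], simp)+
  show "r * norm (w t) \<le> sqrt (3 * C) / \<Lambda> t * sqrt S"
    by (rule le_sqrt_quotient[OF L[OF t] _ n(1)]) (use C r in auto)
  show "norm (w' t) \<le> sqrt (3 * C) / \<Lambda> t * sqrt S"
    by (rule le_sqrt_quotient[OF L[OF t] _ n(2)]) (use C in auto)
qed

lemma has_vector_derivative_iff_quotient:
  fixes f :: "real \<Rightarrow> complex"
  shows "(f has_vector_derivative D) (at t within S) \<longleftrightarrow> ((\<lambda>s. (f s - f t) /\<^sub>R (s - t)) \<longlongrightarrow> D) (at t within S)"
proof -
  have eq: "norm (f s - f t - (s - t) *\<^sub>R D) / norm (s - t) = norm ((f s - f t) /\<^sub>R (s - t) - D)" if "s \<noteq> t" for s
  proof -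
    have "(f s - f t) /\<^sub>R (s - t) - D = (f s - f t - (s - t) *\<^sub>R D) /\<^sub>R (s - t)"
      using that by (simp add: scaleR_diff_right)
    then show ?thesis by (simp only: norm_scaleR) (simp add: divide_inverse)
  qed
  have "(f has_vector_derivative D) (at t within S) \<longleftrightarrow>
      ((\<lambda>s. norm (f s - f t - (s - t) *\<^sub>R D) / norm (s - t)) \<longlongrightarrow> 0) (at t within S)"
    by (simp add: has_vector_derivative_def has_derivative_iff_norm bounded_linear_scaleR_left)
  also have "\<dots> \<longleftrightarrow> ((\<lambda>s. norm ((f s - f t) /\<^sub>R (s - t) - D)) \<longlongrightarrow> 0) (at t within S)"
    by (rule filterlim_cong[OF refl refl]) (use eq in \<open>auto simp: eventually_at_filter\<close>)
  finally show ?thesis by (simp only: tendsto_norm_zero_iff LIM_zero_iff)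
qed

text \<open>Plancherel's theorem transfers the norms of the difference quotients, whose limit is the norm of the time
  derivative.\<close>

lemma fourier_time_quotient:
  fixes u ut w :: "real \<Rightarrow> real^'n \<Rightarrow> complex"
  assumes d: "has_L2_time_derivative u ut" and F: "\<And>t. t \<ge> 0 \<Longrightarrow> fourier_pair (u t) (w t)" and t: "t \<ge> 0"
    and h: "h \<longlonglongrightarrow> 0" "\<And>k. h k > 0"
  shows "L2 (\<lambda>\<xi>. (w (t + h k) \<xi> - w t \<xi>) /\<^sub>R h k)"
    and "(\<lambda>k. L2_norm (\<lambda>\<xi>. (w (t + h k) \<xi> - w t \<xi>) /\<^sub>R h k)) \<longlonglongrightarrow> L2_norm (ut t)"
proof -
  have u: "L2 (u s)" "L2 (ut s)" if "s \<ge> 0" for s using d that by (auto simp: has_L2_time_derivative_def)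
  have th: "t + h k \<ge> 0" for k using t h(2)[of k] by linarith
  show wq: "L2 (\<lambda>\<xi>. (w (t + h k) \<xi> - w t \<xi>) /\<^sub>R h k)" for k
    using F[OF th] F[OF t] by (intro L2_scaleR L2_diff(1)) (auto simp: fourier_pair_def)
  have "(\<lambda>k. t + h k) \<longlonglongrightarrow> t + 0" by (intro tendsto_intros h(1))
  then have f: "filterlim (\<lambda>k. t + h k) (at t within {0..}) sequentially"
    using th h(2) by (auto simp: filterlim_at less_imp_neq[THEN not_sym])
  have "((\<lambda>s. L2_norm (\<lambda>x. (u s x - u t x) /\<^sub>R (s - t) - ut t x)) \<longlongrightarrow> 0) (at t within {0..})"
    using d t by (simp add: has_L2_time_derivative_def)
  from filterlim_compose[OF this f]
  have "(\<lambda>k. L2_norm (\<lambda>x. (u (t + h k) x - u t x) /\<^sub>R h k - ut t x)) \<longlonglongrightarrow> 0" by simp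
  then have "(\<lambda>k. L2_norm (\<lambda>x. (u (t + h k) x - u t x) /\<^sub>R h k)) \<longlonglongrightarrow> L2_norm (ut t)"
    by (intro tendsto_L2_norm always_eventually allI L2_scaleR L2_diff(1) u th t)
  moreover have "L2_norm (\<lambda>x. (u (t + h k) x - u t x) /\<^sub>R h k) = L2_norm (\<lambda>\<xi>. (w (t + h k) \<xi> - w t \<xi>) /\<^sub>R h k)" for k
    unfolding L2_norm_scaleR plancherel[OF fourier_pair_diff[OF F[OF th] F[OF t]]] ..
  ultimately show "(\<lambda>k. L2_norm (\<lambda>\<xi>. (w (t + h k) \<xi> - w t \<xi>) /\<^sub>R h k)) \<longlonglongrightarrow> L2_norm (ut t)" by simp
qed

text \<open>The constant is \<open>2 sqrt (3 C)\<close>: the factor 3 comes from squaring a sum of three terms, the factor 2 from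
  estimating the two norms separately. The data enter through \<open>E\<close>, whose norm is controlled by the norms of
  \<open>u1\<close>, its gradient and \<open>u2\<close>.\<close>

theorem wave_energy_decay:
  fixes u ut :: "real \<Rightarrow> real^'n \<Rightarrow> complex"
  assumes C: "C > 0" and L: "\<And>t. t \<ge> 0 \<Longrightarrow> \<Lambda> t > 0" and mono: "\<And>s t. 0 \<le> s \<Longrightarrow> s \<le> t \<Longrightarrow> \<Lambda> s \<le> \<Lambda> t"
    and decay: "\<And>r w v t. damped_oscillator b r w v \<Longrightarrow> r \<ge> 0 \<Longrightarrow> t \<ge> 0 \<Longrightarrow>
      (\<Lambda> t)\<^sup>2 * ((r * w t)\<^sup>2 + (v t)\<^sup>2) \<le> C * ((1 + r) * \<bar>w 0\<bar> + \<bar>v 0\<bar>)\<^sup>2"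
    and u1: "H1 u1" and u2: "L2 u2" and sol: "cauchy_solution b u1 u2 u ut" and t: "t \<ge> 0"
  shows "L2_norm (grad (u t)) + L2_norm (ut t) \<le> 2 * sqrt (3 * C) * (1 / \<Lambda> t) * (H1_norm u1 + L2_norm u2)"
proof -
  have H: "\<And>t. t \<ge> 0 \<Longrightarrow> H1 (u t)" and d: "has_L2_time_derivative u ut"
    and ae: "AE x in lebesgue. u 0 x = u1 x" "AE x in lebesgue. ut 0 x = u2 x"
    using sol by (simp_all add: cauchy_solution_def)
  obtain w where wF: "\<And>t. t \<ge> 0 \<Longrightarrow> L2_fourier (u t) (w t)" and wf: "\<And>\<xi>. frequency_solution b \<xi> (\<lambda>t. w t \<xi>)"
    using sol unfolding cauchy_solution_def by (elim conjE exE) metis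
  obtain w' where w': "\<And>\<xi>. \<forall>t\<ge>0. ((\<lambda>t. w t \<xi>) has_vector_derivative w' \<xi> t) (at t within {0..}) \<and>
        (w' \<xi> has_vector_derivative - of_real ((norm \<xi>)\<^sup>2) * w t \<xi> - 2 * of_real (b t) * w' \<xi> t) (at t within {0..})"
    using wf unfolding frequency_solution_def by metis
  have wd: "((\<lambda>t. w t \<xi>) has_vector_derivative w' \<xi> s) (at s within {0..})" if "s \<ge> 0" for s \<xi>
    using w'[of \<xi>] that by blast
  have F: "\<And>t. t \<ge> 0 \<Longrightarrow> fourier_pair (u t) (w t)" using wF by (rule L2_fourier_imp_pair)
  have w2: "L2 (w s)" if "s \<ge> 0" for s using F[OF that] by (simp add: fourier_pair_def)
  have u0: "L2 (u 0)" "L2 (ut 0)" and ut2: "L2 (ut t)" using d t by (simp_all add: has_L2_time_derivative_def)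
  have u1': "L2 u1" using u1 by (simp add: H1_def)
  define h where "h k = 1 / real (Suc k)" for k
  have h: "h \<longlonglongrightarrow> 0" "\<And>k. h k > 0" unfolding h_def by (rule LIMSEQ_Suc[OF lim_1_over_n]) simp
  define q where "q s k \<xi> = (w (s + h k) \<xi> - w s \<xi>) /\<^sub>R h k" for s k \<xi>
  have Q: "L2 (q s k)" "(\<lambda>k. L2_norm (q s k)) \<longlonglongrightarrow> L2_norm (ut s)" if "s \<ge> 0" for s k
    unfolding q_def by (rule fourier_time_quotient[OF d F that h]; assumption)+

  have ql: "(\<lambda>k. q 0 k \<xi>) \<longlonglongrightarrow> w' \<xi> 0" for \<xi>
  proof -
    have "((\<lambda>t. w t \<xi>) has_vector_derivative w' \<xi> 0) (at 0 within {0..})" by (rule wd) simp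
    then have "((\<lambda>y. (w y \<xi> - w 0 \<xi>) /\<^sub>R (y - 0)) \<longlongrightarrow> w' \<xi> 0) (at 0 within {0..})"
      by (simp add: has_vector_derivative_iff_quotient)
    moreover have "filterlim h (at 0 within {0..}) sequentially"
      using h by (auto simp: filterlim_at less_imp_le less_imp_neq[THEN not_sym])
    ultimately show ?thesis unfolding q_def by (auto dest: filterlim_compose)
  qed
  have qL: "L2 (q 0 k)" for k by (rule Q(1)) simp
  have m': "(\<lambda>\<xi>. w' \<xi> 0) \<in> borel_measurable lebesgue"
    by (rule borel_measurable_LIMSEQ_metric[OF L2_D(1)[OF qL] ql])
  have qn: "(\<lambda>k. L2_norm (q 0 k)) \<longlonglongrightarrow> L2_norm (ut 0)" by (rule Q(2)) simp
  \<comment> \<open>bounds \<open>w'\<close> at time 0 by the norm of \<open>ut 0\<close> without identifying it as a Fourier transform\<close>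
  note W = L2_fatou[OF qL m' tendsto_norm[OF ql] order_refl qn]
  note G1 = grad_H1[OF u1]
  have w0: "weak_gradient (u 0) (grad u1)"
    using ae(1) by (intro weak_gradient_cong_AE[OF u1' u0(1) _ G1(2)]) (simp add: eq_commute)
  note G0 = fourier_gradient[OF F[of 0] G1(1) w0, simplified]

  define S where "S \<xi> = (norm (w 0 \<xi>))\<^sup>2 + (norm \<xi> * norm (w 0 \<xi>))\<^sup>2 + (norm (w' \<xi> 0))\<^sup>2" for \<xi>
  define E where "E \<xi> = sqrt (S \<xi>)" for \<xi>
  have E2: "(norm (E \<xi>))\<^sup>2 = (norm (w 0 \<xi>))\<^sup>2 + (norm (of_real (norm \<xi>) * w 0 \<xi>))\<^sup>2 + (norm (w' \<xi> 0))\<^sup>2" for \<xi>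
    by (simp add: E_def S_def norm_mult)
  have i: "integrable lebesgue (\<lambda>\<xi>. (norm (w 0 \<xi>))\<^sup>2)" "integrable lebesgue (\<lambda>\<xi>. (norm (of_real (norm \<xi>) * w 0 \<xi>))\<^sup>2)"
    "integrable lebesgue (\<lambda>\<xi>. (norm (w' \<xi> 0))\<^sup>2)"
    using L2_D(2)[OF w2[of 0]] L2_D(2)[OF G0(1)] L2_D(2)[OF W(1)] by simp_all
  have iE: "integrable lebesgue (\<lambda>\<xi>. (norm (E \<xi>))\<^sup>2)" unfolding E2 by (intro Bochner_Integration.integrable_add i)
  have "(\<lambda>\<xi>. sqrt ((norm (E \<xi>))\<^sup>2)) \<in> borel_measurable lebesgue"
    using borel_measurable_integrable[OF iE] by measurable
  moreover have "(\<lambda>\<xi>. sqrt ((norm (E \<xi>))\<^sup>2)) = E" by (rule ext) (simp add: E_def S_def)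
  ultimately have EL: "L2 E" using iE by (simp add: L2_def)
  have "(L2_norm E)\<^sup>2 = (L2_norm (w 0))\<^sup>2 + (L2_norm (\<lambda>\<xi>. of_real (norm \<xi>) * w 0 \<xi>))\<^sup>2 + (L2_norm (\<lambda>\<xi>. w' \<xi> 0))\<^sup>2"
    unfolding L2_norm_power2 E2 using i by simp
  also have "L2_norm (w 0) = L2_norm u1"
    using plancherel[OF F[of 0]] L2_cong_AE(2)[OF ae(1) u0(1) L2_D(1)[OF u1']] by simp
  also have "(L2_norm (\<lambda>\<xi>. w' \<xi> 0))\<^sup>2 \<le> (L2_norm u2)\<^sup>2"
    using W(2) L2_cong_AE(2)[OF ae(2) u0(2) L2_D(1)[OF u2]] by (intro power_mono L2_norm_nonneg) simp
  finally have "(L2_norm E)\<^sup>2 \<le> (H1_norm u1)\<^sup>2 + (L2_norm u2)\<^sup>2" by (simp add: H1_norm_def G0(2))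
  also have "\<dots> \<le> (H1_norm u1 + L2_norm u2)\<^sup>2"
    using mult_nonneg_nonneg[of "H1_norm u1" "L2_norm u2"] L2_norm_nonneg[of u2] by (simp add: power2_sum H1_norm_def)
  finally have En: "L2_norm E \<le> H1_norm u1 + L2_norm u2"
    by (rule power2_le_imp_le) (simp add: H1_norm_def L2_norm_nonneg)

  define c where "c s = sqrt (3 * C) / \<Lambda> s" for s
  have cp: "c s \<ge> 0" if "s \<ge> 0" for s using L[OF that] C by (simp add: c_def)
  have pt: "norm \<xi> * norm (w s \<xi>) \<le> c s * E \<xi>" "norm (w' \<xi> s) \<le> c s * E \<xi>" if "s \<ge> 0" for s \<xi>
    unfolding c_def E_def S_def
    by (rule frequency_decay[OF C L decay, where w = "\<lambda>t. w t \<xi>" and w' = "w' \<xi>" and b = b]; use w' that in simp)+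
  have Ep: "E \<xi> \<ge> 0" for \<xi> by (simp add: E_def S_def)

  note Gt = grad_H1[OF H[OF t]]
  note G = fourier_gradient[OF F[OF t] Gt]
  have "L2_norm (\<lambda>\<xi>. of_real (norm \<xi>) * w t \<xi>) \<le> c t * L2_norm E"
    by (rule L2_bound(2)[OF EL L2_D(1)[OF G(1)] AE_I2 cp[OF t]]) (use pt(1)[OF t] Ep in \<open>simp add: norm_mult\<close>)
  then have gl: "L2_norm (grad (u t)) \<le> c t * L2_norm E" by (simp add: G(2))

  \<comment> \<open>the mean value theorem; the bound of \<open>w'\<close> at the intermediate time is at most the one at time \<open>t\<close>
    because \<open>\<Lambda>\<close> increases\<close>
  have qb: "norm (q t k \<xi>) \<le> c t * norm (E \<xi>)" for k \<xi>
  proof -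
    have "\<exists>x\<in>{t<..<t + h k}. norm (w (t + h k) \<xi> - w t \<xi>) \<le> norm ((t + h k - t) *\<^sub>R w' \<xi> x)"
    proof (rule mvt_general)
      show "t < t + h k" using h(2) by simp
      show "continuous_on {t..t + h k} (\<lambda>t. w t \<xi>)"
      proof (rule continuous_on_vector_derivative)
        fix x assume "x \<in> {t..t + h k}"
        then show "((\<lambda>t. w t \<xi>) has_vector_derivative w' \<xi> x) (at x within {t..t + h k})"
          by (intro has_vector_derivative_within_subset[OF wd]) (use t in simp_all)
      qed
      fix x assume x: "t < x" "x < t + h k"
      have "((\<lambda>t. w t \<xi>) has_vector_derivative w' \<xi> x) (at x within {0..})" using t x by (intro wd) simp
      moreover have "at x within {0..} = at x" using t x by (intro at_within_interior) (simp add: interior_real_atLeast)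
      ultimately show "((\<lambda>t. w t \<xi>) has_derivative (\<lambda>y. y *\<^sub>R w' \<xi> x)) (at x)"
        by (simp add: has_vector_derivative_def)
    qed
    then obtain x where x: "t < x" "norm (w (t + h k) \<xi> - w t \<xi>) \<le> h k * norm (w' \<xi> x)"
      using h(2)[of k] by auto
    have "norm (w' \<xi> x) \<le> c x * E \<xi>" using pt(2)[of x \<xi>] x t by simp
    also have "\<dots> \<le> c t * E \<xi>"
      unfolding c_def using L[OF t] mono[OF t, of x] x C Ep by (intro mult_right_mono divide_left_mono mult_pos_pos L) (use t in auto)
    finally have "norm (w (t + h k) \<xi> - w t \<xi>) \<le> h k * (c t * E \<xi>)"
      using order_trans[OF x(2) mult_left_mono[of _ _ "h k"]] h(2)[of k] by (simp add: less_imp_le)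
    then have "norm (w (t + h k) \<xi> - w t \<xi>) / h k \<le> c t * E \<xi>"
      using h(2)[of k] by (simp add: divide_le_eq mult_ac)
    moreover have "norm (q t k \<xi>) = norm (w (t + h k) \<xi> - w t \<xi>) / h k"
      using h(2)[of k] unfolding q_def norm_scaleR by (simp add: divide_inverse)
    ultimately show ?thesis using Ep[of \<xi>] by simp
  qed
  have "L2_norm (q t k) \<le> c t * L2_norm E" for k
    by (rule L2_bound(2)[OF EL L2_D(1)[OF Q(1)[OF t]] AE_I2 cp[OF t]]) (rule qb)
  then have "L2_norm (ut t) \<le> c t * L2_norm E"
    by (intro tendsto_upperbound[OF Q(2)[OF t]]) auto
  with gl have "L2_norm (grad (u t)) + L2_norm (ut t) \<le> 2 * c t * L2_norm E" by simp
  also have "\<dots> \<le> 2 * c t * (H1_norm u1 + L2_norm u2)" using cp[OF t] by (intro mult_left_mono En) simp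
  finally show ?thesis by (simp add: c_def)
qed

theorem theorem1:
  fixes m :: nat and b \<mu> \<sigma> \<Theta> \<Xi> :: "real \<Rightarrow> real" and \<omega> :: real
  assumes "m \<ge> 1"
    and "C_halfline m b"
    and "\<And>t. t \<ge> 0 \<Longrightarrow> 2 * b t = \<mu> t + \<sigma> t"
    and "\<omega> > 0"
    and "\<And>t. t \<ge> 0 \<Longrightarrow> \<Theta> t > 0"
    and "\<And>t. t \<ge> 0 \<Longrightarrow> \<Xi> t > 0"
    and "\<And>t. t \<ge> 0 \<Longrightarrow> \<mu> t > 0"
    and "\<And>t. t \<ge> 0 \<Longrightarrow> \<exists>D<0. (\<mu> has_real_derivative D) (at t within {0..})"
    and "Limsup at_top (\<lambda>t. ereal (t * \<mu> t)) < 1"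
    and "bdd_above ((\<lambda>t. \<bar>integral {0..t} \<sigma>\<bar>) ` {0..})"
    and "lesssim (\<lambda>t. integral {0..t} (\<lambda>\<theta>. \<bar>exp (integral {0..\<theta>} \<sigma>) - \<omega>\<bar>)) \<Theta>"
    and "\<Theta> \<in> o[at_top](\<lambda>t. t)"
    and "\<Theta> 0 = \<mu> 0"
    and "\<exists>C. \<forall>k\<in>{1..m}. \<forall>t\<ge>0. \<bar>halfline_deriv k b t\<bar> \<le> C k * (1 / \<Xi> t ^ (k + 1))"
    and "lesssim \<Theta> \<Xi>"
    and "\<And>t. t \<ge> 0 \<Longrightarrow> (\<lambda>s. 1 / \<Xi> s ^ (m + 1)) integrable_on {t..}"
    and "lesssim (\<lambda>t. integral {t..} (\<lambda>s. 1 / \<Xi> s ^ (m + 1))) (\<lambda>t. 1 / \<Theta> t ^ m)"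
  shows "comparable (lambda_of \<mu>) (\<lambda>t. exp (integral {0..t} b)) \<and>
    (\<exists>C>0. \<forall>(u1 :: real ^ 'n \<Rightarrow> complex) u2 u ut.
       H1 u1 \<longrightarrow> L2 u2 \<longrightarrow> cauchy_solution b u1 u2 u ut \<longrightarrow>
       (\<forall>t\<ge>0. L2_norm (grad (u t)) + L2_norm (ut t)
              \<le> C * (1 / lambda_of \<mu> t) * (H1_norm u1 + L2_norm u2)))"
proof -
  have "continuous_on {0..} (halfline_deriv 0 b)"
  proof (cases "m = 0")
    case False
    with assms(2) show ?thesis
      by (auto simp: C_halfline_def continuous_on_eq_continuous_within intro: differentiable_imp_continuous_within)
  qed (use assms(1) in simp)
  then have b: "continuous_on {0..} b" by (simp add: halfline_deriv_def)
  interpret symbol_damping b \<mu> \<sigma> \<omega> m \<Theta> \<Xi>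
    by unfold_locales (assumption | rule b assms)+
  obtain C where C: "C > 0" "\<And>r w v t. damped_oscillator b r w v \<Longrightarrow> r \<ge> 0 \<Longrightarrow> t \<ge> 0 \<Longrightarrow>
      wenergy r w v t \<le> C * ((1 + r) * \<bar>w 0\<bar> + \<bar>v 0\<bar>)\<^sup>2"
    using oscillator_decay by metis
  have decay: "(\<Lambda> t)\<^sup>2 * ((r * w t)\<^sup>2 + (v t)\<^sup>2) \<le> C * ((1 + r) * \<bar>w 0\<bar> + \<bar>v 0\<bar>)\<^sup>2"
    if "damped_oscillator b r w v" "r \<ge> 0" "t \<ge> 0" for r w v t
    using C(2)[OF that] by (simp add: wenergy_def power_mult_distrib algebra_simps)
  have "\<forall>(u1 :: real ^ 'n \<Rightarrow> complex) u2 u ut.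
       H1 u1 \<longrightarrow> L2 u2 \<longrightarrow> cauchy_solution b u1 u2 u ut \<longrightarrow>
       (\<forall>t\<ge>0. L2_norm (grad (u t)) + L2_norm (ut t)
              \<le> 2 * sqrt (3 * C) * (1 / \<Lambda> t) * (H1_norm u1 + L2_norm u2))"
    by (intro allI impI wave_energy_decay[OF C(1) Lam_pos Lam_mono decay])
  moreover have "2 * sqrt (3 * C) > 0" using C(1) by simp
  ultimately show ?thesis using lambda_comparable by blast
qed

end
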